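(* Let $\Psi:\mathscr{Q}\to\mathscr{P}$ be a morphism of dg operads such that $\mathscr{Q}(n)$ is finite dimensional for all $n\ge0$ (and $\mathscr{Q}$ is augmented, so that the cobar construction below is defined). For each $n$ let $q_1,\dots,q_{m(n)}$ be a homogeneous basis of $\mathscr{Q}(n)$ and let $p_i:=\Psi(q_i)$. Let $$\mathsf{M}_\Psi:\mathscr{L}_\infty\longrightarrow\mathscr{P}\otimes\Omega\big((\mathscr{S}^{-1})^c\otimes\mathscr{Q}^\vee\big)$$ be the unique morphism of graded operads (a priori ignoring differentials) sending each generator $\ell_n$, $n\ge2$, to $$\sum_{i=1}^{m(n)}(-1)^{n|p_i|}\,p_i\otimes s^{-1}\mathscr{S}_n^{-1}q_i^\vee .$$ Then $\mathsf{M}_\Psi$ commutes with the differentials, i.e. it is a morphism of dg operads. Moreover, if $\Theta:\mathscr{R}\to\mathscr{Q}$ is a second morphism of dg operads with $\mathscr{R}(n)$ finite dimensional for all $n\ge0$ (with $\mathscr{R}$ augmented and $\Theta$ compatible with augmentations), then $$\mathsf{M}_{\Psi\Theta}=(\Psi\otimes1)\,\mathsf{M}_\Theta=\big(1\otimes\Omega((\mathscr{S}^{-1})^c\otimes\Theta^\vee)\big)\,\mathsf{M}_\Psi$$ as morphisms of dg operads $\mathscr{L}_\infty\to\mathscr{P}\otimes\Omega((\mathscr{S}^{-1})^c\otimes\mathscr{R}^\vee)$.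
   Context: Work over a field $\mathbb{K}$ of characteristic $0$. Chain complexes are $\mathbb{Z}$-graded with differential of degree $-1$, and the Koszul sign rule is used throughout. $V^\vee$ is the linear dual complex, $(V^\vee)_n=(V_{-n})^\vee$, with differential such that the pairing $V^\vee\otimes V\to\mathbb{K}$ is a chain map. Operads are symmetric; $\otimes$ of $\mathbb{S}$-modules denotes the arity-wise (Hadamard) tensor product. The arity-wise dual $\mathscr{Q}^\vee$ of an operad that is finite dimensional in each arity is a cooperad. Suspensions: $s$ is a formal element of degree $1$ and $s^{-1}$ its dual. $\mathscr{S}:=\mathrm{End}_{\mathbb{K}s}$ is spanned in arity $n$ by the degree $1-n$ map $\mathscr{S}_n:s^{\otimes n}\mapsto s$. $(\mathscr{S}^{-1})^c$ is the cooperad dual to $\mathscr{S}$; its basis element in arity $n$, of degree $n-1$, is denoted $\mathscr{S}_n^{-1}$, and it is normalized so that evaluation on $\mathscr{S}_n$ gives $(-1)^{n(n-1)/2}$. Cobar construction: for a conilpotent coaugmented dg cooperad $\mathscr{C}$, $\Omega\mathscr{C}=(\mathcal{T}(s^{-1}\overline{\mathscr{C}}),d_1+d_2)$ is the quasi-free operad where $d_1$ is the derivation extending the differential of $\mathscr{C}$ and $d_2$ the derivation extending the (desuspended) infinitesimal decomposition map. It is understood that $(\mathscr{S}^{-1})^c\otimes\mathscr{Q}^\vee$ (and the analogue for $\mathscr{R}$) is a cooperad to which this construction applies. $\mathscr{L}_\infty:=\Omega(\mathit{Lie}^{\text{¡}})$ is the operad of homotopy Lie algebras, where $\mathit{Lie}^{\text{¡}}\cong(\mathscr{S}^{-1})^c\otimes\mathit{Com}^\vee$.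 It is the quasi-free dg operad generated by $\ell_n=s^{-1}\mathscr{S}_n^{-1}\mu_n^\vee$, $n\ge2$, of degree $n-2$ and carrying the sign representation, where $\mu_n$ is the generator of $\mathit{Com}(n)$. Its differential is $$d\ell_n=\sum_{\substack{n_1+n_2=n+1\\ n_1,n_2\ge2}}\ \sum_{\sigma}(-1)^{n_1}\mathrm{sgn}(\sigma)\,(\ell_{n_1}\circ_1\ell_{n_2})^\sigma,$$ $\sigma$ running over the shuffles indexed by $\mathrm{Sh}(n_1-1,n_2)$, the block of size $n_2$ giving the inputs of $\ell_{n_2}$.
   Formalization: That M_Ψ commutes with the differentials is claimed only if Ψ kills all composites, of total arity at least 2, of two augmentation-ideal elements of Q one of which has arity 0 or 1 (automatic if Q(0)=0 and Q(1)=K); without this the claim fails. *)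

theory Defs
  imports
    Complex_Main
    "HOL-Library.Poly_Mapping"
    "HOL-Library.Function_Algebras"
    "HOL-Combinatorics.Permutations"
begin

section \<open>Formal sums, quotients, graded tensor products\<close>

definition ksign :: "int \<Rightarrow> 'k::field" where
  "ksign e = (if even e then 1 else - 1)"

definition fscl :: "'k::field \<Rightarrow> ('x \<Rightarrow>\<^sub>0 'k) \<Rightarrow> ('x \<Rightarrow>\<^sub>0 'k)" where
  "fscl c v = Poly_Mapping.map ((*) c) v"

abbreviation bas :: "'x \<Rightarrow> ('x \<Rightarrow>\<^sub>0 'k::field)" where
  "bas x \<equiv> Poly_Mapping.single x 1"

text \<open>Linear extension of a map given on the basis of a space of formal sums;
  \<open>s\<close> is the scalar multiplication of the target.\<close>

definition lext :: "('k::field \<Rightarrow> 'a \<Rightarrow> 'a::comm_monoid_add) \<Rightarrow> ('x \<Rightarrow> 'a) \<Rightarrow> ('x \<Rightarrow>\<^sub>0 'k) \<Rightarrow> 'a" where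
  "lext s f v = (\<Sum>x\<in>Poly_Mapping.keys v. s (Poly_Mapping.lookup v x) (f x))"

definition linmap ::
  "('k \<Rightarrow> 'a \<Rightarrow> 'a) \<Rightarrow> ('k \<Rightarrow> 'b \<Rightarrow> 'b) \<Rightarrow> 'a set \<Rightarrow> 'b set \<Rightarrow> ('a::plus \<Rightarrow> 'b::plus) \<Rightarrow> bool" where
  "linmap s t A B f \<longleftrightarrow>
     (\<forall>x\<in>A. f x \<in> B) \<and> (\<forall>x\<in>A. \<forall>y\<in>A. f (x + y) = f x + f y) \<and> (\<forall>c. \<forall>x\<in>A. f (s c x) = t c (f x))"

text \<open>Quotients of spaces of formal sums.  The class of \<open>v\<close> modulo a subspace \<open>R\<close> is represented
  by its image under a fixed linear projection with kernel \<open>R\<close>.  Over a field such a projection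
  exists, and \<open>quot R v = quot R w\<close> iff \<open>v - w \<in> R\<close>; so the image of \<open>quot R\<close> is a copy of the
  quotient space inside the type of formal sums.\<close>

definition quot :: "('x \<Rightarrow>\<^sub>0 'k::field) set \<Rightarrow> ('x \<Rightarrow>\<^sub>0 'k) \<Rightarrow> ('x \<Rightarrow>\<^sub>0 'k)" where
  "quot R = (SOME f. Vector_Spaces.linear fscl fscl f \<and> (\<forall>v. v - f v \<in> R) \<and> (\<forall>v\<in>R. f v = 0))"

lemma lookup_fscl: "Poly_Mapping.lookup (fscl c v) x = c * Poly_Mapping.lookup v x"
  unfolding fscl_def by (simp add: map.rep_eq when_def)

lemma vector_space_fscl: "vector_space (fscl :: 'k::field \<Rightarrow> _)"
  by unfold_locales (auto intro!: poly_mapping_eqI simp: lookup_fscl lookup_add algebra_simps)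

lemma quot_exists:
  assumes "module.subspace fscl (R :: ('x \<Rightarrow>\<^sub>0 'k::field) set)"
  shows "\<exists>f. Vector_Spaces.linear fscl fscl f \<and> (\<forall>v. v - f v \<in> R) \<and> (\<forall>v\<in>R. f v = 0)"
proof -
  interpret vector_space "fscl :: 'k \<Rightarrow> ('x \<Rightarrow>\<^sub>0 'k) \<Rightarrow> _" by (rule vector_space_fscl)
  interpret vp: vector_space_pair "fscl :: 'k \<Rightarrow> ('x \<Rightarrow>\<^sub>0 'k) \<Rightarrow> _" "fscl :: 'k \<Rightarrow> ('x \<Rightarrow>\<^sub>0 'k) \<Rightarrow> _" by unfold_locales
  obtain B where B: "B \<subseteq> R" "independent B" "R \<subseteq> span B" using maximal_independent_subset[of R] by auto
  have sB: "span B = R" using B assms span_minimal by blast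
  define C where "C = extend_basis B"
  have C: "independent C" "span C = UNIV" "B \<subseteq> C"
    unfolding C_def using B(2) by (auto simp: independent_extend_basis extend_basis_superset)
  obtain f where f: "Vector_Spaces.linear fscl fscl f" "\<And>x. x\<in>C \<Longrightarrow> f x = (if x \<in> B then 0 else x)"
    using vp.linear_independent_extend[OF C(1), of "\<lambda>x. if x \<in> B then 0 else x"] by auto
  interpret f: Vector_Spaces.linear fscl fscl f by (rule f)
  have 1: "v - f v \<in> R" for v
  proof -
    have "v \<in> span C" using C by auto
    then show ?thesis
    proof (induction rule: span_induct)
      case base
      show ?case using assms by (intro subspaceI) (auto simp: f.zero f.add f.scale subspace_0 add_diff_add subspace_add subspace_scale scale_right_diff_distrib[symmetric])
    next
      case (step a)
      then show ?case using f(2)[OF step] B(1) assms by (auto simp: subspace_0)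
    qed
  qed
  have 2: "f v = 0" if "v \<in> R" for v
  proof -
    have "v \<in> span B" using that sB by simp
    then show ?thesis
    proof (induction rule: span_induct)
      case base show ?case by (intro subspaceI) (auto simp: f.zero f.add f.scale)
    next
      case (step a) then show ?case using f(2) C(3) by auto
    qed
  qed
  show ?thesis using f(1) 1 2 by blast
qed

text \<open>Tensor product of two \<open>\<int>\<close>-graded vector spaces, each given as a family of subspaces of an
  ambient space.  The key \<open>((i, x), (j, y))\<close> stands for \<open>x \<otimes> y\<close> with \<open>x\<close> in degree \<open>i\<close> and
  \<open>y\<close> in degree \<open>j\<close>; \<open>tens_rel\<close> contains the bilinearity relations of total degree \<open>d\<close>.\<close>

type_synonym ('a, 'b) tkey = "(int \<times> 'a) \<times> (int \<times> 'b)"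

definition tens_rel ::
  "('k::field \<Rightarrow> 'a \<Rightarrow> 'a) \<Rightarrow> (int \<Rightarrow> 'a::ab_group_add set) \<Rightarrow>
   ('k \<Rightarrow> 'b \<Rightarrow> 'b) \<Rightarrow> (int \<Rightarrow> 'b::ab_group_add set) \<Rightarrow> int \<Rightarrow> (('a, 'b) tkey \<Rightarrow>\<^sub>0 'k) set" where
  "tens_rel s A t B d = module.span fscl
     ({bas ((i, x + x'), (j, y)) - bas ((i, x), (j, y)) - bas ((i, x'), (j, y)) | i j x x' y.
         i + j = d \<and> x \<in> A i \<and> x' \<in> A i \<and> y \<in> B j} \<union>
      {bas ((i, x), (j, y + y')) - bas ((i, x), (j, y)) - bas ((i, x), (j, y')) | i j x y y'.
         i + j = d \<and> x \<in> A i \<and> y \<in> B j \<and> y' \<in> B j} \<union>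
      {bas ((i, s c x), (j, y)) - fscl c (bas ((i, x), (j, y))) | c i j x y.
         i + j = d \<and> x \<in> A i \<and> y \<in> B j} \<union>
      {bas ((i, x), (j, t c y)) - fscl c (bas ((i, x), (j, y))) | c i j x y.
         i + j = d \<and> x \<in> A i \<and> y \<in> B j})"


section \<open>dg \<open>\<S>\<close>-modules and dg operads\<close>

text \<open>An \<open>\<S>\<close>-module \<open>V\<close> of chain complexes is a family of subspaces \<open>gr V n d = V(n)\<^sub>d\<close> of an
  ambient vector space, with structure maps given for each arity and degree; the structure maps are
  only meaningful on these subspaces.  Every family of vector spaces is of this form, an ambient
  space being the direct sum.  \<open>act V n d \<sigma> x\<close> is \<open>x\<^sup>\<sigma>\<close>.\<close>

record ('k, 'a) dgsmod =
  scl :: "'k \<Rightarrow> 'a \<Rightarrow> 'a"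
  gr :: "nat \<Rightarrow> int \<Rightarrow> 'a set"
  dif :: "nat \<Rightarrow> int \<Rightarrow> 'a \<Rightarrow> 'a"
  act :: "nat \<Rightarrow> int \<Rightarrow> (nat \<Rightarrow> nat) \<Rightarrow> 'a \<Rightarrow> 'a"

text \<open>\<open>cmp P m a n b i x y\<close> is \<open>x \<circ>\<^sub>i y\<close> for \<open>x \<in> P(m)\<^sub>a\<close> and \<open>y \<in> P(n)\<^sub>b\<close>.\<close>

record ('k, 'a) dgop = "('k, 'a) dgsmod" +
  unt :: 'a
  cmp :: "nat \<Rightarrow> int \<Rightarrow> nat \<Rightarrow> int \<Rightarrow> nat \<Rightarrow> 'a \<Rightarrow> 'a \<Rightarrow> 'a"

text \<open>\<open>S\<^sub>n\<close> acts from the right; \<open>f\<^sup>\<sigma>\<close> is \<open>f\<close> with its \<open>j\<close>-th input fed into the slot \<open>\<sigma> j\<close> of \<open>f\<close>, that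
  is \<open>f\<^sup>\<sigma>(x\<^sub>1, \<dots>, x\<^sub>n) = \<plusminus> f(x\<^bsub>\<sigma>\<^sup>-\<^sup>1(1)\<^esub>, \<dots>, x\<^bsub>\<sigma>\<^sup>-\<^sup>1(n)\<^esub>)\<close>.\<close>

definition dg_smodule :: "('k::field, 'a::ab_group_add, 'z) dgsmod_scheme \<Rightarrow> bool" where
  "dg_smodule V \<longleftrightarrow>
     vector_space (scl V) \<and>
     (\<forall>n d. module.subspace (scl V) (gr V n d)) \<and>
     (\<forall>n d. linmap (scl V) (scl V) (gr V n d) (gr V n (d - 1)) (dif V n d)) \<and>
     (\<forall>n d. \<forall>x\<in>gr V n d. dif V n (d - 1) (dif V n d x) = 0) \<and>
     (\<forall>n d \<sigma>. \<sigma> permutes {1..n} \<longrightarrow> linmap (scl V) (scl V) (gr V n d) (gr V n d) (act V n d \<sigma>)) \<and>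
     (\<forall>n d. \<forall>x\<in>gr V n d. act V n d id x = x) \<and>
     (\<forall>n d \<sigma> \<tau>. \<forall>x\<in>gr V n d. \<sigma> permutes {1..n} \<longrightarrow> \<tau> permutes {1..n} \<longrightarrow>
        act V n d \<tau> (act V n d \<sigma> x) = act V n d (\<sigma> \<circ> \<tau>) x) \<and>
     (\<forall>n d \<sigma>. \<forall>x\<in>gr V n d. \<sigma> permutes {1..n} \<longrightarrow>
        dif V n d (act V n d \<sigma> x) = act V n (d - 1) \<sigma> (dif V n d x))"

text \<open>The permutation \<open>\<sigma> \<circ>\<^sub>i \<tau>\<close> of \<open>{1..m + n - 1}\<close> with
  \<open>f\<^sup>\<sigma> \<circ>\<^sub>i g\<^sup>\<tau> = (f \<circ>\<^bsub>\<sigma>(i)\<^esub> g)\<^bsup>\<sigma> \<circ>\<^sub>i \<tau>\<^esup>\<close>, where \<open>f\<close> has arity \<open>m\<close> and \<open>g\<close> arity \<open>n\<close>.\<close>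

definition perm_cmp :: "nat \<Rightarrow> nat \<Rightarrow> nat \<Rightarrow> (nat \<Rightarrow> nat) \<Rightarrow> (nat \<Rightarrow> nat) \<Rightarrow> nat \<Rightarrow> nat" where
  "perm_cmp m n i \<sigma> \<tau> x =
     (let shift = (\<lambda>y. if y < \<sigma> i then y else y + n - 1) in
      if x \<notin> {1..m + n - 1} then x
      else if x < i then shift (\<sigma> x)
      else if x < i + n then \<sigma> i - 1 + \<tau> (x - i + 1)
      else shift (\<sigma> (x - n + 1)))"

definition dg_operad :: "('k::field, 'a::ab_group_add) dgop \<Rightarrow> bool" where
  "dg_operad P \<longleftrightarrow>
     dg_smodule P \<and>
     unt P \<in> gr P 1 0 \<and> dif P 1 0 (unt P) = 0 \<and>
     (\<forall>m a n b i. 1 \<le> i \<and> i \<le> m \<longrightarrow>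
        (\<forall>x\<in>gr P m a. linmap (scl P) (scl P) (gr P n b) (gr P (m + n - 1) (a + b)) (cmp P m a n b i x)) \<and>
        (\<forall>y\<in>gr P n b. linmap (scl P) (scl P) (gr P m a) (gr P (m + n - 1) (a + b)) (\<lambda>x. cmp P m a n b i x y))) \<and>
     (\<forall>n d. \<forall>x\<in>gr P n d. cmp P 1 0 n d 1 (unt P) x = x) \<and>
     (\<forall>n d i. \<forall>x\<in>gr P n d. 1 \<le> i \<and> i \<le> n \<longrightarrow> cmp P n d 1 0 i x (unt P) = x) \<and>
     (\<forall>l a m b n c i j. \<forall>x\<in>gr P l a. \<forall>y\<in>gr P m b. \<forall>z\<in>gr P n c.
        1 \<le> i \<and> i \<le> l \<and> 1 \<le> j \<and> j \<le> m \<longrightarrow>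
        cmp P (l + m - 1) (a + b) n c (i - 1 + j) (cmp P l a m b i x y) z =
        cmp P l a (m + n - 1) (b + c) i x (cmp P m b n c j y z)) \<and>
     (\<forall>l a m b n c i k. \<forall>x\<in>gr P l a. \<forall>y\<in>gr P m b. \<forall>z\<in>gr P n c.
        1 \<le> i \<and> i < k \<and> k \<le> l \<longrightarrow>
        cmp P (l + m - 1) (a + b) n c (k - 1 + m) (cmp P l a m b i x y) z =
        scl P (ksign (b * c)) (cmp P (l + n - 1) (a + c) m b i (cmp P l a n c k x z) y)) \<and>
     (\<forall>m a n b i \<sigma> \<tau>. \<forall>x\<in>gr P m a. \<forall>y\<in>gr P n b.
        1 \<le> i \<and> i \<le> m \<and> \<sigma> permutes {1..m} \<and> \<tau> permutes {1..n} \<longrightarrow>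
        cmp P m a n b i (act P m a \<sigma> x) (act P n b \<tau> y) =
        act P (m + n - 1) (a + b) (perm_cmp m n i \<sigma> \<tau>) (cmp P m a n b (\<sigma> i) x y)) \<and>
     (\<forall>m a n b i. \<forall>x\<in>gr P m a. \<forall>y\<in>gr P n b. 1 \<le> i \<and> i \<le> m \<longrightarrow>
        dif P (m + n - 1) (a + b) (cmp P m a n b i x y) =
        cmp P m (a - 1) n b i (dif P m a x) y + scl P (ksign a) (cmp P m a n (b - 1) i x (dif P n b y)))"

text \<open>Morphisms are families of degree \<open>0\<close> maps, one for each arity and degree.\<close>

type_synonym ('a, 'b) fam = "nat \<Rightarrow> int \<Rightarrow> 'a \<Rightarrow> 'b"

definition graded_operad_hom ::
  "('k::field, 'a::ab_group_add) dgop \<Rightarrow> ('k, 'b::ab_group_add) dgop \<Rightarrow> ('a, 'b) fam \<Rightarrow> bool" where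
  "graded_operad_hom P W f \<longleftrightarrow>
     (\<forall>n d. linmap (scl P) (scl W) (gr P n d) (gr W n d) (f n d)) \<and>
     (\<forall>n d \<sigma>. \<forall>x\<in>gr P n d. \<sigma> permutes {1..n} \<longrightarrow> f n d (act P n d \<sigma> x) = act W n d \<sigma> (f n d x)) \<and>
     f 1 0 (unt P) = unt W \<and>
     (\<forall>m a n b i. \<forall>x\<in>gr P m a. \<forall>y\<in>gr P n b. 1 \<le> i \<and> i \<le> m \<longrightarrow>
        f (m + n - 1) (a + b) (cmp P m a n b i x y) = cmp W m a n b i (f m a x) (f n b y))"

definition dg_operad_hom ::
  "('k::field, 'a::ab_group_add) dgop \<Rightarrow> ('k, 'b::ab_group_add) dgop \<Rightarrow> ('a, 'b) fam \<Rightarrow> bool" where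
  "dg_operad_hom P W f \<longleftrightarrow>
     graded_operad_hom P W f \<and>
     (\<forall>n d. \<forall>x\<in>gr P n d. f n (d - 1) (dif P n d x) = dif W n d (f n d x))"

definition fam_eq_on :: "('k, 'a, 'z) dgsmod_scheme \<Rightarrow> ('a, 'b) fam \<Rightarrow> ('a, 'b) fam \<Rightarrow> bool" where
  "fam_eq_on V f g \<longleftrightarrow> (\<forall>n d. \<forall>x\<in>gr V n d. f n d x = g n d x)"

definition fam_comp :: "('b, 'c) fam \<Rightarrow> ('a, 'b) fam \<Rightarrow> ('a, 'c) fam" where
  "fam_comp g f = (\<lambda>n d x. g n d (f n d x))"

definition unit_operad :: "('k::field, 'k) dgop" where
  "unit_operad = \<lparr> scl = (*), gr = (\<lambda>n d. if n = 1 \<and> d = 0 then UNIV else {0}), dif = (\<lambda>n d x. 0),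
     act = (\<lambda>n d \<sigma> x. x), unt = 1, cmp = (\<lambda>m a n b i x y. x * y) \<rparr>"

text \<open>An augmentation of \<open>Q\<close> is a morphism of dg operads to the unit operad.\<close>

definition augmentation :: "('k::field, 'a::ab_group_add) dgop \<Rightarrow> ('a, 'k) fam \<Rightarrow> bool" where
  "augmentation Q \<epsilon> \<longleftrightarrow> dg_operad_hom Q unit_operad \<epsilon>"

definition aug_ideal ::
  "('k::field, 'a::ab_group_add) dgop \<Rightarrow> ('a, 'k) fam \<Rightarrow> nat \<Rightarrow> int \<Rightarrow> 'a set" where
  "aug_ideal Q \<epsilon> n d = {x \<in> gr Q n d. \<epsilon> n d x = 0}"

text \<open>\<open>Com\<close>, with \<open>\<mu>\<^sub>n = 1\<close> in each arity \<open>n \<ge> 1\<close>.\<close>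

definition Com :: "('k::field, 'k) dgop" where
  "Com = \<lparr> scl = (*), gr = (\<lambda>n d. if 1 \<le> n \<and> d = 0 then UNIV else {0}), dif = (\<lambda>n d x. 0),
     act = (\<lambda>n d \<sigma> x. x), unt = 1, cmp = (\<lambda>m a n b i x y. x * y) \<rparr>"

text \<open>The identity of \<open>\<bbbK>\<close> in arity \<open>1\<close>, as a family.  It is the augmentation of \<open>Com\<close>.  On \<open>End(\<bbbK>s)\<close>
  below it is not multiplicative, as \<open>\<S>\<^sub>2 \<circ>\<^sub>1 \<S>\<^sub>0\<close> is the unit; there it only serves to name the
  element \<open>\<S>\<^sub>1\<^sup>-\<^sup>1\<close>, and \<open>\<S>\<^sub>1\<^sup>-\<^sup>1 \<otimes> \<epsilon>\<close> is a coaugmentation of \<open>(\<S>\<^sup>-\<^sup>1)\<^sup>c \<otimes> Q\<^sup>\<or>\<close> whenever \<open>\<epsilon>\<close> is an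
  augmentation of \<open>Q\<close>.\<close>

definition std_aug :: "('k::field, 'k) fam" where
  "std_aug = (\<lambda>n d x. if n = 1 \<and> d = 0 then x else 0)"

text \<open>\<open>End(\<bbbK>s)\<close>, where \<open>c \<in> \<bbbK>\<close> stands for the multiple by \<open>c\<close> of the map \<open>\<S>\<^sub>n : s\<^sup>\<otimes>\<^sup>n \<mapsto> s\<close>.
  In \<open>\<S>\<^sub>m \<circ>\<^sub>i \<S>\<^sub>n\<close> the map \<open>\<S>\<^sub>n\<close> of degree \<open>1 - n\<close> is moved past \<open>i - 1\<close> copies of \<open>s\<close>.\<close>

definition End_s :: "('k::field, 'k) dgop" where
  "End_s = \<lparr> scl = (*), gr = (\<lambda>n d. if d = 1 - int n then UNIV else {0}), dif = (\<lambda>n d x. 0),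
     act = (\<lambda>n d \<sigma> x. of_int (sign \<sigma>) * x), unt = 1,
     cmp = (\<lambda>m a n b i x y. ksign ((1 - int n) * (int i - 1)) * x * y) \<rparr>"


section \<open>Hadamard products\<close>

text \<open>\<open>V(m) \<otimes> W(n)\<close>: \<open>tcls\<close> sends a formal sum of total degree \<open>d\<close> to its class, \<open>pure\<close> is a pure
  tensor and \<open>tgr\<close> is the part of total degree \<open>d\<close>.\<close>

definition tcls ::
  "('k::field, 'a::ab_group_add, 'y) dgsmod_scheme \<Rightarrow> nat \<Rightarrow> ('k, 'b::ab_group_add, 'z) dgsmod_scheme \<Rightarrow>
   nat \<Rightarrow> int \<Rightarrow> (('a, 'b) tkey \<Rightarrow>\<^sub>0 'k) \<Rightarrow> (('a, 'b) tkey \<Rightarrow>\<^sub>0 'k)" where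
  "tcls V m W n d = quot (tens_rel (scl V) (gr V m) (scl W) (gr W n) d)"

definition pure ::
  "('k::field, 'a::ab_group_add, 'y) dgsmod_scheme \<Rightarrow> nat \<Rightarrow> ('k, 'b::ab_group_add, 'z) dgsmod_scheme \<Rightarrow>
   nat \<Rightarrow> int \<Rightarrow> 'a \<Rightarrow> int \<Rightarrow> 'b \<Rightarrow> (('a, 'b) tkey \<Rightarrow>\<^sub>0 'k)" where
  "pure V m W n i x j y = tcls V m W n (i + j) (bas ((i, x), (j, y)))"

definition tgr ::
  "('k::field, 'a::ab_group_add, 'y) dgsmod_scheme \<Rightarrow> nat \<Rightarrow> ('k, 'b::ab_group_add, 'z) dgsmod_scheme \<Rightarrow>
   nat \<Rightarrow> int \<Rightarrow> (('a, 'b) tkey \<Rightarrow>\<^sub>0 'k) set" where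
  "tgr V m W n d = tcls V m W n d ` module.span fscl
     {bas ((i, x), (j, y)) | i x j y. x \<in> gr V m i \<and> y \<in> gr W n j \<and> i + j = d}"

definition had_smod ::
  "('k::field, 'a::ab_group_add, 'y) dgsmod_scheme \<Rightarrow> ('k, 'b::ab_group_add, 'z) dgsmod_scheme \<Rightarrow>
   ('k, ('a, 'b) tkey \<Rightarrow>\<^sub>0 'k) dgsmod" where
  "had_smod V W = \<lparr> scl = fscl, gr = (\<lambda>n d. tgr V n W n d),
     dif = (\<lambda>n d. lext fscl (\<lambda>((i, x), (j, y)).
       pure V n W n (i - 1) (dif V n i x) j y +
       fscl (ksign i) (pure V n W n i x (j - 1) (dif W n j y)))),
     act = (\<lambda>n d \<sigma>. lext fscl (\<lambda>((i, x), (j, y)).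
       pure V n W n i (act V n i \<sigma> x) j (act W n j \<sigma> y))) \<rparr>"

definition had_op ::
  "('k::field, 'a::ab_group_add) dgop \<Rightarrow> ('k, 'b::ab_group_add) dgop \<Rightarrow>
   ('k, ('a, 'b) tkey \<Rightarrow>\<^sub>0 'k) dgop" where
  "had_op P W = dgsmod.extend (had_smod P W) (dgop.fields
     (pure P 1 W 1 0 (unt P) 0 (unt W))
     (\<lambda>m a n b k v w.
        lext fscl (\<lambda>((i, x), (j, y)). lext fscl (\<lambda>((i', x'), (j', y')).
          fscl (ksign (j * i'))
            (pure P (m + n - 1) W (m + n - 1)
              (i + i') (cmp P m i n i' k x x') (j + j') (cmp W m j n j' k y y'))) w) v))"

text \<open>\<open>f \<otimes> g\<close>, with values in \<open>V' \<otimes> W'\<close>.\<close>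

definition had_map ::
  "('k::field, 'c::ab_group_add, 'y) dgsmod_scheme \<Rightarrow> ('k, 'e::ab_group_add, 'z) dgsmod_scheme \<Rightarrow>
   ('a, 'c) fam \<Rightarrow> ('b, 'e) fam \<Rightarrow> (('a, 'b) tkey \<Rightarrow>\<^sub>0 'k, ('c, 'e) tkey \<Rightarrow>\<^sub>0 'k) fam" where
  "had_map V' W' f g = (\<lambda>n d. lext fscl (\<lambda>((i, x), (j, y)). pure V' n W' n i (f n i x) j (g n j y)))"

definition id_fam :: "('a, 'a) fam" where
  "id_fam = (\<lambda>n d x. x)"


section \<open>Coaugmented dg cooperads\<close>

text \<open>\<open>dec C a b i d\<close> is the partial decomposition map from \<open>C(a + b - 1)\<^sub>d\<close> to
  \<open>(C(a) \<otimes> C(b))\<^sub>d\<close> (an element of \<open>tgr C a C b d\<close>) dual to a partial composition \<open>\<circ>\<^sub>i\<close>;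
  \<open>coaug C\<close> is the image of \<open>1\<close> under the coaugmentation.\<close>

record (overloaded) ('k, 'c) dgcoop = "('k, 'c) dgsmod" +
  counit :: "'c \<Rightarrow> 'k"
  coaug :: 'c
  dec :: "nat \<Rightarrow> nat \<Rightarrow> nat \<Rightarrow> int \<Rightarrow> 'c \<Rightarrow> (('c, 'c) tkey \<Rightarrow>\<^sub>0 'k)"

text \<open>Arity-wise dual.  An element of degree \<open>d\<close> is a functional on \<open>V(n)\<^bsub>-d\<^esub>\<close>, extended by \<open>0\<close>
  to the ambient type.  The pairing being a chain map amounts to
  \<open>(d f)(x) = - (-1)\<^bsup>|f|\<^esup> f(d x)\<close>.\<close>

definition dual_smod :: "('k::field, 'a::ab_group_add, 'z) dgsmod_scheme \<Rightarrow> ('k, 'a \<Rightarrow> 'k) dgsmod" where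
  "dual_smod V = \<lparr> scl = (\<lambda>c f x. c * f x),
     gr = (\<lambda>n d. {f. linmap (scl V) (*) (gr V n (- d)) UNIV f \<and> (\<forall>x. x \<notin> gr V n (- d) \<longrightarrow> f x = 0)}),
     dif = (\<lambda>n d f x. if x \<in> gr V n (1 - d) then - (ksign d * f (dif V n (1 - d) x)) else 0),
     act = (\<lambda>n d \<sigma> f x. if x \<in> gr V n (- d) then f (act V n (- d) (inv \<sigma>) x) else 0) \<rparr>"

text \<open>The pairing \<open>\<langle>f \<otimes> g, x \<otimes> y\<rangle> = (-1)\<^bsup>|g||x|\<^esup> f(x) g(y)\<close>, extended linearly, for \<open>x\<close> of degree \<open>j\<close>
  and \<open>y\<close> of degree \<open>k\<close>.\<close>

definition tpair ::
  "int \<Rightarrow> 'a \<Rightarrow> int \<Rightarrow> 'b \<Rightarrow> (('a \<Rightarrow> 'k, 'b \<Rightarrow> 'k) tkey \<Rightarrow>\<^sub>0 'k::field) \<Rightarrow> 'k" where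
  "tpair j x k y = lext (*) (\<lambda>((i, f), (i', g)).
     if i = - j \<and> i' = - k then ksign (i' * j) * f x * g y else 0)"

definition dual_coop ::
  "('k::field, 'a::ab_group_add) dgop \<Rightarrow> ('a, 'k) fam \<Rightarrow> ('k, 'a \<Rightarrow> 'k) dgcoop" where
  "dual_coop Q \<epsilon> = dgsmod.extend (dual_smod Q) (dgcoop.fields
     (\<lambda>f. f (unt Q))
     (\<lambda>x. if x \<in> gr Q 1 0 then \<epsilon> 1 0 x else 0)
     (\<lambda>a b i d f. THE t. t \<in> tgr (dual_smod Q) a (dual_smod Q) b d \<and>
        (\<forall>j k. \<forall>x\<in>gr Q a j. \<forall>y\<in>gr Q b k. j + k = - d \<longrightarrow>
           tpair j x k y t = f (cmp Q a j b k i x y))))"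

definition dual_map ::
  "('k::field, 'a::ab_group_add, 'z) dgsmod_scheme \<Rightarrow> ('a, 'b) fam \<Rightarrow> ('b \<Rightarrow> 'k, 'a \<Rightarrow> 'k) fam" where
  "dual_map V \<Theta> = (\<lambda>n d f x. if x \<in> gr V n (- d) then f (\<Theta> n (- d) x) else 0)"

definition had_coop ::
  "('k::field, 'a::ab_group_add) dgcoop \<Rightarrow> ('k, 'b::ab_group_add) dgcoop \<Rightarrow>
   ('k, ('a, 'b) tkey \<Rightarrow>\<^sub>0 'k) dgcoop" where
  "had_coop C D = dgsmod.extend (had_smod C D) (dgcoop.fields
     (lext (*) (\<lambda>((i, x), (j, y)). if i = 0 \<and> j = 0 then counit C x * counit D y else 0))
     (pure C 1 D 1 0 (coaug C) 0 (coaug D))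
     (\<lambda>a b k d.
        lext fscl (\<lambda>((i, x), (j, y)).
          lext fscl (\<lambda>((i', x'), (i'', x'')).
            lext fscl (\<lambda>((j', y'), (j'', y'')).
              fscl (ksign (i'' * j'))
                (pure (had_smod C D) a (had_smod C D) b
                  (i' + j') (pure C a D a i' x' j' y') (i'' + j'') (pure C b D b i'' x'' j'' y'')))
            (dec D a b k j y))
          (dec C a b k i x))))"

text \<open>The cooperad \<open>(\<S>\<^sup>-\<^sup>1)\<^sup>c\<close> dual to \<open>End(\<bbbK>s)\<close>, its basis elements \<open>\<S>\<^sub>n\<^sup>-\<^sup>1\<close> of degree \<open>n - 1\<close>, and
  \<open>(\<S>\<^sup>-\<^sup>1)\<^sup>c \<otimes> Q\<^sup>\<or>\<close>.\<close>

definition susp_coop :: "('k::field, 'k \<Rightarrow> 'k) dgcoop" where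
  "susp_coop = dual_coop End_s std_aug"

definition susp_elt :: "nat \<Rightarrow> 'k::field \<Rightarrow> 'k" where
  "susp_elt n x = ksign (int (n * (n - 1) div 2)) * x"

type_synonym ('k, 'q) suspdual = "('k \<Rightarrow> 'k, 'q \<Rightarrow> 'k) tkey \<Rightarrow>\<^sub>0 'k"

definition susp_dual ::
  "('k::field, 'q::ab_group_add) dgop \<Rightarrow> ('q, 'k) fam \<Rightarrow> ('k, ('k, 'q) suspdual) dgcoop" where
  "susp_dual Q \<epsilon> = had_coop susp_coop (dual_coop Q \<epsilon>)"


section \<open>Free operads and the cobar construction\<close>

text \<open>The free operad on a graded \<open>\<S>\<close>-module \<open>E\<close>, as formal sums of operadic terms in elements of \<open>E\<close>
  modulo the linear and equivariance relations of \<open>E\<close> and the axioms of a graded operad.\<close>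

datatype 'e oterm =
    Unt
  | Gen nat int 'e
  | Cmp "'e oterm" nat "'e oterm"
  | Prm "nat \<Rightarrow> nat" "'e oterm"

primrec ar :: "'e oterm \<Rightarrow> nat" where
  "ar Unt = 1"
| "ar (Gen n d x) = n"
| "ar (Cmp t i u) = ar t + ar u - 1"
| "ar (Prm \<sigma> t) = ar t"

primrec deg :: "'e oterm \<Rightarrow> int" where
  "deg Unt = 0"
| "deg (Gen n d x) = d"
| "deg (Cmp t i u) = deg t + deg u"
| "deg (Prm \<sigma> t) = deg t"

primrec wf_term :: "('k, 'e, 'z) dgsmod_scheme \<Rightarrow> 'e oterm \<Rightarrow> bool" where
  "wf_term E Unt = True"
| "wf_term E (Gen n d x) = (x \<in> gr E n d)"
| "wf_term E (Cmp t i u) = (wf_term E t \<and> wf_term E u \<and> 1 \<le> i \<and> i \<le> ar t)"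
| "wf_term E (Prm \<sigma> t) = (wf_term E t \<and> \<sigma> permutes {1..ar t})"

definition fcmp :: "nat \<Rightarrow> ('e oterm \<Rightarrow>\<^sub>0 'k::field) \<Rightarrow> ('e oterm \<Rightarrow>\<^sub>0 'k) \<Rightarrow> ('e oterm \<Rightarrow>\<^sub>0 'k)" where
  "fcmp i v w = lext fscl (\<lambda>t. lext fscl (\<lambda>u. bas (Cmp t i u)) w) v"

definition fprm :: "(nat \<Rightarrow> nat) \<Rightarrow> ('e oterm \<Rightarrow>\<^sub>0 'k::field) \<Rightarrow> ('e oterm \<Rightarrow>\<^sub>0 'k)" where
  "fprm \<sigma> v = lext fscl (\<lambda>t. bas (Prm \<sigma> t)) v"

text \<open>\<open>free_rel E n d\<close>: the formal sums of arity \<open>n\<close> and degree \<open>d\<close> that vanish in the free operad.\<close>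

inductive free_rel ::
  "('k::field, 'e::ab_group_add, 'z) dgsmod_scheme \<Rightarrow> nat \<Rightarrow> int \<Rightarrow> ('e oterm \<Rightarrow>\<^sub>0 'k) \<Rightarrow> bool"
  for E :: "('k::field, 'e::ab_group_add, 'z) dgsmod_scheme" where
  zero: "free_rel E n d 0"
| plus: "free_rel E n d v \<Longrightarrow> free_rel E n d w \<Longrightarrow> free_rel E n d (v + w)"
| scale: "free_rel E n d v \<Longrightarrow> free_rel E n d (fscl c v)"
| gen_plus: "x \<in> gr E n d \<Longrightarrow> y \<in> gr E n d \<Longrightarrow>
    free_rel E n d (bas (Gen n d (x + y)) - bas (Gen n d x) - bas (Gen n d y))"
| gen_scale: "x \<in> gr E n d \<Longrightarrow>
    free_rel E n d (bas (Gen n d (scl E c x)) - fscl c (bas (Gen n d x)))"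
| gen_act: "x \<in> gr E n d \<Longrightarrow> \<sigma> permutes {1..n} \<Longrightarrow>
    free_rel E n d (bas (Gen n d (act E n d \<sigma> x)) - bas (Prm \<sigma> (Gen n d x)))"
| unit_left: "wf_term E t \<Longrightarrow> free_rel E (ar t) (deg t) (bas (Cmp Unt 1 t) - bas t)"
| unit_right: "wf_term E t \<Longrightarrow> 1 \<le> i \<Longrightarrow> i \<le> ar t \<Longrightarrow>
    free_rel E (ar t) (deg t) (bas (Cmp t i Unt) - bas t)"
| assoc_seq: "wf_term E t \<Longrightarrow> wf_term E u \<Longrightarrow> wf_term E r \<Longrightarrow>
    1 \<le> i \<Longrightarrow> i \<le> ar t \<Longrightarrow> 1 \<le> j \<Longrightarrow> j \<le> ar u \<Longrightarrow>
    free_rel E (ar (Cmp t i (Cmp u j r))) (deg t + deg u + deg r)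
      (bas (Cmp (Cmp t i u) (i - 1 + j) r) - bas (Cmp t i (Cmp u j r)))"
| assoc_par: "wf_term E t \<Longrightarrow> wf_term E u \<Longrightarrow> wf_term E r \<Longrightarrow>
    1 \<le> i \<Longrightarrow> i < k \<Longrightarrow> k \<le> ar t \<Longrightarrow>
    free_rel E (ar (Cmp (Cmp t i u) (k - 1 + ar u) r)) (deg t + deg u + deg r)
      (bas (Cmp (Cmp t i u) (k - 1 + ar u) r) -
       fscl (ksign (deg u * deg r)) (bas (Cmp (Cmp t k r) i u)))"
| prm_id: "wf_term E t \<Longrightarrow> free_rel E (ar t) (deg t) (bas (Prm id t) - bas t)"
| prm_prm: "wf_term E t \<Longrightarrow> \<sigma> permutes {1..ar t} \<Longrightarrow> \<tau> permutes {1..ar t} \<Longrightarrow>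
    free_rel E (ar t) (deg t) (bas (Prm \<tau> (Prm \<sigma> t)) - bas (Prm (\<sigma> \<circ> \<tau>) t))"
| equivar: "wf_term E t \<Longrightarrow> wf_term E u \<Longrightarrow> 1 \<le> i \<Longrightarrow> i \<le> ar t \<Longrightarrow>
    \<sigma> permutes {1..ar t} \<Longrightarrow> \<tau> permutes {1..ar u} \<Longrightarrow>
    free_rel E (ar t + ar u - 1) (deg t + deg u)
      (bas (Cmp (Prm \<sigma> t) i (Prm \<tau> u)) -
       bas (Prm (perm_cmp (ar t) (ar u) i \<sigma> \<tau>) (Cmp t (\<sigma> i) u)))"
| cong_left: "free_rel E n d v \<Longrightarrow> wf_term E u \<Longrightarrow> 1 \<le> i \<Longrightarrow> i \<le> n \<Longrightarrow>
    free_rel E (n + ar u - 1) (d + deg u) (fcmp i v (bas u))"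
| cong_right: "free_rel E n d v \<Longrightarrow> wf_term E t \<Longrightarrow> 1 \<le> i \<Longrightarrow> i \<le> ar t \<Longrightarrow>
    free_rel E (ar t + n - 1) (deg t + d) (fcmp i (bas t) v)"
| cong_prm: "free_rel E n d v \<Longrightarrow> \<sigma> permutes {1..n} \<Longrightarrow> free_rel E n d (fprm \<sigma> v)"

definition fcls ::
  "('k::field, 'e::ab_group_add, 'z) dgsmod_scheme \<Rightarrow> nat \<Rightarrow> int \<Rightarrow> ('e oterm \<Rightarrow>\<^sub>0 'k) \<Rightarrow> ('e oterm \<Rightarrow>\<^sub>0 'k)" where
  "fcls E n d = quot {v. free_rel E n d v}"

text \<open>The derivation extending \<open>\<delta>\<close>, on terms; \<open>\<delta> n d x\<close> is the value on the generator \<open>x \<in> E(n)\<^sub>d\<close>.\<close>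

primrec deriv_term :: "(nat \<Rightarrow> int \<Rightarrow> 'e \<Rightarrow> ('e oterm \<Rightarrow>\<^sub>0 'k)) \<Rightarrow> 'e oterm \<Rightarrow> ('e oterm \<Rightarrow>\<^sub>0 'k::field)" where
  "deriv_term \<delta> Unt = 0"
| "deriv_term \<delta> (Gen n d x) = \<delta> n d x"
| "deriv_term \<delta> (Cmp t i u) =
     fcmp i (deriv_term \<delta> t) (bas u) + fscl (ksign (deg t)) (fcmp i (bas t) (deriv_term \<delta> u))"
| "deriv_term \<delta> (Prm \<sigma> t) = fprm \<sigma> (deriv_term \<delta> t)"

definition quasi_free ::
  "('k::field, 'e::ab_group_add, 'z) dgsmod_scheme \<Rightarrow> (nat \<Rightarrow> int \<Rightarrow> 'e \<Rightarrow> ('e oterm \<Rightarrow>\<^sub>0 'k)) \<Rightarrow>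
   ('k, 'e oterm \<Rightarrow>\<^sub>0 'k) dgop" where
  "quasi_free E \<delta> = \<lparr> scl = fscl,
     gr = (\<lambda>n d. fcls E n d ` module.span fscl {bas t | t. wf_term E t \<and> ar t = n \<and> deg t = d}),
     dif = (\<lambda>n d v. fcls E n (d - 1) (lext fscl (deriv_term \<delta>) v)),
     act = (\<lambda>n d \<sigma> v. fcls E n d (fprm \<sigma> v)),
     unt = fcls E 1 0 (bas Unt),
     cmp = (\<lambda>m a n b i v w. fcls E (m + n - 1) (a + b) (fcmp i v w)) \<rparr>"

text \<open>\<open>s\<^sup>-\<^sup>1C\<close>-bar, the coaugmentation coideal being the kernel of the counit: \<open>c\<close>, regarded in degree
  \<open>|c| - 1\<close>, stands for \<open>s\<^sup>-\<^sup>1c\<close>.  \<open>red_part\<close> is the projection of \<open>C\<close> onto that kernel along the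
  coaugmentation.\<close>

definition desusp_bar :: "('k::field, 'c::ab_group_add) dgcoop \<Rightarrow> ('k, 'c) dgsmod" where
  "desusp_bar C = \<lparr> scl = scl C,
     gr = (\<lambda>n d. {c \<in> gr C n (d + 1). n = 1 \<and> d + 1 = 0 \<longrightarrow> counit C c = 0}),
     dif = (\<lambda>n d c. - dif C n (d + 1) c),
     act = (\<lambda>n d. act C n (d + 1)) \<rparr>"

definition red_part :: "('k::field, 'c::ab_group_add) dgcoop \<Rightarrow> nat \<Rightarrow> int \<Rightarrow> 'c \<Rightarrow> 'c" where
  "red_part C n d c = (if n = 1 \<and> d = 0 then c - scl C (counit C c) (coaug C) else c)"

text \<open>For \<open>S \<subseteq> {1..n}\<close>, the permutation sending \<open>S\<close> in increasing order to \<open>1, \<dots>, |S|\<close> and the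
  complement in increasing order to \<open>|S| + 1, \<dots>, n\<close>.  In \<open>(f \<circ>\<^sub>1 g)\<^sup>\<sigma>\<close> with \<open>g\<close> of arity \<open>|S|\<close> the
  inputs in \<open>S\<close> are those of \<open>g\<close>, so these permutations enumerate the trees with two vertices.\<close>

definition unshuffle :: "nat \<Rightarrow> nat set \<Rightarrow> nat \<Rightarrow> nat" where
  "unshuffle n S x =
     (if x \<notin> {1..n} then x
      else if x \<in> S then card {y \<in> S. y \<le> x}
      else card S + card {y \<in> {1..n} - S. y \<le> x})"

text \<open>\<open>d\<^sub>1 + d\<^sub>2\<close> on the generator \<open>s\<^sup>-\<^sup>1c\<close> of arity \<open>n\<close> and degree \<open>d\<close>.  The infinitesimal decomposition of
  \<open>c\<close> is the sum over \<open>a + b = n + 1\<close> and over \<open>S\<close> of the terms \<open>(c' \<circ>\<^sub>1 c'')\<^sup>\<sigma>\<close>, where \<open>\<sigma>\<close> is the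
  permutation of \<open>S\<close> and \<open>c' \<otimes> c''\<close> is the partial decomposition of \<open>c\<^bsup>\<sigma>\<^sup>-\<^sup>1\<^esup>\<close>; the desuspension turns
  \<open>c' \<circ>\<^sub>1 c''\<close> into \<open>- (-1)\<^bsup>|c'|\<^esup> s\<^sup>-\<^sup>1c' \<circ>\<^sub>1 s\<^sup>-\<^sup>1c''\<close>.\<close>

definition cobar_d1 :: "('k::field, 'c::ab_group_add) dgcoop \<Rightarrow> nat \<Rightarrow> int \<Rightarrow> 'c \<Rightarrow> ('c oterm \<Rightarrow>\<^sub>0 'k)" where
  "cobar_d1 C n d c = bas (Gen n (d - 1) (dif (desusp_bar C) n d c))"

definition cobar_d2 :: "('k::field, 'c::ab_group_add) dgcoop \<Rightarrow> nat \<Rightarrow> int \<Rightarrow> 'c \<Rightarrow> ('c oterm \<Rightarrow>\<^sub>0 'k)" where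
  "cobar_d2 C n d c =
     (\<Sum>a\<in>{1..n + 1}. \<Sum>S\<in>{S. S \<subseteq> {1..n} \<and> card S = n + 1 - a}.
        let b = n + 1 - a; \<sigma> = unshuffle n S in
        lext fscl (\<lambda>((i, x), (j, y)).
          fscl (- ksign i)
            (bas (Prm \<sigma> (Cmp (Gen a (i - 1) (red_part C a i x)) 1 (Gen b (j - 1) (red_part C b j y))))))
        (dec C a b 1 (d + 1) (act C n (d + 1) (inv \<sigma>) c)))"

definition cobar :: "('k::field, 'c::ab_group_add) dgcoop \<Rightarrow> ('k, 'c oterm \<Rightarrow>\<^sub>0 'k) dgop" where
  "cobar C = quasi_free (desusp_bar C) (\<lambda>n d c. cobar_d1 C n d c + cobar_d2 C n d c)"

text \<open>The generator \<open>s\<^sup>-\<^sup>1c\<close> for \<open>c\<close> in the coaugmentation coideal, of arity \<open>n\<close> and degree \<open>d\<close>.\<close>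

definition cobar_gen :: "('k::field, 'c::ab_group_add) dgcoop \<Rightarrow> nat \<Rightarrow> int \<Rightarrow> 'c \<Rightarrow> ('c oterm \<Rightarrow>\<^sub>0 'k)" where
  "cobar_gen C n d c = fcls (desusp_bar C) n (d - 1) (bas (Gen n (d - 1) c))"

primrec map_term :: "(nat \<Rightarrow> int \<Rightarrow> 'c \<Rightarrow> 'e) \<Rightarrow> 'c oterm \<Rightarrow> 'e oterm" where
  "map_term g Unt = Unt"
| "map_term g (Gen n d x) = Gen n d (g n (d + 1) x)"
| "map_term g (Cmp t i u) = Cmp (map_term g t) i (map_term g u)"
| "map_term g (Prm \<sigma> t) = Prm \<sigma> (map_term g t)"

text \<open>\<open>\<Omega>(g)\<close> for a morphism \<open>g\<close> of coaugmented dg cooperads with target \<open>D\<close>.\<close>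

definition cobar_map ::
  "('k::field, 'e::ab_group_add) dgcoop \<Rightarrow> ('c, 'e) fam \<Rightarrow> ('c oterm \<Rightarrow>\<^sub>0 'k, 'e oterm \<Rightarrow>\<^sub>0 'k) fam" where
  "cobar_map D g = (\<lambda>n d v. fcls (desusp_bar D) n d (lext fscl (\<lambda>t. bas (map_term g t)) v))"


section \<open>The operad of homotopy Lie algebras and the maps \<open>M\<^sub>\<Psi>\<close>\<close>

text \<open>The element \<open>s\<^sup>-\<^sup>1\<S>\<^sub>n\<^sup>-\<^sup>1f\<close> for \<open>f \<in> Q\<^sup>\<or>(n)\<^sub>d\<close>, of degree \<open>n - 2 + d\<close>.\<close>

definition susp_gen ::
  "('k::field, 'q::ab_group_add) dgop \<Rightarrow> ('q, 'k) fam \<Rightarrow> nat \<Rightarrow> int \<Rightarrow> ('q \<Rightarrow> 'k) \<Rightarrow>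
   (('k, 'q) suspdual oterm \<Rightarrow>\<^sub>0 'k)" where
  "susp_gen Q \<epsilon> n d f = cobar_gen (susp_dual Q \<epsilon>) n (int n - 1 + d)
     (pure susp_coop n (dual_coop Q \<epsilon>) n (int n - 1) (susp_elt n) d f)"

definition L_infinity :: "('k::field, ('k, 'k) suspdual oterm \<Rightarrow>\<^sub>0 'k) dgop" where
  "L_infinity = cobar (susp_dual Com std_aug)"

definition ell :: "nat \<Rightarrow> (('k::field, 'k) suspdual oterm \<Rightarrow>\<^sub>0 'k)" where
  "ell n = susp_gen Com std_aug n 0 (\<lambda>x. x)"

definition finite_dim_arity :: "('k::field, 'q::ab_group_add, 'z) dgsmod_scheme \<Rightarrow> nat \<Rightarrow> bool" where
  "finite_dim_arity Q n \<longleftrightarrow>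
     finite {d. gr Q n d \<noteq> {0}} \<and> (\<forall>d. \<exists>B. finite B \<and> module.span (scl Q) B = gr Q n d)"

text \<open>\<open>q 0, \<dots>, q (m - 1)\<close> form a homogeneous basis of \<open>Q(n)\<close>, with \<open>q i\<close> of degree \<open>dg i\<close>.\<close>

definition homogeneous_basis ::
  "('k::field, 'q::ab_group_add, 'z) dgsmod_scheme \<Rightarrow> nat \<Rightarrow> nat \<Rightarrow> (nat \<Rightarrow> 'q) \<Rightarrow> (nat \<Rightarrow> int) \<Rightarrow> bool" where
  "homogeneous_basis Q n m q dg \<longleftrightarrow>
     (\<forall>d. let I = {i. i < m \<and> dg i = d} in
        inj_on q I \<and> \<not> module.dependent (scl Q) (q ` I) \<and> module.span (scl Q) (q ` I) = gr Q n d)"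

text \<open>The element \<open>q\<^sub>i\<^sup>\<or>\<close> of the dual basis.\<close>

definition dual_elt ::
  "('k::field, 'q::ab_group_add, 'z) dgsmod_scheme \<Rightarrow> nat \<Rightarrow> nat \<Rightarrow> (nat \<Rightarrow> 'q) \<Rightarrow> (nat \<Rightarrow> int) \<Rightarrow> nat \<Rightarrow>
   'q \<Rightarrow> 'k" where
  "dual_elt Q n m q dg i x =
     (if x \<in> gr Q n (dg i)
      then module.representation (scl Q) (q ` {k. k < m \<and> dg k = dg i}) x (q i) else 0)"

text \<open>\<open>M\<close> is a morphism of graded operads from \<open>L\<^sub>\<infinity>\<close> to \<open>P \<otimes> \<Omega>((\<S>\<^sup>-\<^sup>1)\<^sup>c \<otimes> Q\<^sup>\<or>)\<close> with the prescribed values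
  on the generators.\<close>

definition is_M ::
  "('k::field, 'p::ab_group_add) dgop \<Rightarrow> ('k, 'q::ab_group_add) dgop \<Rightarrow> ('q, 'k) fam \<Rightarrow>
   (nat \<Rightarrow> nat) \<Rightarrow> (nat \<Rightarrow> nat \<Rightarrow> 'q) \<Rightarrow> (nat \<Rightarrow> nat \<Rightarrow> int) \<Rightarrow> ('q, 'p) fam \<Rightarrow>
   (('k, 'k) suspdual oterm \<Rightarrow>\<^sub>0 'k, ('p, ('k, 'q) suspdual oterm \<Rightarrow>\<^sub>0 'k) tkey \<Rightarrow>\<^sub>0 'k) fam \<Rightarrow> bool" where
  "is_M P Q \<epsilon> m q dg \<Psi> M \<longleftrightarrow>
     graded_operad_hom L_infinity (had_op P (cobar (susp_dual Q \<epsilon>))) M \<and>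
     (\<forall>n\<ge>2. M n (int n - 2) (ell n) =
        (\<Sum>i<m n. fscl (ksign (int n * dg n i))
           (pure P n (cobar (susp_dual Q \<epsilon>)) n
              (dg n i) (\<Psi> n (dg n i) (q n i))
              (int n - 2 - dg n i)
              (susp_gen Q \<epsilon> n (- dg n i) (dual_elt Q n (m n) (q n) (dg n) i)))))"

text \<open>\<open>L\<^sub>\<infinity>\<close> has no generators of arity \<open>0\<close> and \<open>1\<close>.  Hence \<open>M\<^sub>\<Psi>\<close> can only commute with the differentials
  if the terms of \<open>d\<^sub>2\<close> with a vertex of arity \<open>0\<close> or \<open>1\<close> do not contribute in arities \<open>\<ge> 2\<close>, which means
  the following.  It is automatic if \<open>Q\<close> is reduced, i.e. \<open>Q(0) = 0\<close> and \<open>Q(1)\<close> is spanned by the unit.\<close>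

definition low_arity_vanishing ::
  "('k::field, 'q::ab_group_add) dgop \<Rightarrow> ('q, 'k) fam \<Rightarrow> ('q, 'p::zero) fam \<Rightarrow> bool" where
  "low_arity_vanishing Q \<epsilon> \<Psi> \<longleftrightarrow>
     (\<forall>a b i d e. \<forall>x\<in>aug_ideal Q \<epsilon> a d. \<forall>y\<in>aug_ideal Q \<epsilon> b e.
        1 \<le> i \<and> i \<le> a \<and> (a \<le> 1 \<or> b \<le> 1) \<and> 2 \<le> a + b - 1 \<longrightarrow>
        \<Psi> (a + b - 1) (d + e) (cmp Q a d b e i x y) = 0)"

lemma low_arity_vanishing_if_reduced:
  assumes Q: "dg_operad Q" "dg_operad_hom Q P \<Psi>" "augmentation Q \<epsilon>"
   and "\<And>d. gr Q 0 d = {0}" "\<And>d. aug_ideal Q \<epsilon> 1 d \<subseteq> {0}"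
  shows "low_arity_vanishing Q \<epsilon> \<Psi>"
proof -
  have l: "linmap (scl Q) (scl P) (gr Q n d) (gr P n d) (\<Psi> n d)" for n d using Q(2) by (auto simp: dg_operad_hom_def graded_operad_hom_def)
  have z: "0 \<in> gr Q n d" for n d
    using Q(1) unfolding dg_operad_def dg_smodule_def
    using module_iff_vector_space module.subspace_0 by metis
  have p0: "\<Psi> n d 0 = 0" for n d using l z unfolding linmap_def by (metis add_0 add_cancel_right_left)
  have A: "(\<forall>m a n b i. 1 \<le> i \<and> i \<le> m \<longrightarrow>
        (\<forall>x\<in>gr Q m a. linmap (scl Q) (scl Q) (gr Q n b) (gr Q (m + n - 1) (a + b)) (cmp Q m a n b i x)) \<and>
        (\<forall>y\<in>gr Q n b. linmap (scl Q) (scl Q) (gr Q m a) (gr Q (m + n - 1) (a + b)) (\<lambda>x. cmp Q m a n b i x y)))"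
    using Q(1) unfolding dg_operad_def by (elim conjE) assumption
  show ?thesis unfolding low_arity_vanishing_def
  proof (intro allI ballI impI)
    fix a b i d e x y
    assume x: "x \<in> aug_ideal Q \<epsilon> a d" and y: "y \<in> aug_ideal Q \<epsilon> b e"
     and h: "1 \<le> i \<and> i \<le> a \<and> (a \<le> 1 \<or> b \<le> 1) \<and> 2 \<le> a + b - 1"
    have xg: "x \<in> gr Q a d" "y \<in> gr Q b e" using x y by (auto simp: aug_ideal_def)
    have L: "linmap (scl Q) (scl Q) (gr Q b e) (gr Q (a + b - 1) (d + e)) (cmp Q a d b e i x)"
     "linmap (scl Q) (scl Q) (gr Q a d) (gr Q (a + b - 1) (d + e)) (\<lambda>x. cmp Q a d b e i x y)"
      using A h xg by blast+
    have "x = 0 \<or> y = 0"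
    proof (cases "a \<le> 1")
      case True then have "a = 1" using h by auto
      then show ?thesis using x assms(5) by auto
    next
      case False then have "b = 0 \<or> b = 1" using h by auto
      then show ?thesis using y assms(4,5) xg by auto
    qed
    then have "cmp Q a d b e i x y = 0"
      using L z unfolding linmap_def by (metis add_0 add_cancel_right_left)
    then show "\<Psi> (a + b - 1) (d + e) (cmp Q a d b e i x y) = 0" by (simp add: p0)
  qed
qed

end

theory Submission
  imports Defs
begin

text \<open>Since \<open>L\<^sub>\<infinity>\<close> is quasi-free, everything can be checked on the generators. The image \<open>X\<^sub>n\<close> of
  \<open>\<ell>\<^sub>n\<close> comes from the canonical element \<open>\<Sum> q\<^sub>i \<otimes> q\<^sub>i\<^sup>\<or>\<close>, for which applying a linear map to the first
  factor is the same as applying its transpose to the second. The differential of \<open>P\<close> is therefore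
  cancelled by \<open>d\<^sub>1\<close>, while \<open>d\<^sub>2\<close>, which transposes the partial compositions of \<open>Q\<close>, produces the composites
  \<open>X\<^sub>a \<circ>\<^sub>1 X\<^sub>b\<close> in the Hadamard product, summed over unshuffles as in \<open>d \<ell>\<^sub>n\<close>; the terms with \<open>a \<le> 1\<close> or
  \<open>b \<le> 1\<close> drop out by the vanishing assumption in low arity. The same transposition rule applied to
  \<open>\<Theta>\<close> gives the naturality statement.\<close>

section \<open>Graded signs and formal sums\<close>

text \<open>The two expansions that are compared, of the differential of \<open>ell n\<close> and of
  \<open>X n\<close>, are instances of one computation. \<open>Com\<close> and \<open>Q\<close>
  satisfy the same locale \<open>based_op\<close>, so \<open>d2_U\<close> expands the quadratic part
  of the cobar differential for both, and what remains is a matter of signs. The exponent n|p_i| is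
  what makes the interchange signs of the composites \<open>X a\<close>, \<open>X b\<close> agree
  with the signs produced by d_2; on both sides sgn(\<sigma>) (-1)^a is left. The encoding shapes
  the rest. A quotient is the image of a chosen projection on formal sums, so an element of a tensor
  product or of the free operad is a formal sum fixed by a projection that is known only through its
  kernel. The structure maps are linear on all formal sums. Once they are known to respect the
  relations, identities can be checked on pure tensors and on classes of single terms. Arity one
  needs care: only the coideal has generators, whereas decompositions involve the whole cooperad.
  The elements \<open>\<Gamma>\<close> absorb the projection onto the coideal and are linear on all
  functionals.\<close>

interpretation fs: vector_space "fscl :: 'k::field \<Rightarrow> ('x \<Rightarrow>\<^sub>0 'k) \<Rightarrow> _"
  by (rule vector_space_fscl)

lemma vector_space_times: "vector_space ((*) :: 'k::field \<Rightarrow> 'k \<Rightarrow> 'k)"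
  by unfold_locales (auto simp: algebra_simps)

lemma keys_fscl: "Poly_Mapping.keys (fscl c v) \<subseteq> Poly_Mapping.keys v"
  by (auto simp: in_keys_iff lookup_fscl)

lemma ksign_simps [simp]:
  "ksign 0 = 1" "ksign a * ksign a = (1 :: 'k::field)" "ksign (- a) = (ksign a :: 'k)"
  by (auto simp: ksign_def)

lemma ksign_add: "ksign (a + b) = (ksign a * ksign b :: 'k::field)"
  by (auto simp: ksign_def)

section \<open>Linear extension\<close>

text \<open>The support of a sum can shrink by cancellation, so linearity of \<open>lext\<close> is
  proved over a common finite superset of the supports, where the additional summands
  vanish.\<close>

lemma lext_superset:
  assumes "vector_space s" "finite A" "Poly_Mapping.keys v \<subseteq> A"
  shows "lext s f v = (\<Sum>x\<in>A. s (Poly_Mapping.lookup v x) (f x))"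
proof -
  interpret vector_space s by fact
  show ?thesis unfolding lext_def
    by (rule sum.mono_neutral_left) (use assms in \<open>auto simp: in_keys_iff\<close>)
qed

lemma lext_add:
  assumes "vector_space s"
  shows "lext s f (v + w) = lext s f v + lext s f w"
proof -
  interpret vector_space s by fact
  let ?A = "Poly_Mapping.keys v \<union> Poly_Mapping.keys w"
  have "Poly_Mapping.keys (v + w) \<subseteq> ?A" by (rule keys_add)
  then show ?thesis
    by (simp add: lext_superset[OF assms, of ?A] lookup_add scale_left_distrib sum.distrib)
qed

lemma lext_fscl:
  assumes "vector_space s"
  shows "lext s f (fscl c v) = s c (lext s f v)"
proof -
  interpret vector_space s by fact
  show ?thesis using keys_fscl[of c v]
    by (simp add: lext_superset[OF assms, of "Poly_Mapping.keys v"] lookup_fscl scale_sum_right)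
qed

lemma lext_zero: "lext s f 0 = 0"
  by (simp add: lext_def)

lemma lext_bas:
  assumes "vector_space s"
  shows "lext s f (bas x) = f x"
proof -
  interpret vector_space s by fact
  show ?thesis by (simp add: lext_def)
qed

lemma lext_uminus:
  assumes "vector_space (s :: 'k::field \<Rightarrow> 'a::ab_group_add \<Rightarrow> 'a)"
  shows "lext s f (- v) = - lext s f v"
  using lext_add[OF assms, of f v "- v"] by (simp add: lext_zero add_eq_0_iff)

lemma lext_diff:
  assumes "vector_space (s :: 'k::field \<Rightarrow> 'a::ab_group_add \<Rightarrow> 'a)"
  shows "lext s f (v - w) = lext s f v - lext s f w"
  using lext_add[OF assms, of f v "- w"] by (simp add: lext_uminus[OF assms])

lemma lext_sum:
  assumes "vector_space s"
  shows "lext s f (sum g A) = (\<Sum>a\<in>A. lext s f (g a))"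
  by (induction A rule: infinite_finite_induct) (auto simp: lext_zero lext_add[OF assms])

lemma lext_cong: "(\<And>x. x \<in> Poly_Mapping.keys v \<Longrightarrow> f x = g x) \<Longrightarrow> lext s f v = lext s g v"
  by (simp add: lext_def)

lemma lext_fun_add:
  assumes "vector_space s"
  shows "lext s (\<lambda>x. f x + g x) v = lext s f v + lext s g v"
proof -
  interpret vector_space s by fact
  show ?thesis by (simp add: lext_def scale_right_distrib sum.distrib)
qed

lemma lext_fun_scale:
  assumes "vector_space s"
  shows "lext s (\<lambda>x. s c (f x)) v = s c (lext s f v)"
proof -
  interpret vector_space s by fact
  show ?thesis by (simp add: lext_def scale_sum_right mult.commute)
qed

lemma lext_fun_zero:
  assumes "vector_space s"
  shows "lext s (\<lambda>x. 0) v = 0"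
proof -
  interpret vector_space s by fact
  show ?thesis by (simp add: lext_def)
qed

lemma lext_bas_self: "lext fscl bas v = v"
proof (rule poly_mapping_eqI)
  fix x
  show "Poly_Mapping.lookup (lext fscl bas v) x = Poly_Mapping.lookup v x"
    by (simp add: lext_def lookup_sum lookup_fscl lookup_single when_def in_keys_iff if_distrib cong: if_cong)
qed

lemma keys_lext: "Poly_Mapping.keys (lext fscl f v) \<subseteq> (\<Union>x\<in>Poly_Mapping.keys v. Poly_Mapping.keys (f x))"
  unfolding lext_def
  by (rule order_trans[OF keys_sum]) (use keys_fscl in fastforce)

lemma keys_lextI:
  assumes "\<And>x. x \<in> Poly_Mapping.keys v \<Longrightarrow> Poly_Mapping.keys (f x) \<subseteq> T"
  shows "Poly_Mapping.keys (lext fscl f v) \<subseteq> T"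
  using keys_lext[of f v] assms by blast

lemma keys_addI: "Poly_Mapping.keys v \<subseteq> T \<Longrightarrow> Poly_Mapping.keys w \<subseteq> T \<Longrightarrow> Poly_Mapping.keys (v + w) \<subseteq> T"
  using keys_add[of v w] by blast

lemma keys_diffI:
  "Poly_Mapping.keys v \<subseteq> T \<Longrightarrow> Poly_Mapping.keys (w :: 'x \<Rightarrow>\<^sub>0 'k::field) \<subseteq> T \<Longrightarrow> Poly_Mapping.keys (v - w) \<subseteq> T"
  using keys_addI[of v T "- w"] by simp

lemma keys_sumI: "(\<And>i. i \<in> I \<Longrightarrow> Poly_Mapping.keys (f i) \<subseteq> T) \<Longrightarrow> Poly_Mapping.keys (sum f I) \<subseteq> T"
  using keys_sum[of f I] by blast

lemma keys_basI: "x \<in> T \<Longrightarrow> Poly_Mapping.keys (bas x) \<subseteq> T"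
  by simp

lemma keys_fsclI: "Poly_Mapping.keys v \<subseteq> T \<Longrightarrow> Poly_Mapping.keys (fscl c v) \<subseteq> T"
  using keys_fscl[of c v] by blast

lemmas keys_intros = keys_addI keys_diffI keys_sumI keys_basI keys_fsclI keys_lextI

lemma lext_lext:
  assumes "vector_space s"
  shows "lext s f (lext fscl g v) = lext s (\<lambda>x. lext s f (g x)) v"
  by (simp add: lext_def[of fscl g] lext_sum[OF assms] lext_fscl[OF assms])
    (simp add: lext_def)

lemmas lexts = lext_add lext_fscl lext_bas lext_uminus lext_diff lext_sum
lemmas lext_f [simp] = lext_add[OF vector_space_fscl] lext_fscl[OF vector_space_fscl]
  lext_zero lext_bas[OF vector_space_fscl] lext_uminus[OF vector_space_fscl]
  lext_diff[OF vector_space_fscl] lext_sum[OF vector_space_fscl]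
lemmas lext_t [simp] = lext_add[OF vector_space_times] lext_fscl[OF vector_space_times]
  lext_bas[OF vector_space_times] lext_uminus[OF vector_space_times]
  lext_diff[OF vector_space_times] lext_sum[OF vector_space_times]

text \<open>Every formal sum is the extension of \<open>bas\<close> over itself, and a linear map
  commutes with this expansion. In this way nested extensions are turned into a single one.\<close>

lemma linear_eq_lext:
  fixes v :: "'x \<Rightarrow>\<^sub>0 'k::field"
  assumes "\<And>v w. g (v + w) = g v + g w" "\<And>c v. g (fscl c v) = s c (g v)" "g 0 = 0"
  shows "g v = lext s (\<lambda>x. g (bas x)) v"
proof -
  have "g (sum h A) = (\<Sum>a\<in>A. g (h a))" for h and A :: "'x set"
    by (induction A rule: infinite_finite_induct) (auto simp: assms)
  then have "g (lext fscl bas v) = lext s (\<lambda>x. g (bas x)) v"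
    by (simp add: lext_def assms)
  then show ?thesis by (simp add: lext_bas_self)
qed

text \<open>The spans in the definitions of \<open>tgr\<close> and \<open>quasi_free\<close> become
  conditions on supports, which are easily propagated through linear extensions.\<close>

lemma span_bas: "module.span fscl {bas t | t. \<phi> t} = {v :: 'x \<Rightarrow>\<^sub>0 'k::field. \<forall>t\<in>Poly_Mapping.keys v. \<phi> t}"
proof (intro equalityI subsetI)
  let ?T = "{v :: 'x \<Rightarrow>\<^sub>0 'k. \<forall>t\<in>Poly_Mapping.keys v. \<phi> t}"
  have T: "?T = {v. Poly_Mapping.keys v \<subseteq> Collect \<phi>}" by auto
  have "module.subspace fscl ?T"
    unfolding T
    by (rule fs.subspaceI)
      (simp_all only: mem_Collect_eq keys_zero empty_subsetI keys_addI keys_fsclI)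
  moreover have "{bas t | t. \<phi> t} \<subseteq> ?T" by (auto simp: keys_single)
  ultimately have "module.span fscl {bas t | t. \<phi> t} \<subseteq> ?T" by (intro fs.span_minimal)
  then show "v \<in> ?T" if "v \<in> module.span fscl {bas t | t. \<phi> t}" for v using that by (rule subsetD)
next
  fix v :: "'x \<Rightarrow>\<^sub>0 'k" assume v: "v \<in> {v. \<forall>t\<in>Poly_Mapping.keys v. \<phi> t}"
  have "lext fscl bas v \<in> module.span fscl {bas t | t. \<phi> t}"
    unfolding lext_def by (intro fs.span_sum fs.span_scale fs.span_base) (use v in auto)
  then show "v \<in> module.span fscl {bas t | t. \<phi> t}" by (simp add: lext_bas_self)
qed

section \<open>Maps that are linear on a subspace\<close>

lemma linmapI:
  assumes "\<And>x. x \<in> A \<Longrightarrow> f x \<in> B" "\<And>x y. x \<in> A \<Longrightarrow> y \<in> A \<Longrightarrow> f (x + y) = f x + f y"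
    "\<And>c x. x \<in> A \<Longrightarrow> f (s c x) = t c (f x)"
  shows "linmap s t A B f"
  unfolding linmap_def using assms by blast

lemma linmapD:
  assumes "linmap s t A B f"
  shows "x \<in> A \<Longrightarrow> f x \<in> B" "x \<in> A \<Longrightarrow> y \<in> A \<Longrightarrow> f (x + y) = f x + f y"
    "x \<in> A \<Longrightarrow> f (s c x) = t c (f x)"
  using assms unfolding linmap_def by blast+

lemma linmap_comp: "linmap s t A B f \<Longrightarrow> linmap t u B C g \<Longrightarrow> linmap s u A C (\<lambda>x. g (f x))"
  by (intro linmapI) (simp_all only: linmapD)

lemma linmap_zero:
  assumes "linmap s t A B (f :: 'a::ab_group_add \<Rightarrow> 'b::ab_group_add)" "vector_space s" "module.subspace s A"
  shows "f 0 = 0"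
proof -
  interpret vector_space s by fact
  have "0 \<in> A" using assms(3) subspace_0 by auto
  then have "f (0 + 0) = f 0 + f 0" by (intro linmapD(2)[OF assms(1)])
  then show ?thesis by simp
qed

lemma linmap_sum:
  assumes "linmap s t A B (f :: 'a::ab_group_add \<Rightarrow> 'b::ab_group_add)" "vector_space s" "module.subspace s A"
    and "\<And>i. i \<in> I \<Longrightarrow> g i \<in> A"
  shows "f (sum g I) = (\<Sum>i\<in>I. f (g i))"
proof -
  interpret vector_space s by fact
  show ?thesis using assms(4)
  proof (induction I rule: infinite_finite_induct)
    case (insert i I)
    have "sum g I \<in> A" using insert.prems by (intro subspace_sum assms(3)) blast
    then have "f (g i + sum g I) = f (g i) + f (sum g I)"
      using insert.prems by (intro linmapD(2)[OF assms(1)]) blast+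
    then show ?case using insert by simp
  qed (simp_all add: linmap_zero[OF assms(1-3)])
qed

lemma linmap_lext:
  assumes "linmap s t A B (f :: 'a::ab_group_add \<Rightarrow> 'b::ab_group_add)" "vector_space s" "module.subspace s A"
    and "\<And>x. x \<in> Poly_Mapping.keys v \<Longrightarrow> g x \<in> A"
  shows "f (lext s g v) = lext t (\<lambda>x. f (g x)) v"
proof -
  interpret vector_space s by fact
  have "f (lext s g v) = (\<Sum>x\<in>Poly_Mapping.keys v. f (s (Poly_Mapping.lookup v x) (g x)))"
    unfolding lext_def by (intro linmap_sum[OF assms(1-3)] subspace_scale[OF assms(3)] assms(4))
  also have "\<dots> = lext t (\<lambda>x. f (g x)) v"
    unfolding lext_def by (intro sum.cong linmapD(3)[OF assms(1)] assms(4) refl)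
  finally show ?thesis .
qed

section \<open>Quotients\<close>

context
  fixes R :: "('x \<Rightarrow>\<^sub>0 'k::field) set"
  assumes R: "module.subspace fscl R"
begin

lemma quot_spec: "Vector_Spaces.linear fscl fscl (quot R)" "v - quot R v \<in> R" "v \<in> R \<Longrightarrow> quot R v = 0"
  using someI_ex[OF quot_exists[OF R]] unfolding quot_def by blast+

lemma quot_linear: "quot R (v + w) = quot R v + quot R w" "quot R (fscl c v) = fscl c (quot R v)"
  "quot R 0 = 0" "quot R (v - w) = quot R v - quot R w" "quot R (- v) = - quot R v"
  "quot R (sum f A) = (\<Sum>a\<in>A. quot R (f a))"
proof -
  interpret Vector_Spaces.linear fscl fscl "quot R" by (rule quot_spec(1))
  show "quot R (v + w) = quot R v + quot R w" "quot R (fscl c v) = fscl c (quot R v)"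
    "quot R 0 = 0" "quot R (v - w) = quot R v - quot R w" "quot R (- v) = - quot R v"
    "quot R (sum f A) = (\<Sum>a\<in>A. quot R (f a))"
    by (rule add scale zero diff neg sum)+
qed

lemma quot_eq_0_iff: "quot R v = 0 \<longleftrightarrow> v \<in> R"
  using quot_spec(2)[of v] quot_spec(3)[of v] by auto

lemma quot_eq_iff: "quot R v = quot R w \<longleftrightarrow> v - w \<in> R"
  by (simp add: quot_eq_0_iff[symmetric] quot_linear)

lemma quot_idem: "quot R (quot R v) = quot R v"
  using quot_spec(2)[of v] R fs.subspace_neg[of R "v - quot R v"] by (simp add: quot_eq_iff)

lemma quot_lext: "quot R (lext fscl f v) = lext fscl (\<lambda>x. quot R (f x)) v"
  by (simp add: lext_def quot_linear)

text \<open>The way maps descend to a quotient: \<open>v - quot R v\<close> lies in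
  \<open>R\<close>, so a map that kills \<open>R\<close> cannot tell \<open>v\<close> from its
  representative.\<close>

lemma quot_lift:
  assumes "\<And>v w. g (v - w) = g v - (g w :: 'a::ab_group_add)" "\<And>v. v \<in> R \<Longrightarrow> g v = 0"
  shows "g (quot R v) = g v"
  using assms(1)[of v "quot R v"] assms(2)[OF quot_spec(2)[of v]] by simp

text \<open>The projection changes \<open>v\<close> by an element of \<open>R\<close>, which is
  supported in \<open>T\<close>; hence it preserves the sums supported in \<open>T\<close>, and
  idempotence identifies its image with its fixed points.\<close>

lemma quot_range:
  assumes T: "\<And>v t. v \<in> R \<Longrightarrow> t \<in> Poly_Mapping.keys v \<Longrightarrow> t \<in> T"
  shows "quot R ` {v. Poly_Mapping.keys v \<subseteq> T} = {v. Poly_Mapping.keys v \<subseteq> T \<and> quot R v = v}"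
proof (intro equalityI subsetI)
  fix w assume "w \<in> quot R ` {v. Poly_Mapping.keys v \<subseteq> T}"
  then obtain v where v: "w = quot R v" "Poly_Mapping.keys v \<subseteq> T" by auto
  have "Poly_Mapping.keys (v - (v - quot R v)) \<subseteq> T"
    by (rule keys_diffI) (use v T quot_spec(2) in blast)+
  then show "w \<in> {v. Poly_Mapping.keys v \<subseteq> T \<and> quot R v = v}" by (simp add: v quot_idem)
next
  fix w assume "w \<in> {v. Poly_Mapping.keys v \<subseteq> T \<and> quot R v = v}"
  then show "w \<in> quot R ` {v. Poly_Mapping.keys v \<subseteq> T}" by (intro image_eqI[of _ _ w]) auto
qed

text \<open>A fixed element is the combination, with its own coefficients, of the projections of the
  basis elements in its support.\<close>

lemma quot_range_induct:
  assumes "Poly_Mapping.keys x \<subseteq> T" "quot R x = x"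
    "P 0" "\<And>t. t \<in> T \<Longrightarrow> P (quot R (bas t))"
    "\<And>x y. P x \<Longrightarrow> P y \<Longrightarrow> P (x + y)" "\<And>c x. P x \<Longrightarrow> P (fscl c x)"
  shows "P x"
proof -
  have s: "P (sum f A)" if "\<And>a. a \<in> A \<Longrightarrow> P (f a)" for f and A :: "'x set"
    using that by (induction A rule: infinite_finite_induct) (simp_all add: assms(3,5))
  have eq: "lext fscl (\<lambda>t. quot R (bas t)) x = x"
    using quot_lext[of bas x] unfolding lext_bas_self assms(2) by (rule sym)
  have "P (lext fscl (\<lambda>t. quot R (bas t)) x)"
    unfolding lext_def
  proof (rule s)
    fix t assume "t \<in> Poly_Mapping.keys x"
    then have "P (quot R (bas t))" using assms(1,4) by blast
    then show "P (fscl (Poly_Mapping.lookup x t) (quot R (bas t)))" by (rule assms(6))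
  qed
  then show ?thesis by (simp only: eq)
qed

end

declare One_nat_def [simp del]

section \<open>Graded operads\<close>

locale gvec =
  fixes V :: "('k::field, 'a::ab_group_add, 'z) dgsmod_scheme"
  assumes vs: "vector_space (scl V)"
    and sub: "module.subspace (scl V) (gr V n d)"
begin

sublocale vec: vector_space "scl V" by (rule vs)

lemma gr_zero [simp, intro]: "0 \<in> gr V n d"
  using vec.subspace_0 sub .

lemma gr_add [intro]: "x \<in> gr V n d \<Longrightarrow> y \<in> gr V n d \<Longrightarrow> x + y \<in> gr V n d"
  using vec.subspace_add sub .

lemma gr_scl [intro]: "x \<in> gr V n d \<Longrightarrow> scl V c x \<in> gr V n d"
  using vec.subspace_scale sub .

lemma gr_neg [intro]: "x \<in> gr V n d \<Longrightarrow> - x \<in> gr V n d"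
  using vec.subspace_neg sub .

lemma gr_diff [intro]: "x \<in> gr V n d \<Longrightarrow> y \<in> gr V n d \<Longrightarrow> x - y \<in> gr V n d"
  using vec.subspace_diff sub .

lemma gr_sum: "(\<And>i. i \<in> I \<Longrightarrow> f i \<in> gr V n d) \<Longrightarrow> sum f I \<in> gr V n d"
  using vec.subspace_sum sub .

lemma lin_zero: "linmap (scl V) t (gr V n d) B (f :: 'a \<Rightarrow> 'b::ab_group_add) \<Longrightarrow> f 0 = 0"
  by (rule linmap_zero[OF _ vs sub])

lemma lin_neg:
  assumes "linmap (scl V) t (gr V n d) B (f :: 'a \<Rightarrow> 'b::ab_group_add)" "x \<in> gr V n d"
  shows "f (- x) = - f x"
proof -
  have "f (x + - x) = f x + f (- x)"
    using assms(2) by (intro linmapD(2)[OF assms(1)] gr_neg)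
  then show ?thesis by (simp add: lin_zero[OF assms(1)] eq_neg_iff_add_eq_0 add.commute)
qed

lemma lin_diff:
  assumes "linmap (scl V) t (gr V n d) B (f :: 'a \<Rightarrow> 'b::ab_group_add)" "x \<in> gr V n d" "y \<in> gr V n d"
  shows "f (x - y) = f x - f y"
proof -
  have "f (x + - y) = f x + f (- y)"
    using assms(2,3) by (intro linmapD(2)[OF assms(1)] gr_neg)
  then show ?thesis by (simp add: lin_neg[OF assms(1,3)])
qed

lemma lin_sum:
  assumes "linmap (scl V) t (gr V n d) B (f :: 'a \<Rightarrow> 'b::ab_group_add)" "\<And>i. i \<in> I \<Longrightarrow> g i \<in> gr V n d"
  shows "f (sum g I) = (\<Sum>i\<in>I. f (g i))"
  by (rule linmap_sum[OF assms(1) vs sub assms(2)])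

lemma lin_lext:
  assumes "linmap (scl V) t (gr V n d) B (f :: 'a \<Rightarrow> 'b::ab_group_add)"
    "\<And>x. x \<in> Poly_Mapping.keys v \<Longrightarrow> g x \<in> gr V n d"
  shows "f (lext (scl V) g v) = lext t (\<lambda>x. f (g x)) v"
  by (rule linmap_lext[OF assms(1) vs sub assms(2)])

lemma gr_lext: "(\<And>x. x \<in> Poly_Mapping.keys v \<Longrightarrow> g x \<in> gr V n d) \<Longrightarrow> lext (scl V) g v \<in> gr V n d"
  unfolding lext_def by (intro gr_sum gr_scl)

end

locale smod = gvec V for V :: "('k::field, 'a::ab_group_add, 'z) dgsmod_scheme" +
  assumes act_lin: "\<sigma> permutes {1..n} \<Longrightarrow> linmap (scl V) (scl V) (gr V n d) (gr V n d) (act V n d \<sigma>)"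
    and act_id: "x \<in> gr V n d \<Longrightarrow> act V n d id x = x"
    and act_act: "x \<in> gr V n d \<Longrightarrow> \<sigma> permutes {1..n} \<Longrightarrow> \<tau> permutes {1..n} \<Longrightarrow>
      act V n d \<tau> (act V n d \<sigma> x) = act V n d (\<sigma> \<circ> \<tau>) x"
begin

lemma act_in: "x \<in> gr V n d \<Longrightarrow> \<sigma> permutes {1..n} \<Longrightarrow> act V n d \<sigma> x \<in> gr V n d"
  using linmapD(1)[OF act_lin] .

lemma act_inv:
  assumes "x \<in> gr V n d" "\<sigma> permutes {1..n}"
  shows "act V n d (inv \<sigma>) (act V n d \<sigma> x) = x" "act V n d \<sigma> (act V n d (inv \<sigma>) x) = x"
  using assms by (simp_all add: act_act permutes_inv permutes_inv_o act_id)

end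

locale dsmod = smod V for V :: "('k::field, 'a::ab_group_add, 'z) dgsmod_scheme" +
  assumes dif_lin: "linmap (scl V) (scl V) (gr V n d) (gr V n (d - 1)) (dif V n d)"
    and dif_act: "x \<in> gr V n d \<Longrightarrow> \<sigma> permutes {1..n} \<Longrightarrow>
      dif V n d (act V n d \<sigma> x) = act V n (d - 1) \<sigma> (dif V n d x)"

locale gop = smod P for P :: "('k::field, 'a::ab_group_add) dgop" +
  assumes unt_in: "unt P \<in> gr P 1 0"
    and cmp_lin_right: "1 \<le> i \<Longrightarrow> i \<le> m \<Longrightarrow> x \<in> gr P m a \<Longrightarrow>
      linmap (scl P) (scl P) (gr P n b) (gr P (m + n - 1) (a + b)) (\<lambda>y. cmp P m a n b i x y)"
    and cmp_lin_left: "1 \<le> i \<Longrightarrow> i \<le> m \<Longrightarrow> y \<in> gr P n b \<Longrightarrow>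
      linmap (scl P) (scl P) (gr P m a) (gr P (m + n - 1) (a + b)) (\<lambda>x. cmp P m a n b i x y)"
    and unit_l: "x \<in> gr P n d \<Longrightarrow> cmp P 1 0 n d 1 (unt P) x = x"
    and unit_r: "x \<in> gr P n d \<Longrightarrow> 1 \<le> i \<Longrightarrow> i \<le> n \<Longrightarrow> cmp P n d 1 0 i x (unt P) = x"
    and seq: "x \<in> gr P l a \<Longrightarrow> y \<in> gr P m b \<Longrightarrow> z \<in> gr P n c \<Longrightarrow>
      1 \<le> i \<Longrightarrow> i \<le> l \<Longrightarrow> 1 \<le> j \<Longrightarrow> j \<le> m \<Longrightarrow>
      cmp P (l + m - 1) (a + b) n c (i - 1 + j) (cmp P l a m b i x y) z =
      cmp P l a (m + n - 1) (b + c) i x (cmp P m b n c j y z)"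
    and par: "x \<in> gr P l a \<Longrightarrow> y \<in> gr P m b \<Longrightarrow> z \<in> gr P n c \<Longrightarrow>
      1 \<le> i \<Longrightarrow> i < k \<Longrightarrow> k \<le> l \<Longrightarrow>
      cmp P (l + m - 1) (a + b) n c (k - 1 + m) (cmp P l a m b i x y) z =
      scl P (ksign (b * c)) (cmp P (l + n - 1) (a + c) m b i (cmp P l a n c k x z) y)"
    and equi: "x \<in> gr P m a \<Longrightarrow> y \<in> gr P n b \<Longrightarrow> 1 \<le> i \<Longrightarrow> i \<le> m \<Longrightarrow>
      \<sigma> permutes {1..m} \<Longrightarrow> \<tau> permutes {1..n} \<Longrightarrow>
      cmp P m a n b i (act P m a \<sigma> x) (act P n b \<tau> y) =
      act P (m + n - 1) (a + b) (perm_cmp m n i \<sigma> \<tau>) (cmp P m a n b (\<sigma> i) x y)"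
begin

lemma cmp_in: "1 \<le> i \<Longrightarrow> i \<le> m \<Longrightarrow> x \<in> gr P m a \<Longrightarrow> y \<in> gr P n b \<Longrightarrow>
    cmp P m a n b i x y \<in> gr P (m + n - 1) (a + b)"
  using linmapD(1)[OF cmp_lin_right] .

end

locale predg = gop P + dsmod P for P :: "('k::field, 'a::ab_group_add) dgop" +
  assumes dif_unt: "dif P 1 0 (unt P) = 0"
    and dif_cmp: "x \<in> gr P m a \<Longrightarrow> y \<in> gr P n b \<Longrightarrow> 1 \<le> i \<Longrightarrow> i \<le> m \<Longrightarrow>
      dif P (m + n - 1) (a + b) (cmp P m a n b i x y) =
      cmp P m (a - 1) n b i (dif P m a x) y + scl P (ksign a) (cmp P m a n (b - 1) i x (dif P n b y))"

lemma dg_operad_predg: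
  assumes "dg_operad P"
  shows "predg P"
proof -
  note D = assms[unfolded dg_operad_def]
  have "dg_smodule P" using D by (rule conjunct1)
  note S = this[unfolded dg_smodule_def]
  have "gvec P" unfolding gvec_def using S by (elim conjE) (intro conjI allI; blast)
  moreover have "smod_axioms P" unfolding smod_axioms_def using S by (elim conjE) (intro conjI allI impI; blast)
  moreover have "dsmod_axioms P" unfolding dsmod_axioms_def using S by (elim conjE) (intro conjI allI impI; simp)
  moreover have "gop_axioms P" unfolding gop_axioms_def using D by (elim conjE) (intro conjI allI impI; simp)
  moreover have "predg_axioms P" unfolding predg_axioms_def using D by (elim conjE) (intro conjI allI impI; simp)
  ultimately show ?thesis by (simp add: predg_def gop_def dsmod_def smod_def)
qed

text \<open>An operad is a record that extends an S-module. The rule carries the module structure of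
  \<open>had_smod\<close> over to the Hadamard operad built on it.\<close>

lemma smod_cong:
  "smod V \<Longrightarrow> scl V' = scl V \<Longrightarrow> gr V' = gr V \<Longrightarrow> act V' = act V \<Longrightarrow> smod V'"
  by (simp add: smod_def smod_axioms_def gvec_def)

lemma dsmod_cong:
  "dsmod V \<Longrightarrow> scl V' = scl V \<Longrightarrow> gr V' = gr V \<Longrightarrow> act V' = act V \<Longrightarrow> dif V' = dif V \<Longrightarrow> dsmod V'"
  by (simp add: dsmod_def dsmod_axioms_def smod_def smod_axioms_def gvec_def)

section \<open>Graded tensor products\<close>

text \<open>The function is given on all keys, but bilinearity is demanded only between graded
  pieces of total degree \<open>d\<close>: these are the keys that occur in the relations
  \<open>tens_rel\<close>.\<close>

definition bilin ::
  "('k::field \<Rightarrow> 'a \<Rightarrow> 'a) \<Rightarrow> (int \<Rightarrow> 'a::ab_group_add set) \<Rightarrow>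
   ('k \<Rightarrow> 'b \<Rightarrow> 'b) \<Rightarrow> (int \<Rightarrow> 'b::ab_group_add set) \<Rightarrow> ('k \<Rightarrow> 'c \<Rightarrow> 'c) \<Rightarrow> int \<Rightarrow>
   (('a, 'b) tkey \<Rightarrow> 'c::ab_group_add) \<Rightarrow> bool" where
  "bilin s A t B u d \<beta> \<longleftrightarrow> (\<forall>i j. i + j = d \<longrightarrow>
     (\<forall>x\<in>A i. linmap t u (B j) UNIV (\<lambda>y. \<beta> ((i, x), (j, y)))) \<and>
     (\<forall>y\<in>B j. linmap s u (A i) UNIV (\<lambda>x. \<beta> ((i, x), (j, y)))))"

lemma bilinI:
  assumes "\<And>i j x. i + j = d \<Longrightarrow> x \<in> A i \<Longrightarrow> linmap t u (B j) UNIV (\<lambda>y. \<beta> ((i, x), (j, y)))"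
    "\<And>i j y. i + j = d \<Longrightarrow> y \<in> B j \<Longrightarrow> linmap s u (A i) UNIV (\<lambda>x. \<beta> ((i, x), (j, y)))"
  shows "bilin s A t B u d \<beta>"
  unfolding bilin_def using assms by blast

lemma bilinD:
  assumes "bilin s A t B u d \<beta>" "i + j = d"
  shows "x \<in> A i \<Longrightarrow> linmap t u (B j) UNIV (\<lambda>y. \<beta> ((i, x), (j, y)))"
    "y \<in> B j \<Longrightarrow> linmap s u (A i) UNIV (\<lambda>x. \<beta> ((i, x), (j, y)))"
  using assms unfolding bilin_def by blast+

definition tkeys ::
  "('k, 'a, 'y) dgsmod_scheme \<Rightarrow> nat \<Rightarrow> ('k, 'b, 'z) dgsmod_scheme \<Rightarrow> nat \<Rightarrow> int \<Rightarrow> ('a, 'b) tkey set" where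
  "tkeys V m W n d = {((i, x), (j, y)) | i x j y. x \<in> gr V m i \<and> y \<in> gr W n j \<and> i + j = d}"

lemma tkeysE:
  assumes "t \<in> tkeys V m W n d"
  obtains i x j y where "t = ((i, x), (j, y))" "x \<in> gr V m i" "y \<in> gr W n j" "i + j = d"
  using assms unfolding tkeys_def by blast

lemma tkeysI: "x \<in> gr V m i \<Longrightarrow> y \<in> gr W n j \<Longrightarrow> i + j = d \<Longrightarrow> ((i, x), (j, y)) \<in> tkeys V m W n d"
  unfolding tkeys_def by blast

locale tensor = V: gvec V + W: gvec W
  for V :: "('k::field, 'a::ab_group_add, 'y) dgsmod_scheme" and W :: "('k, 'b::ab_group_add, 'z) dgsmod_scheme"
begin

abbreviation "rel m n d \<equiv> tens_rel (scl V) (gr V m) (scl W) (gr W n) d"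

lemma rel_subspace: "module.subspace fscl (rel m n d)"
  unfolding tens_rel_def by (rule fs.subspace_span)

lemma rel_induct [consumes 1]:
  assumes "v \<in> rel m n d" "module.subspace fscl T"
    "\<And>i j x x' y. i + j = d \<Longrightarrow> x \<in> gr V m i \<Longrightarrow> x' \<in> gr V m i \<Longrightarrow> y \<in> gr W n j \<Longrightarrow>
      bas ((i, x + x'), (j, y)) - bas ((i, x), (j, y)) - bas ((i, x'), (j, y)) \<in> T"
    "\<And>i j x y y'. i + j = d \<Longrightarrow> x \<in> gr V m i \<Longrightarrow> y \<in> gr W n j \<Longrightarrow> y' \<in> gr W n j \<Longrightarrow>
      bas ((i, x), (j, y + y')) - bas ((i, x), (j, y)) - bas ((i, x), (j, y')) \<in> T"
    "\<And>c i j x y. i + j = d \<Longrightarrow> x \<in> gr V m i \<Longrightarrow> y \<in> gr W n j \<Longrightarrow>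
      bas ((i, scl V c x), (j, y)) - fscl c (bas ((i, x), (j, y))) \<in> T"
    "\<And>c i j x y. i + j = d \<Longrightarrow> x \<in> gr V m i \<Longrightarrow> y \<in> gr W n j \<Longrightarrow>
      bas ((i, x), (j, scl W c y)) - fscl c (bas ((i, x), (j, y))) \<in> T"
  shows "v \<in> T"
proof -
  have "rel m n d \<subseteq> T"
    unfolding tens_rel_def
    by (rule fs.span_minimal[OF _ assms(2)], intro Un_least subsetI; elim CollectE exE conjE; simp only: assms(3-6))
  then show ?thesis using assms(1) by blast
qed

lemma keys_subspace: "module.subspace fscl {v :: 'x \<Rightarrow>\<^sub>0 'k. Poly_Mapping.keys v \<subseteq> T}"
  by (rule fs.subspaceI)
    (simp_all only: mem_Collect_eq keys_zero empty_subsetI keys_addI keys_fsclI)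

text \<open>Homogeneity of the bilinearity relations. It provides the support condition of
  \<open>quot_range\<close>, so that representatives of tensors stay within admissible keys.\<close>

lemma rel_keys: "v \<in> rel m n d \<Longrightarrow> Poly_Mapping.keys v \<subseteq> tkeys V m W n d"
  by (erule rel_induct[of _ _ _ _ "{v. Poly_Mapping.keys v \<subseteq> tkeys V m W n d}", simplified mem_Collect_eq])
    (intro keys_subspace keys_intros tkeysI V.gr_add W.gr_add V.gr_scl W.gr_scl; assumption)+

lemma tcls_linear:
  "tcls V m W n d (v + w) = tcls V m W n d v + tcls V m W n d w"
  "tcls V m W n d (fscl c v) = fscl c (tcls V m W n d v)"
  "tcls V m W n d 0 = 0"
  "tcls V m W n d (lext fscl f u) = lext fscl (\<lambda>x. tcls V m W n d (f x)) u"
  unfolding tcls_def by (simp_all add: quot_linear[OF rel_subspace] quot_lext[OF rel_subspace])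

lemma tgr_eq: "tgr V m W n d = {v. Poly_Mapping.keys v \<subseteq> tkeys V m W n d \<and> tcls V m W n d v = v}"
proof -
  have e: "{bas ((i, x), (j, y)) |i x j y. x \<in> gr V m i \<and> y \<in> gr W n j \<and> i + j = d} =
      {bas t | t. t \<in> tkeys V m W n d}"
    unfolding tkeys_def by blast
  have k: "{v. \<forall>t\<in>Poly_Mapping.keys v. t \<in> tkeys V m W n d} = {v. Poly_Mapping.keys v \<subseteq> tkeys V m W n d}"
    by auto
  show ?thesis
    unfolding tgr_def e span_bas tcls_def k
    by (rule quot_range[OF rel_subspace]) (rule subsetD[OF rel_keys])
qed

lemma tcls_in: "Poly_Mapping.keys v \<subseteq> tkeys V m W n d \<Longrightarrow> tcls V m W n d v \<in> tgr V m W n d"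
  unfolding tgr_eq tcls_def
  using quot_range[OF rel_subspace, of m n d "tkeys V m W n d"] rel_keys by blast

lemma tgr_keys: "v \<in> tgr V m W n d \<Longrightarrow> Poly_Mapping.keys v \<subseteq> tkeys V m W n d"
  by (simp add: tgr_eq)

lemma tgr_subspace: "module.subspace fscl (tgr V m W n d)"
  by (rule fs.subspaceI) (auto simp: tgr_eq tcls_linear keys_addI keys_fsclI intro: subsetD[OF keys_addI] subsetD[OF keys_fsclI])

lemma pure_in: "x \<in> gr V m i \<Longrightarrow> y \<in> gr W n j \<Longrightarrow> i + j = d \<Longrightarrow> pure V m W n i x j y \<in> tgr V m W n d"
  unfolding tgr_def pure_def by (auto intro!: imageI fs.span_base)

lemma tgr_induct [consumes 1, case_names zero pure add scale]:
  assumes "v \<in> tgr V m W n d" "P 0"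
    "\<And>i x j y. x \<in> gr V m i \<Longrightarrow> y \<in> gr W n j \<Longrightarrow> i + j = d \<Longrightarrow> P (pure V m W n i x j y)"
    "\<And>v w. P v \<Longrightarrow> P w \<Longrightarrow> P (v + w)" "\<And>c v. P v \<Longrightarrow> P (fscl c v)"
  shows "P v"
proof (rule quot_range_induct[OF rel_subspace])
  show "Poly_Mapping.keys v \<subseteq> tkeys V m W n d" "quot (rel m n d) v = v"
    using assms(1) by (simp_all add: tgr_eq tcls_def)
  show "P (quot (rel m n d) (bas t))" if "t \<in> tkeys V m W n d" for t
    using that
  proof (rule tkeysE)
    fix i x j y assume "t = ((i, x), (j, y))" "x \<in> gr V m i" "y \<in> gr W n j" "i + j = d"
    then show ?thesis using assms(3)[of x i y j] unfolding pure_def tcls_def by simp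
  qed
qed (use assms in blast)+

text \<open>The universal property of the tensor product: the extension of a bilinear function kills
  each of the four kinds of relation, so it may be computed on any representative.\<close>

lemma lext_tcls:
  assumes "vector_space u" "bilin (scl V) (gr V m) (scl W) (gr W n) u d \<beta>"
  shows "lext u \<beta> (tcls V m W n d v) = lext u \<beta> v"
  unfolding tcls_def
proof (rule quot_lift[OF rel_subspace])
  interpret vector_space u by fact
  note l = lexts[OF assms(1)] lext_zero
  show "lext u \<beta> (v - w) = lext u \<beta> v - lext u \<beta> w" for v w by (simp add: l)
  show "lext u \<beta> v = 0" if "v \<in> rel m n d" for v
  proof -
    have "v \<in> {v. lext u \<beta> v = 0}"
      using that
    proof (rule rel_induct)
      show "module.subspace fscl {v. lext u \<beta> v = 0}" by (rule fs.subspaceI) (simp_all add: l)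
    qed (simp_all add: l linmapD[OF bilinD(1)[OF assms(2)]] linmapD[OF bilinD(2)[OF assms(2)]])
    then show ?thesis by simp
  qed
qed

lemma lext_pure:
  assumes "vector_space u" "bilin (scl V) (gr V m) (scl W) (gr W n) u (i + j) \<beta>"
  shows "lext u \<beta> (pure V m W n i x j y) = \<beta> ((i, x), (j, y))"
  unfolding pure_def by (simp add: lext_tcls[OF assms] lexts[OF assms(1)])

text \<open>The counterpart of the universal property: each defining relation has class zero, which
  says that the pure tensor is a bilinear function of its two entries.\<close>

lemma bilin_bas: "bilin (scl V) (gr V m) (scl W) (gr W n) fscl d (\<lambda>t. tcls V m W n d (bas t))"
proof -
  have r: "quot (rel m n d) (v - w) = 0 \<Longrightarrow> quot (rel m n d) v = quot (rel m n d) w" for v w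
    by (simp add: quot_linear[OF rel_subspace])
  have "x \<in> rel m n d \<Longrightarrow> quot (rel m n d) x = 0" for x by (rule quot_spec(3)[OF rel_subspace])
  note z = this[unfolded tens_rel_def, OF fs.span_base, folded tens_rel_def]
  show ?thesis
    unfolding tcls_def
  proof (intro bilinI linmapI UNIV_I)
    fix i j x y y' assume a: "i + j = d" "x \<in> gr V m i" "y \<in> gr W n j" "y' \<in> gr W n j"
    have "quot (rel m n d) (bas ((i, x), (j, y + y')) - bas ((i, x), (j, y)) - bas ((i, x), (j, y'))) = 0"
      by (rule z) (use a in blast)
    then show "quot (rel m n d) (bas ((i, x), (j, y + y'))) = quot (rel m n d) (bas ((i, x), (j, y))) + quot (rel m n d) (bas ((i, x), (j, y')))"
      by (simp add: quot_linear[OF rel_subspace] algebra_simps)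
  next
    fix i j x c y assume a: "i + j = d" "x \<in> gr V m i" "y \<in> gr W n j"
    have "quot (rel m n d) (bas ((i, x), (j, scl W c y)) - fscl c (bas ((i, x), (j, y)))) = 0"
      by (rule z) (use a in blast)
    then show "quot (rel m n d) (bas ((i, x), (j, scl W c y))) = fscl c (quot (rel m n d) (bas ((i, x), (j, y))))"
      by (simp add: quot_linear[OF rel_subspace])
  next
    fix i j x x' y assume a: "i + j = d" "y \<in> gr W n j" "x \<in> gr V m i" "x' \<in> gr V m i"
    have "quot (rel m n d) (bas ((i, x + x'), (j, y)) - bas ((i, x), (j, y)) - bas ((i, x'), (j, y))) = 0"
      by (rule z) (use a in blast)
    then show "quot (rel m n d) (bas ((i, x + x'), (j, y))) = quot (rel m n d) (bas ((i, x), (j, y))) + quot (rel m n d) (bas ((i, x'), (j, y)))"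
      by (simp add: quot_linear[OF rel_subspace] algebra_simps)
  next
    fix i j y c x assume a: "i + j = d" "y \<in> gr W n j" "x \<in> gr V m i"
    have "quot (rel m n d) (bas ((i, scl V c x), (j, y)) - fscl c (bas ((i, x), (j, y)))) = 0"
      by (rule z) (use a in blast)
    then show "quot (rel m n d) (bas ((i, scl V c x), (j, y))) = fscl c (quot (rel m n d) (bas ((i, x), (j, y))))"
      by (simp add: quot_linear[OF rel_subspace])
  qed
qed

lemma pure_lin_left: "y \<in> gr W n j \<Longrightarrow> linmap (scl V) fscl (gr V m i) UNIV (\<lambda>x. pure V m W n i x j y)"
  unfolding pure_def by (rule bilinD(2)[OF bilin_bas refl])

lemma pure_lin_right: "x \<in> gr V m i \<Longrightarrow> linmap (scl W) fscl (gr W n j) UNIV (\<lambda>y. pure V m W n i x j y)"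
  unfolding pure_def by (rule bilinD(1)[OF bilin_bas refl])

lemma pure_lin_left': 
  "linmap s (scl V) A (gr V m i) f \<Longrightarrow> y \<in> gr W n j \<Longrightarrow> linmap s fscl A UNIV (\<lambda>x. pure V m W n i (f x) j y)"
  by (rule linmap_comp[OF _ pure_lin_left])

lemma pure_lin_right':
  "linmap s (scl W) A (gr W n j) f \<Longrightarrow> x \<in> gr V m i \<Longrightarrow> linmap s fscl A UNIV (\<lambda>y. pure V m W n i x j (f y))"
  by (rule linmap_comp[OF _ pure_lin_right])

end

lemma linmap_fun_fscl: "linmap s fscl A UNIV f \<Longrightarrow> linmap s fscl A UNIV (\<lambda>x. fscl c (f x))"
  by (rule linmapI) (simp_all add: linmapD fs.scale_right_distrib fs.scale_left_commute)

lemma linmap_fun_add: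
  "linmap s fscl A UNIV f \<Longrightarrow> linmap s fscl A UNIV g \<Longrightarrow> linmap s fscl A UNIV (\<lambda>x. f x + g x)"
  by (rule linmapI) (simp_all add: linmapD fs.scale_right_distrib algebra_simps)

lemma linmap_id: "linmap s s A A (\<lambda>x. x)"
  by (simp add: linmap_def)

lemma linmap_fun_lext:
  assumes "vector_space u" "\<And>t. t \<in> Poly_Mapping.keys v \<Longrightarrow> linmap s u A UNIV (\<lambda>x. f x t)"
  shows "linmap s u A UNIV (\<lambda>x. lext u (f x) v)"
proof (rule linmapI)
  interpret vector_space u by fact
  show "lext u (f (x + y)) v = lext u (f x) v + lext u (f y) v" if "x \<in> A" "y \<in> A" for x y
    unfolding lext_fun_add[OF assms(1), symmetric]
    by (rule lext_cong) (rule linmapD(2)[OF assms(2) that])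
  show "lext u (f (s c x)) v = u c (lext u (f x) v)" if "x \<in> A" for c x
    unfolding lext_fun_scale[OF assms(1), symmetric]
    by (rule lext_cong) (rule linmapD(3)[OF assms(2) that])
qed auto

text \<open>The inner representative is replaced first, separately for each key of the outer class;
  this is legitimate because the outer class is still supported on admissible keys. The outer
  function is then bilinear, being an extension of bilinear functions over \<open>w\<close>.\<close>

lemma lext2_tcls:
  assumes t: "tensor V W" "tensor V' W'"
    and u: "vector_space u"
    and k: "Poly_Mapping.keys v \<subseteq> tkeys V m W n d" "Poly_Mapping.keys w \<subseteq> tkeys V' m' W' n' d'"
    and b1: "\<And>t'. t' \<in> tkeys V' m' W' n' d' \<Longrightarrow> bilin (scl V) (gr V m) (scl W) (gr W n) u d (\<lambda>t. \<Phi> t t')"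
    and b2: "\<And>t. t \<in> tkeys V m W n d \<Longrightarrow> bilin (scl V') (gr V' m') (scl W') (gr W' n') u d' (\<Phi> t)"
  shows "lext u (\<lambda>t. lext u (\<Phi> t) (tcls V' m' W' n' d' w)) (tcls V m W n d v) = lext u (\<lambda>t. lext u (\<Phi> t) w) v"
proof -
  interpret t1: tensor V W by fact
  interpret t2: tensor V' W' by fact
  have tk: "Poly_Mapping.keys (tcls V m W n d v) \<subseteq> tkeys V m W n d"
    by (rule t1.tgr_keys[OF t1.tcls_in[OF k(1)]])
  have "lext u (\<lambda>t. lext u (\<Phi> t) (tcls V' m' W' n' d' w)) (tcls V m W n d v)
      = lext u (\<lambda>t. lext u (\<Phi> t) w) (tcls V m W n d v)"
    using tk by (intro lext_cong t2.lext_tcls u b2) auto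
  also have "\<dots> = lext u (\<lambda>t. lext u (\<Phi> t) w) v"
    by (intro t1.lext_tcls u bilinI linmap_fun_lext)
      (use k(2) bilinD[OF b1] in blast)+
  finally show ?thesis .
qed

lemma lext2_pure:
  assumes t: "tensor V W" "tensor V' W'"
    and u: "vector_space u"
    and k: "x \<in> gr V m i" "y \<in> gr W n j" "x' \<in> gr V' m' i'" "y' \<in> gr W' n' j'"
    and b1: "\<And>t'. t' \<in> tkeys V' m' W' n' (i' + j') \<Longrightarrow> bilin (scl V) (gr V m) (scl W) (gr W n) u (i + j) (\<lambda>t. \<Phi> t t')"
    and b2: "\<And>t. t \<in> tkeys V m W n (i + j) \<Longrightarrow> bilin (scl V') (gr V' m') (scl W') (gr W' n') u (i' + j') (\<Phi> t)"
  shows "lext u (\<lambda>t. lext u (\<Phi> t) (pure V' m' W' n' i' x' j' y')) (pure V m W n i x j y)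
    = \<Phi> ((i, x), (j, y)) ((i', x'), (j', y'))"
  unfolding pure_def
  by (subst lext2_tcls[OF t u _ _ b1 b2]) (use k in \<open>auto simp: lexts[OF u] tkeysI\<close>)

section \<open>Block permutations\<close>

text \<open>The \<open>n\<close> positions starting at \<open>i\<close> are mapped injectively by
  \<tau> to the \<open>n\<close> positions starting at \<open>\<sigma> i\<close>, and the other
  positions injectively by \<sigma> to the complement. An injective self-map of a finite set is a
  bijection.\<close>

lemma perm_cmp_permutes:
  assumes i: "1 \<le> i" "i \<le> m" and s: "\<sigma> permutes {1..m}" "\<tau> permutes {1..n}"
  shows "perm_cmp m n i \<sigma> \<tau> permutes {1..m + n - 1}"
proof (rule bij_imp_permutes)
  let ?p = "perm_cmp m n i \<sigma> \<tau>" and ?N = "{1..m + n - 1}"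
  \<comment> \<open>\<open>g\<close> recovers the slot of the outer operation from a position
    outside the inserted block, and \<open>sh\<close> renumbers the values of \<sigma> after the
    block has been inserted at \<open>\<sigma> i\<close>.\<close>
  define g where "g x = (if x < i then x else x - n + 1)" for x
  define sh where "sh y = (if y < \<sigma> i then y else y + n - 1)" for y
  have s1: "\<sigma> y \<in> {1..m}" if "y \<in> {1..m}" for y using that permutes_in_image[OF s(1)] by blast
  have s2: "\<tau> y \<in> {1..n}" if "y \<in> {1..n}" for y using that permutes_in_image[OF s(2)] by blast
  have i1: "\<sigma> x = \<sigma> y \<longleftrightarrow> x = y" and i2: "\<tau> x = \<tau> y \<longleftrightarrow> x = y" for x y
    using permutes_inj[OF s(1)] permutes_inj[OF s(2)] by (auto dest: injD)
  have mid: "?p x = \<sigma> i - 1 + \<tau> (x - i + 1)" if "x \<in> ?N" "i \<le> x" "x < i + n" for x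
    using that by (auto simp: perm_cmp_def)
  have out: "?p x = sh (\<sigma> (g x))" "g x \<in> {1..m}" "g x \<noteq> i" if "x \<in> ?N" "\<not> (i \<le> x \<and> x < i + n)" for x
    using that i by (auto simp: perm_cmp_def g_def sh_def)
  have mr: "?p x \<in> {\<sigma> i..<\<sigma> i + n}" if "x \<in> ?N" "i \<le> x" "x < i + n" for x
  proof -
    have "x - i + 1 \<in> {1..n}" using that by auto
    then show ?thesis using mid[OF that] s2[of "x - i + 1"] s1[of i] i by auto
  qed
  have orr: "?p x \<in> ?N - {\<sigma> i..<\<sigma> i + n}" if "x \<in> ?N" "\<not> (i \<le> x \<and> x < i + n)" for x
    using out[OF that] s1[of "g x"] i1[of "g x" i] s1[of i] i by (auto simp: sh_def)
  have inj: "x = y" if "x \<in> ?N" "y \<in> ?N" "?p x = ?p y" for x y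
  proof (cases "i \<le> x \<and> x < i + n")
    case True
    then have y: "i \<le> y" "y < i + n" using mr[OF that(1)] orr[OF that(2)] that(3) by auto
    have "\<tau> (x - i + 1) = \<tau> (y - i + 1)"
      using mid[OF that(1)] mid[OF that(2)] True y that(3) by auto
    then show ?thesis using True y i2 by auto
  next
    case False
    then have y: "\<not> (i \<le> y \<and> y < i + n)" using mr[OF that(2)] orr[OF that(1)] that(3) by auto
    have ne: "\<sigma> (g x) \<noteq> \<sigma> i" "\<sigma> (g y) \<noteq> \<sigma> i"
      using out(3)[OF that(1) False] out(3)[OF that(2) y] i1 by auto
    have "\<sigma> (g x) = \<sigma> (g y)"
      using that(3) ne unfolding out(1)[OF that(1) False] out(1)[OF that(2) y] sh_def
      by (auto split: if_splits)
    then have "g x = g y" using i1 by auto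
    then show ?thesis using False y i unfolding g_def by (auto split: if_splits)
  qed
  have sub: "?p ` ?N \<subseteq> ?N"
  proof
    fix z assume "z \<in> ?p ` ?N"
    then obtain x where x: "x \<in> ?N" "z = ?p x" by blast
    show "z \<in> ?N"
      using mr[OF x(1)] orr[OF x(1)] x(2) s1[of i] i by (cases "i \<le> x \<and> x < i + n") auto
  qed
  have "inj_on ?p ?N" using inj by (auto intro: inj_onI)
  then show "bij_betw ?p ?N ?N"
    using endo_inj_surj[OF _ sub] by (simp add: bij_betw_def)
  show "?p x = x" if "x \<notin> ?N" for x using that by (simp only: perm_cmp_def Let_def if_True HOL.simp_thms)
qed

section \<open>Hadamard products\<close>

lemma had_smod_simps [simp]:
  "scl (had_smod V W) = fscl" "gr (had_smod V W) = (\<lambda>n d. tgr V n W n d)"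
  by (simp_all add: had_smod_def)

lemma had_op_simps [simp]:
  "scl (had_op P W) = fscl" "gr (had_op P W) = (\<lambda>n d. tgr P n W n d)"
  "act (had_op P W) = act (had_smod P W)" "dif (had_op P W) = dif (had_smod P W)"
  "unt (had_op P W) = pure P 1 W 1 0 (unt P) 0 (unt W)"
  by (simp_all add: had_op_def dgsmod.defs dgop.defs had_smod_def)

lemma had_coop_simps [simp]:
  "scl (had_coop C D) = fscl" "gr (had_coop C D) = (\<lambda>n d. tgr C n D n d)"
  "act (had_coop C D) = act (had_smod C D)" "dif (had_coop C D) = dif (had_smod C D)"
  "coaug (had_coop C D) = pure C 1 D 1 0 (coaug C) 0 (coaug D)"
  by (simp_all add: had_coop_def dgsmod.defs dgcoop.defs had_smod_def)

lemmas lext_fun_f [simp] =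
  lext_fun_add[OF vector_space_fscl] lext_fun_scale[OF vector_space_fscl] lext_fun_zero[OF vector_space_fscl]

lemma had_act_linear [simp]:
  "act (had_smod V W) n d \<sigma> (v + w) = act (had_smod V W) n d \<sigma> v + act (had_smod V W) n d \<sigma> w"
  "act (had_smod V W) n d \<sigma> (fscl c v) = fscl c (act (had_smod V W) n d \<sigma> v)"
  "act (had_smod V W) n d \<sigma> 0 = 0"
  "act (had_smod V W) n d \<sigma> (sum f A) = (\<Sum>a\<in>A. act (had_smod V W) n d \<sigma> (f a))"
  by (simp_all add: had_smod_def)

lemma had_dif_linear [simp]:
  "dif (had_smod V W) n d (v + w) = dif (had_smod V W) n d v + dif (had_smod V W) n d w"
  "dif (had_smod V W) n d (fscl c v) = fscl c (dif (had_smod V W) n d v)"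
  "dif (had_smod V W) n d 0 = 0"
  "dif (had_smod V W) n d (sum f A) = (\<Sum>a\<in>A. dif (had_smod V W) n d (f a))"
  by (simp_all add: had_smod_def)

lemma tensor_smod: "smod V \<Longrightarrow> smod W \<Longrightarrow> tensor V W"
  by (simp add: tensor_def smod_def)

lemma had_act_pure:
  assumes "smod V" "smod W" "x \<in> gr V n i" "y \<in> gr W n j" "\<sigma> permutes {1..n}"
  shows "act (had_smod V W) n d \<sigma> (pure V n W n i x j y) = pure V n W n i (act V n i \<sigma> x) j (act W n j \<sigma> y)"
proof -
  interpret V: smod V by fact
  interpret W: smod W by fact
  interpret tensor V W by unfold_locales
  show ?thesis
    unfolding had_smod_def using assms
    by simp (subst lext_pure[OF vector_space_fscl], rule bilinI;
      auto intro!: pure_lin_left' pure_lin_right' V.act_lin W.act_lin V.act_in W.act_in)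
qed

lemma had_dif_pure:
  assumes "dsmod V" "dsmod W" "x \<in> gr V n i" "y \<in> gr W n j"
  shows "dif (had_smod V W) n d (pure V n W n i x j y) =
    pure V n W n (i - 1) (dif V n i x) j y + fscl (ksign i) (pure V n W n i x (j - 1) (dif W n j y))"
proof -
  interpret V: dsmod V by fact
  interpret W: dsmod W by fact
  interpret tensor V W by unfold_locales
  show ?thesis
    unfolding had_smod_def using assms
    by simp (subst lext_pure[OF vector_space_fscl], rule bilinI;
      auto intro!: linmap_fun_fscl linmap_fun_add pure_lin_left' pure_lin_right' V.dif_lin W.dif_lin
        linmapD(1)[OF V.dif_lin] linmapD(1)[OF W.dif_lin] pure_lin_left pure_lin_right)
qed

lemma gvec_had: "smod V \<Longrightarrow> smod W \<Longrightarrow> gvec (had_smod V W)"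
  unfolding gvec_def using tensor.tgr_subspace[OF tensor_smod] vector_space_fscl by auto

lemma smod_had:
  assumes "smod V" "smod W"
  shows "smod (had_smod V W)"
proof -
  interpret V: smod V by fact
  interpret W: smod W by fact
  interpret tensor V W by unfold_locales
  interpret H: gvec "had_smod V W" by (rule gvec_had[OF assms])
  note p = had_act_pure[OF assms] V.act_in W.act_in
  show ?thesis
  proof unfold_locales
    fix \<sigma> and n :: nat and d assume s: "\<sigma> permutes {1..n}"
    have "act (had_smod V W) n d \<sigma> v \<in> tgr V n W n d" if "v \<in> tgr V n W n d" for v
      using that
      by (induction rule: tgr_induct)
        (use H.gr_zero H.gr_add H.gr_scl s in \<open>simp_all add: p pure_in\<close>)
    then show "linmap (scl (had_smod V W)) (scl (had_smod V W)) (gr (had_smod V W) n d) (gr (had_smod V W) n d)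
        (act (had_smod V W) n d \<sigma>)"
      by (intro linmapI) simp_all
  next
    fix x and n :: nat and d assume "x \<in> gr (had_smod V W) n d"
    then have "x \<in> tgr V n W n d" by simp
    then show "act (had_smod V W) n d id x = x"
      by (induction rule: tgr_induct) (simp_all add: p V.act_id W.act_id V.act_id[unfolded id_def] W.act_id[unfolded id_def] permutes_id[unfolded id_def])
  next
    fix x and n :: nat and d \<sigma> \<tau> assume s: "\<sigma> permutes {1..n}" "\<tau> permutes {1..n}"
    assume "x \<in> gr (had_smod V W) n d"
    then have "x \<in> tgr V n W n d" by simp
    then show "act (had_smod V W) n d \<tau> (act (had_smod V W) n d \<sigma> x) = act (had_smod V W) n d (\<sigma> \<circ> \<tau>) x"
      by (induction rule: tgr_induct)
        (simp_all add: p s V.act_act W.act_act permutes_compose[OF s(2,1), unfolded o_def] o_def)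
  qed
qed

lemma dsmod_had:
  assumes "dsmod V" "dsmod W"
  shows "dsmod (had_smod V W)"
proof -
  interpret V: dsmod V by fact
  interpret W: dsmod W by fact
  interpret tensor V W by unfold_locales
  interpret H: smod "had_smod V W" by (intro smod_had V.smod_axioms W.smod_axioms)
  note p = had_act_pure[OF V.smod_axioms W.smod_axioms] V.act_in W.act_in had_dif_pure[OF assms]
    linmapD(1)[OF V.dif_lin] linmapD(1)[OF W.dif_lin] V.dif_act W.dif_act
  show ?thesis
  proof unfold_locales
    fix n :: nat and d
    have "dif (had_smod V W) n d v \<in> tgr V n W n (d - 1)" if "v \<in> tgr V n W n d" for v
      using that
    proof (induction rule: tgr_induct)
      case (pure i x j y)
      have "pure V n W n (i - 1) (dif V n i x) j y \<in> tgr V n W n (d - 1)"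
        "pure V n W n i x (j - 1) (dif W n j y) \<in> tgr V n W n (d - 1)"
        using pure by (auto intro!: pure_in simp: p)
      then show ?case using pure H.gr_add[of _ n "d - 1"] H.gr_scl[of _ n "d - 1"] by (simp add: p)
    qed (use H.gr_zero[of n "d - 1"] H.gr_add[of _ n "d - 1"] H.gr_scl[of _ n "d - 1"] in simp_all)
    then show "linmap (scl (had_smod V W)) (scl (had_smod V W)) (gr (had_smod V W) n d) (gr (had_smod V W) n (d - 1))
        (dif (had_smod V W) n d)"
      by (intro linmapI) simp_all
  next
    fix x and n :: nat and d \<sigma> assume s: "\<sigma> permutes {1..n}"
    assume "x \<in> gr (had_smod V W) n d"
    then have "x \<in> tgr V n W n d" by simp
    then show "dif (had_smod V W) n d (act (had_smod V W) n d \<sigma> x) = act (had_smod V W) n (d - 1) \<sigma> (dif (had_smod V W) n d x)"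
      by (induction rule: tgr_induct) (simp_all add: p s)
  qed
qed

text \<open>The composition of the Hadamard operad on a pair of keys, isolated so that the
  two-variable extension lemmas apply. The sign is the Koszul sign for exchanging \<open>y\<close>
  and \<open>x'\<close>.\<close>

definition had_mul ::
  "('k::field, 'a::ab_group_add) dgop \<Rightarrow> ('k, 'b::ab_group_add) dgop \<Rightarrow> nat \<Rightarrow> nat \<Rightarrow> nat \<Rightarrow>
   ('a, 'b) tkey \<Rightarrow> ('a, 'b) tkey \<Rightarrow> (('a, 'b) tkey \<Rightarrow>\<^sub>0 'k)" where
  "had_mul P W m n k = (\<lambda>((i, x), (j, y)) ((i', x'), (j', y')).
     fscl (ksign (j * i')) (pure P (m + n - 1) W (m + n - 1)
       (i + i') (cmp P m i n i' k x x') (j + j') (cmp W m j n j' k y y')))"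

lemma had_cmp:
  "cmp (had_op P W) m a n b k v w = lext fscl (\<lambda>t. lext fscl (had_mul P W m n k t) w) v"
  by (simp add: had_op_def dgsmod.defs dgop.defs had_smod_def had_mul_def split_def)

lemma had_cmp_linear [simp]:
  "cmp (had_op P W) m a n b k (v + v') w = cmp (had_op P W) m a n b k v w + cmp (had_op P W) m a n b k v' w"
  "cmp (had_op P W) m a n b k (fscl c v) w = fscl c (cmp (had_op P W) m a n b k v w)"
  "cmp (had_op P W) m a n b k 0 w = 0"
  "cmp (had_op P W) m a n b k (sum f A) w = (\<Sum>a'\<in>A. cmp (had_op P W) m a n b k (f a') w)"
  "cmp (had_op P W) m a n b k v (w + w') = cmp (had_op P W) m a n b k v w + cmp (had_op P W) m a n b k v w'"
  "cmp (had_op P W) m a n b k v (fscl c w) = fscl c (cmp (had_op P W) m a n b k v w)"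
  "cmp (had_op P W) m a n b k v 0 = 0"
proof -
  show "cmp (had_op P W) m a n b k (v + v') w = cmp (had_op P W) m a n b k v w + cmp (had_op P W) m a n b k v' w"
  "cmp (had_op P W) m a n b k (fscl c v) w = fscl c (cmp (had_op P W) m a n b k v w)"
  "cmp (had_op P W) m a n b k 0 w = 0"
  "cmp (had_op P W) m a n b k (sum f A) w = (\<Sum>a'\<in>A. cmp (had_op P W) m a n b k (f a') w)"
  "cmp (had_op P W) m a n b k v (w + w') = cmp (had_op P W) m a n b k v w + cmp (had_op P W) m a n b k v w'"
  "cmp (had_op P W) m a n b k v (fscl c w) = fscl c (cmp (had_op P W) m a n b k v w)"
  "cmp (had_op P W) m a n b k v 0 = 0"
    by (simp_all add: had_cmp)
qed

lemma had_cmp_sum_right [simp]: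
  "cmp (had_op P W) m a n b k v (sum f A) = (\<Sum>a'\<in>A. cmp (had_op P W) m a n b k v (f a'))"
  by (induction A rule: infinite_finite_induct) simp_all

lemma had_cmp_pure:
  assumes "gop P" "gop W" "1 \<le> k" "k \<le> m"
    "x \<in> gr P m i" "y \<in> gr W m j" "x' \<in> gr P n i'" "y' \<in> gr W n j'"
  shows "cmp (had_op P W) m a n b k (pure P m W m i x j y) (pure P n W n i' x' j' y') =
    fscl (ksign (j * i')) (pure P (m + n - 1) W (m + n - 1)
       (i + i') (cmp P m i n i' k x x') (j + j') (cmp W m j n j' k y y'))"
proof -
  interpret P: gop P by fact
  interpret W: gop W by fact
  interpret T: tensor P W by unfold_locales
  have "lext fscl (\<lambda>t. lext fscl (had_mul P W m n k t) (pure P n W n i' x' j' y')) (pure P m W m i x j y) =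
      had_mul P W m n k ((i, x), (j, y)) ((i', x'), (j', y'))"
  proof (rule lext2_pure[OF _ _ vector_space_fscl assms(5-8)])
    fix t' assume "t' \<in> tkeys P n W n (i' + j')"
    then show "bilin (scl P) (gr P m) (scl W) (gr W m) fscl (i + j) (\<lambda>t. had_mul P W m n k t t')"
      by (elim tkeysE) (use assms(3,4) in \<open>auto intro!: bilinI linmap_fun_fscl T.pure_lin_left'
        T.pure_lin_right' P.cmp_lin_left W.cmp_lin_left P.cmp_in W.cmp_in simp: had_mul_def\<close>)
  next
    fix t assume "t \<in> tkeys P m W m (i + j)"
    then show "bilin (scl P) (gr P n) (scl W) (gr W n) fscl (i' + j') (had_mul P W m n k t)"
      by (elim tkeysE) (use assms(3,4) in \<open>auto intro!: bilinI linmap_fun_fscl T.pure_lin_left'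
        T.pure_lin_right' P.cmp_lin_right W.cmp_lin_right P.cmp_in W.cmp_in simp: had_mul_def\<close>)
  qed unfold_locales
  then show ?thesis by (simp add: had_cmp had_mul_def)
qed

text \<open>The structure maps of \<open>had_op\<close> are linear on all formal sums, so identities between them need to
  be checked on pure tensors only.\<close>

definition additive_hom :: "(('x \<Rightarrow>\<^sub>0 'k::field) \<Rightarrow> ('y \<Rightarrow>\<^sub>0 'k)) \<Rightarrow> bool" where
  "additive_hom f \<longleftrightarrow> f 0 = 0 \<and> (\<forall>v w. f (v + w) = f v + f w) \<and> (\<forall>c v. f (fscl c v) = fscl c (f v))"

context tensor
begin

lemma tgr_ext1:
  assumes "v \<in> tgr V m W n d" "additive_hom f" "additive_hom g"
    "\<And>i x j y. x \<in> gr V m i \<Longrightarrow> y \<in> gr W n j \<Longrightarrow> i + j = d \<Longrightarrow> f (pure V m W n i x j y) = g (pure V m W n i x j y)"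
  shows "f v = g v"
  using assms(1)
  by (induction rule: tgr_induct) (use assms(2-4) in \<open>simp_all add: additive_hom_def\<close>)

lemma tgr_ext2:
  assumes "v \<in> tgr V m W n d" "v' \<in> tgr V m' W n' d'"
    "\<And>w. additive_hom (\<lambda>v. f v w)" "\<And>w. additive_hom (\<lambda>v. g v w)"
    "\<And>v. additive_hom (f v)" "\<And>v. additive_hom (g v)"
    "\<And>i x j y i' x' j' y'. x \<in> gr V m i \<Longrightarrow> y \<in> gr W n j \<Longrightarrow> i + j = d \<Longrightarrow>
      x' \<in> gr V m' i' \<Longrightarrow> y' \<in> gr W n' j' \<Longrightarrow> i' + j' = d' \<Longrightarrow>
      f (pure V m W n i x j y) (pure V m' W n' i' x' j' y') = g (pure V m W n i x j y) (pure V m' W n' i' x' j' y')"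
  shows "f v v' = g v v'"
  by (rule tgr_ext1[OF assms(1,3,4)], rule tgr_ext1[OF assms(2,5,6)], rule assms(7))

lemma tgr_ext3:
  assumes "v \<in> tgr V m W n d" "v' \<in> tgr V m' W n' d'" "v'' \<in> tgr V m'' W n'' d''"
    "\<And>w u. additive_hom (\<lambda>v. f v w u)" "\<And>w u. additive_hom (\<lambda>v. g v w u)"
    "\<And>v u. additive_hom (\<lambda>w. f v w u)" "\<And>v u. additive_hom (\<lambda>w. g v w u)"
    "\<And>v w. additive_hom (f v w)" "\<And>v w. additive_hom (g v w)"
    "\<And>i x j y i' x' j' y' i'' x'' j'' y''. x \<in> gr V m i \<Longrightarrow> y \<in> gr W n j \<Longrightarrow> i + j = d \<Longrightarrow>
      x' \<in> gr V m' i' \<Longrightarrow> y' \<in> gr W n' j' \<Longrightarrow> i' + j' = d' \<Longrightarrow>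
      x'' \<in> gr V m'' i'' \<Longrightarrow> y'' \<in> gr W n'' j'' \<Longrightarrow> i'' + j'' = d'' \<Longrightarrow>
      f (pure V m W n i x j y) (pure V m' W n' i' x' j' y') (pure V m'' W n'' i'' x'' j'' y'') =
      g (pure V m W n i x j y) (pure V m' W n' i' x' j' y') (pure V m'' W n'' i'' x'' j'' y'')"
  shows "f v v' v'' = g v v' v''"
  by (rule tgr_ext2[OF assms(1,2,4-7)], rule tgr_ext1[OF assms(3,8,9)], rule assms(10))

lemma pure_scl: "x \<in> gr V m i \<Longrightarrow> y \<in> gr W n j \<Longrightarrow> pure V m W n i (scl V c x) j y = fscl c (pure V m W n i x j y)"
  "x \<in> gr V m i \<Longrightarrow> y \<in> gr W n j \<Longrightarrow> pure V m W n i x j (scl W c y) = fscl c (pure V m W n i x j y)"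
  by (rule linmapD(3)[OF pure_lin_left] linmapD(3)[OF pure_lin_right]; assumption)+

lemma pure_add: "x \<in> gr V m i \<Longrightarrow> x' \<in> gr V m i \<Longrightarrow> y \<in> gr W n j \<Longrightarrow>
    pure V m W n i (x + x') j y = pure V m W n i x j y + pure V m W n i x' j y"
  "x \<in> gr V m i \<Longrightarrow> y \<in> gr W n j \<Longrightarrow> y' \<in> gr W n j \<Longrightarrow>
    pure V m W n i x j (y + y') = pure V m W n i x j y + pure V m W n i x j y'"
  by (rule linmapD(2)[OF pure_lin_left] linmapD(2)[OF pure_lin_right]; assumption)+

end

text \<open>Each axiom holds in both tensor factors. On pure tensors the associativity axioms leave
  a comparison of interchange signs, which is decided by parity.\<close>

lemma gop_had:
  assumes "gop P" "gop W"
  shows "gop (had_op P W)"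
proof -
  interpret P: gop P by fact
  interpret W: gop W by fact
  interpret tensor P W by unfold_locales
  interpret S: smod "had_op P W"
    by (rule smod_cong[OF smod_had[OF P.smod_axioms W.smod_axioms]]) simp_all
  note p = had_act_pure[OF P.smod_axioms W.smod_axioms] P.act_in W.act_in had_cmp_pure[OF assms] P.cmp_in W.cmp_in
  have z: "0 \<in> tgr P n W n d" for n d using S.gr_zero by simp
  have ad: "v \<in> tgr P n W n d \<Longrightarrow> w \<in> tgr P n W n d \<Longrightarrow> v + w \<in> tgr P n W n d" for v w n d
    using S.gr_add by simp
  have sc: "v \<in> tgr P n W n d \<Longrightarrow> fscl c v \<in> tgr P n W n d" for v c n d
    using S.gr_scl by simp
  have c_in: "cmp (had_op P W) m a n b i v w \<in> tgr P (m + n - 1) W (m + n - 1) (a + b)"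
    if "1 \<le> i" "i \<le> m" "v \<in> tgr P m W m a" "w \<in> tgr P n W n b" for m a n b i v w
    using that(3)
  proof (induction rule: tgr_induct)
    case (pure j x k y)
    show ?case using that(4)
    proof (induction rule: tgr_induct)
      case (pure j' x' k' y')
      then show ?case using \<open>x \<in> gr P m j\<close> \<open>y \<in> gr W m k\<close> \<open>j + k = a\<close> that(1,2)
        by (auto simp: p intro!: sc pure_in)
    qed (simp_all add: z ad sc)
  qed (simp_all add: z ad sc)
  note ah = additive_hom_def
  show ?thesis
  proof unfold_locales
    show "unt (had_op P W) \<in> gr (had_op P W) 1 0"
      by (auto intro!: pure_in P.unt_in W.unt_in)
  next
    fix i m n :: nat and a b x assume "1 \<le> i" "i \<le> m" "x \<in> gr (had_op P W) m a"
    then show "linmap (scl (had_op P W)) (scl (had_op P W)) (gr (had_op P W) n b)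
        (gr (had_op P W) (m + n - 1) (a + b)) (cmp (had_op P W) m a n b i x)"
      by (intro linmapI) (simp_all only: had_op_simps had_cmp_linear c_in)
  next
    fix i m n :: nat and a b y assume "1 \<le> i" "i \<le> m" "y \<in> gr (had_op P W) n b"
    then show "linmap (scl (had_op P W)) (scl (had_op P W)) (gr (had_op P W) m a)
        (gr (had_op P W) (m + n - 1) (a + b)) (\<lambda>x. cmp (had_op P W) m a n b i x y)"
      by (intro linmapI) (simp_all only: had_op_simps had_cmp_linear c_in)
  next
    fix x and n :: nat and d assume "x \<in> gr (had_op P W) n d"
    then have x: "x \<in> tgr P n W n d" by simp
    show "cmp (had_op P W) 1 0 n d 1 (unt (had_op P W)) x = x"
      by (rule tgr_ext1[OF x]) (simp_all add: ah, simp_all add: p P.unt_in W.unt_in P.unit_l W.unit_l)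
  next
    fix x and n :: nat and d i assume "x \<in> gr (had_op P W) n d" and i: "1 \<le> i" "i \<le> n"
    then have x: "x \<in> tgr P n W n d" by simp
    show "cmp (had_op P W) n d 1 0 i x (unt (had_op P W)) = x"
      using i by - (rule tgr_ext1[OF x], simp_all add: ah, simp_all add: p P.unit_r W.unit_r P.unt_in W.unt_in)
  next
    fix x y z and l m n i j :: nat and a b c
    assume "x \<in> gr (had_op P W) l a" "y \<in> gr (had_op P W) m b" "z \<in> gr (had_op P W) n c"
      and i: "1 \<le> i" "i \<le> l" "1 \<le> j" "j \<le> m"
    then have x: "x \<in> tgr P l W l a" and y: "y \<in> tgr P m W m b" and z: "z \<in> tgr P n W n c" by simp_all
    have e: "l + m - 1 + n - 1 = l + (m + n - 1) - 1" and i': "1 \<le> i - 1 + j" "i - 1 + j \<le> l + m - 1"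
      using i by auto
    show "cmp (had_op P W) (l + m - 1) (a + b) n c (i - 1 + j) (cmp (had_op P W) l a m b i x y) z =
      cmp (had_op P W) l a (m + n - 1) (b + c) i x (cmp (had_op P W) m b n c j y z)"
    proof (rule tgr_ext3[OF x y z])
      fix a1 x1 a2 x2 b1 y1 b2 y2 c1 z1 c2 z2
      assume h: "x1 \<in> gr P l a1" "x2 \<in> gr W l a2" "y1 \<in> gr P m b1" "y2 \<in> gr W m b2" "z1 \<in> gr P n c1" "z2 \<in> gr W n c2"
      have s: "ksign (a2 * b1) * ksign ((a2 + b2) * c1) = (ksign (b2 * c1) * ksign (a2 * (b1 + c1)) :: 'a)"
        by (auto simp: ksign_def)
      show "cmp (had_op P W) (l + m - 1) (a + b) n c (i - 1 + j)
          (cmp (had_op P W) l a m b i (pure P l W l a1 x1 a2 x2) (pure P m W m b1 y1 b2 y2)) (pure P n W n c1 z1 c2 z2) =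
        cmp (had_op P W) l a (m + n - 1) (b + c) i (pure P l W l a1 x1 a2 x2)
          (cmp (had_op P W) m b n c j (pure P m W m b1 y1 b2 y2) (pure P n W n c1 z1 c2 z2))"
        using P.seq[OF h(1,3,5) i] W.seq[OF h(2,4,6) i] P.cmp_in[OF i(1,2) h(1,3)] W.cmp_in[OF i(1,2) h(2,4)]
          P.cmp_in[OF i(3,4) h(3,5)] W.cmp_in[OF i(3,4) h(4,6)]
        by (simp only: had_cmp_pure[OF assms] had_cmp_linear h i i' fs.scale_scale s e add.assoc)
    qed (simp_all add: ah)
  next
    fix x y z and l m n i k :: nat and a b c
    assume "x \<in> gr (had_op P W) l a" "y \<in> gr (had_op P W) m b" "z \<in> gr (had_op P W) n c"
      and i: "1 \<le> i" "i < k" "k \<le> l"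
    then have x: "x \<in> tgr P l W l a" and y: "y \<in> tgr P m W m b" and z: "z \<in> tgr P n W n c" by simp_all
    have e: "l + m - 1 + n - 1 = l + n - 1 + m - 1" and i': "1 \<le> i" "i \<le> l" "1 \<le> k" "k \<le> l"
      "1 \<le> k - 1 + m" "k - 1 + m \<le> l + m - 1" "1 \<le> i" "i \<le> l + n - 1"
      using i by auto
    show "cmp (had_op P W) (l + m - 1) (a + b) n c (k - 1 + m) (cmp (had_op P W) l a m b i x y) z =
      scl (had_op P W) (ksign (b * c)) (cmp (had_op P W) (l + n - 1) (a + c) m b i (cmp (had_op P W) l a n c k x z) y)"
    proof (rule tgr_ext3[OF x y z])
      fix a1 x1 a2 x2 b1 y1 b2 y2 c1 z1 c2 z2
      assume h: "x1 \<in> gr P l a1" "x2 \<in> gr W l a2" "y1 \<in> gr P m b1" "y2 \<in> gr W m b2" "z1 \<in> gr P n c1" "z2 \<in> gr W n c2"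
        and bc: "b1 + b2 = b" "c1 + c2 = c"
      \<comment> \<open>On the left stand the interchange signs of the two composites, followed by
        the signs of parallel associativity in \<open>W\<close> and in \<open>P\<close>.\<close>
      have s: "ksign (a2 * b1) * (ksign ((a2 + b2) * c1) * (ksign (b2 * c2) * ksign (b1 * c1))) =
        (ksign (b * c) * (ksign (a2 * c1) * ksign ((a2 + c2) * b1)) :: 'a)"
        unfolding bc[symmetric] by (auto simp: ksign_def)
      have sw: "a1 + b1 + c1 = a1 + c1 + b1" "a2 + b2 + c2 = a2 + c2 + b2" by auto
      have g: "cmp P (l + n - 1) (a1 + c1) m b1 i (cmp P l a1 n c1 k x1 z1) y1 \<in> gr P (l + n - 1 + m - 1) (a1 + c1 + b1)"
        "cmp W (l + n - 1) (a2 + c2) m b2 i (cmp W l a2 n c2 k x2 z2) y2 \<in> gr W (l + n - 1 + m - 1) (a2 + c2 + b2)"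
        by (intro P.cmp_in W.cmp_in i' h)+
      show "cmp (had_op P W) (l + m - 1) (a + b) n c (k - 1 + m)
          (cmp (had_op P W) l a m b i (pure P l W l a1 x1 a2 x2) (pure P m W m b1 y1 b2 y2)) (pure P n W n c1 z1 c2 z2) =
        scl (had_op P W) (ksign (b * c)) (cmp (had_op P W) (l + n - 1) (a + c) m b i
          (cmp (had_op P W) l a n c k (pure P l W l a1 x1 a2 x2) (pure P n W n c1 z1 c2 z2)) (pure P m W m b1 y1 b2 y2))"
        using P.par[OF h(1,3,5) i] W.par[OF h(2,4,6) i] P.cmp_in[OF i'(1,2) h(1,3)] W.cmp_in[OF i'(1,2) h(2,4)]
          P.cmp_in[OF i'(3,4) h(1,5)] W.cmp_in[OF i'(3,4) h(2,6)]
        by (simp only: had_cmp_pure[OF assms] had_cmp_linear had_op_simps h i' fs.scale_scale e sw pure_scl g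
            P.gr_scl s mult.assoc)
    qed (simp_all add: ah fs.scale_right_distrib fs.scale_left_commute)
  next
    fix x y and m n i :: nat and a b \<sigma> \<tau>
    assume "x \<in> gr (had_op P W) m a" "y \<in> gr (had_op P W) n b" and i: "1 \<le> i" "i \<le> m"
      and s: "\<sigma> permutes {1..m}" "\<tau> permutes {1..n}"
    then have x: "x \<in> tgr P m W m a" and y: "y \<in> tgr P n W n b" by simp_all
    have i': "1 \<le> \<sigma> i" "\<sigma> i \<le> m" using permutes_in_image[OF s(1), of i] i by auto
    have pc: "perm_cmp m n i \<sigma> \<tau> permutes {1..m + n - 1}" by (rule perm_cmp_permutes[OF i s])
    show "cmp (had_op P W) m a n b i (act (had_op P W) m a \<sigma> x) (act (had_op P W) n b \<tau> y) =
      act (had_op P W) (m + n - 1) (a + b) (perm_cmp m n i \<sigma> \<tau>) (cmp (had_op P W) m a n b (\<sigma> i) x y)"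
    proof (rule tgr_ext2[OF x y])
      fix a1 x1 a2 x2 b1 y1 b2 y2
      assume h: "x1 \<in> gr P m a1" "x2 \<in> gr W m a2" "y1 \<in> gr P n b1" "y2 \<in> gr W n b2"
      show "cmp (had_op P W) m a n b i (act (had_op P W) m a \<sigma> (pure P m W m a1 x1 a2 x2)) (act (had_op P W) n b \<tau> (pure P n W n b1 y1 b2 y2)) =
        act (had_op P W) (m + n - 1) (a + b) (perm_cmp m n i \<sigma> \<tau>) (cmp (had_op P W) m a n b (\<sigma> i) (pure P m W m a1 x1 a2 x2) (pure P n W n b1 y1 b2 y2))"
        using P.equi[OF h(1,3) i s] W.equi[OF h(2,4) i s]
        by (simp only: p h i i' s had_op_simps had_act_linear pc)
    qed (simp_all add: ah)
  qed
qed

lemma predg_had: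
  assumes "predg P" "predg W"
  shows "predg (had_op P W)"
proof -
  interpret P: predg P by fact
  interpret W: predg W by fact
  interpret tensor P W by unfold_locales
  interpret S: gop "had_op P W" by (rule gop_had[OF P.gop_axioms W.gop_axioms])
  interpret D: dsmod "had_op P W"
    by (rule dsmod_cong[OF dsmod_had[OF P.dsmod_axioms W.dsmod_axioms]]) simp_all
  note d = had_dif_pure[OF P.dsmod_axioms W.dsmod_axioms] linmapD(1)[OF P.dif_lin] linmapD(1)[OF W.dif_lin]
  note c = had_cmp_pure[OF P.gop_axioms W.gop_axioms]
  show ?thesis
  proof unfold_locales
    have z: "pure P 1 W 1 (-1) 0 0 (unt W) = 0" "pure P 1 W 1 0 (unt P) (-1) 0 = 0"
      using P.lin_zero[OF pure_lin_left[OF W.unt_in], where d="-1"] W.lin_zero[OF pure_lin_right[OF P.unt_in], where d="-1"] by auto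
    show "dif (had_op P W) 1 0 (unt (had_op P W)) = 0"
      using z by (simp add: had_dif_pure[OF P.dsmod_axioms W.dsmod_axioms P.unt_in W.unt_in] P.dif_unt W.dif_unt)
  next
    fix x y and m n i :: nat and a b
    assume "x \<in> gr (had_op P W) m a" "y \<in> gr (had_op P W) n b" and i: "1 \<le> i" "i \<le> m"
    then have x: "x \<in> tgr P m W m a" and y: "y \<in> tgr P n W n b" by simp_all
    show "dif (had_op P W) (m + n - 1) (a + b) (cmp (had_op P W) m a n b i x y) =
       cmp (had_op P W) m (a - 1) n b i (dif (had_op P W) m a x) y +
       scl (had_op P W) (ksign a) (cmp (had_op P W) m a n (b - 1) i x (dif (had_op P W) n b y))"
    proof (rule tgr_ext2[OF x y])
      fix a1 x1 a2 x2 b1 y1 b2 y2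
      assume h: "x1 \<in> gr P m a1" "x2 \<in> gr W m a2" "y1 \<in> gr P n b1" "y2 \<in> gr W n b2" and a: "a1 + a2 = a"
      \<comment> \<open>Differentiating the \<open>W\<close>-entry of the left argument lowers
        \<open>a2\<close> by one, and differentiating the \<open>P\<close>-entry of the right
        argument lowers \<open>b1\<close>; this explains the shifted exponents in the interchange
        signs.\<close>
      have s: "ksign (a1 * 1 + (a2 - 1) * b1) = (ksign (a2 * b1) * ksign (a1 + b1) :: 'a)"
         "ksign a * ksign (a2 * (b1 - 1)) = (ksign (a2 * b1) * ksign a1 :: 'a)"
         "ksign a * (ksign b1 * ksign (a2 * b1)) = (ksign (a2 * b1) * (ksign (a1 + b1) * ksign a2) :: 'a)"
        unfolding a[symmetric] by (auto simp: ksign_def)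
      have s': "ksign a1 * ksign ((a2 - 1) * b1) = (ksign (a2 * b1) * ksign (a1 + b1) :: 'a)"
        by (auto simp: ksign_def)
      have e: "a1 + b1 - 1 = a1 - 1 + b1" "a2 + b2 - 1 = a2 - 1 + b2" and e': "a1 + (b1 - 1) = a1 - 1 + b1" "a2 + (b2 - 1) = a2 - 1 + b2"
        by auto
      have g: "cmp P m (a1 - 1) n b1 i (dif P m a1 x1) y1 \<in> gr P (m + n - 1) (a1 - 1 + b1)"
        "cmp P m a1 n (b1 - 1) i x1 (dif P n b1 y1) \<in> gr P (m + n - 1) (a1 - 1 + b1)"
        "cmp W m (a2 - 1) n b2 i (dif W m a2 x2) y2 \<in> gr W (m + n - 1) (a2 - 1 + b2)"
        "cmp W m a2 n (b2 - 1) i x2 (dif W n b2 y2) \<in> gr W (m + n - 1) (a2 - 1 + b2)"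
        "cmp P m a1 n b1 i x1 y1 \<in> gr P (m + n - 1) (a1 + b1)"
        "cmp W m a2 n b2 i x2 y2 \<in> gr W (m + n - 1) (a2 + b2)"
        using P.cmp_in[OF i _ h(3), of "dif P m a1 x1" "a1 - 1"] P.cmp_in[OF i h(1), of "dif P n b1 y1" n "b1 - 1"]
          W.cmp_in[OF i _ h(4), of "dif W m a2 x2" "a2 - 1"] W.cmp_in[OF i h(2), of "dif W n b2 y2" n "b2 - 1"]
          P.cmp_in[OF i h(1,3)] W.cmp_in[OF i h(2,4)] d(2)[OF h(1)] d(2)[OF h(3)] d(3)[OF h(2)] d(3)[OF h(4)]
        unfolding e' by blast+
      show "dif (had_op P W) (m + n - 1) (a + b) (cmp (had_op P W) m a n b i (pure P m W m a1 x1 a2 x2) (pure P n W n b1 y1 b2 y2)) =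
       cmp (had_op P W) m (a - 1) n b i (dif (had_op P W) m a (pure P m W m a1 x1 a2 x2)) (pure P n W n b1 y1 b2 y2) +
       scl (had_op P W) (ksign a) (cmp (had_op P W) m a n (b - 1) i (pure P m W m a1 x1 a2 x2) (dif (had_op P W) n b (pure P n W n b1 y1 b2 y2)))"
        by (simp only: c d h i g had_op_simps had_cmp_linear had_dif_linear P.dif_cmp W.dif_cmp e e' pure_add pure_scl
           P.gr_scl W.gr_scl fs.scale_right_distrib fs.scale_scale s s') (simp only: add.assoc add.left_commute add.commute)
    qed (simp_all add: additive_hom_def fs.scale_right_distrib fs.scale_left_commute algebra_simps)
  qed
qed

section \<open>Morphisms of graded operads and their Hadamard products\<close>

lemma ghomD:
  assumes "graded_operad_hom P W f"
  shows "linmap (scl P) (scl W) (gr P n d) (gr W n d) (f n d)"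
    "x \<in> gr P n d \<Longrightarrow> \<sigma> permutes {1..n} \<Longrightarrow> f n d (act P n d \<sigma> x) = act W n d \<sigma> (f n d x)"
    "f 1 0 (unt P) = unt W"
    "x \<in> gr P m a \<Longrightarrow> y \<in> gr P n b \<Longrightarrow> 1 \<le> i \<Longrightarrow> i \<le> m \<Longrightarrow>
        f (m + n - 1) (a + b) (cmp P m a n b i x y) = cmp W m a n b i (f m a x) (f n b y)"
  using assms unfolding graded_operad_hom_def by (elim conjE; simp)+

lemma had_map_linear [simp]:
  "had_map V' W' f g n d (v + w) = had_map V' W' f g n d v + had_map V' W' f g n d w"
  "had_map V' W' f g n d (fscl c v) = fscl c (had_map V' W' f g n d v)"
  "had_map V' W' f g n d 0 = 0"
  "had_map V' W' f g n d (sum h A) = (\<Sum>a\<in>A. had_map V' W' f g n d (h a))"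
  by (simp_all add: had_map_def)

lemma had_map_pure:
  assumes "gvec V" "gvec W" "gvec V'" "gvec W'"
    "\<And>n d. linmap (scl V) (scl V') (gr V n d) (gr V' n d) (f n d)"
    "\<And>n d. linmap (scl W) (scl W') (gr W n d) (gr W' n d) (g n d)"
    "x \<in> gr V n i" "y \<in> gr W n j"
  shows "had_map V' W' f g n d (pure V n W n i x j y) = pure V' n W' n i (f n i x) j (g n j y)"
proof -
  interpret T: tensor V W by (simp add: tensor_def assms)
  interpret T': tensor V' W' by (simp add: tensor_def assms)
  show ?thesis unfolding had_map_def
    by (subst T.lext_pure[OF vector_space_fscl], rule bilinI;
      auto intro!: T'.pure_lin_left' T'.pure_lin_right' assms(5,6) linmapD(1)[OF assms(5)] linmapD(1)[OF assms(6)] simp: assms(7,8))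
qed

lemma had_map_linmap:
  assumes "gvec V" "gvec W" "gvec V'" "gvec W'"
    "\<And>n d. linmap (scl V) (scl V') (gr V n d) (gr V' n d) (f n d)"
    "\<And>n d. linmap (scl W) (scl W') (gr W n d) (gr W' n d) (g n d)"
  shows "linmap fscl fscl (tgr V n W n d) (tgr V' n W' n d) (had_map V' W' f g n d)"
proof -
  interpret T: tensor V W by (simp add: tensor_def assms)
  interpret T': tensor V' W' by (simp add: tensor_def assms)
  note s = T'.tgr_subspace
  have "had_map V' W' f g n d v \<in> tgr V' n W' n d" if "v \<in> tgr V n W n d" for v
    using that
    by (induction rule: T.tgr_induct)
      (auto intro!: T'.pure_in fs.subspace_add[OF s] fs.subspace_scale[OF s] fs.subspace_0[OF s]
        linmapD(1)[OF assms(5)] linmapD(1)[OF assms(6)] simp: had_map_pure[OF assms])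
  then show ?thesis by (intro linmapI) simp_all
qed

lemma had_map_hom:
  assumes "gop P" "gop W" "gop P'" "gop W'" "graded_operad_hom P P' f" "graded_operad_hom W W' g"
  shows "graded_operad_hom (had_op P W) (had_op P' W') (had_map P' W' f g)"
proof -
  interpret P: gop P by fact
  interpret W: gop W by fact
  interpret P': gop P' by fact
  interpret W': gop W' by fact
  interpret T: tensor P W by unfold_locales
  have gv: "gvec P" "gvec W" "gvec P'" "gvec W'" by unfold_locales
  note f = ghomD[OF assms(5)] and g = ghomD[OF assms(6)]
  note mp = had_map_pure[OF gv f(1) g(1)]
  note p = mp f(2) g(2) had_act_pure[OF P.smod_axioms W.smod_axioms] had_act_pure[OF P'.smod_axioms W'.smod_axioms]
    linmapD(1)[OF f(1)] linmapD(1)[OF g(1)] P.act_in W.act_in P.cmp_in W.cmp_in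
  show ?thesis unfolding graded_operad_hom_def
  proof (intro conjI allI ballI impI)
    show "linmap (scl (had_op P W)) (scl (had_op P' W')) (gr (had_op P W) n d) (gr (had_op P' W') n d) (had_map P' W' f g n d)" for n d
      using had_map_linmap[OF gv f(1) g(1)] by simp
  next
    fix n d \<sigma> x assume "x \<in> gr (had_op P W) n d" and s: "\<sigma> permutes {1..n}"
    then have x: "x \<in> tgr P n W n d" by simp
    show "had_map P' W' f g n d (act (had_op P W) n d \<sigma> x) = act (had_op P' W') n d \<sigma> (had_map P' W' f g n d x)"
      by (rule T.tgr_ext1[OF x]) (simp_all add: additive_hom_def p s)
  next
    show "had_map P' W' f g 1 0 (unt (had_op P W)) = unt (had_op P' W')"
      by (simp only: had_op_simps mp[OF P.unt_in W.unt_in] f(3) g(3))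
  next
    fix m a n b i x y assume "x \<in> gr (had_op P W) m a" "y \<in> gr (had_op P W) n b" and "1 \<le> i \<and> i \<le> m"
    then have x: "x \<in> tgr P m W m a" and y: "y \<in> tgr P n W n b" and i: "1 \<le> i" "i \<le> m" by simp_all
    show "had_map P' W' f g (m + n - 1) (a + b) (cmp (had_op P W) m a n b i x y) =
        cmp (had_op P' W') m a n b i (had_map P' W' f g m a x) (had_map P' W' f g n b y)"
      by (rule T.tgr_ext2[OF x y]) (simp_all only: additive_hom_def p i had_cmp_linear had_map_linear
          had_cmp_pure[OF assms(1,2)] had_cmp_pure[OF assms(3,4)] f(4) g(4) HOL.simp_thms)
  qed
qed

section \<open>The free operad\<close>

lemma quasi_free_simps [simp]:
  "scl (quasi_free E \<delta>) = fscl"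
  "dif (quasi_free E \<delta>) = (\<lambda>n d v. fcls E n (d - 1) (lext fscl (deriv_term \<delta>) v))"
  "act (quasi_free E \<delta>) = (\<lambda>n d \<sigma> v. fcls E n d (fprm \<sigma> v))"
  "unt (quasi_free E \<delta>) = fcls E 1 0 (bas Unt)"
  "cmp (quasi_free E \<delta>) = (\<lambda>m a n b i v w. fcls E (m + n - 1) (a + b) (fcmp i v w))"
  by (simp_all add: quasi_free_def)

lemma fcmp_linear [simp]:
  "fcmp i (v + v') w = fcmp i v w + fcmp i v' w" "fcmp i (fscl c v) w = fscl c (fcmp i v w)"
  "fcmp i 0 w = 0" "fcmp i (v - v') w = fcmp i v w - fcmp i v' w"
  "fcmp i v (w + w') = fcmp i v w + fcmp i v w'" "fcmp i v (fscl c w) = fscl c (fcmp i v w)"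
  "fcmp i v 0 = 0" "fcmp i v (w - w') = fcmp i v w - fcmp i v w'"
  "fcmp i (bas t) (bas u) = bas (Cmp t i u)"
proof -
  show a: "fcmp i (v + v') w = fcmp i v w + fcmp i v' w" "fcmp i 0 w = 0"
    "fcmp i v (w + w') = fcmp i v w + fcmp i v w'" "fcmp i v 0 = 0" for v v' w w'
    by (simp_all add: fcmp_def)
  show "fcmp i (fscl c v) w = fscl c (fcmp i v w)" "fcmp i v (fscl c w) = fscl c (fcmp i v w)"
    "fcmp i (bas t) (bas u) = bas (Cmp t i u)" "fcmp i (v - v') w = fcmp i v w - fcmp i v' w"
    by (simp_all add: fcmp_def)
  show "fcmp i v (w - w') = fcmp i v w - fcmp i v w'"
    using a(3)[of v "w - w'" w'] by (simp add: algebra_simps)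
qed

lemma fcmp_lext_right: "fcmp i v w = lext fscl (\<lambda>u. fcmp i v (bas u)) w"
  by (rule linear_eq_lext) simp_all

lemma fcmp_lext_left: "fcmp i v w = lext fscl (\<lambda>t. fcmp i (bas t) w) v"
  by (rule linear_eq_lext) simp_all

lemma fprm_linear [simp]:
  "fprm \<sigma> (v + w) = fprm \<sigma> v + fprm \<sigma> w" "fprm \<sigma> (fscl c v) = fscl c (fprm \<sigma> v)"
  "fprm \<sigma> 0 = 0" "fprm \<sigma> (v - w) = fprm \<sigma> v - fprm \<sigma> w" "fprm \<sigma> (bas t) = bas (Prm \<sigma> t)"
  "fprm \<sigma> (- v) = - fprm \<sigma> v"
  by (simp_all add: fprm_def)

definition terms :: "('k, 'e, 'z) dgsmod_scheme \<Rightarrow> nat \<Rightarrow> int \<Rightarrow> 'e oterm set" where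
  "terms E n d = {t. wf_term E t \<and> ar t = n \<and> deg t = d}"

lemma terms_iff: "t \<in> terms E n d \<longleftrightarrow> wf_term E t \<and> ar t = n \<and> deg t = d"
  by (simp add: terms_def)

lemma keys_fcmp:
  assumes "Poly_Mapping.keys v \<subseteq> terms E m a" "Poly_Mapping.keys w \<subseteq> terms E n b" "1 \<le> i" "i \<le> m"
  shows "Poly_Mapping.keys (fcmp i v w) \<subseteq> terms E (m + n - 1) (a + b)"
  unfolding fcmp_def
  by (intro keys_lextI keys_basI) (use assms in \<open>auto simp: terms_iff subset_iff\<close>)

lemma keys_fprm:
  assumes "Poly_Mapping.keys v \<subseteq> terms E n d" "\<sigma> permutes {1..n}"
  shows "Poly_Mapping.keys (fprm \<sigma> v) \<subseteq> terms E n d"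
  unfolding fprm_def
  by (intro keys_lextI keys_basI) (use assms in \<open>auto simp: terms_iff subset_iff\<close>)

definition cls :: "('k::field, 'e::ab_group_add, 'z) dgsmod_scheme \<Rightarrow> 'e oterm \<Rightarrow> ('e oterm \<Rightarrow>\<^sub>0 'k)" where
  "cls E t = fcls E (ar t) (deg t) (bas t)"

primrec ev :: "('k::field, 'h::ab_group_add) dgop \<Rightarrow> (nat \<Rightarrow> int \<Rightarrow> 'e \<Rightarrow> 'h) \<Rightarrow> 'e oterm \<Rightarrow> 'h" where
  "ev H g Unt = unt H"
| "ev H g (Gen n d x) = g n d x"
| "ev H g (Cmp t i u) = cmp H (ar t) (deg t) (ar u) (deg u) i (ev H g t) (ev H g u)"
| "ev H g (Prm \<sigma> t) = act H (ar t) (deg t) \<sigma> (ev H g t)"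

context gop
begin

lemma cmp_linear:
  assumes "1 \<le> i" "i \<le> m"
  shows "x \<in> gr P m a \<Longrightarrow> x' \<in> gr P m a \<Longrightarrow> y \<in> gr P n b \<Longrightarrow>
      cmp P m a n b i (x + x') y = cmp P m a n b i x y + cmp P m a n b i x' y"
    "x \<in> gr P m a \<Longrightarrow> y \<in> gr P n b \<Longrightarrow> cmp P m a n b i (scl P c x) y = scl P c (cmp P m a n b i x y)"
    "y \<in> gr P n b \<Longrightarrow> cmp P m a n b i 0 y = 0"
    "x \<in> gr P m a \<Longrightarrow> y \<in> gr P n b \<Longrightarrow> y' \<in> gr P n b \<Longrightarrow>
      cmp P m a n b i x (y + y') = cmp P m a n b i x y + cmp P m a n b i x y'"
    "x \<in> gr P m a \<Longrightarrow> y \<in> gr P n b \<Longrightarrow> cmp P m a n b i x (scl P c y) = scl P c (cmp P m a n b i x y)"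
    "x \<in> gr P m a \<Longrightarrow> cmp P m a n b i x 0 = 0"
  using linmapD(2,3)[OF cmp_lin_left[OF assms]] linmapD(2,3)[OF cmp_lin_right[OF assms]]
    lin_zero[OF cmp_lin_left[OF assms]] lin_zero[OF cmp_lin_right[OF assms]] by simp_all

lemma seq':
  assumes "x \<in> gr P l a" "y \<in> gr P m b" "z \<in> gr P n c"
    "1 \<le> i" "i \<le> l" "1 \<le> j" "j \<le> m" "A = a + b" "B = b + c"
  shows "cmp P (l + m - 1) A n c (i - 1 + j) (cmp P l a m b i x y) z =
      cmp P l a (m + n - 1) B i x (cmp P m b n c j y z)"
  using seq[OF assms(1-7)] assms(8,9) by simp

lemma par':
  assumes "x \<in> gr P l a" "y \<in> gr P m b" "z \<in> gr P n c"
    "1 \<le> i" "i < k" "k \<le> l" "A = a + b" "B = a + c"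
  shows "cmp P (l + m - 1) A n c (k - 1 + m) (cmp P l a m b i x y) z =
      scl P (ksign (b * c)) (cmp P (l + n - 1) B m b i (cmp P l a n c k x z) y)"
  using par[OF assms(1-6)] assms(7,8) by simp

end

section \<open>Classes of operadic terms form a graded operad\<close>

locale free_op = smod E for E :: "('k::field, 'e::ab_group_add, 'z) dgsmod_scheme"
begin

lemma frel_subspace: "module.subspace fscl {v. free_rel E n d v}"
  by (rule fs.subspaceI) (auto intro: free_rel.intros)

lemmas fq = quot_linear[OF frel_subspace] 

lemma fcls_linear [simp]:
  "fcls E n d (v + w) = fcls E n d v + fcls E n d w"
  "fcls E n d (fscl c v) = fscl c (fcls E n d v)"
  "fcls E n d 0 = 0"
  "fcls E n d (v - w) = fcls E n d v - fcls E n d w"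
  "fcls E n d (- v) = - fcls E n d v"
  "fcls E n d (sum f A) = (\<Sum>a\<in>A. fcls E n d (f a))"
  "fcls E n d (fcls E n d v) = fcls E n d v"
  unfolding fcls_def by (simp_all add: quot_linear[OF frel_subspace] quot_idem[OF frel_subspace])

lemma fcls_lext: "fcls E n d (lext fscl f u) = lext fscl (\<lambda>x. fcls E n d (f x)) u"
  unfolding fcls_def by (rule quot_lext[OF frel_subspace])

lemma fcls_eq_0_iff: "fcls E n d v = 0 \<longleftrightarrow> free_rel E n d v"
  unfolding fcls_def by (simp add: quot_eq_0_iff[OF frel_subspace])

lemma fcls_eqI: "free_rel E n d (v - w) \<Longrightarrow> fcls E n d v = fcls E n d w"
  using fcls_eq_0_iff[of n d "v - w"] by simp

text \<open>The relations are homogeneous: the two sides of each axiom are well-formed terms of the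
  same arity and degree, and the congruence rules preserve this. Hence the projection can be studied
  in one arity and degree at a time.\<close>

lemma frel_keys: "free_rel E n d v \<Longrightarrow> Poly_Mapping.keys v \<subseteq> terms E n d"
proof (induction rule: free_rel.induct)
  case (cong_left n d v u i)
  then show ?case by (intro keys_fcmp) (auto simp: terms_iff)
next
  case (cong_right n d v t i)
  then show ?case by (intro keys_fcmp) (auto simp: terms_iff)
next
  case (cong_prm n d v \<sigma>)
  then show ?case by (intro keys_fprm)
next
  case (equivar t u i \<sigma> \<tau>)
  then show ?case
    \<comment> \<open>The right-hand side of the equivariance axiom composes at slot
      \<open>\<sigma> i\<close>, which has to be a slot of \<open>t\<close> again.\<close>
    using permutes_in_image[of \<sigma> "{1..ar t}" i]
    by (intro keys_diffI keys_basI) (auto simp: terms_iff perm_cmp_permutes)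
next
  case (zero n d) then show ?case by simp
next
  case (plus n d v w) then show ?case by (intro keys_addI)
next
  case (scale n d v c) then show ?case by (intro keys_fsclI)
qed (intro keys_diffI keys_fsclI keys_basI; auto simp: terms_iff act_in gr_add gr_scl permutes_compose permutes_id)+

lemma gr_free_eq:
  "gr (quasi_free E \<delta>) n d = {v. Poly_Mapping.keys v \<subseteq> terms E n d \<and> fcls E n d v = v}"
proof -
  have k: "{v. \<forall>t\<in>Poly_Mapping.keys v. wf_term E t \<and> ar t = n \<and> deg t = d} = {v. Poly_Mapping.keys v \<subseteq> terms E n d}"
    by (auto simp: terms_iff)
  have "gr (quasi_free E \<delta>) n d = fcls E n d ` {v. Poly_Mapping.keys v \<subseteq> terms E n d}"
    unfolding quasi_free_def by (simp add: span_bas k)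
  also have "\<dots> = {v. Poly_Mapping.keys v \<subseteq> terms E n d \<and> fcls E n d v = v}"
    unfolding fcls_def by (rule quot_range[OF frel_subspace]) (use frel_keys in blast)
  finally show ?thesis .
qed

lemma fcls_in: "Poly_Mapping.keys v \<subseteq> terms E n d \<Longrightarrow> fcls E n d v \<in> gr (quasi_free E \<delta>) n d"
  unfolding gr_free_eq fcls_def
  using quot_range[OF frel_subspace, of n d "terms E n d"] frel_keys by blast

lemma gvec_free: "gvec (quasi_free E \<delta>)"
  unfolding gvec_def
proof (intro conjI allI)
  show "module.subspace (scl (quasi_free E \<delta>)) (gr (quasi_free E \<delta>) n d)" for n d
    unfolding gr_free_eq quasi_free_simps
    by (rule fs.subspaceI)
      (simp_all only: mem_Collect_eq keys_zero empty_subsetI keys_addI keys_fsclI fcls_linear HOL.simp_thms)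
qed (simp add: vector_space_fscl)

text \<open>The congruence rule composes a relation with a single term. Expanding \<open>w\<close>
  into terms extends this to formal sums, and the relation in question is the difference between
  \<open>v\<close> and its representative.\<close>

lemma fcls_cmp_left:
  assumes "Poly_Mapping.keys v \<subseteq> terms E m a" "Poly_Mapping.keys w \<subseteq> terms E n b" "1 \<le> i" "i \<le> m"
  shows "fcls E (m + n - 1) (a + b) (fcmp i (fcls E m a v) w) = fcls E (m + n - 1) (a + b) (fcmp i v w)"
proof -
  have r: "free_rel E m a (v - fcls E m a v)"
    by (simp add: fcls_eq_0_iff[symmetric])
  have "fcls E (m + n - 1) (a + b) (fcmp i (v - fcls E m a v) (bas u)) = 0" if "u \<in> Poly_Mapping.keys w" for u
  proof -
    have "wf_term E u" "ar u = n" "deg u = b" using that assms(2) by (auto simp: terms_iff)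
    then show ?thesis
      using free_rel.cong_left[OF r _ assms(3,4), of u] by (simp only: fcls_eq_0_iff)
  qed
  then have "fcls E (m + n - 1) (a + b) (fcmp i (v - fcls E m a v) w) = 0"
    unfolding fcmp_lext_right[of i _ w] fcls_lext by (simp add: lext_def)
  then show ?thesis by simp
qed

lemma fcls_cmp_right:
  assumes "Poly_Mapping.keys v \<subseteq> terms E m a" "Poly_Mapping.keys w \<subseteq> terms E n b" "1 \<le> i" "i \<le> m"
  shows "fcls E (m + n - 1) (a + b) (fcmp i v (fcls E n b w)) = fcls E (m + n - 1) (a + b) (fcmp i v w)"
proof -
  have r: "free_rel E n b (w - fcls E n b w)"
    by (simp add: fcls_eq_0_iff[symmetric])
  have "fcls E (m + n - 1) (a + b) (fcmp i (bas u) (w - fcls E n b w)) = 0" if "u \<in> Poly_Mapping.keys v" for u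
  proof -
    have "wf_term E u" "ar u = m" "deg u = a" using that assms(1) by (auto simp: terms_iff)
    then show ?thesis
      using free_rel.cong_right[OF r, of u i] assms(3,4) by (simp only: fcls_eq_0_iff)
  qed
  then have "fcls E (m + n - 1) (a + b) (fcmp i v (w - fcls E n b w)) = 0"
    unfolding fcmp_lext_left[of i v] fcls_lext by (simp add: lext_def)
  then show ?thesis by simp
qed

lemma fcls_keys: "Poly_Mapping.keys v \<subseteq> terms E n d \<Longrightarrow> Poly_Mapping.keys (fcls E n d v) \<subseteq> terms E n d"
  using fcls_in[of v n d] by (simp add: gr_free_eq)

lemma fcls_cmp:
  assumes "Poly_Mapping.keys v \<subseteq> terms E m a" "Poly_Mapping.keys w \<subseteq> terms E n b" "1 \<le> i" "i \<le> m"
  shows "fcls E (m + n - 1) (a + b) (fcmp i (fcls E m a v) (fcls E n b w)) = fcls E (m + n - 1) (a + b) (fcmp i v w)"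
  using fcls_cmp_left[OF assms(1) fcls_keys[OF assms(2)] assms(3,4)] fcls_cmp_right[OF assms] by simp

lemma fcls_prm:
  assumes "\<sigma> permutes {1..n}"
  shows "fcls E n d (fprm \<sigma> (fcls E n d v)) = fcls E n d (fprm \<sigma> v)"
proof -
  have r: "free_rel E n d (v - fcls E n d v)"
    by (simp add: fcls_eq_0_iff[symmetric])
  have "fcls E n d (fprm \<sigma> (v - fcls E n d v)) = 0"
    using free_rel.cong_prm[OF r assms] by (simp add: fcls_eq_0_iff del: fprm_linear)
  then show ?thesis by simp
qed

lemma cls_in: "wf_term E t \<Longrightarrow> ar t = n \<Longrightarrow> deg t = d \<Longrightarrow> cls E t \<in> gr (quasi_free E \<delta>) n d"
  unfolding cls_def using fcls_in[of "bas t" n d] by (auto simp: terms_iff)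

lemma act_cls: "wf_term E t \<Longrightarrow> \<sigma> permutes {1..ar t} \<Longrightarrow> ar t = n \<Longrightarrow> deg t = d \<Longrightarrow>
    act (quasi_free E \<delta>) n d \<sigma> (cls E t) = cls E (Prm \<sigma> t)"
  unfolding cls_def using fcls_prm[of \<sigma> "ar t" "deg t" "bas t"] by auto

lemma cmp_cls: "wf_term E t \<Longrightarrow> wf_term E u \<Longrightarrow> 1 \<le> i \<Longrightarrow> i \<le> ar t \<Longrightarrow> ar t = m \<Longrightarrow> deg t = a \<Longrightarrow>
    ar u = n \<Longrightarrow> deg u = b \<Longrightarrow>
    cmp (quasi_free E \<delta>) m a n b i (cls E t) (cls E u) = cls E (Cmp t i u)"
  unfolding cls_def using fcls_cmp[of "bas t" "ar t" "deg t" "bas u" "ar u" "deg u" i] by (auto simp: terms_iff)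

lemma cls_eqI: "free_rel E n d (bas t - bas u) \<Longrightarrow> n = ar t \<Longrightarrow> n = ar u \<Longrightarrow> d = deg t \<Longrightarrow> d = deg u \<Longrightarrow> cls E t = cls E u"
  unfolding cls_def by (auto dest: fcls_eqI)

lemma free_induct [consumes 1, case_names zero cls add scale]:
  assumes "v \<in> gr (quasi_free E \<delta>) n d" "P 0"
    "\<And>t. wf_term E t \<Longrightarrow> ar t = n \<Longrightarrow> deg t = d \<Longrightarrow> P (cls E t)"
    "\<And>v w. P v \<Longrightarrow> P w \<Longrightarrow> P (v + w)" "\<And>c v. P v \<Longrightarrow> P (fscl c v)"
  shows "P v"
proof (rule quot_range_induct[OF frel_subspace])
  show "Poly_Mapping.keys v \<subseteq> terms E n d" "quot {v. free_rel E n d v} v = v"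
    using assms(1) by (simp_all add: gr_free_eq fcls_def)
  show "P (quot {v. free_rel E n d v} (bas t))" if "t \<in> terms E n d" for t
    using that assms(3)[of t] unfolding cls_def fcls_def terms_iff by auto
qed (use assms in blast)+

lemma free_ext1:
  assumes "v \<in> gr (quasi_free E \<delta>) n d" "additive_hom f" "additive_hom g"
    "\<And>t. wf_term E t \<Longrightarrow> ar t = n \<Longrightarrow> deg t = d \<Longrightarrow> f (cls E t) = g (cls E t)"
  shows "f v = g v"
  using assms(1)
  by (induction rule: free_induct) (use assms(2-4) in \<open>simp_all add: additive_hom_def\<close>)

lemma free_ext2:
  assumes "v \<in> gr (quasi_free E \<delta>) n d" "v' \<in> gr (quasi_free E \<delta>) n' d'"
    "\<And>w. additive_hom (\<lambda>v. f v w)" "\<And>w. additive_hom (\<lambda>v. g v w)"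
    "\<And>v. additive_hom (f v)" "\<And>v. additive_hom (g v)"
    "\<And>t u. wf_term E t \<Longrightarrow> ar t = n \<Longrightarrow> deg t = d \<Longrightarrow> wf_term E u \<Longrightarrow> ar u = n' \<Longrightarrow> deg u = d' \<Longrightarrow>
      f (cls E t) (cls E u) = g (cls E t) (cls E u)"
  shows "f v v' = g v v'"
  by (rule free_ext1[OF assms(1,3,4)], rule free_ext1[OF assms(2,5,6)], rule assms(7))

lemma free_ext3:
  assumes "v \<in> gr (quasi_free E \<delta>) n d" "v' \<in> gr (quasi_free E \<delta>) n' d'" "v'' \<in> gr (quasi_free E \<delta>) n'' d''"
    "\<And>w u. additive_hom (\<lambda>v. f v w u)" "\<And>w u. additive_hom (\<lambda>v. g v w u)"
    "\<And>v u. additive_hom (\<lambda>w. f v w u)" "\<And>v u. additive_hom (\<lambda>w. g v w u)"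
    "\<And>v w. additive_hom (f v w)" "\<And>v w. additive_hom (g v w)"
    "\<And>t u r. wf_term E t \<Longrightarrow> ar t = n \<Longrightarrow> deg t = d \<Longrightarrow> wf_term E u \<Longrightarrow> ar u = n' \<Longrightarrow> deg u = d' \<Longrightarrow>
      wf_term E r \<Longrightarrow> ar r = n'' \<Longrightarrow> deg r = d'' \<Longrightarrow>
      f (cls E t) (cls E u) (cls E r) = g (cls E t) (cls E u) (cls E r)"
  shows "f v v' v'' = g v v' v''"
  by (rule free_ext2[OF assms(1,2,4-7)], rule free_ext1[OF assms(3,8,9)], rule assms(10))

text \<open>Every axiom of a graded operad is a constructor of \<open>free_rel\<close>, hence an
  equation between classes of terms; such classes span, and both sides are linear in each
  argument.\<close>

lemma gop_free: "gop (quasi_free E \<delta>)"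
proof -
  interpret F: gvec "quasi_free E \<delta>" by (rule gvec_free)
  note ah = additive_hom_def
  let ?F = "quasi_free E \<delta>"
  have c_in: "cmp ?F m a n b i v w \<in> gr ?F (m + n - 1) (a + b)"
    if "1 \<le> i" "i \<le> m" "v \<in> gr ?F m a" "w \<in> gr ?F n b" for m a n b i v w
    using that fcls_in[OF keys_fcmp[of v E m a w n b i]] by (simp add: gr_free_eq)
  have a_in: "act ?F n d \<sigma> v \<in> gr ?F n d" if "v \<in> gr ?F n d" "\<sigma> permutes {1..n}" for n d \<sigma> v
    using that fcls_in[OF keys_fprm[of v E n d \<sigma>]] by (simp add: gr_free_eq)
  show ?thesis
  proof unfold_locales
    fix \<sigma> and n :: nat and d assume s: "\<sigma> permutes {1..n}"
    then show "linmap (scl ?F) (scl ?F) (gr ?F n d) (gr ?F n d) (act ?F n d \<sigma>)"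
      using a_in by (intro linmapI) simp_all
  next
    fix x and n :: nat and d assume x: "x \<in> gr ?F n d"
    have "act ?F n d id (cls E t) = cls E t" if "wf_term E t" "ar t = n" "deg t = d" for t
      using that permutes_id[of "{1..n}"]
      by (simp only: act_cls wf_term.simps ar.simps deg.simps) (auto intro!: cls_eqI free_rel.prm_id[unfolded id_def] simp: id_def)
    note eq = this
    show "act ?F n d id x = x"
      by (rule free_ext1[OF x, where g = "\<lambda>v. v"], simp add: ah, simp add: ah, rule eq)
  next
    fix x and n :: nat and d \<sigma> \<tau> assume x: "x \<in> gr ?F n d" and s: "\<sigma> permutes {1..n}" "\<tau> permutes {1..n}"
    have "act ?F n d \<tau> (act ?F n d \<sigma> (cls E t)) = act ?F n d (\<sigma> \<circ> \<tau>) (cls E t)" if "wf_term E t" "ar t = n" "deg t = d" for t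
      using that s permutes_compose[OF s(2,1)]
      by (simp only: act_cls wf_term.simps ar.simps deg.simps) (auto intro!: cls_eqI free_rel.prm_prm)
    note eq = this
    show "act ?F n d \<tau> (act ?F n d \<sigma> x) = act ?F n d (\<sigma> \<circ> \<tau>) x"
      by (rule free_ext1[OF x]; (rule eq; assumption)?; simp add: ah)
  next
    show "unt ?F \<in> gr ?F 1 0"
      using cls_in[of Unt 1 0] by (simp add: cls_def)
  next
    fix i m n :: nat and a b x assume "1 \<le> i" "i \<le> m" "x \<in> gr ?F m a"
    then show "linmap (scl ?F) (scl ?F) (gr ?F n b) (gr ?F (m + n - 1) (a + b)) (cmp ?F m a n b i x)"
      using c_in by (intro linmapI) simp_all
  next
    fix i m n :: nat and a b y assume "1 \<le> i" "i \<le> m" "y \<in> gr ?F n b"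
    then show "linmap (scl ?F) (scl ?F) (gr ?F m a) (gr ?F (m + n - 1) (a + b)) (\<lambda>x. cmp ?F m a n b i x y)"
      using c_in by (intro linmapI) simp_all
  next
    fix x and n :: nat and d assume x: "x \<in> gr ?F n d"
    have u: "unt ?F = cls E Unt" by (simp add: cls_def)
    have "cmp ?F 1 0 n d 1 (cls E Unt) (cls E t) = cls E t" if "wf_term E t" "ar t = n" "deg t = d" for t
      using that by (simp only: cmp_cls wf_term.simps ar.simps deg.simps order_refl) (auto intro!: cls_eqI free_rel.unit_left)
    note eq = this
    show "cmp ?F 1 0 n d 1 (unt ?F) x = x"
      unfolding u by (rule free_ext1[OF x]; (rule eq; assumption)?; simp add: ah)
  next
    fix x and n i :: nat and d assume x: "x \<in> gr ?F n d" and i: "1 \<le> i" "i \<le> n"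
    have u: "unt ?F = cls E Unt" by (simp add: cls_def)
    have "cmp ?F n d 1 0 i (cls E t) (cls E Unt) = cls E t" if "wf_term E t" "ar t = n" "deg t = d" for t
      using that i by (simp only: cmp_cls wf_term.simps ar.simps deg.simps order_refl) (auto intro!: cls_eqI free_rel.unit_right)
    note eq = this
    show "cmp ?F n d 1 0 i x (unt ?F) = x"
      unfolding u by (rule free_ext1[OF x]; (rule eq; assumption)?; simp add: ah)
  next
    fix x y z and l m n i j :: nat and a b c
    assume x: "x \<in> gr ?F l a" and y: "y \<in> gr ?F m b" and z: "z \<in> gr ?F n c"
      and i: "1 \<le> i" "i \<le> l" "1 \<le> j" "j \<le> m"
    have "cmp ?F (l + m - 1) (a + b) n c (i - 1 + j) (cmp ?F l a m b i (cls E t) (cls E u)) (cls E r) =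
      cmp ?F l a (m + n - 1) (b + c) i (cls E t) (cmp ?F m b n c j (cls E u) (cls E r))"
      if h: "wf_term E t" "ar t = l" "deg t = a" "wf_term E u" "ar u = m" "deg u = b"
        "wf_term E r" "ar r = n" "deg r = c" for t u r
    proof -
      have i': "1 \<le> i - 1 + j" "i - 1 + j \<le> l + m - 1" using i by auto
      have "cls E (Cmp (Cmp t i u) (i - 1 + j) r) = cls E (Cmp t i (Cmp u j r))"
        by (rule cls_eqI[OF free_rel.assoc_seq]) (use h i in auto)
      then show ?thesis using h i i' by (simp only: cmp_cls wf_term.simps ar.simps deg.simps HOL.simp_thms)
    qed
    note eq = this
    show "cmp ?F (l + m - 1) (a + b) n c (i - 1 + j) (cmp ?F l a m b i x y) z =
      cmp ?F l a (m + n - 1) (b + c) i x (cmp ?F m b n c j y z)"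
      by (rule free_ext3[OF x y z]; (rule eq; assumption)?; simp add: ah)
  next
    fix x y z and l m n i k :: nat and a b c
    assume x: "x \<in> gr ?F l a" and y: "y \<in> gr ?F m b" and z: "z \<in> gr ?F n c"
      and i: "1 \<le> i" "i < k" "k \<le> l"
    have "cmp ?F (l + m - 1) (a + b) n c (k - 1 + m) (cmp ?F l a m b i (cls E t) (cls E u)) (cls E r) =
      scl ?F (ksign (b * c)) (cmp ?F (l + n - 1) (a + c) m b i (cmp ?F l a n c k (cls E t) (cls E r)) (cls E u))"
      if h: "wf_term E t" "ar t = l" "deg t = a" "wf_term E u" "ar u = m" "deg u = b"
        "wf_term E r" "ar r = n" "deg r = c" for t u r
    proof -
      have i': "1 \<le> k - 1 + m" "k - 1 + m \<le> l + m - 1" "i \<le> l" "1 \<le> k" "i \<le> l + n - 1" using i by auto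
      have e: "ar (Cmp (Cmp t k r) i u) = ar (Cmp (Cmp t i u) (k - 1 + ar u) r)"
        "deg (Cmp (Cmp t k r) i u) = deg (Cmp (Cmp t i u) (k - 1 + ar u) r)"
        using i h by auto
      have "cls E (Cmp (Cmp t i u) (k - 1 + ar u) r) = fscl (ksign (b * c)) (cls E (Cmp (Cmp t k r) i u))"
        unfolding cls_def e
        using fcls_eqI[OF free_rel.assoc_par[OF h(1,4,7) i(1,2)]] h i
        by simp
      then show ?thesis using h i i' by (simp only: cmp_cls wf_term.simps ar.simps deg.simps HOL.simp_thms quasi_free_simps(1))
    qed
    note eq = this
    show "cmp ?F (l + m - 1) (a + b) n c (k - 1 + m) (cmp ?F l a m b i x y) z =
      scl ?F (ksign (b * c)) (cmp ?F (l + n - 1) (a + c) m b i (cmp ?F l a n c k x z) y)"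
      by (rule free_ext3[OF x y z]; (rule eq; assumption)?; simp add: ah fs.scale_right_distrib fs.scale_left_commute)
  next
    fix x y and m n i :: nat and a b \<sigma> \<tau>
    assume x: "x \<in> gr ?F m a" and y: "y \<in> gr ?F n b" and i: "1 \<le> i" "i \<le> m"
      and s: "\<sigma> permutes {1..m}" "\<tau> permutes {1..n}"
    have i': "1 \<le> \<sigma> i" "\<sigma> i \<le> m" using permutes_in_image[OF s(1), of i] i by auto
    note pc = perm_cmp_permutes[OF i s]
    have "cmp ?F m a n b i (act ?F m a \<sigma> (cls E t)) (act ?F n b \<tau> (cls E u)) =
      act ?F (m + n - 1) (a + b) (perm_cmp m n i \<sigma> \<tau>) (cmp ?F m a n b (\<sigma> i) (cls E t) (cls E u))"
      if h: "wf_term E t" "ar t = m" "deg t = a" "wf_term E u" "ar u = n" "deg u = b" for t u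
    proof -
      have "cls E (Cmp (Prm \<sigma> t) i (Prm \<tau> u)) = cls E (Prm (perm_cmp (ar t) (ar u) i \<sigma> \<tau>) (Cmp t (\<sigma> i) u))"
        by (rule cls_eqI[OF free_rel.equivar]) (use h i s in auto)
      then show ?thesis using h i i' s pc
        by (simp only: cmp_cls act_cls wf_term.simps ar.simps deg.simps HOL.simp_thms)
    qed
    note eq = this
    show "cmp ?F m a n b i (act ?F m a \<sigma> x) (act ?F n b \<tau> y) =
      act ?F (m + n - 1) (a + b) (perm_cmp m n i \<sigma> \<tau>) (cmp ?F m a n b (\<sigma> i) x y)"
      by (rule free_ext2[OF x y]; (rule eq; assumption)?; simp add: ah)
  qed
qed

text \<open>Terms are built from generators by operations that both morphisms preserve, so agreement
  on generators passes to all terms by structural induction.\<close>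

lemma free_hom_unique:
  assumes "gop H" "graded_operad_hom (quasi_free E \<delta>) H f" "graded_operad_hom (quasi_free E \<delta>) H g"
    and gen: "\<And>n d x. x \<in> gr E n d \<Longrightarrow> f n d (cls E (Gen n d x)) = g n d (cls E (Gen n d x))"
  shows "fam_eq_on (quasi_free E \<delta>) f g"
proof -
  interpret H: gop H by fact
  interpret F: gop "quasi_free E \<delta>" by (rule gop_free)
  note f = ghomD[OF assms(2)] and g = ghomD[OF assms(3)]
  have t: "wf_term E t \<Longrightarrow> f (ar t) (deg t) (cls E t) = g (ar t) (deg t) (cls E t)" for t
  proof (induction t)
    case Unt then show ?case using f(3) g(3) by (simp add: cls_def)
  next
    case (Gen n d x) then show ?case using gen by simp
  next
    case (Cmp t i u)
    then have w: "wf_term E t" "wf_term E u" "1 \<le> i" "i \<le> ar t" by simp_all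
    note c = cmp_cls[OF w refl refl refl refl, of \<delta>, symmetric]
    show ?case unfolding ar.simps deg.simps c
      using f(4)[OF cls_in[OF w(1) refl refl] cls_in[OF w(2) refl refl] w(3,4)]
        g(4)[OF cls_in[OF w(1) refl refl] cls_in[OF w(2) refl refl] w(3,4)] Cmp.IH w by simp
  next
    case (Prm \<sigma> t)
    then have w: "wf_term E t" "\<sigma> permutes {1..ar t}" by simp_all
    note c = act_cls[OF w refl refl, of \<delta>, symmetric]
    show ?case unfolding ar.simps deg.simps c
      using f(2)[OF cls_in[OF w(1) refl refl] w(2)] g(2)[OF cls_in[OF w(1) refl refl] w(2)] Prm.IH w by simp
  qed
  have "x \<in> gr (quasi_free E \<delta>) n d \<and> f n d x = g n d x" if "x \<in> gr (quasi_free E \<delta>) n d" for x n d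
    using that
  proof (induction rule: free_induct)
    case zero then show ?case by (simp only: F.gr_zero F.lin_zero[OF f(1)] F.lin_zero[OF g(1)] HOL.simp_thms)
  next
    case (cls u) then show ?case using t[of u] by (auto intro: cls_in)
  next
    case (add v w) then show ?case using F.gr_add[of v n d w] by (simp add: linmapD(2)[OF f(1)] linmapD(2)[OF g(1)])
  next
    case (scale c v) then show ?case using F.gr_scl[of v n d c] linmapD(3)[OF f(1), of v n d c] linmapD(3)[OF g(1), of v n d c]
      by simp
  qed
  then show ?thesis unfolding fam_eq_on_def by blast
qed

end

section \<open>Evaluation of terms: the universal property of the free operad\<close>

locale free_ext = free_op E + H: gop H
  for E :: "('k::field, 'e::ab_group_add, 'z) dgsmod_scheme" and H :: "('k, 'h::ab_group_add) dgop" +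
  fixes g :: "nat \<Rightarrow> int \<Rightarrow> 'e \<Rightarrow> 'h"
  assumes g_lin: "linmap (scl E) (scl H) (gr E n d) (gr H n d) (g n d)"
    and g_act: "x \<in> gr E n d \<Longrightarrow> \<sigma> permutes {1..n} \<Longrightarrow> g n d (act E n d \<sigma> x) = act H n d \<sigma> (g n d x)"
begin

lemma ev_in: "wf_term E t \<Longrightarrow> ev H g t \<in> gr H (ar t) (deg t)"
proof (induction t)
  case (Cmp t i u) then show ?case by (auto intro!: H.cmp_in)
qed (auto intro: H.unt_in linmapD(1)[OF g_lin] H.act_in)

abbreviation "lev \<equiv> lext (scl H) (ev H g)"

lemmas lev = lexts[OF H.vs, of "ev H g"] lext_zero[of "scl H" "ev H g"]

lemma ev_in': "t \<in> terms E n d \<Longrightarrow> ev H g t \<in> gr H n d"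
  using ev_in by (auto simp: terms_iff)

lemma lev_in: "Poly_Mapping.keys v \<subseteq> terms E n d \<Longrightarrow> lev v \<in> gr H n d"
  using ev_in' by (intro H.gr_lext) blast

lemma lev_fcmp:
  assumes "Poly_Mapping.keys v \<subseteq> terms E m a" "Poly_Mapping.keys w \<subseteq> terms E n b" "1 \<le> i" "i \<le> m"
  shows "lev (fcmp i v w) = cmp H m a n b i (lev v) (lev w)"
proof -
  have "lev (fcmp i v w) = lext (scl H) (\<lambda>t. lext (scl H) (\<lambda>u. ev H g (Cmp t i u)) w) v"
    unfolding fcmp_def by (simp add: lext_lext[OF H.vs] lev)
  also have "\<dots> = lext (scl H) (\<lambda>t. lext (scl H) (\<lambda>u. cmp H m a n b i (ev H g t) (ev H g u)) w) v"
    by (intro lext_cong) (use assms in \<open>auto simp: terms_iff subset_iff\<close>)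
  also have "\<dots> = lext (scl H) (\<lambda>t. cmp H m a n b i (ev H g t) (lev w)) v"
    by (intro lext_cong H.lin_lext[symmetric, OF H.cmp_lin_right]) (use assms ev_in' in \<open>auto simp: subset_iff\<close>)
  also have "\<dots> = cmp H m a n b i (lev v) (lev w)"
    by (rule H.lin_lext[symmetric, OF H.cmp_lin_left[OF assms(3,4) lev_in[OF assms(2)]]]) (use assms ev_in' in \<open>auto simp: subset_iff\<close>)
  finally show ?thesis .
qed

lemma lev_fprm:
  assumes "Poly_Mapping.keys v \<subseteq> terms E n d" "\<sigma> permutes {1..n}"
  shows "lev (fprm \<sigma> v) = act H n d \<sigma> (lev v)"
proof -
  have "lev (fprm \<sigma> v) = lext (scl H) (\<lambda>t. ev H g (Prm \<sigma> t)) v"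
    unfolding fprm_def by (simp add: lext_lext[OF H.vs] lev)
  also have "\<dots> = lext (scl H) (\<lambda>t. act H n d \<sigma> (ev H g t)) v"
    by (intro lext_cong) (use assms in \<open>auto simp: terms_iff subset_iff\<close>)
  also have "\<dots> = act H n d \<sigma> (lev v)"
    by (rule H.lin_lext[symmetric, OF H.act_lin[OF assms(2)]]) (use assms ev_in' in \<open>auto simp: subset_iff\<close>)
  finally show ?thesis .
qed

text \<open>Each relation is an axiom that holds in \<open>H\<close> or a property of
  \<open>g\<close>. In the congruence cases the sums must be homogeneous, because the composition of
  \<open>H\<close> takes arities and degrees as arguments; \<open>frel_keys\<close> guarantees
  this.\<close>

lemma lev_rel: "free_rel E n d v \<Longrightarrow> lev v = 0"
proof (induction rule: free_rel.induct)
  case (plus n d v w) then show ?case by (simp add: lev)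
next
  case (scale n d v c) then show ?case by (simp add: lev)
next
  case (gen_plus x n d y) then show ?case by (simp add: lev linmapD(2)[OF g_lin])
next
  case (gen_scale x n d c) then show ?case by (simp add: lev linmapD(3)[OF g_lin])
next
  case (gen_act x n d \<sigma>) then show ?case by (simp add: lev g_act)
next
  case (unit_left t) then show ?case using H.unit_l[OF ev_in[of t]] by (simp add: lev)
next
  case (unit_right t i) then show ?case using H.unit_r[OF ev_in[of t], of i] by (simp add: lev)
next
  case (assoc_seq t u r i j)
  then show ?case using H.seq[OF ev_in[of t] ev_in[of u] ev_in[of r], of i j] by (simp add: lev)
next
  case (assoc_par t u r i k)
  then show ?case using H.par[OF ev_in[of t] ev_in[of u] ev_in[of r], of i k] by (simp add: lev)
next
  case (prm_id t) then show ?case using H.act_id[OF ev_in[of t]] by (simp add: lev)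
next
  case (prm_prm t \<sigma> \<tau>) then show ?case using H.act_act[OF ev_in[of t]] by (simp add: lev)
next
  case (equivar t u i \<sigma> \<tau>) then show ?case using H.equi[OF ev_in[of t] ev_in[of u], of i \<sigma> \<tau>] by (simp add: lev)
next
  case (cong_left n d v u i)
  have "lev (fcmp i v (bas u)) = cmp H n d (ar u) (deg u) i (lev v) (lev (bas u))"
    by (rule lev_fcmp[OF frel_keys[OF cong_left(1)] _ cong_left(3,4)]) (use cong_left(2) in \<open>simp add: terms_iff\<close>)
  then show ?case
    using H.cmp_linear(3)[OF cong_left(3,4) ev_in[OF cong_left(2)], of d] cong_left(5) by (simp add: lev)
next
  case (cong_right n d v t i)
  have "lev (fcmp i (bas t) v) = cmp H (ar t) (deg t) n d i (lev (bas t)) (lev v)"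
    by (rule lev_fcmp[OF _ frel_keys[OF cong_right(1)] cong_right(3,4)]) (use cong_right(2) in \<open>simp add: terms_iff\<close>)
  then show ?case
    using H.cmp_linear(6)[OF cong_right(3,4) ev_in[OF cong_right(2)], of n d] cong_right(5) by (simp add: lev)
next
  case (cong_prm n d v \<sigma>)
  then show ?case using lev_fprm[OF frel_keys[OF cong_prm(1)] cong_prm(2)] H.lin_zero[OF H.act_lin[OF cong_prm(2)]] by simp
qed (simp add: lev)

lemma lev_fcls: "lev (fcls E n d v) = lev v"
  unfolding fcls_def by (rule quot_lift[OF frel_subspace]) (auto simp: lexts[OF H.vs] lev_rel)

lemma lev_cls: "lev (cls E t) = ev H g t"
  unfolding cls_def by (simp add: lev_fcls lev)

lemma lev_hom: "graded_operad_hom (quasi_free E \<delta>) H (\<lambda>n d. lev)"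
  unfolding graded_operad_hom_def
proof (intro conjI allI ballI impI)
  show "linmap (scl (quasi_free E \<delta>)) (scl H) (gr (quasi_free E \<delta>) n d) (gr H n d) lev" for n d
    by (rule linmapI) (auto simp: lev gr_free_eq lev_in)
  show "lev (unt (quasi_free E \<delta>)) = unt H" by (simp add: lev_fcls lev)
  show "lev (act (quasi_free E \<delta>) n d \<sigma> x) = act H n d \<sigma> (lev x)"
    if "x \<in> gr (quasi_free E \<delta>) n d" "\<sigma> permutes {1..n}" for n d \<sigma> x
    using that by (simp add: lev_fcls lev_fprm gr_free_eq)
  show "lev (cmp (quasi_free E \<delta>) m a n b i x y) = cmp H m a n b i (lev x) (lev y)"
    if "x \<in> gr (quasi_free E \<delta>) m a" "y \<in> gr (quasi_free E \<delta>) n b" "1 \<le> i \<and> i \<le> m" for m a n b i x y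
    using that by (simp add: lev_fcls lev_fcmp gr_free_eq)
qed

end

text \<open>Derivations of the free operad. The values of \<open>\<delta>\<close> are formal sums,
  in which \<open>bas (Gen n d (x + y))\<close> is not the sum of the two generators; therefore
  linearity and equivariance are required only after passing to classes.\<close>

locale free_der = free_op E for E :: "('k::field, 'e::ab_group_add, 'z) dgsmod_scheme" +
  fixes \<delta> :: "nat \<Rightarrow> int \<Rightarrow> 'e \<Rightarrow> ('e oterm \<Rightarrow>\<^sub>0 'k)"
  assumes \<delta>_keys: "x \<in> gr E n d \<Longrightarrow> Poly_Mapping.keys (\<delta> n d x) \<subseteq> terms E n (d - 1)"
    and \<delta>_add: "x \<in> gr E n d \<Longrightarrow> y \<in> gr E n d \<Longrightarrow>
      fcls E n (d - 1) (\<delta> n d (x + y)) = fcls E n (d - 1) (\<delta> n d x) + fcls E n (d - 1) (\<delta> n d y)"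
    and \<delta>_scl: "x \<in> gr E n d \<Longrightarrow> fcls E n (d - 1) (\<delta> n d (scl E c x)) = fscl c (fcls E n (d - 1) (\<delta> n d x))"
    and \<delta>_act: "x \<in> gr E n d \<Longrightarrow> \<sigma> permutes {1..n} \<Longrightarrow>
      fcls E n (d - 1) (\<delta> n d (act E n d \<sigma> x)) = fcls E n (d - 1) (fprm \<sigma> (\<delta> n d x))"
begin

abbreviation "F \<equiv> quasi_free E \<delta>"
abbreviation "D \<equiv> deriv_term \<delta>"

sublocale F: gop F by (rule gop_free)

lemma D_keys: "wf_term E t \<Longrightarrow> Poly_Mapping.keys (D t) \<subseteq> terms E (ar t) (deg t - 1)"
proof (induction t)
  case (Cmp t i u)
  then have w: "wf_term E t" "wf_term E u" "1 \<le> i" "i \<le> ar t" by simp_all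
  have b: "Poly_Mapping.keys (bas t :: _ \<Rightarrow>\<^sub>0 'k) \<subseteq> terms E (ar t) (deg t)" "Poly_Mapping.keys (bas u :: _ \<Rightarrow>\<^sub>0 'k) \<subseteq> terms E (ar u) (deg u)"
    using w by (auto simp: terms_iff)
  have e: "deg t + deg u - 1 = deg t - 1 + deg u" "deg t - 1 + deg u = deg t + (deg u - 1)" by auto
  have "Poly_Mapping.keys (fcmp i (D t) (bas u)) \<subseteq> terms E (ar t + ar u - 1) (deg t - 1 + deg u)"
    using Cmp w by (intro keys_fcmp b) auto
  moreover have "Poly_Mapping.keys (fcmp i (bas t) (D u)) \<subseteq> terms E (ar t + ar u - 1) (deg t - 1 + deg u)"
    unfolding e(2) using Cmp w by (intro keys_fcmp b) auto
  ultimately show ?case unfolding deriv_term.simps ar.simps deg.simps e(1) by (intro keys_intros)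
next
  case (Prm \<sigma> t) then show ?case by (simp add: keys_fprm)
qed (use \<delta>_keys in auto)

definition Dt :: "'e oterm \<Rightarrow> ('e oterm \<Rightarrow>\<^sub>0 'k)" where
  "Dt t = fcls E (ar t) (deg t - 1) (D t)"

lemma Dt_in: "wf_term E t \<Longrightarrow> Dt t \<in> gr F (ar t) (deg t - 1)"
  unfolding Dt_def by (intro fcls_in D_keys)

lemma Dt_Unt: "Dt Unt = 0"
  by (simp add: Dt_def)

lemma Dt_Cmp:
  assumes w: "wf_term E t" "wf_term E u" "1 \<le> i" "i \<le> ar t"
  shows "Dt (Cmp t i u) = cmp F (ar t) (deg t - 1) (ar u) (deg u) i (Dt t) (cls E u)
    + fscl (ksign (deg t)) (cmp F (ar t) (deg t) (ar u) (deg u - 1) i (cls E t) (Dt u))"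
proof -
  have b: "Poly_Mapping.keys (bas t :: _ \<Rightarrow>\<^sub>0 'k) \<subseteq> terms E (ar t) (deg t)" "Poly_Mapping.keys (bas u :: _ \<Rightarrow>\<^sub>0 'k) \<subseteq> terms E (ar u) (deg u)"
    using w by (auto simp: terms_iff)
  have e: "deg t + deg u - 1 = deg t - 1 + deg u" "deg t + (deg u - 1) = deg t - 1 + deg u" by auto
  have "fcls E (ar t + ar u - 1) (deg t - 1 + deg u) (fcmp i (D t) (bas u)) = cmp F (ar t) (deg t - 1) (ar u) (deg u) i (Dt t) (cls E u)"
    unfolding Dt_def cls_def quasi_free_simps by (rule fcls_cmp[symmetric, OF D_keys b(2) w(3,4)]) fact
  moreover have "fcls E (ar t + ar u - 1) (deg t - 1 + deg u) (fcmp i (bas t) (D u)) = cmp F (ar t) (deg t) (ar u) (deg u - 1) i (cls E t) (Dt u)"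
    unfolding Dt_def cls_def quasi_free_simps e(2)[symmetric] by (rule fcls_cmp[symmetric, OF b(1) D_keys w(3,4)]) fact
  ultimately show ?thesis by (simp add: Dt_def e)
qed

lemma Dt_Prm:
  assumes w: "wf_term E t" "\<sigma> permutes {1..ar t}"
  shows "Dt (Prm \<sigma> t) = act F (ar t) (deg t - 1) \<sigma> (Dt t)"
  unfolding Dt_def using fcls_prm[OF w(2)] by simp

text \<open>Both sides have three summands, according to the factor that is differentiated; they are
  matched by sequential associativity in \<open>F\<close>, and the Leibniz signs agree because
  degrees add under composition.\<close>

lemma Dt_seq:
  assumes w: "wf_term E t" "wf_term E u" "wf_term E r" and i: "1 \<le> i" "i \<le> ar t" "1 \<le> j" "j \<le> ar u"
  shows "Dt (Cmp (Cmp t i u) (i - 1 + j) r) = Dt (Cmp t i (Cmp u j r))"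
proof -
  have i': "1 \<le> i - 1 + j" "i - 1 + j \<le> ar t + ar u - 1" using i by auto
  have e: "deg t + deg u - 1 = deg t - 1 + deg u" "deg u + deg r - 1 = deg u - 1 + deg r" by auto
  note m = cls_in[OF w(1) refl refl, of \<delta>] cls_in[OF w(2) refl refl, of \<delta>] cls_in[OF w(3) refl refl, of \<delta>] Dt_in[OF w(1)] Dt_in[OF w(2)] Dt_in[OF w(3)]
  have wtu: "wf_term E (Cmp t i u)" and wur: "wf_term E (Cmp u j r)" using w i by simp_all
  have c: "cls E (Cmp t i u) = cmp F (ar t) (deg t) (ar u) (deg u) i (cls E t) (cls E u)"
    "cls E (Cmp u j r) = cmp F (ar u) (deg u) (ar r) (deg r) j (cls E u) (cls E r)"
    using w i by (simp_all only: cmp_cls)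
  have lin: "cmp F m a n b i (v + v') z = cmp F m a n b i v z + cmp F m a n b i v' z"
    "cmp F m a n b i (fscl k v) z = fscl k (cmp F m a n b i v z)"
    "cmp F m a n b i v (z + z') = cmp F m a n b i v z + cmp F m a n b i v z'"
    "cmp F m a n b i v (fscl k z) = fscl k (cmp F m a n b i v z)" for m a n b i v v' z z' k
    by simp_all
  have 1: "cmp F (ar t + ar u - 1) (deg t + deg u - 1) (ar r) (deg r) (i - 1 + j) (cmp F (ar t) (deg t - 1) (ar u) (deg u) i (Dt t) (cls E u)) (cls E r)
    = cmp F (ar t) (deg t - 1) (ar u + ar r - 1) (deg u + deg r) i (Dt t) (cmp F (ar u) (deg u) (ar r) (deg r) j (cls E u) (cls E r))"
    by (rule F.seq'[OF m(4,2,3) i]) auto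
  have 2: "cmp F (ar t + ar u - 1) (deg t + deg u - 1) (ar r) (deg r) (i - 1 + j) (cmp F (ar t) (deg t) (ar u) (deg u - 1) i (cls E t) (Dt u)) (cls E r)
    = cmp F (ar t) (deg t) (ar u + ar r - 1) (deg u + deg r - 1) i (cls E t) (cmp F (ar u) (deg u - 1) (ar r) (deg r) j (Dt u) (cls E r))"
    by (rule F.seq'[OF m(1,5,3) i]) auto
  have 3: "cmp F (ar t + ar u - 1) (deg t + deg u) (ar r) (deg r - 1) (i - 1 + j) (cmp F (ar t) (deg t) (ar u) (deg u) i (cls E t) (cls E u)) (Dt r)
    = cmp F (ar t) (deg t) (ar u + ar r - 1) (deg u + deg r - 1) i (cls E t) (cmp F (ar u) (deg u) (ar r) (deg r - 1) j (cls E u) (Dt r))"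
    by (rule F.seq'[OF m(1,2,6) i]) auto
  show ?thesis
    unfolding Dt_Cmp[OF wtu w(3) i'[folded ar.simps(3)[of t i u]]] Dt_Cmp[OF w(1) wur i(1,2)] Dt_Cmp[OF w(1,2) i(1,2)] Dt_Cmp[OF w(2,3) i(3,4)]
    unfolding ar.simps deg.simps c lin 1 2 3
    by (simp add: ksign_add fs.scale_right_distrib algebra_simps del: quasi_free_simps)
qed

text \<open>Differentiating \<open>u\<close> or \<open>r\<close> lowers its degree and thus changes
  the exchange sign (-1)^(|u||r|). The change is compensated by the Leibniz sign, which sees the
  factors in the other order on the other side.\<close>

lemma Dt_par:
  assumes w: "wf_term E t" "wf_term E u" "wf_term E r" and i: "1 \<le> i" "i < k" "k \<le> ar t"
  shows "Dt (Cmp (Cmp t i u) (k - 1 + ar u) r) = fscl (ksign (deg u * deg r)) (Dt (Cmp (Cmp t k r) i u))"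
proof -
  have i': "1 \<le> k - 1 + ar u" "k - 1 + ar u \<le> ar t + ar u - 1" "i \<le> ar t" "1 \<le> k" "i \<le> ar t + ar r - 1" using i by auto
  note m = cls_in[OF w(1) refl refl, of \<delta>] cls_in[OF w(2) refl refl, of \<delta>] cls_in[OF w(3) refl refl, of \<delta>] Dt_in[OF w(1)] Dt_in[OF w(2)] Dt_in[OF w(3)]
  have wtu: "wf_term E (Cmp t i u)" and wtr: "wf_term E (Cmp t k r)" using w i by simp_all
  have c: "cls E (Cmp t i u) = cmp F (ar t) (deg t) (ar u) (deg u) i (cls E t) (cls E u)"
    "cls E (Cmp t k r) = cmp F (ar t) (deg t) (ar r) (deg r) k (cls E t) (cls E r)"
    using w i i' by (simp_all only: cmp_cls)
  have lin: "cmp F m a n b i (v + v') z = cmp F m a n b i v z + cmp F m a n b i v' z"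
    "cmp F m a n b i (fscl k v) z = fscl k (cmp F m a n b i v z)"
    "cmp F m a n b i v (z + z') = cmp F m a n b i v z + cmp F m a n b i v z'"
    "cmp F m a n b i v (fscl k z) = fscl k (cmp F m a n b i v z)" for m a n b i v v' z z' k
    by simp_all
  have 1: "cmp F (ar t + ar u - 1) (deg t + deg u - 1) (ar r) (deg r) (k - 1 + ar u) (cmp F (ar t) (deg t - 1) (ar u) (deg u) i (Dt t) (cls E u)) (cls E r)
    = scl F (ksign (deg u * deg r)) (cmp F (ar t + ar r - 1) (deg t + deg r - 1) (ar u) (deg u) i (cmp F (ar t) (deg t - 1) (ar r) (deg r) k (Dt t) (cls E r)) (cls E u))"
    by (rule F.par'[OF m(4,2,3) i]) auto
  have 2: "cmp F (ar t + ar u - 1) (deg t + deg u - 1) (ar r) (deg r) (k - 1 + ar u) (cmp F (ar t) (deg t) (ar u) (deg u - 1) i (cls E t) (Dt u)) (cls E r)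
    = scl F (ksign ((deg u - 1) * deg r)) (cmp F (ar t + ar r - 1) (deg t + deg r) (ar u) (deg u - 1) i (cmp F (ar t) (deg t) (ar r) (deg r) k (cls E t) (cls E r)) (Dt u))"
    by (rule F.par'[OF m(1,5,3) i]) auto
  have 3: "cmp F (ar t + ar u - 1) (deg t + deg u) (ar r) (deg r - 1) (k - 1 + ar u) (cmp F (ar t) (deg t) (ar u) (deg u) i (cls E t) (cls E u)) (Dt r)
    = scl F (ksign (deg u * (deg r - 1))) (cmp F (ar t + ar r - 1) (deg t + deg r - 1) (ar u) (deg u) i (cmp F (ar t) (deg t) (ar r) (deg r - 1) k (cls E t) (Dt r)) (cls E u))"
    by (rule F.par'[OF m(1,2,6) i]) auto
  have s: "ksign (deg t) * ksign ((deg u - 1) * deg r) = (ksign (deg u * deg r) * ksign (deg t + deg r) :: 'k)"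
    "ksign (deg t + deg u) * ksign (deg u * (deg r - 1)) = (ksign (deg u * deg r) * ksign (deg t) :: 'k)"
    by (auto simp: ksign_def)
  show ?thesis
    unfolding Dt_Cmp[OF wtu w(3) i'(1,2)[folded ar.simps(3)[of t i u]]] Dt_Cmp[OF wtr w(2) i(1) i'(5)[folded ar.simps(3)[of t k r]]] Dt_Cmp[OF w(1,2) i(1) i'(3)] Dt_Cmp[OF w(1,3) i'(4) i(3)]
    unfolding ar.simps deg.simps c lin 1 2 3 quasi_free_simps(1) fs.scale_scale fs.scale_right_distrib s
    by (simp only: add.assoc add.left_commute add.commute)
qed

lemma Dt_equi:
  assumes w: "wf_term E t" "wf_term E u" and i: "1 \<le> i" "i \<le> ar t"
    and s: "\<sigma> permutes {1..ar t}" "\<tau> permutes {1..ar u}"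
  shows "Dt (Cmp (Prm \<sigma> t) i (Prm \<tau> u)) = Dt (Prm (perm_cmp (ar t) (ar u) i \<sigma> \<tau>) (Cmp t (\<sigma> i) u))"
proof -
  have i': "1 \<le> \<sigma> i" "\<sigma> i \<le> ar t" using permutes_in_image[OF s(1), of i] i by auto
  note m = cls_in[OF w(1) refl refl, of \<delta>] cls_in[OF w(2) refl refl, of \<delta>] Dt_in[OF w(1)] Dt_in[OF w(2)]
  have ws: "wf_term E (Prm \<sigma> t)" "wf_term E (Prm \<tau> u)" "wf_term E (Cmp t (\<sigma> i) u)" using w s i' by simp_all
  have c: "cls E (Prm \<sigma> t) = act F (ar t) (deg t) \<sigma> (cls E t)" "cls E (Prm \<tau> u) = act F (ar u) (deg u) \<tau> (cls E u)"
    using w s by (simp_all only: act_cls)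
  have e: "deg t + deg u - 1 = deg t - 1 + deg u" and e': "deg t + (deg u - 1) = deg t - 1 + deg u" by auto
  let ?p = "perm_cmp (ar t) (ar u) i \<sigma> \<tau>"
  have 1: "cmp F (ar t) (deg t - 1) (ar u) (deg u) i (act F (ar t) (deg t - 1) \<sigma> (Dt t)) (act F (ar u) (deg u) \<tau> (cls E u))
    = act F (ar t + ar u - 1) (deg t - 1 + deg u) ?p (cmp F (ar t) (deg t - 1) (ar u) (deg u) (\<sigma> i) (Dt t) (cls E u))"
    by (rule F.equi[OF m(3,2) i s])
  have 2: "cmp F (ar t) (deg t) (ar u) (deg u - 1) i (act F (ar t) (deg t) \<sigma> (cls E t)) (act F (ar u) (deg u - 1) \<tau> (Dt u))
    = act F (ar t + ar u - 1) (deg t - 1 + deg u) ?p (cmp F (ar t) (deg t) (ar u) (deg u - 1) (\<sigma> i) (cls E t) (Dt u))"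
    using F.equi[OF m(1,4) i s] unfolding e' .
  have pp: "?p permutes {1..ar (Cmp t (\<sigma> i) u)}" using perm_cmp_permutes[OF i s] by simp
  have al: "act F n d p (v + fscl a v') = act F n d p v + fscl a (act F n d p v')" for n d p v v' a by simp
  show ?thesis
    unfolding Dt_Prm[OF ws(3) pp] Dt_Cmp[OF ws(1,2) i[folded ar.simps(4)[of \<sigma> t]]] Dt_Cmp[OF w i'] Dt_Prm[OF w(1) s(1)] Dt_Prm[OF w(2) s(2)] c
    unfolding ar.simps deg.simps 1 2 e al ..
qed

text \<open>A derivation descends to the free operad because it preserves relations. In the
  congruence cases the Leibniz rule gives two summands: one contains the derivative of the smaller
  relation, which vanishes by induction, the other contains that relation itself.\<close>

lemma D_rel: "free_rel E n d v \<Longrightarrow> fcls E n (d - 1) (lext fscl D v) = 0"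
proof (induction rule: free_rel.induct)
  case (gen_plus x n d y) then show ?case by (simp add: \<delta>_add)
next
  case (gen_scale x n d c) then show ?case by (simp add: \<delta>_scl)
next
  case (gen_act x n d \<sigma>) then show ?case by (simp add: \<delta>_act)
next
  case (unit_left t)
  have "Dt (Cmp Unt 1 t) = Dt t"
    using unit_left Dt_Cmp[of Unt t 1] F.unit_l[OF Dt_in[OF unit_left(1)]] by (simp add: Dt_Unt cls_def)
  then show ?case by (simp add: Dt_def)
next
  case (unit_right t i)
  have "Dt (Cmp t i Unt) = Dt t"
    using unit_right Dt_Cmp[of t Unt i] F.unit_r[OF Dt_in[OF unit_right(1)], of i] by (simp add: Dt_Unt cls_def)
  then show ?case by (simp add: Dt_def)
next
  case (assoc_seq t u r i j)
  have e: "ar (Cmp (Cmp t i u) (i - 1 + j) r) = ar (Cmp t i (Cmp u j r))" "deg t + deg u + deg r = deg (Cmp t i (Cmp u j r))"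
    "deg (Cmp (Cmp t i u) (i - 1 + j) r) = deg (Cmp t i (Cmp u j r))"
    using assoc_seq by auto
  show ?case using Dt_seq[OF assoc_seq] unfolding e(2) unfolding Dt_def e(1,3) by simp
next
  case (assoc_par t u r i k)
  have e: "ar (Cmp (Cmp t i u) (k - 1 + ar u) r) = ar (Cmp (Cmp t k r) i u)" "deg t + deg u + deg r = deg (Cmp (Cmp t k r) i u)"
    "deg (Cmp (Cmp t i u) (k - 1 + ar u) r) = deg (Cmp (Cmp t k r) i u)"
    using assoc_par by auto
  show ?case using Dt_par[OF assoc_par] unfolding e(2) unfolding Dt_def e(1,3) by simp
next
  case (prm_id t)
  have "Dt (Prm id t) = Dt t"
    using Dt_Prm[OF prm_id permutes_id] F.act_id[OF Dt_in[OF prm_id]] by simp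
  then show ?case by (simp add: Dt_def)
next
  case (prm_prm t \<sigma> \<tau>)
  have "Dt (Prm \<tau> (Prm \<sigma> t)) = Dt (Prm (\<sigma> \<circ> \<tau>) t)"
    using prm_prm Dt_Prm[of t \<sigma>] Dt_Prm[of "Prm \<sigma> t" \<tau>] Dt_Prm[of t "\<sigma> \<circ> \<tau>"] F.act_act[OF Dt_in[OF prm_prm(1)] prm_prm(2,3)]
      permutes_compose[OF prm_prm(3,2)] by (simp del: quasi_free_simps)
  then show ?case by (simp add: Dt_def)
next
  case (equivar t u i \<sigma> \<tau>)
  show ?case using Dt_equi[OF equivar] by (simp add: Dt_def)
next
  case (cong_left n d v u i)
  note k = frel_keys[OF cong_left(1)]
  have b: "Poly_Mapping.keys (bas u :: _ \<Rightarrow>\<^sub>0 'k) \<subseteq> terms E (ar u) (deg u)" using cong_left by (auto simp: terms_iff)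
  have kd: "Poly_Mapping.keys (lext fscl D v) \<subseteq> terms E n (d - 1)"
    by (rule keys_lextI) (use k D_keys in \<open>auto simp: terms_iff subset_iff\<close>)
  have "lext fscl D (fcmp i v (bas u)) = lext fscl (\<lambda>t. fcmp i (D t) (bas u) + fscl (ksign (deg t)) (fcmp i (bas t) (D u))) v"
    by (simp add: fcmp_def[of i v] lext_lext[OF vector_space_fscl])
  \<comment> \<open>All terms of a relation of degree \<open>d\<close> have this degree, so the
    Leibniz sign is constant and can be taken out of the extension over \<open>v\<close>.\<close>
  also have "\<dots> = lext fscl (\<lambda>t. fcmp i (D t) (bas u) + fscl (ksign d) (fcmp i (bas t) (D u))) v"
    by (rule lext_cong) (use k in \<open>auto simp: terms_iff subset_iff\<close>)
  also have "\<dots> = fcmp i (lext fscl D v) (bas u) + fscl (ksign d) (fcmp i v (D u))"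
    by (simp add: fcmp_def lext_lext[OF vector_space_fscl])
  finally have eq: "lext fscl D (fcmp i v (bas u)) = fcmp i (lext fscl D v) (bas u) + fscl (ksign d) (fcmp i v (D u))" .
  have e: "d + deg u - 1 = d - 1 + deg u" "d - 1 + deg u = d + (deg u - 1)" by auto
  have 1: "fcls E (n + ar u - 1) (d - 1 + deg u) (fcmp i (lext fscl D v) (bas u)) = 0"
    using fcls_cmp_left[OF kd b cong_left(3,4)] cong_left(5) by simp
  have 2: "fcls E (n + ar u - 1) (d - 1 + deg u) (fcmp i v (D u)) = 0"
    using fcls_cmp_left[OF k D_keys[OF cong_left(2)] cong_left(3,4)] cong_left(1) unfolding e(2) by (simp add: fcls_eq_0_iff[THEN iffD2])
  show ?case unfolding eq e(1) by (simp add: 1 2)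
next
  case (cong_right n d v t i)
  note k = frel_keys[OF cong_right(1)]
  have b: "Poly_Mapping.keys (bas t :: _ \<Rightarrow>\<^sub>0 'k) \<subseteq> terms E (ar t) (deg t)" using cong_right by (auto simp: terms_iff)
  have kd: "Poly_Mapping.keys (lext fscl D v) \<subseteq> terms E n (d - 1)"
    by (rule keys_lextI) (use k D_keys in \<open>auto simp: terms_iff subset_iff\<close>)
  have "lext fscl D (fcmp i (bas t) v) = lext fscl (\<lambda>u. fcmp i (D t) (bas u) + fscl (ksign (deg t)) (fcmp i (bas t) (D u))) v"
    by (simp add: fcmp_def[of i "bas t" v] lext_lext[OF vector_space_fscl])
  also have "\<dots> = fcmp i (D t) v + fscl (ksign (deg t)) (fcmp i (bas t) (lext fscl D v))"
    by (simp add: fcmp_lext_right[of i "D t" v], simp add: fcmp_def lext_lext[OF vector_space_fscl])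
  finally have eq: "lext fscl D (fcmp i (bas t) v) = fcmp i (D t) v + fscl (ksign (deg t)) (fcmp i (bas t) (lext fscl D v))" .
  have e: "deg t + d - 1 = deg t - 1 + d" "deg t - 1 + d = deg t + (d - 1)" by auto
  have 1: "fcls E (ar t + n - 1) (deg t - 1 + d) (fcmp i (D t) v) = 0"
    using fcls_cmp_right[OF D_keys[OF cong_right(2)] k cong_right(3,4)] cong_right(1) by (simp add: fcls_eq_0_iff[THEN iffD2])
  have 2: "fcls E (ar t + n - 1) (deg t - 1 + d) (fcmp i (bas t) (lext fscl D v)) = 0"
    using fcls_cmp_right[OF b kd cong_right(3,4)] cong_right(5) unfolding e(2) by simp
  show ?case unfolding eq e(1) by (simp add: 1 2)
next
  case (cong_prm n d v \<sigma>)
  have "lext fscl D (fprm \<sigma> v) = lext fscl (\<lambda>t. fprm \<sigma> (D t)) v"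
    by (simp add: fprm_def[of \<sigma> v] lext_lext[OF vector_space_fscl])
  also have "\<dots> = fprm \<sigma> (lext fscl D v)"
    by (simp add: fprm_def lext_lext[OF vector_space_fscl])
  finally show ?case using fcls_prm[OF cong_prm(2), of "d - 1" "lext fscl D v"] cong_prm(3) by simp
qed simp_all

lemma dif_cls: "wf_term E t \<Longrightarrow> ar t = n \<Longrightarrow> deg t = d \<Longrightarrow> dif F n d (cls E t) = Dt t"
proof -
  assume t: "wf_term E t" "ar t = n" "deg t = d"
  \<comment> \<open>The differential is computed on the representative of the class of
    \<open>t\<close>, which differs from \<open>bas t\<close> by a relation; by \<open>D_rel\<close>
    this difference has no effect.\<close>
  have "fcls E n (d - 1) (lext fscl D (bas t - fcls E n d (bas t))) = 0"
    by (rule D_rel) (simp add: fcls_eq_0_iff[symmetric])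
  then show ?thesis using t by (simp add: cls_def Dt_def)
qed

lemma predg_free: "predg F"
proof unfold_locales
  note ah = additive_hom_def
  show "linmap (scl F) (scl F) (gr F n d) (gr F n (d - 1)) (dif F n d)" for n d
  proof (rule linmapI)
    fix x assume "x \<in> gr F n d"
    then have k: "Poly_Mapping.keys x \<subseteq> terms E n d" by (simp add: gr_free_eq)
    show "dif F n d x \<in> gr F n (d - 1)"
      unfolding quasi_free_simps
      by (intro fcls_in keys_lextI) (use k D_keys in \<open>auto simp: terms_iff subset_iff\<close>)
  qed simp_all
  show "dif F n d (act F n d \<sigma> x) = act F n (d - 1) \<sigma> (dif F n d x)" if "x \<in> gr F n d" "\<sigma> permutes {1..n}" for x n d \<sigma>
  proof (rule free_ext1[OF that(1)])
    fix t assume t: "wf_term E t" "ar t = n" "deg t = d"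
    then show "dif F n d (act F n d \<sigma> (cls E t)) = act F n (d - 1) \<sigma> (dif F n d (cls E t))"
      using that(2) Dt_Prm[of t \<sigma>] by (simp add: act_cls dif_cls del: quasi_free_simps)
  qed (simp_all add: ah)
  show "dif F 1 0 (unt F) = 0"
    using dif_cls[of Unt 1 0] by (simp add: cls_def Dt_Unt)
  show "dif F (m + n - 1) (a + b) (cmp F m a n b i x y) =
       cmp F m (a - 1) n b i (dif F m a x) y + scl F (ksign a) (cmp F m a n (b - 1) i x (dif F n b y))"
    if x: "x \<in> gr F m a" and y: "y \<in> gr F n b" and i: "1 \<le> i" "i \<le> m" for x m a y n b i
  proof (rule free_ext2[OF x y])
    fix t u assume t: "wf_term E t" "ar t = m" "deg t = a" and u: "wf_term E u" "ar u = n" "deg u = b"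
    have w: "wf_term E (Cmp t i u)" "ar (Cmp t i u) = m + n - 1" "deg (Cmp t i u) = a + b" using t u i by auto
    show "dif F (m + n - 1) (a + b) (cmp F m a n b i (cls E t) (cls E u)) =
       cmp F m (a - 1) n b i (dif F m a (cls E t)) (cls E u) + scl F (ksign a) (cmp F m a n (b - 1) i (cls E t) (dif F n b (cls E u)))"
      using i t u Dt_Cmp[of t u i] unfolding cmp_cls[OF t(1) u(1) i(1) i(2)[folded t(2)] t(2,3) u(2,3)] dif_cls[OF w] dif_cls[OF t] dif_cls[OF u]
      by (simp del: quasi_free_simps(2-))
  qed (simp_all add: ah fs.scale_right_distrib fs.scale_left_commute algebra_simps)
qed

end

text \<open>For a morphism \<open>f\<close> the two composites with the differentials satisfy the
  same Leibniz rule along \<open>f\<close>, so their agreement propagates from generators to all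
  terms.\<close>

lemma (in free_der) free_dg_hom:
  assumes H: "predg H" and f: "graded_operad_hom F H f"
    and gen: "\<And>n d x. x \<in> gr E n d \<Longrightarrow> f n (d - 1) (dif F n d (cls E (Gen n d x))) = dif H n d (f n d (cls E (Gen n d x)))"
  shows "dg_operad_hom F H f"
proof -
  interpret H: predg H by fact
  interpret FF: predg F by (rule predg_free)
  note h = ghomD[OF f]
  have in1: "f n d x \<in> gr H n d" if "x \<in> gr F n d" for n d x using linmapD(1)[OF h(1) that] .
  have din: "dif F n d x \<in> gr F n (d - 1)" if "x \<in> gr F n d" for n d x using linmapD(1)[OF FF.dif_lin that] .
  let ?ok = "\<lambda>n d x. f n (d - 1) (dif F n d x) = dif H n d (f n d x)"
  have t: "wf_term E t \<Longrightarrow> ?ok (ar t) (deg t) (cls E t)" for t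
  proof (induction t)
    case Unt
    have u: "cls E Unt = unt F" by (simp add: cls_def)
    show ?case using FF.dif_unt H.dif_unt h(3) F.lin_zero[OF h(1), of 1 "-1"] unfolding u ar.simps deg.simps by (simp only: diff_0)
  next
    case (Gen n d x) then show ?case using gen by simp
  next
    case (Cmp t i u)
    then have w: "wf_term E t" "wf_term E u" "1 \<le> i" "i \<le> ar t" by simp_all
    note c = cmp_cls[OF w refl refl refl refl, of \<delta>, symmetric]
    note m = cls_in[OF w(1) refl refl, of \<delta>] cls_in[OF w(2) refl refl, of \<delta>]
    have e: "deg t + deg u - 1 = deg t - 1 + deg u" and e': "deg t + (deg u - 1) = deg t - 1 + deg u" by auto
    have m1: "cmp F (ar t) (deg t - 1) (ar u) (deg u) i (dif F (ar t) (deg t) (cls E t)) (cls E u) \<in> gr F (ar t + ar u - 1) (deg t - 1 + deg u)"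
      by (rule F.cmp_in[OF w(3,4) din[OF m(1)] m(2)])
    have m2: "cmp F (ar t) (deg t) (ar u) (deg u - 1) i (cls E t) (dif F (ar u) (deg u) (cls E u)) \<in> gr F (ar t + ar u - 1) (deg t - 1 + deg u)"
      using F.cmp_in[OF w(3,4) m(1) din[OF m(2)]] unfolding e' .
    have f1: "f (ar t + ar u - 1) (deg t - 1 + deg u) (cmp F (ar t) (deg t - 1) (ar u) (deg u) i (dif F (ar t) (deg t) (cls E t)) (cls E u))
      = cmp H (ar t) (deg t - 1) (ar u) (deg u) i (dif H (ar t) (deg t) (f (ar t) (deg t) (cls E t))) (f (ar u) (deg u) (cls E u))"
      using h(4)[OF din[OF m(1)] m(2) w(3,4)] Cmp.IH w by simp
    have f2: "f (ar t + ar u - 1) (deg t - 1 + deg u) (cmp F (ar t) (deg t) (ar u) (deg u - 1) i (cls E t) (dif F (ar u) (deg u) (cls E u)))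
      = cmp H (ar t) (deg t) (ar u) (deg u - 1) i (f (ar t) (deg t) (cls E t)) (dif H (ar u) (deg u) (f (ar u) (deg u) (cls E u)))"
      using h(4)[OF m(1) din[OF m(2)] w(3,4)] Cmp.IH w unfolding e' by simp
    show ?case
      unfolding ar.simps deg.simps c FF.dif_cmp[OF m w(3,4)] h(4)[OF m w(3,4)] H.dif_cmp[OF in1[OF m(1)] in1[OF m(2)] w(3,4)]
        e linmapD(2)[OF h(1) m1 F.gr_scl[OF m2]] linmapD(3)[OF h(1) m2] f1 f2 ..
  next
    case (Prm \<sigma> t)
    then have w: "wf_term E t" "\<sigma> permutes {1..ar t}" by simp_all
    note c = act_cls[OF w refl refl, of \<delta>, symmetric]
    note m = cls_in[OF w(1) refl refl, of \<delta>]
    show ?case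
      unfolding ar.simps deg.simps c FF.dif_act[OF m w(2)] h(2)[OF m w(2)] h(2)[OF din[OF m] w(2)] H.dif_act[OF in1[OF m] w(2)]
      using Prm.IH w by simp
  qed
  have "x \<in> gr F n d \<and> ?ok n d x" if "x \<in> gr F n d" for x n d
    using that
  proof (induction rule: free_induct)
    case zero then show ?case by (simp only: F.gr_zero F.lin_zero[OF h(1)] F.lin_zero[OF FF.dif_lin] H.lin_zero[OF H.dif_lin] HOL.simp_thms)
  next
    case (cls u) then show ?case using t[of u] by (auto intro: cls_in)
  next
    case (add v w) then show ?case
      using F.gr_add[of v n d w] linmapD(2)[OF h(1) din din, of v n d w] linmapD(2)[OF h(1), of v n d w]
        linmapD(2)[OF H.dif_lin in1 in1, of v n d w] linmapD(2)[OF FF.dif_lin, of v n d w] by simp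
  next
    case (scale c v) then show ?case
      using F.gr_scl[of v n d c] linmapD(3)[OF h(1) din, of v n d c] linmapD(3)[OF h(1), of v n d c]
        linmapD(3)[OF H.dif_lin in1, of v n d c] linmapD(3)[OF FF.dif_lin, of v n d c] by simp
  qed
  then show ?thesis unfolding dg_operad_hom_def using f by blast
qed

section \<open>Unshuffles and block permutations\<close>

lemma unshuffle_in:
  assumes "S \<subseteq> {1..n}" "x \<in> {1..n}"
  shows "x \<in> S \<Longrightarrow> unshuffle n S x \<in> {1..card S}" "x \<notin> S \<Longrightarrow> unshuffle n S x \<in> {card S + 1..n}"
proof -
  have fS: "finite S" using assms(1) finite_subset by blast
  have cn: "card ({1..n} - S) = n - card S" using assms(1) by (simp add: card_Diff_subset fS)
  have cs: "card S \<le> n" using card_mono[OF _ assms(1)] by simp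
  show "unshuffle n S x \<in> {1..card S}" if "x \<in> S"
  proof -
    have "0 < card {y \<in> S. y \<le> x}" using that fS by (subst card_gt_0_iff) auto
    moreover have "card {y \<in> S. y \<le> x} \<le> card S" using fS by (intro card_mono) auto
    ultimately show ?thesis using that assms by (simp add: unshuffle_def)
  qed
  show "unshuffle n S x \<in> {card S + 1..n}" if "x \<notin> S"
  proof -
    have "0 < card {y \<in> {1..n} - S. y \<le> x}" using that assms by (subst card_gt_0_iff) auto
    moreover have "card {y \<in> {1..n} - S. y \<le> x} \<le> card ({1..n} - S)" by (intro card_mono) auto
    ultimately show ?thesis using that assms cn cs by (simp add: unshuffle_def)
  qed
qed

text \<open>This recovers \<open>S\<close> from its permutation: it consists of the inputs that are
  sent to the first block, the inputs of the inner vertex.\<close>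

lemma unshuffle_le_iff:
  assumes "S \<subseteq> {1..n}" "x \<in> {1..n}"
  shows "unshuffle n S x \<le> card S \<longleftrightarrow> x \<in> S"
  using unshuffle_in[OF assms] by (cases "x \<in> S") auto

text \<open>Counting is strictly increasing on \<open>S\<close> and on its complement, and the two
  ranges of values are disjoint. Injectivity on a finite set is enough.\<close>

lemma unshuffle_permutes:
  assumes S: "S \<subseteq> {1..n}"
  shows "unshuffle n S permutes {1..n}"
proof (rule bij_imp_permutes)
  have fS: "finite S" using S finite_subset by blast
  have mono: "card {y \<in> A. y \<le> x} < card {y \<in> A. y \<le> x'}" if "finite A" "x' \<in> A" "x < x'" for A and x x' :: nat
  proof (rule psubset_card_mono)
    have "{y \<in> A. y \<le> x} \<subseteq> {y \<in> A. y \<le> x'}" "x' \<in> {y \<in> A. y \<le> x'}" "x' \<notin> {y \<in> A. y \<le> x}"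
      using that by auto
    then show "{y \<in> A. y \<le> x} \<subset> {y \<in> A. y \<le> x'}" by blast
  qed (use that in simp)
  have inj: "x = x'" if "finite A" "x \<in> A" "x' \<in> A" "card {y \<in> A. y \<le> x} = card {y \<in> A. y \<le> x'}" for A and x x' :: nat
    using mono[OF that(1,2), of x'] mono[OF that(1,3), of x] that(4) by (cases x x' rule: linorder_cases) auto
  have "inj_on (unshuffle n S) {1..n}"
  proof (rule inj_onI)
    fix x y assume x: "x \<in> {1..n}" and y: "y \<in> {1..n}" and e: "unshuffle n S x = unshuffle n S y"
    have xy: "x \<in> S \<longleftrightarrow> y \<in> S" using unshuffle_le_iff[OF S x] unshuffle_le_iff[OF S y] e by simp
    show "x = y"
    proof (cases "x \<in> S")
      case True then show ?thesis using xy e x y inj[OF fS, of x y] by (simp add: unshuffle_def)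
    next
      case False then show ?thesis using xy e x y inj[of "{1..n} - S" x y] by (simp add: unshuffle_def)
    qed
  qed
  moreover have "unshuffle n S ` {1..n} \<subseteq> {1..n}"
  proof
    fix z assume "z \<in> unshuffle n S ` {1..n}"
    then obtain x where x: "x \<in> {1..n}" "z = unshuffle n S x" by blast
    have "card S \<le> n" using card_mono[OF _ S] by simp
    then show "z \<in> {1..n}" using unshuffle_in[OF S x(1)] x(2) by (cases "x \<in> S") auto
  qed
  ultimately show "bij_betw (unshuffle n S) {1..n} {1..n}"
    using endo_inj_surj[of "{1..n}" "unshuffle n S"] by (simp add: bij_betw_def)
  show "unshuffle n S x = x" if "x \<notin> {1..n}" for x using that unfolding unshuffle_def by (simp only: if_True HOL.simp_thms)
qed

lemma permutes_restrict:
  assumes p: "p permutes {1..n::nat}" and A: "A \<subseteq> {1..n}" "p ` A \<subseteq> A"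
  shows "(\<lambda>x. if x \<in> A then p x else x) permutes A"
proof (rule bij_imp_permutes)
  have f: "finite A" using A(1) finite_subset by blast
  have "inj_on p A" using permutes_inj[OF p] by (rule inj_on_subset) simp
  then have "bij_betw p A A" using endo_inj_surj[OF f A(2)] by (simp add: bij_betw_def)
  then show "bij_betw (\<lambda>x. if x \<in> A then p x else x) A A" by (simp cong: bij_betw_cong)
qed simp

text \<open>A permutation that preserves the initial block of length \<open>b\<close> splits into
  one of the block and one of the remaining points. Adding a fixed slot \<open>1\<close>, which
  stands for the collapsed block, to the latter gives \<open>\<alpha>\<close>.\<close>

lemma block_perm_decomp:
  assumes a: "1 \<le> a" and r: "\<rho> permutes {1..a + b - 1}"
    and blk: "\<And>x. x \<in> {1..a + b - 1} \<Longrightarrow> \<rho> x \<le> b \<longleftrightarrow> x \<le> b"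
  obtains \<alpha> \<beta> where "\<alpha> permutes {1..a}" "\<alpha> 1 = 1" "\<beta> permutes {1..b}" "perm_cmp a b 1 \<alpha> \<beta> = \<rho>"
proof
  let ?N = "{1..a + b - 1}"
  have rin: "\<rho> x \<in> ?N" if "x \<in> ?N" for x using that permutes_in_image[OF r] by blast
  have rinj: "\<rho> x = \<rho> y \<longleftrightarrow> x = y" for x y using permutes_inj[OF r] by (auto dest: injD)
  define \<beta> where "\<beta> x = (if x \<in> {1..b} then \<rho> x else x)" for x
  \<comment> \<open>A slot \<open>x\<close> from \<open>2\<close> on sits at position
    \<open>x + b - 1\<close> once slot \<open>1\<close> has been expanded into \<open>b\<close>
    inputs; the value of \<rho> is shifted back by the same amount.\<close>
  define \<alpha> where "\<alpha> x = (if x \<in> {2..a} then \<rho> (x + b - 1) - b + 1 else x)" for x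
  have b1: "\<rho> ` {1..b} \<subseteq> {1..b}"
  proof
    fix z assume "z \<in> \<rho> ` {1..b}"
    then obtain x where x: "x \<in> {1..b}" "z = \<rho> x" by blast
    then have "x \<in> ?N" using a by auto
    then show "z \<in> {1..b}" using rin[of x] blk[of x] x by auto
  qed
  show "\<beta> permutes {1..b}"
  proof -
    have "{1..b} \<subseteq> ?N" using a by auto
    from permutes_restrict[OF r this b1] show ?thesis unfolding \<beta>_def .
  qed
  have hi: "\<rho> (x + b - 1) \<in> {b + 1..a + b - 1}" if "x \<in> {2..a}" for x
  proof -
    have "x + b - 1 \<in> ?N" "\<not> x + b - 1 \<le> b" using that by auto
    then show ?thesis using rin[of "x + b - 1"] blk[of "x + b - 1"] by auto
  qed
  show "\<alpha> permutes {1..a}"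
  proof (rule bij_imp_permutes)
    have "inj_on \<alpha> {1..a}"
    proof (rule inj_onI)
      fix x y assume x: "x \<in> {1..a}" and y: "y \<in> {1..a}" and e: "\<alpha> x = \<alpha> y"
      show "x = y"
      proof (cases "x \<in> {2..a} \<and> y \<in> {2..a}")
        case True
        have "\<rho> (x + b - 1) - b + 1 = \<rho> (y + b - 1) - b + 1" using e True by (simp add: \<alpha>_def)
        moreover have "b + 1 \<le> \<rho> (x + b - 1)" "b + 1 \<le> \<rho> (y + b - 1)" using hi[of x] hi[of y] True by simp_all
        ultimately have "\<rho> (x + b - 1) = \<rho> (y + b - 1)" by linarith
        then show ?thesis using rinj True by auto
      next
        case False
        then show ?thesis using e hi[of x] hi[of y] x y by (auto simp: \<alpha>_def split: if_splits)
      qed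
    qed
    moreover have "\<alpha> ` {1..a} \<subseteq> {1..a}"
    proof
      fix z assume "z \<in> \<alpha> ` {1..a}"
      then obtain x where x: "x \<in> {1..a}" "z = \<alpha> x" by blast
      then show "z \<in> {1..a}" using hi[of x] by (auto simp: \<alpha>_def)
    qed
    ultimately show "bij_betw \<alpha> {1..a} {1..a}"
      using endo_inj_surj[of "{1..a}" \<alpha>] by (simp add: bij_betw_def)
  qed (auto simp: \<alpha>_def)
  show \<alpha>1: "\<alpha> 1 = 1" by (simp add: \<alpha>_def)
  show "perm_cmp a b 1 \<alpha> \<beta> = \<rho>"
  proof
    fix x
    consider "x \<notin> ?N" | "x \<in> ?N" "x \<le> b" | "x \<in> ?N" "b < x" by linarith
    then show "perm_cmp a b 1 \<alpha> \<beta> x = \<rho> x"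
    proof cases
      case 1 then show ?thesis
        unfolding perm_cmp_def using permutes_not_in[OF r] by (simp only: Let_def if_True HOL.simp_thms)
    next
      case 2
      then show ?thesis unfolding perm_cmp_def using \<alpha>1 by (auto simp: \<beta>_def)
    next
      case 3
      then have "x - b + 1 \<in> {2..a}" "x - b + 1 + b - 1 = x" by auto
      then show ?thesis unfolding perm_cmp_def using \<alpha>1 3 hi[of "x - b + 1"] by (auto simp: \<alpha>_def)
    qed
  qed
qed

section \<open>The cobar construction\<close>

definition tact ::
  "('k::field, 'c::ab_group_add, 'z) dgsmod_scheme \<Rightarrow> nat \<Rightarrow> nat \<Rightarrow> (nat \<Rightarrow> nat) \<Rightarrow> (nat \<Rightarrow> nat) \<Rightarrow>
   (('c, 'c) tkey \<Rightarrow>\<^sub>0 'k) \<Rightarrow> (('c, 'c) tkey \<Rightarrow>\<^sub>0 'k)" where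
  "tact C a b \<alpha> \<beta> = lext fscl (\<lambda>((i, x), (j, y)). pure C a C b i (act C a i \<alpha> x) j (act C b j \<beta> y))"

lemma tact_linear [simp]:
  "tact C a b \<alpha> \<beta> (v + w) = tact C a b \<alpha> \<beta> v + tact C a b \<alpha> \<beta> w"
  "tact C a b \<alpha> \<beta> (fscl c v) = fscl c (tact C a b \<alpha> \<beta> v)" "tact C a b \<alpha> \<beta> 0 = 0"
  by (simp_all add: tact_def)

lemma (in smod) tact_pure:
  assumes "x \<in> gr V a i" "y \<in> gr V b j" "\<alpha> permutes {1..a}" "\<beta> permutes {1..b}"
  shows "tact V a b \<alpha> \<beta> (pure V a V b i x j y) = pure V a V b i (act V a i \<alpha> x) j (act V b j \<beta> y)"
proof -
  interpret tensor V V by unfold_locales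
  show ?thesis unfolding tact_def
    by (subst lext_pure[OF vector_space_fscl], rule bilinI;
      auto intro!: pure_lin_left' pure_lin_right' act_lin act_in simp: assms)
qed

text \<open>The part of the structure of a coaugmented dg cooperad that enters the cobar construction as a
  graded operad with a derivation; coassociativity is only needed for the derivation to square to zero.\<close>

locale precoop = dsmod C for C :: "('k::field, 'c::ab_group_add) dgcoop" +
  assumes counit_lin: "linmap (scl C) (*) (gr C 1 0) UNIV (counit C)"
    and counit_dif: "x \<in> gr C 1 1 \<Longrightarrow> counit C (dif C 1 1 x) = 0"
    and coaug_in: "coaug C \<in> gr C 1 0"
    and counit_coaug: "counit C (coaug C) = 1"
    and dec_lin: "1 \<le> a \<Longrightarrow> linmap (scl C) fscl (gr C (a + b - 1) d) (tgr C a C b d) (dec C a b 1 d)"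
    and dec_act: "1 \<le> a \<Longrightarrow> x \<in> gr C (a + b - 1) d \<Longrightarrow> \<alpha> permutes {1..a} \<Longrightarrow> \<alpha> 1 = 1 \<Longrightarrow> \<beta> permutes {1..b} \<Longrightarrow>
      dec C a b 1 d (act C (a + b - 1) d (perm_cmp a b 1 \<alpha> \<beta>) x) = tact C a b \<alpha> \<beta> (dec C a b 1 d x)"
begin

abbreviation "E \<equiv> desusp_bar C"

lemma E_simps [simp]: "scl E = scl C" "act E = (\<lambda>n d. act C n (d + 1))" "dif E = (\<lambda>n d c. - dif C n (d + 1) c)"
  by (simp_all add: desusp_bar_def)

lemma gr_E: "gr E n d = {c \<in> gr C n (d + 1). n = 1 \<and> d + 1 = 0 \<longrightarrow> counit C c = 0}"
  by (simp add: desusp_bar_def)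

lemma gr_ED: "c \<in> gr E n d \<Longrightarrow> c \<in> gr C n (d + 1)"
  by (simp add: gr_E)

lemma permutes_11: "\<sigma> permutes {1..1::nat} \<Longrightarrow> \<sigma> = id"
  by simp

lemma dsmod_E: "dsmod E"
proof -
  note c = linmapD[OF counit_lin]
  have g: "gvec E" unfolding gvec_def
  proof (intro conjI allI)
    show "vector_space (scl E)" using vs by simp
    show "module.subspace (scl E) (gr E n d)" for n d
      unfolding E_simps gr_E
      by (rule vec.subspaceI) (auto simp: gr_add gr_scl c lin_zero[OF counit_lin])
  qed
  then interpret E: gvec E .
  have a: "act C n (d + 1) \<sigma> x \<in> gr E n d" if "x \<in> gr E n d" "\<sigma> permutes {1..n}" for n d \<sigma> x
  proof (cases "n = 1")
    case True
    \<comment> \<open>The counit condition is imposed only in arity one, where the identity is the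
      sole permutation.\<close>
    then have "\<sigma> = id" using that(2) permutes_11 by blast
    then show ?thesis using that gr_ED[OF that(1)] by (simp only: act_id)
  next
    case False then show ?thesis using that by (simp add: gr_E act_in)
  qed
  \<comment> \<open>A differential can land in the degree where the counit condition applies; there
    \<open>counit_dif\<close> shows that it lies in the kernel.\<close>
  have dd: "dif C n (d + 1) x \<in> gr E n (d - 1)" if "x \<in> gr E n d" for x n d
    using linmapD(1)[OF dif_lin, of x n "d + 1"] that counit_dif[of x] by (auto simp: gr_E)
  have "smod E"
  proof (rule smod.intro[OF g], unfold_locales)
    show "linmap (scl E) (scl E) (gr E n d) (gr E n d) (act E n d \<sigma>)" if "\<sigma> permutes {1..n}" for \<sigma> and n :: nat and d
      using a that linmapD(2,3)[OF act_lin[OF that]] gr_ED by (intro linmapI) simp_all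
    show "act E n d id x = x" if "x \<in> gr E n d" for x d and n :: nat
      using act_id[OF gr_ED[OF that]] by (simp only: E_simps)
    show "act E n d \<tau> (act E n d \<sigma> x) = act E n d (\<sigma> \<circ> \<tau>) x"
      if "x \<in> gr E n d" "\<sigma> permutes {1..n}" "\<tau> permutes {1..n}" for x d \<sigma> \<tau> and n :: nat
      using act_act[OF gr_ED[OF that(1)] that(2,3)] by (simp only: E_simps)
  qed
  then interpret E: smod E .
  show ?thesis
  proof unfold_locales
    show "linmap (scl E) (scl E) (gr E n d) (gr E n (d - 1)) (dif E n d)" for n d
    proof (rule linmapI)
      fix x assume x: "x \<in> gr E n d"
      show "dif E n d x \<in> gr E n (d - 1)" using E.gr_neg[OF dd[OF x]] by simp
      show "dif E n d (scl E c x) = scl E c (dif E n d x)" for c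
        using linmapD(3)[OF dif_lin gr_ED[OF x], of c] by simp
      fix y assume y: "y \<in> gr E n d"
      show "dif E n d (x + y) = dif E n d x + dif E n d y"
        using linmapD(2)[OF dif_lin gr_ED[OF x] gr_ED[OF y]] by simp
    qed
    show "dif E n d (act E n d \<sigma> x) = act E n (d - 1) \<sigma> (dif E n d x)" if "x \<in> gr E n d" "\<sigma> permutes {1..n}" for x d \<sigma> and n :: nat
      using dif_act[OF gr_ED[OF that(1)] that(2)] lin_neg[OF act_lin[OF that(2)] linmapD(1)[OF dif_lin gr_ED[OF that(1)]]]
      by simp
  qed
qed

sublocale E: dsmod E by (rule dsmod_E)

sublocale FE: free_op E by unfold_locales

abbreviation "F \<equiv> cobar C"

lemma F_eq: "F = quasi_free E (\<lambda>n d c. cobar_d1 C n d c + cobar_d2 C n d c)"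
  by (simp add: cobar_def)

sublocale F: gop F unfolding F_eq by (rule FE.gop_free)

sublocale CC: tensor C C by unfold_locales

lemma F_simps: "scl F = fscl" "act F n d \<sigma> v = fcls E n d (fprm \<sigma> v)" "cmp F m a n b i v w = fcls E (m + n - 1) (a + b) (fcmp i v w)"
  by (simp_all add: F_eq)

lemma F_linear [simp]:
  "cmp F m a n b i (v + v') w = cmp F m a n b i v w + cmp F m a n b i v' w"
  "cmp F m a n b i (fscl c v) w = fscl c (cmp F m a n b i v w)"
  "cmp F m a n b i v (w + w') = cmp F m a n b i v w + cmp F m a n b i v w'"
  "cmp F m a n b i v (fscl c w) = fscl c (cmp F m a n b i v w)"
  "cmp F m a n b i 0 w = 0" "cmp F m a n b i v 0 = 0"
  "act F n d \<sigma> (v + w) = act F n d \<sigma> v + act F n d \<sigma> w" "act F n d \<sigma> (fscl c v) = fscl c (act F n d \<sigma> v)" "act F n d \<sigma> 0 = 0"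
  "act F n d \<sigma> (- v) = - act F n d \<sigma> v"
  by (simp_all add: F_simps)

lemma act_F_sum: "act F n d \<sigma> (sum f A) = (\<Sum>a\<in>A. act F n d \<sigma> (f a))"
  by (induction A rule: infinite_finite_induct) simp_all

lemma red_lin: "linmap (scl C) (scl C) (gr C n d) (gr E n (d - 1)) (red_part C n d)"
  by (rule linmapI)
    (auto simp: red_part_def gr_E linmapD[OF counit_lin] lin_diff[OF counit_lin] gr_scl coaug_in counit_coaug
      vec.scale_left_distrib vec.scale_right_diff_distrib gr_diff)

lemma red_act: "x \<in> gr C n d \<Longrightarrow> \<sigma> permutes {1..n} \<Longrightarrow> red_part C n d (act C n d \<sigma> x) = act C n d \<sigma> (red_part C n d x)"
proof (cases "n = 1 \<and> d = 0")
  case True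
  assume x: "x \<in> gr C n d" and s: "\<sigma> permutes {1..n}"
  have "\<sigma> = id" using True s permutes_11 by blast
  moreover have "red_part C n d x \<in> gr C n d" using linmapD(1)[OF red_lin x] gr_ED by fastforce
  ultimately show ?thesis using x by (simp only: act_id)
qed (auto simp: red_part_def)

text \<open>The class of the desuspended reduced part. It is linear on all of \<open>C\<close> and
  not only on the coideal, so that d_2, which reduces both factors of a full decomposition, becomes
  a bilinear expression in these factors.\<close>

definition Gr :: "nat \<Rightarrow> int \<Rightarrow> 'c \<Rightarrow> ('c oterm \<Rightarrow>\<^sub>0 'k)" where
  "Gr n d c = cls E (Gen n (d - 1) (red_part C n d c))"

lemma gen_lin: "linmap (scl C) fscl (gr E n d) (gr F n d) (\<lambda>c. cls E (Gen n d c))"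
proof (rule linmapI)
  fix x assume x: "x \<in> gr E n d"
  show "cls E (Gen n d x) \<in> gr F n d" unfolding F_eq using x by (intro FE.cls_in) simp_all
  show "cls E (Gen n d (scl C c x)) = fscl c (cls E (Gen n d x))" for c
    unfolding cls_def using FE.fcls_eqI[OF free_rel.gen_scale[OF x, of c]] by simp
  fix y assume y: "y \<in> gr E n d"
  show "cls E (Gen n d (x + y)) = cls E (Gen n d x) + cls E (Gen n d y)"
    unfolding cls_def using FE.fcls_eq_0_iff[THEN iffD2, OF free_rel.gen_plus[OF x y]] by (simp add: algebra_simps)
qed

lemma gen_act: "x \<in> gr E n d \<Longrightarrow> \<sigma> permutes {1..n} \<Longrightarrow> act F n d \<sigma> (cls E (Gen n d x)) = cls E (Gen n d (act C n (d + 1) \<sigma> x))"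
  unfolding F_eq
  using FE.act_cls[of "Gen n d x" \<sigma> n d] FE.cls_eqI[OF free_rel.gen_act[of x E n d \<sigma>]] by simp

lemma Gr_lin: "linmap (scl C) fscl (gr C n d) (gr F n (d - 1)) (Gr n d)"
  unfolding Gr_def by (rule linmap_comp[OF red_lin gen_lin])

lemma Gr_in: "x \<in> gr C n d \<Longrightarrow> Gr n d x \<in> gr F n (d - 1)"
  by (rule linmapD(1)[OF Gr_lin])

lemma Gr_act: "x \<in> gr C n d \<Longrightarrow> \<sigma> permutes {1..n} \<Longrightarrow> act F n (d - 1) \<sigma> (Gr n d x) = Gr n d (act C n d \<sigma> x)"
  using gen_act[OF linmapD(1)[OF red_lin], of x n d \<sigma>] by (simp add: Gr_def red_act)

section \<open>The quadratic part of the cobar differential on classes\<close>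

definition Bd :: "nat \<Rightarrow> nat \<Rightarrow> (('c, 'c) tkey \<Rightarrow>\<^sub>0 'k) \<Rightarrow> ('c oterm \<Rightarrow>\<^sub>0 'k)" where
  "Bd a b = lext fscl (\<lambda>((i, x), (j, y)). fscl (- ksign i) (cmp F a (i - 1) b (j - 1) 1 (Gr a i x) (Gr b j y)))"

lemma Bd_linear [simp]: "Bd a b (v + w) = Bd a b v + Bd a b w" "Bd a b (fscl c v) = fscl c (Bd a b v)" "Bd a b 0 = 0"
  "Bd a b (sum f A) = (\<Sum>x\<in>A. Bd a b (f x))"
  by (simp_all add: Bd_def)

lemma Bd_pure:
  assumes "1 \<le> a" "x \<in> gr C a i" "y \<in> gr C b j"
  shows "Bd a b (pure C a C b i x j y) = fscl (- ksign i) (cmp F a (i - 1) b (j - 1) 1 (Gr a i x) (Gr b j y))"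
proof -
  note l = F.cmp_lin_left[OF order_refl assms(1) Gr_in] F.cmp_lin_right[OF order_refl assms(1) Gr_in]
  note g = linmapD[OF Gr_lin]
  show ?thesis unfolding Bd_def
  proof (subst CC.lext_pure[OF vector_space_fscl])
    show "bilin (scl C) (gr C a) (scl C) (gr C b) fscl (i + j)
      (\<lambda>((i, x), (j, y)). fscl (- ksign i) (cmp F a (i - 1) b (j - 1) 1 (Gr a i x) (Gr b j y)))"
      by (rule bilinI; unfold prod.case; rule linmap_fun_fscl; rule linmapI) (simp_all add: g)
  qed (simp add: assms)
qed

lemma Bd_in:
  assumes a: "1 \<le> a" and u: "u \<in> tgr C a C b d"
  shows "Bd a b u \<in> gr F (a + b - 1) (d - 2)"
  using u
proof (induction rule: CC.tgr_induct)
  case zero then show ?case using F.gr_zero by simp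
next
  case (pure i x j y)
  have "cmp F a (i - 1) b (j - 1) 1 (Gr a i x) (Gr b j y) \<in> gr F (a + b - 1) (i - 1 + (j - 1))"
    using pure a by (intro F.cmp_in Gr_in) auto
  moreover have "i - 1 + (j - 1) = d - 2" using pure by auto
  ultimately show ?case using pure a F.gr_scl[of _ "a + b - 1" "d - 2" "- ksign i"]
    by (simp only: Bd_pure F_simps(1))
next
  case (add v w) then show ?case using F.gr_add by simp
next
  case (scale c v) then show ?case using F.gr_scl[of _ "a + b - 1" "d - 2" c] by (simp add: F_simps(1))
qed

lemma Bd_tact:
  assumes a: "1 \<le> a" and u: "u \<in> tgr C a C b d" and p: "\<alpha> permutes {1..a}" "\<alpha> 1 = 1" "\<beta> permutes {1..b}"
  shows "Bd a b (tact C a b \<alpha> \<beta> u) = act F (a + b - 1) (d - 2) (perm_cmp a b 1 \<alpha> \<beta>) (Bd a b u)"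
proof (rule CC.tgr_ext1[OF u])
  fix i x j y assume h: "x \<in> gr C a i" "y \<in> gr C b j" "i + j = d"
  have e: "i - 1 + (j - 1) = d - 2" using h by auto
  show "Bd a b (tact C a b \<alpha> \<beta> (pure C a C b i x j y)) = act F (a + b - 1) (d - 2) (perm_cmp a b 1 \<alpha> \<beta>) (Bd a b (pure C a C b i x j y))"
    using F.equi[OF Gr_in[OF h(1)] Gr_in[OF h(2)] order_refl a p(1,3)] h a p
    by (simp add: tact_pure Bd_pure act_in Gr_act e)
qed (simp_all add: additive_hom_def)

text \<open>One summand of d_2, written for an arbitrary permutation: composing an unshuffle with a
  further permutation in general no longer gives an unshuffle.\<close>

definition Tm :: "nat \<Rightarrow> int \<Rightarrow> nat \<Rightarrow> (nat \<Rightarrow> nat) \<Rightarrow> 'c \<Rightarrow> ('c oterm \<Rightarrow>\<^sub>0 'k)" where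
  "Tm n d a \<sigma> c = act F n (d - 1) \<sigma> (Bd a (n + 1 - a) (dec C a (n + 1 - a) 1 (d + 1) (act C n (d + 1) (inv \<sigma>) c)))"

lemma dec_lin': "a \<in> {1..n + 1} \<Longrightarrow> linmap (scl C) fscl (gr C n d) (tgr C a C (n + 1 - a) d) (dec C a (n + 1 - a) 1 d)"
  using dec_lin[of a "n + 1 - a" d] by simp

lemma Tm_linmap:
  assumes a: "a \<in> {1..n + 1}" and s: "\<sigma> permutes {1..n}"
  shows "linmap (scl C) fscl (gr C n (d + 1)) (gr F n (d - 1)) (Tm n d a \<sigma>)"
proof (rule linmapI)
  have e: "a + (n + 1 - a) - 1 = n" "d + 1 - 2 = d - 1" "1 \<le> a" using a by auto
  note l = linmapD[OF dec_lin'[OF a]] linmapD[OF act_lin[OF permutes_inv[OF s]]]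
  fix x assume x: "x \<in> gr C n (d + 1)"
  show "Tm n d a \<sigma> x \<in> gr F n (d - 1)" unfolding Tm_def
    using Bd_in[OF e(3) l(1)[OF l(4)[OF x]]] s unfolding e by (rule F.act_in)
  show "Tm n d a \<sigma> (scl C c x) = fscl c (Tm n d a \<sigma> x)" for c
    using x by (simp add: Tm_def l)
  fix y assume "y \<in> gr C n (d + 1)"
  then show "Tm n d a \<sigma> (x + y) = Tm n d a \<sigma> x + Tm n d a \<sigma> y" using x by (simp add: Tm_def l)
qed

text \<open>A summand depends on its permutation only through the set of inputs of the inner vertex.
  Two permutations with the same set differ by a block permutation \<rho>; its inverse acts
  separately on the two factors of the decomposition, hence on the composite, where the outer action
  cancels it.\<close>

lemma Tm_block:
  assumes a: "a \<in> {1..n + 1}" and s: "\<sigma> permutes {1..n}" and p: "\<pi> permutes {1..n}"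
    and blk: "\<And>x. x \<in> {1..n} \<Longrightarrow> \<sigma> x \<le> n + 1 - a \<longleftrightarrow> \<pi> x \<le> n + 1 - a"
    and c: "c \<in> gr C n (d + 1)"
  shows "Tm n d a \<pi> c = Tm n d a \<sigma> c"
proof -
  let ?b = "n + 1 - a"
  have e: "a + ?b - 1 = n" "d + 1 - 2 = d - 1" "1 \<le> a" using a by auto
  define \<rho> where "\<rho> = \<pi> \<circ> inv \<sigma>"
  have rp: "\<rho> permutes {1..n}" unfolding \<rho>_def by (intro permutes_compose permutes_inv s p)
  have rb: "\<rho> x \<le> ?b \<longleftrightarrow> x \<le> ?b" if "x \<in> {1..n}" for x
  proof -
    have "inv \<sigma> x \<in> {1..n}" using permutes_in_image[OF permutes_inv[OF s]] that by blast
    then show ?thesis using blk[of "inv \<sigma> x"] permutes_inverses(1)[OF s, of x] by (simp add: \<rho>_def)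
  qed
  have irb: "inv \<rho> x \<le> ?b \<longleftrightarrow> x \<le> ?b" if "x \<in> {1..a + ?b - 1}" for x
  proof -
    have "inv \<rho> x \<in> {1..n}" using permutes_in_image[OF permutes_inv[OF rp]] that e by simp
    then show ?thesis using rb[of "inv \<rho> x"] permutes_inverses(1)[OF rp, of x] by simp
  qed
  \<comment> \<open>The inverse of \<rho> is decomposed into blocks because \<open>Tm\<close> acts
    on \<open>c\<close> by the inverse of its permutation.\<close>
  obtain \<alpha> \<beta> where ab: "\<alpha> permutes {1..a}" "\<alpha> 1 = 1" "\<beta> permutes {1..?b}" "perm_cmp a ?b 1 \<alpha> \<beta> = inv \<rho>"
    using block_perm_decomp[OF e(3), of "inv \<rho>" ?b] permutes_inv[OF rp] irb unfolding e(1) by blast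
  have pr: "\<pi> = \<rho> \<circ> \<sigma>" unfolding \<rho>_def comp_assoc permutes_inv_o(2)[OF s] by simp
  have ip: "inv \<pi> = inv \<sigma> \<circ> inv \<rho>" unfolding pr
    by (rule o_inv_distrib[OF permutes_bij[OF rp] permutes_bij[OF s]])
  define z where "z = act C n (d + 1) (inv \<sigma>) c"
  have z: "z \<in> gr C n (d + 1)" unfolding z_def by (intro act_in c permutes_inv s)
  have "act C n (d + 1) (inv \<pi>) c = act C n (d + 1) (inv \<rho>) z"
    unfolding z_def ip using act_act[OF c permutes_inv[OF s] permutes_inv[OF rp]] by simp
  then have "dec C a ?b 1 (d + 1) (act C n (d + 1) (inv \<pi>) c) = tact C a ?b \<alpha> \<beta> (dec C a ?b 1 (d + 1) z)"
    using dec_act[OF e(3), of z ?b "d + 1" \<alpha> \<beta>] z ab unfolding e(1) by simp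
  moreover have "dec C a ?b 1 (d + 1) z \<in> tgr C a C ?b (d + 1)" by (rule linmapD(1)[OF dec_lin'[OF a] z])
  moreover note Bd_in[OF e(3) this]
  ultimately have B: "Bd a ?b (dec C a ?b 1 (d + 1) (act C n (d + 1) (inv \<pi>) c)) = act F n (d - 1) (inv \<rho>) (Bd a ?b (dec C a ?b 1 (d + 1) z))"
    and Bi: "Bd a ?b (dec C a ?b 1 (d + 1) z) \<in> gr F n (d - 1)"
    using Bd_tact[OF e(3), of "dec C a ?b 1 (d + 1) z" ?b "d + 1" \<alpha> \<beta>] ab unfolding e by simp_all
  have "Tm n d a \<pi> c = act F n (d - 1) (\<rho> \<circ> \<sigma>) (act F n (d - 1) (inv \<rho>) (Bd a ?b (dec C a ?b 1 (d + 1) z)))"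
    unfolding Tm_def B pr[symmetric] ..
  also have "\<dots> = act F n (d - 1) \<sigma> (Bd a ?b (dec C a ?b 1 (d + 1) z))"
    using F.act_act[OF F.act_in[OF Bi permutes_inv[OF rp]] rp s] F.act_inv(2)[OF Bi rp] by simp
  finally show ?thesis by (simp add: Tm_def z_def)
qed

definition d2 :: "nat \<Rightarrow> int \<Rightarrow> 'c \<Rightarrow> ('c oterm \<Rightarrow>\<^sub>0 'k)" where
  "d2 n d c = (\<Sum>a\<in>{1..n + 1}. \<Sum>S\<in>{S. S \<subseteq> {1..n} \<and> card S = n + 1 - a}. Tm n d a (unshuffle n S) c)"

lemma d2_linmap: "linmap (scl C) fscl (gr C n (d + 1)) (gr F n (d - 1)) (d2 n d)"
proof (rule linmapI)
  note l = linmapD[OF Tm_linmap[OF _ unshuffle_permutes]]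
  fix x assume x: "x \<in> gr C n (d + 1)"
  show "d2 n d x \<in> gr F n (d - 1)" unfolding d2_def using x by (intro F.gr_sum l(1)) auto
  show "d2 n d (scl C c x) = fscl c (d2 n d x)" for c
    unfolding d2_def fs.scale_sum_right using x by (intro sum.cong l(3)) auto
  fix y assume y: "y \<in> gr C n (d + 1)"
  show "d2 n d (x + y) = d2 n d x + d2 n d y" 
    unfolding d2_def sum.distrib[symmetric] using x y by (intro sum.cong l(2)) auto
qed

text \<open>The unshuffle of \<open>S\<close> followed on the right by the inverse of \<tau> sends
  exactly \<open>\<tau>\<close>
  S\<open>to the first block. By\<close>Tm_block\<open>the summand of\<close>S\<open>for the
  translated element is therefore the translate of the summand of\<close>\<tau> \<open>S\<close>,
  and \<tau> permutes the subsets of each size.\<close>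

lemma d2_act:
  assumes c: "c \<in> gr C n (d + 1)" and t: "\<tau> permutes {1..n}"
  shows "d2 n d (act C n (d + 1) \<tau> c) = act F n (d - 1) \<tau> (d2 n d c)"
proof -
  have eq: "Tm n d a (unshuffle n S) (act C n (d + 1) \<tau> c) = act F n (d - 1) \<tau> (Tm n d a (unshuffle n (\<tau> ` S)) c)"
    if a: "a \<in> {1..n + 1}" and S: "S \<subseteq> {1..n}" "card S = n + 1 - a" for a S
  proof -
    let ?u = "unshuffle n S"
    let ?b = "n + 1 - a"
    have e: "a + ?b - 1 = n" "d + 1 - 2 = d - 1" "1 \<le> a" using a by auto
    have u: "?u permutes {1..n}" by (rule unshuffle_permutes[OF S(1)])
    define \<pi> where "\<pi> = ?u \<circ> inv \<tau>"
    have pp: "\<pi> permutes {1..n}" unfolding \<pi>_def by (intro permutes_compose permutes_inv u t)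
    have ip: "inv \<pi> = \<tau> \<circ> inv ?u" unfolding \<pi>_def
      using o_inv_distrib[OF permutes_bij[OF u] permutes_bij[OF permutes_inv[OF t]]] permutes_inv_inv[OF t] by simp
    have up: "?u = \<pi> \<circ> \<tau>" unfolding \<pi>_def comp_assoc permutes_inv_o(2)[OF t] by simp
    have tS: "\<tau> ` S \<subseteq> {1..n}" "card (\<tau> ` S) = n + 1 - a"
      using permutes_image[OF t] S card_image[OF inj_on_subset[OF permutes_inj[OF t]], of S] by auto
    have 1: "act C n (d + 1) (inv ?u) (act C n (d + 1) \<tau> c) = act C n (d + 1) (inv \<pi>) c"
      unfolding ip by (rule act_act[OF c t permutes_inv[OF u]])
    let ?B = "Bd a ?b (dec C a ?b 1 (d + 1) (act C n (d + 1) (inv \<pi>) c))"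
    have Bi: "?B \<in> gr F n (d - 1)"
      using Bd_in[OF e(3) linmapD(1)[OF dec_lin'[OF a] act_in[OF c permutes_inv[OF pp]]]] unfolding e .
    have "Tm n d a ?u (act C n (d + 1) \<tau> c) = act F n (d - 1) \<tau> (Tm n d a \<pi> c)"
      unfolding Tm_def 1 unfolding up using F.act_act[OF Bi pp t] by simp
    also have "Tm n d a \<pi> c = Tm n d a (unshuffle n (\<tau> ` S)) c"
    proof (rule Tm_block[OF a unshuffle_permutes[OF tS(1)] pp _ c])
      fix x assume x: "x \<in> {1..n}"
      have ix: "inv \<tau> x \<in> {1..n}" using permutes_in_image[OF permutes_inv[OF t]] x by blast
      have "x \<in> \<tau> ` S \<longleftrightarrow> inv \<tau> x \<in> S"
        using permutes_inverses[OF t] by (metis image_iff)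
      then show "unshuffle n (\<tau> ` S) x \<le> n + 1 - a \<longleftrightarrow> \<pi> x \<le> n + 1 - a"
        using unshuffle_le_iff[OF tS(1) x] unshuffle_le_iff[OF S(1) ix] tS S by (simp add: \<pi>_def)
    qed
    finally show ?thesis .
  qed
  have bij: "bij_betw ((`) \<tau>) {S. S \<subseteq> {1..n} \<and> card S = b} {S. S \<subseteq> {1..n} \<and> card S = b}" for b
  proof (rule bij_betw_byWitness[where f' = "(`) (inv \<tau>)"])
    have i: "inj_on \<tau> S" "inj_on (inv \<tau>) S" for S
      using permutes_inj[OF t] permutes_inj[OF permutes_inv[OF t]] by (auto intro: inj_on_subset)
    show "(`) \<tau> ` {S. S \<subseteq> {1..n} \<and> card S = b} \<subseteq> {S. S \<subseteq> {1..n} \<and> card S = b}"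
      using image_mono[of _ "{1..n}" \<tau>] permutes_image[OF t] i by (auto simp: card_image)
    show "(`) (inv \<tau>) ` {S. S \<subseteq> {1..n} \<and> card S = b} \<subseteq> {S. S \<subseteq> {1..n} \<and> card S = b}"
      using image_mono[of _ "{1..n}" "inv \<tau>"] permutes_image[OF permutes_inv[OF t]] i by (auto simp: card_image)
  qed (auto simp: image_image permutes_inverses[OF t])
  show ?thesis
    unfolding d2_def act_F_sum
  proof (rule sum.cong[OF refl])
    fix a assume a: "a \<in> {1..n + 1}"
    let ?X = "{S. S \<subseteq> {1..n} \<and> card S = n + 1 - a}"
    have "(\<Sum>S\<in>?X. Tm n d a (unshuffle n S) (act C n (d + 1) \<tau> c)) = (\<Sum>S\<in>?X. act F n (d - 1) \<tau> (Tm n d a (unshuffle n (\<tau> ` S)) c))"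
      using eq[OF a] by (intro sum.cong) auto
    also have "\<dots> = (\<Sum>S\<in>?X. act F n (d - 1) \<tau> (Tm n d a (unshuffle n S) c))"
      by (rule sum.reindex_bij_betw[OF bij])
    finally show "(\<Sum>S\<in>?X. Tm n d a (unshuffle n S) (act C n (d + 1) \<tau> c)) = (\<Sum>S\<in>?X. act F n (d - 1) \<tau> (Tm n d a (unshuffle n S) c))" .
  qed
qed

text \<open>The passage from the formal sum that defines the cobar differential to classes: every
  key of a decomposition contributes a well-formed term, whose class is the composite of two values
  of \<open>Gr\<close>.\<close>

lemma d2_keys_eq:
  assumes c: "c \<in> gr C n (d + 1)"
  shows "Poly_Mapping.keys (cobar_d2 C n d c) \<subseteq> terms E n (d - 1)" "fcls E n (d - 1) (cobar_d2 C n d c) = d2 n d c"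
proof -
  let ?f = "\<lambda>a \<sigma>. (\<lambda>((i, x), (j, y)).
          fscl (- ksign i) (bas (Prm \<sigma> (Cmp (Gen a (i - 1) (red_part C a i x)) 1 (Gen (n + 1 - a) (j - 1) (red_part C (n + 1 - a) j y))))))"
  let ?u = "\<lambda>a \<sigma>. dec C a (n + 1 - a) 1 (d + 1) (act C n (d + 1) (inv \<sigma>) c)"
  have d2: "cobar_d2 C n d c = (\<Sum>a\<in>{1..n + 1}. \<Sum>S\<in>{S. S \<subseteq> {1..n} \<and> card S = n + 1 - a}. lext fscl (?f a (unshuffle n S)) (?u a (unshuffle n S)))"
    unfolding cobar_d2_def Let_def ..
  have *: "Poly_Mapping.keys (lext fscl (?f a \<sigma>) (?u a \<sigma>)) \<subseteq> terms E n (d - 1) \<and> fcls E n (d - 1) (lext fscl (?f a \<sigma>) (?u a \<sigma>)) = Tm n d a \<sigma> c"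
    if a: "a \<in> {1..n + 1}" and s: "\<sigma> permutes {1..n}" for a \<sigma>
  proof
    let ?b = "n + 1 - a"
    have e: "a + ?b - 1 = n" "1 \<le> a" using a by auto
    have "?u a \<sigma> \<in> tgr C a C ?b (d + 1)"
      by (rule linmapD(1)[OF dec_lin'[OF a] act_in[OF c permutes_inv[OF s]]])
    then have k: "Poly_Mapping.keys (?u a \<sigma>) \<subseteq> tkeys C a C ?b (d + 1)" by (rule CC.tgr_keys)
    have w: "wf_term E (Prm \<sigma> (Cmp (Gen a (i - 1) (red_part C a i x)) 1 (Gen ?b (j - 1) (red_part C ?b j y))))"
      "i - 1 + (j - 1) = d - 1"
      if "x \<in> gr C a i" "y \<in> gr C ?b j" "i + j = d + 1" for i x j y
      using that e s linmapD(1)[OF red_lin] by auto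
    show "Poly_Mapping.keys (lext fscl (?f a \<sigma>) (?u a \<sigma>)) \<subseteq> terms E n (d - 1)"
    proof (rule keys_lextI)
      fix t assume "t \<in> Poly_Mapping.keys (?u a \<sigma>)"
      then have "t \<in> tkeys C a C ?b (d + 1)" using k by blast
      then show "Poly_Mapping.keys (?f a \<sigma> t) \<subseteq> terms E n (d - 1)"
      proof (rule tkeysE)
        fix i x j y assume h: "t = ((i, x), (j, y))" "x \<in> gr C a i" "y \<in> gr C ?b j" "i + j = d + 1"
        show ?thesis unfolding h(1) prod.case
          by (intro keys_fsclI keys_basI) (use w[OF h(2-4)] e in \<open>simp add: terms_iff\<close>)
      qed
    qed
    have "fcls E n (d - 1) (lext fscl (?f a \<sigma>) (?u a \<sigma>)) = lext fscl (\<lambda>t. fcls E n (d - 1) (?f a \<sigma> t)) (?u a \<sigma>)"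
      by (rule FE.fcls_lext)
    also have "\<dots> = lext fscl (\<lambda>t. act F n (d - 1) \<sigma> ((\<lambda>((i, x), (j, y)). fscl (- ksign i) (cmp F a (i - 1) ?b (j - 1) 1 (Gr a i x) (Gr ?b j y))) t)) (?u a \<sigma>)"
    proof (rule lext_cong)
      fix t assume "t \<in> Poly_Mapping.keys (?u a \<sigma>)"
      then have "t \<in> tkeys C a C ?b (d + 1)" using k by blast
      then show "fcls E n (d - 1) (?f a \<sigma> t) = act F n (d - 1) \<sigma> ((\<lambda>((i, x), (j, y)). fscl (- ksign i) (cmp F a (i - 1) ?b (j - 1) 1 (Gr a i x) (Gr ?b j y))) t)"
      proof (rule tkeysE)
        fix i x j y assume h: "t = ((i, x), (j, y))" "x \<in> gr C a i" "y \<in> gr C ?b j" "i + j = d + 1"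
        note w' = w[OF h(2-4)]
        let ?g1 = "Gen a (i - 1) (red_part C a i x)" and ?g2 = "Gen ?b (j - 1) (red_part C ?b j y)"
        have "cmp F a (i - 1) ?b (j - 1) 1 (Gr a i x) (Gr ?b j y) = cls E (Cmp ?g1 1 ?g2)"
          unfolding Gr_def F_eq by (rule FE.cmp_cls) (use w' e in auto)
        moreover have "act F n (d - 1) \<sigma> (cls E (Cmp ?g1 1 ?g2)) = cls E (Prm \<sigma> (Cmp ?g1 1 ?g2))"
          unfolding F_eq by (rule FE.act_cls) (use w' e in auto)
        moreover have "cls E (Prm \<sigma> (Cmp ?g1 1 ?g2)) = fcls E n (d - 1) (bas (Prm \<sigma> (Cmp ?g1 1 ?g2)))"
          unfolding cls_def using w' e by simp
        ultimately show ?thesis unfolding h(1) prod.case by simp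
      qed
    qed
    also have "\<dots> = Tm n d a \<sigma> c"
      unfolding Tm_def Bd_def
      by (rule linear_eq_lext[of "\<lambda>v. act F n (d - 1) \<sigma> (lext fscl _ v)" fscl, symmetric, THEN trans[rotated]])
         (simp_all)
    finally show "fcls E n (d - 1) (lext fscl (?f a \<sigma>) (?u a \<sigma>)) = Tm n d a \<sigma> c" .
  qed
  show "Poly_Mapping.keys (cobar_d2 C n d c) \<subseteq> terms E n (d - 1)"
    unfolding d2 using * unshuffle_permutes by (intro keys_sumI) blast
  show "fcls E n (d - 1) (cobar_d2 C n d c) = d2 n d c"
    unfolding d2 d2_def FE.fcls_linear using * unshuffle_permutes by (intro sum.cong) auto
qed

lemma d1_eq: 
  "fcls E n (d - 1) (cobar_d1 C n d c) = cls E (Gen n (d - 1) (dif E n d c))"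
  "c \<in> gr E n d \<Longrightarrow> Poly_Mapping.keys (cobar_d1 C n d c) \<subseteq> terms E n (d - 1)"
  using linmapD(1)[OF E.dif_lin, of c n d] by (simp_all add: cobar_d1_def cls_def terms_iff)

text \<open>On classes d_1 + d_2 is linear and equivariant, so it extends from generators to a
  derivation of the free operad.\<close>

sublocale FD: free_der E "\<lambda>n d c. cobar_d1 C n d c + cobar_d2 C n d c"
proof
  note k = d2_keys_eq[OF gr_ED]
  have d1l: "linmap (scl C) fscl (gr E n d) (gr F n (d - 1)) (\<lambda>c. cls E (Gen n (d - 1) (dif E n d c)))" for n d
    by (rule linmap_comp[OF _ gen_lin]) (use E.dif_lin in simp)
  fix x n d assume x: "x \<in> gr E n d"
  show "Poly_Mapping.keys (cobar_d1 C n d x + cobar_d2 C n d x) \<subseteq> terms E n (d - 1)"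
    by (intro keys_addI d1_eq k(1) x)
  show "fcls E n (d - 1) (cobar_d1 C n d (scl E c x) + cobar_d2 C n d (scl E c x)) =
     fscl c (fcls E n (d - 1) (cobar_d1 C n d x + cobar_d2 C n d x))" for c
    using x E.gr_scl[OF x, of c] linmapD(3)[OF d2_linmap gr_ED[OF x], of c] linmapD(3)[OF d1l x, of c]
    by (simp add: d1_eq k fs.scale_right_distrib)
  show "fcls E n (d - 1) (cobar_d1 C n d (act E n d \<sigma> x) + cobar_d2 C n d (act E n d \<sigma> x)) =
     fcls E n (d - 1) (fprm \<sigma> (cobar_d1 C n d x + cobar_d2 C n d x))" if s: "\<sigma> permutes {1..n}" for \<sigma>
  proof -
    have "fcls E n (d - 1) (fprm \<sigma> (cobar_d1 C n d x + cobar_d2 C n d x)) =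
      act F n (d - 1) \<sigma> (fcls E n (d - 1) (cobar_d1 C n d x + cobar_d2 C n d x))"
      unfolding F_simps using FE.fcls_prm[OF s] by simp
    also have "\<dots> = act F n (d - 1) \<sigma> (cls E (Gen n (d - 1) (dif E n d x))) + act F n (d - 1) \<sigma> (d2 n d x)"
      using x by (simp add: d1_eq k)
    also have "\<dots> = cls E (Gen n (d - 1) (dif E n d (act E n d \<sigma> x))) + d2 n d (act C n (d + 1) \<sigma> x)"
      using gen_act[OF linmapD(1)[OF E.dif_lin x] s] E.dif_act[OF x s] d2_act[OF gr_ED[OF x] s] by simp
    also have "\<dots> = fcls E n (d - 1) (cobar_d1 C n d (act E n d \<sigma> x) + cobar_d2 C n d (act E n d \<sigma> x))"
      using E.act_in[OF x s] k(2)[of "act E n d \<sigma> x" n d] by (simp add: d1_eq)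
    finally show ?thesis by simp
  qed
  fix y assume y: "y \<in> gr E n d"
  show "fcls E n (d - 1) (cobar_d1 C n d (x + y) + cobar_d2 C n d (x + y)) =
     fcls E n (d - 1) (cobar_d1 C n d x + cobar_d2 C n d x) + fcls E n (d - 1) (cobar_d1 C n d y + cobar_d2 C n d y)"
    using x y E.gr_add[OF x y] linmapD(2)[OF d2_linmap gr_ED[OF x] gr_ED[OF y]] linmapD(2)[OF d1l x y]
    by (simp add: d1_eq k)
qed

lemma predg_cobar: "predg F"
  unfolding F_eq by (rule FD.predg_free)

lemma dif_gen: "c \<in> gr E n d \<Longrightarrow> dif F n d (cls E (Gen n d c)) = cls E (Gen n (d - 1) (- dif C n (d + 1) c)) + d2 n d c"
  unfolding F_eq using FD.dif_cls[of "Gen n d c" n d] by (simp add: FD.Dt_def d1_eq d2_keys_eq[OF gr_ED] del: quasi_free_simps)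

end

section \<open>Dual cooperads\<close>

lemma sum_fun_apply: "(sum f A :: 'a \<Rightarrow> 'b::comm_monoid_add) x = (\<Sum>a\<in>A. f a x)"
  by (induction A rule: infinite_finite_induct) auto

text \<open>If \<alpha> fixes the slot that is expanded, the composite permutation is the product of
  \<beta> on the first block and a translate of \<alpha> on the rest. This form makes its sign
  accessible.\<close>

lemma perm_cmp_block:
  assumes a: "1 \<le> a" and p: "\<alpha> permutes {1..a}" "\<alpha> 1 = 1" "\<beta> permutes {1..b}"
  shows "perm_cmp a b 1 \<alpha> \<beta> = map_permutation {2..a} (\<lambda>x. x + b - 1) \<alpha> \<circ> \<beta>"
proof
  fix x
  let ?f = "\<lambda>x. x + b - 1"
  have inj: "inj_on ?f {2..a}" by (auto simp: inj_on_def)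
  have im: "y \<in> ?f ` {2..a} \<longleftrightarrow> y \<in> {b + 1..a + b - 1}" for y
    by (auto intro!: image_eqI[of _ _ "y + 1 - b"])
  consider "x \<notin> {1..a + b - 1}" | "x \<in> {1..a + b - 1}" "x \<le> b" | "x \<in> {1..a + b - 1}" "b < x" by linarith
  then show "perm_cmp a b 1 \<alpha> \<beta> x = (map_permutation {2..a} ?f \<alpha> \<circ> \<beta>) x"
  proof cases
    case 1
    have "x \<notin> {1..b}" "x \<notin> {b + 1..a + b - 1}" using 1 a by auto
    then have "\<beta> x = x" "x \<notin> ?f ` {2..a}" using permutes_not_in[OF p(3)] im by blast+
    then have "(map_permutation {2..a} ?f \<alpha> \<circ> \<beta>) x = x" by (simp add: map_permutation_def restrict_id_def)
    then show ?thesis using 1 unfolding perm_cmp_def by (simp only: Let_def if_True HOL.simp_thms)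
  next
    case 2
    have "\<beta> x \<in> {1..b}" using permutes_in_image[OF p(3), of x] 2 by auto
    then have "\<beta> x \<notin> ?f ` {2..a}" unfolding im by auto
    then show ?thesis using 2 p(2) unfolding perm_cmp_def by (auto simp: map_permutation_def restrict_id_def)
  next
    case 3
    then have x: "\<beta> x = x" "x = ?f (x + 1 - b)" "x + 1 - b \<in> {2..a}" using permutes_not_in[OF p(3), of x] by auto
    have "map_permutation {2..a} ?f \<alpha> x = ?f (\<alpha> (x + 1 - b))"
    proof -
      have "inv_into {2..a} ?f x = x + 1 - b" using inv_into_f_f[OF inj x(3)] x(2) by simp
      moreover have "x \<in> ?f ` {2..a}" unfolding im using 3 by auto
      ultimately show ?thesis by (simp add: map_permutation_def restrict_id_def)
    qed
    moreover have "1 \<noteq> \<alpha> (x + 1 - b)" using permutes_inj[OF p(1)] p(2) x(3) by (metis Suc_1 atLeastAtMost_iff injD not_less_eq_eq One_nat_def order_refl)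
    moreover have "\<alpha> (x + 1 - b) \<in> {1..a}" using permutes_in_image[OF p(1), of "x + 1 - b"] x(3) by auto
    moreover have "x - b + 1 = x + 1 - b" using 3 by auto
    ultimately show ?thesis using 3 p(2) x(1) unfolding perm_cmp_def by (auto simp: Let_def)
  qed
qed

text \<open>With slot \<open>1\<close> fixed no block moves past another input, so signs simply
  multiply. For End(Ks) this is the equivariance of the composition at the first slot.\<close>

lemma sign_perm_cmp_1:
  assumes a: "1 \<le> a" and p: "\<alpha> permutes {1..a}" "\<alpha> 1 = 1" "\<beta> permutes {1..b}"
  shows "sign (perm_cmp a b 1 \<alpha> \<beta>) = sign \<alpha> * sign \<beta>"
proof -
  let ?f = "\<lambda>x. x + b - 1"
  have inj: "inj_on ?f {2..a}" by (auto simp: inj_on_def)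
  have p2: "\<alpha> permutes {2..a}" by (rule permutes_superset[OF p(1)]) (use p(2) in \<open>auto simp: not_le less_Suc_eq numeral_2_eq_2 One_nat_def\<close>)
  have mp: "permutation (map_permutation {2..a} ?f \<alpha>)"
    by (rule permutes_imp_permutation[of "?f ` {2..a}"])
      (use map_permutation_permutes[of ?f "{2..a}" "?f ` {2..a}" \<alpha>] inj p2 in \<open>auto simp: bij_betw_def\<close>)
  have bp: "permutation \<beta>" by (rule permutes_imp_permutation[OF _ p(3)]) simp
  show ?thesis
    unfolding perm_cmp_block[OF assms] sign_compose[OF mp bp] sign_map_permutation[OF inj p2 finite_atLeastAtMost] ..
qed

section \<open>The arity-wise dual of a dg S-module\<close>

lemma dual_smod_simps [simp]: "scl (dual_smod V) = (\<lambda>c f x. c * f x)"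
  by (simp add: dual_smod_def)

lemma gr_dual: "gr (dual_smod V) n d = {f. linmap (scl V) (*) (gr V n (- d)) UNIV f \<and> (\<forall>x. x \<notin> gr V n (- d) \<longrightarrow> f x = 0)}"
  by (simp add: dual_smod_def)

lemma act_dual: "act (dual_smod V) n d \<sigma> f = (\<lambda>x. if x \<in> gr V n (- d) then f (act V n (- d) (inv \<sigma>) x) else 0)"
  by (simp add: dual_smod_def)

lemma dif_dual: "dif (dual_smod V) n d f = (\<lambda>x. if x \<in> gr V n (1 - d) then - (ksign d * f (dif V n (1 - d) x)) else 0)"
  by (simp add: dual_smod_def)

lemma dual_coop_simps [simp]:
  "scl (dual_coop Q \<epsilon>) = scl (dual_smod Q)" "gr (dual_coop Q \<epsilon>) = gr (dual_smod Q)"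
  "act (dual_coop Q \<epsilon>) = act (dual_smod Q)" "dif (dual_coop Q \<epsilon>) = dif (dual_smod Q)"
  "counit (dual_coop Q \<epsilon>) = (\<lambda>f. f (unt Q))" "coaug (dual_coop Q \<epsilon>) = (\<lambda>x. if x \<in> gr Q 1 0 then \<epsilon> 1 0 x else 0)"
  by (simp_all add: dual_coop_def dgsmod.defs dgcoop.defs dual_smod_def)

lemma tensor_dual_coop [simp]:
  "tgr (dual_coop Q \<epsilon>) a (dual_coop Q' \<epsilon>') b d = tgr (dual_smod Q) a (dual_smod Q') b d"
  "pure (dual_coop Q \<epsilon>) a (dual_coop Q' \<epsilon>') b = pure (dual_smod Q) a (dual_smod Q') b"
  "tact (dual_coop Q \<epsilon>) a b = tact (dual_smod Q) a b"
  unfolding tgr_def pure_def tcls_def tact_def dual_coop_simps by (rule refl)+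

lemma gr_dualI:
  assumes "linmap (scl V) (*) (gr V n (- d)) UNIV f" "\<And>x. x \<notin> gr V n (- d) \<Longrightarrow> f x = 0"
  shows "f \<in> gr (dual_smod V) n d"
  using assms by (simp add: gr_dual)

lemma gr_dualD:
  assumes "f \<in> gr (dual_smod V) n d"
  shows "linmap (scl V) (*) (gr V n (- d)) UNIV f" "x \<notin> gr V n (- d) \<Longrightarrow> f x = 0"
  using assms by (simp_all add: gr_dual)

lemma gvec_dual:
  assumes "gvec V"
  shows "gvec (dual_smod V)"
proof -
  interpret V: gvec V by fact
  have vs: "vector_space (scl (dual_smod V))"
    by unfold_locales (auto simp: fun_eq_iff algebra_simps)
  then interpret D: vector_space "scl (dual_smod V)" .
  show ?thesis unfolding gvec_def
  proof (intro conjI allI vs D.subspaceI)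
    fix n d
    show "0 \<in> gr (dual_smod V) n d" by (auto simp: gr_dual intro: linmapI)
    fix f assume f: "f \<in> gr (dual_smod V) n d"
    note lf = linmapD[OF gr_dualD(1)[OF f]]
    show "scl (dual_smod V) c f \<in> gr (dual_smod V) n d" for c
      by (rule gr_dualI, rule linmapI) (auto simp: lf gr_dualD(2)[OF f] algebra_simps)
    fix g assume g: "g \<in> gr (dual_smod V) n d"
    note lg = linmapD[OF gr_dualD(1)[OF g]]
    show "f + g \<in> gr (dual_smod V) n d"
      by (rule gr_dualI, rule linmapI) (auto simp: lf lg gr_dualD(2)[OF f] gr_dualD(2)[OF g] algebra_simps)
  qed
qed

text \<open>The transpose of a linear map, with a scalar that makes room for a Koszul sign. The
  functional is cut off outside its graded piece, as the definition of \<open>dual_smod\<close>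
  requires.\<close>

lemma dual_pullback:
  assumes "linmap (scl V) (scl W) (gr V n d) (gr W n' d') A" "f \<in> gr (dual_smod W) n' (- d')" "gvec V"
  shows "(\<lambda>x. if x \<in> gr V n d then c * f (A x) else 0) \<in> gr (dual_smod V) n (- d)"
proof -
  interpret V: gvec V by fact
  have f: "linmap (scl W) (*) (gr W n' d') UNIV f" using gr_dualD(1)[OF assms(2)] by simp
  note l = linmapD[OF assms(1)] linmapD[OF f]
  show ?thesis
    by (rule gr_dualI; (rule linmapI)?) (auto simp: l V.gr_add V.gr_scl algebra_simps)
qed

lemma dsmod_dual:
  assumes "dsmod V"
  shows "dsmod (dual_smod V)"
proof -
  interpret V: dsmod V by fact
  interpret D: gvec "dual_smod V" by (rule gvec_dual) unfold_locales
  have gV: "gvec V" by unfold_locales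
  have a: "act (dual_smod V) n d \<sigma> f \<in> gr (dual_smod V) n d" if "f \<in> gr (dual_smod V) n d" "\<sigma> permutes {1..n}" for n d \<sigma> f
    using dual_pullback[OF V.act_lin[OF permutes_inv[OF that(2)]] _ gV, of f "- d" 1] that(1) by (simp add: act_dual cong: if_cong)
  have dd: "dif (dual_smod V) n d f \<in> gr (dual_smod V) n (d - 1)" if "f \<in> gr (dual_smod V) n d" for n d f
    using dual_pullback[OF V.dif_lin _ gV, of f n "1 - d" "- ksign d"] that by (simp add: dif_dual cong: if_cong)
  show ?thesis
  proof unfold_locales
    show "linmap (scl (dual_smod V)) (scl (dual_smod V)) (gr (dual_smod V) n d) (gr (dual_smod V) n d) (act (dual_smod V) n d \<sigma>)"
      if "\<sigma> permutes {1..n}" for \<sigma> and n :: nat and d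
      using a that by (intro linmapI) (auto simp: act_dual fun_eq_iff)
    show "act (dual_smod V) n d id f = f" if "f \<in> gr (dual_smod V) n d" for f and n :: nat and d
      using gr_dualD(2)[OF that] V.act_id by (auto simp: act_dual fun_eq_iff simp del: id_apply)
    show "act (dual_smod V) n d \<tau> (act (dual_smod V) n d \<sigma> f) = act (dual_smod V) n d (\<sigma> \<circ> \<tau>) f"
      if "f \<in> gr (dual_smod V) n d" "\<sigma> permutes {1..n}" "\<tau> permutes {1..n}" for f and n :: nat and d \<sigma> \<tau>
    proof -
      have io: "inv (\<sigma> \<circ> \<tau>) = inv \<tau> \<circ> inv \<sigma>"
        by (rule o_inv_distrib[OF permutes_bij[OF that(2)] permutes_bij[OF that(3)]])
      show ?thesis
        unfolding act_dual io
        using V.act_in[OF _ permutes_inv[OF that(3)]] V.act_act[OF _ permutes_inv[OF that(3)] permutes_inv[OF that(2)]]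
        by (intro ext) (simp only: split: if_split; simp; blast)
    qed
    show "linmap (scl (dual_smod V)) (scl (dual_smod V)) (gr (dual_smod V) n d) (gr (dual_smod V) n (d - 1)) (dif (dual_smod V) n d)" for n d
      using dd by (intro linmapI) (auto simp: dif_dual fun_eq_iff algebra_simps)
    show "dif (dual_smod V) n d (act (dual_smod V) n d \<sigma> f) = act (dual_smod V) n (d - 1) \<sigma> (dif (dual_smod V) n d f)"
      if "f \<in> gr (dual_smod V) n d" "\<sigma> permutes {1..n}" for f and n :: nat and d \<sigma>
    proof -
      have e: "- (d - 1) = 1 - d" "1 - d - 1 = - d" by auto
      show ?thesis
      proof
        fix x
        show "dif (dual_smod V) n d (act (dual_smod V) n d \<sigma> f) x = act (dual_smod V) n (d - 1) \<sigma> (dif (dual_smod V) n d f) x"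
        proof (cases "x \<in> gr V n (1 - d)")
          case True
          have "dif V n (1 - d) x \<in> gr V n (- d)" using linmapD(1)[OF V.dif_lin True] unfolding e .
          moreover have "act V n (1 - d) (inv \<sigma>) x \<in> gr V n (1 - d)" by (rule V.act_in[OF True permutes_inv[OF that(2)]])
          moreover have "dif V n (1 - d) (act V n (1 - d) (inv \<sigma>) x) = act V n (- d) (inv \<sigma>) (dif V n (1 - d) x)"
            using V.dif_act[OF True permutes_inv[OF that(2)]] unfolding e .
          ultimately show ?thesis using True by (simp only: act_dual dif_dual e if_True)
        next
          case False then show ?thesis by (simp only: act_dual dif_dual e if_False)
        qed
      qed
    qed
  qed
qed

section \<open>Homogeneous bases and dual bases\<close>

locale based = gvec Q for Q :: "('k::field, 'q::ab_group_add, 'z) dgsmod_scheme" +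
  fixes m :: "nat \<Rightarrow> nat" and q :: "nat \<Rightarrow> nat \<Rightarrow> 'q" and dg :: "nat \<Rightarrow> nat \<Rightarrow> int"
  assumes basis: "homogeneous_basis Q n (m n) (q n) (dg n)"
begin

abbreviation de :: "nat \<Rightarrow> nat \<Rightarrow> 'q \<Rightarrow> 'k" where
  "de n i \<equiv> dual_elt Q n (m n) (q n) (dg n) i"

lemma basisD:
  shows "inj_on (q n) {i. i < m n \<and> dg n i = d}" "vec.independent (q n ` {i. i < m n \<and> dg n i = d})"
    "vec.span (q n ` {i. i < m n \<and> dg n i = d}) = gr Q n d"
  using basis[of n] unfolding homogeneous_basis_def Let_def by blast+

lemma q_in: "i < m n \<Longrightarrow> dg n i = d \<Longrightarrow> q n i \<in> gr Q n d"
  unfolding basisD(3)[symmetric] by (rule vec.span_base) blast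

lemma de_lin: "linmap (scl Q) (*) (gr Q n (dg n i)) UNIV (de n i)"
  using vec.representation_add[OF basisD(2)[of n "dg n i"]] vec.representation_scale[OF basisD(2)[of n "dg n i"]]
  by (intro linmapI) (auto simp: dual_elt_def basisD(3) gr_add gr_scl)

lemma de_in: "dg n i = - d \<Longrightarrow> de n i \<in> gr (dual_smod Q) n d"
  using de_lin[of n i] by (intro gr_dualI) (auto simp: dual_elt_def)

lemma de_q: "i < m n \<Longrightarrow> k < m n \<Longrightarrow> dg n i = dg n k \<Longrightarrow> de n i (q n k) = (if i = k then 1 else 0)"
  using vec.representation_basis[OF basisD(2)[of n "dg n i"], of "q n k"] inj_onD[OF basisD(1)[of n "dg n i"], of i k]
    q_in[of k n "dg n i"]
  by (auto simp: dual_elt_def)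

lemma expand:
  assumes "x \<in> gr Q n d"
  shows "x = (\<Sum>i<m n. if dg n i = d then scl Q (de n i x) (q n i) else 0)"
proof -
  let ?I = "{i. i < m n \<and> dg n i = d}"
  have "x = (\<Sum>b\<in>q n ` ?I. scl Q (vec.representation (q n ` ?I) x b) b)"
    by (rule vec.sum_representation_eq[symmetric]) (use assms basisD in auto)
  also have "\<dots> = (\<Sum>i\<in>?I. scl Q (vec.representation (q n ` ?I) x (q n i)) (q n i))"
    by (rule sum.reindex_cong[OF basisD(1)]) auto
  also have "\<dots> = (\<Sum>i\<in>?I. scl Q (de n i x) (q n i))"
    by (rule sum.cong) (use assms in \<open>auto simp: dual_elt_def\<close>)
  also have "\<dots> = (\<Sum>i<m n. if dg n i = d then scl Q (de n i x) (q n i) else 0)"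
    by (subst sum.If_cases) (auto intro: sum.cong)
  finally show ?thesis .
qed

lemma lin_expand:
  assumes "linmap (scl Q) t (gr Q n d) UNIV (f :: 'q \<Rightarrow> 'b::ab_group_add)" "x \<in> gr Q n d"
  shows "f x = (\<Sum>i<m n. if dg n i = d then t (de n i x) (f (q n i)) else 0)"
proof -
  have "f x = f (\<Sum>i<m n. if dg n i = d then scl Q (de n i x) (q n i) else 0)"
    using expand[OF assms(2)] by simp
  also have "\<dots> = (\<Sum>i<m n. f (if dg n i = d then scl Q (de n i x) (q n i) else 0))"
    by (rule lin_sum[OF assms(1)]) (auto intro: q_in gr_scl)
  also have "\<dots> = (\<Sum>i<m n. if dg n i = d then t (de n i x) (f (q n i)) else 0)"
    by (rule sum.cong) (auto simp: linmapD(3)[OF assms(1)] q_in lin_zero[OF assms(1)])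
  finally show ?thesis .
qed

lemma dual_expand:
  assumes "f \<in> gr (dual_smod Q) n d"
  shows "f = (\<Sum>i<m n. if dg n i = - d then scl (dual_smod Q) (f (q n i)) (de n i) else 0)"
proof
  fix x
  note f = gr_dualD[OF assms]
  show "f x = (\<Sum>i<m n. if dg n i = - d then scl (dual_smod Q) (f (q n i)) (de n i) else 0) x"
  proof (cases "x \<in> gr Q n (- d)")
    case True
    show ?thesis unfolding sum_fun_apply lin_expand[OF f(1) True]
      by (rule sum.cong) auto
  next
    case False
    then have "(\<Sum>i<m n. (if dg n i = - d then scl (dual_smod Q) (f (q n i)) (de n i) else 0) x) = 0"
      by (intro sum.neutral) (auto simp: dual_elt_def)
    then show ?thesis unfolding sum_fun_apply using f(2)[OF False] by (simp only:)
  qed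
qed

sublocale Dual: gvec "dual_smod Q" by (rule gvec_dual) unfold_locales

lemma dual_lin_expand:
  assumes "linmap (scl (dual_smod Q)) t (gr (dual_smod Q) n d) UNIV (h :: ('q \<Rightarrow> 'k) \<Rightarrow> 'b::ab_group_add)" "f \<in> gr (dual_smod Q) n d"
  shows "h f = (\<Sum>i<m n. if dg n i = - d then t (f (q n i)) (h (de n i)) else 0)"
proof -
  have "h f = h (\<Sum>i<m n. if dg n i = - d then scl (dual_smod Q) (f (q n i)) (de n i) else 0)"
    using dual_expand[OF assms(2)] by simp
  also have "\<dots> = (\<Sum>i<m n. h (if dg n i = - d then scl (dual_smod Q) (f (q n i)) (de n i) else 0))"
    by (rule Dual.lin_sum[OF assms(1)]) (auto simp del: dual_smod_simps intro!: de_in Dual.gr_scl)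
  also have "\<dots> = (\<Sum>i<m n. if dg n i = - d then t (f (q n i)) (h (de n i)) else 0)"
    by (rule sum.cong) (auto simp: linmapD(3)[OF assms(1)] de_in Dual.lin_zero[OF assms(1)] simp del: dual_smod_simps)
  finally show ?thesis .
qed

end

text \<open>What the dual cooperad uses of an operad: only the partial compositions at the first slot, and
  only their equivariance under permutations that fix this slot.\<close>

locale based_op = dsmod Q + based Q m q dg
  for Q :: "('k::field, 'q::ab_group_add) dgop" and m q dg +
  fixes \<epsilon> :: "('q, 'k) fam"
  assumes unt_in: "unt Q \<in> gr Q 1 0" and dif_unt: "dif Q 1 0 (unt Q) = 0"
    and eps_lin: "linmap (scl Q) (*) (gr Q 1 0) UNIV (\<epsilon> 1 0)" and eps_unt: "\<epsilon> 1 0 (unt Q) = 1"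
    and cmp1_lin_right: "1 \<le> a \<Longrightarrow> x \<in> gr Q a i \<Longrightarrow>
      linmap (scl Q) (scl Q) (gr Q b j) (gr Q (a + b - 1) (i + j)) (\<lambda>y. cmp Q a i b j 1 x y)"
    and cmp1_lin_left: "1 \<le> a \<Longrightarrow> y \<in> gr Q b j \<Longrightarrow>
      linmap (scl Q) (scl Q) (gr Q a i) (gr Q (a + b - 1) (i + j)) (\<lambda>x. cmp Q a i b j 1 x y)"
    and cmp1_equi: "1 \<le> a \<Longrightarrow> x \<in> gr Q a i \<Longrightarrow> y \<in> gr Q b j \<Longrightarrow> \<alpha> permutes {1..a} \<Longrightarrow> \<alpha> 1 = 1 \<Longrightarrow> \<beta> permutes {1..b} \<Longrightarrow>
      cmp Q a i b j 1 (act Q a i \<alpha> x) (act Q b j \<beta> y) =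
      act Q (a + b - 1) (i + j) (perm_cmp a b 1 \<alpha> \<beta>) (cmp Q a i b j 1 x y)"
begin

abbreviation "D \<equiv> dual_smod Q"

sublocale DD: dsmod D by (rule dsmod_dual) unfold_locales
sublocale T: tensor D D by unfold_locales

lemma cmp1_in: "1 \<le> a \<Longrightarrow> x \<in> gr Q a i \<Longrightarrow> y \<in> gr Q b j \<Longrightarrow> cmp Q a i b j 1 x y \<in> gr Q (a + b - 1) (i + j)"
  using linmapD(1)[OF cmp1_lin_right] .

lemma tpair_linear [simp]:
  "tpair j x k y (v + w) = tpair j x k y v + tpair j x k y w"
  "tpair j x k y (fscl c v) = c * tpair j x k y v" "tpair j x k y 0 = 0"
  "tpair j x k y (sum f A) = (\<Sum>a\<in>A. tpair j x k y (f a))"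
  by (simp_all add: tpair_def)

lemma tpair_pure:
  "tpair j x k y (pure D a D b i f i' g) = (if i = - j \<and> i' = - k then ksign (i' * j) * f x * g y else 0)"
  if "f \<in> gr D a i" "g \<in> gr D b i'"
  unfolding tpair_def
  by (subst T.lext_pure[OF vector_space_times], rule bilinI) (use that in \<open>auto intro!: linmapI simp: algebra_simps\<close>)

text \<open>The coefficient of a tensor at a pair of dual basis elements is its pairing with the
  corresponding basis elements, corrected by the Koszul sign of the pairing. In particular the
  pairings determine the tensor.\<close>

lemma tens_expand:
  assumes "t \<in> tgr D a D b e"
  shows "t = (\<Sum>j<m a. \<Sum>k<m b. if dg a j + dg b k = - e then
    fscl (ksign (dg a j * dg b k) * tpair (dg a j) (q a j) (dg b k) (q b k) t)
      (pure D a D b (- dg a j) (de a j) (- dg b k) (de b k)) else 0)"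
proof (rule T.tgr_ext1[OF assms, where f = "\<lambda>t. t"])
  fix i f i' g assume f: "f \<in> gr D a i" and g: "g \<in> gr D b i'" and e: "i + i' = e"
  have "pure D a D b i f i' g = (\<Sum>j<m a. if dg a j = - i then fscl (f (q a j)) (pure D a D b i (de a j) i' g) else 0)"
    by (rule dual_lin_expand[OF T.pure_lin_left[OF g] f])
  also have "\<dots> = (\<Sum>j<m a. if dg a j = - i then fscl (f (q a j)) (\<Sum>k<m b. if dg b k = - i' then fscl (g (q b k)) (pure D a D b i (de a j) i' (de b k)) else 0) else 0)"
    by (intro sum.cong refl if_cong arg_cong[of _ _ "fscl _"] dual_lin_expand[OF T.pure_lin_right g] de_in)
  also have "\<dots> = (\<Sum>j<m a. \<Sum>k<m b. if dg a j = - i \<and> dg b k = - i' then fscl (f (q a j) * g (q b k)) (pure D a D b i (de a j) i' (de b k)) else 0)"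
    by (intro sum.cong refl) (auto simp: fs.scale_sum_right intro!: sum.cong)
  also have "\<dots> = (\<Sum>j<m a. \<Sum>k<m b. if dg a j + dg b k = - e then
    fscl (ksign (dg a j * dg b k) * tpair (dg a j) (q a j) (dg b k) (q b k) (pure D a D b i f i' g))
      (pure D a D b (- dg a j) (de a j) (- dg b k) (de b k)) else 0)"
    by (intro sum.cong refl) (use e in \<open>auto simp: tpair_pure[OF f g] ksign_def mult.commute\<close>)
  finally show "pure D a D b i f i' g = \<dots>" .
next
  show "additive_hom (\<lambda>t. t :: (_ \<Rightarrow>\<^sub>0 'k))" by (simp add: additive_hom_def)
  show "additive_hom (\<lambda>t. \<Sum>j<m a. \<Sum>k<m b. if dg a j + dg b k = - e then
    fscl (ksign (dg a j * dg b k) * tpair (dg a j) (q a j) (dg b k) (q b k) t)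
      (pure D a D b (- dg a j) (de a j) (- dg b k) (de b k)) else 0)"
    unfolding additive_hom_def
  proof (intro conjI allI)
    show "(\<Sum>j<m a. \<Sum>k<m b. if dg a j + dg b k = - e then
      fscl (ksign (dg a j * dg b k) * tpair (dg a j) (q a j) (dg b k) (q b k) 0)
        (pure D a D b (- dg a j) (de a j) (- dg b k) (de b k)) else 0) = 0"
      by (intro sum.neutral ballI) simp
  qed (auto simp: sum.distrib[symmetric] fs.scale_sum_right algebra_simps fs.scale_left_distrib intro!: sum.cong)
qed

lemma tens_eqI:
  assumes "t \<in> tgr D a D b e" "t' \<in> tgr D a D b e"
    "\<And>j k x y. x \<in> gr Q a j \<Longrightarrow> y \<in> gr Q b k \<Longrightarrow> j + k = - e \<Longrightarrow> tpair j x k y t = tpair j x k y t'"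
  shows "t = t'"
proof -
  let ?X = "\<lambda>t. \<Sum>j<m a. \<Sum>k<m b. if dg a j + dg b k = - e then
    fscl (ksign (dg a j * dg b k) * tpair (dg a j) (q a j) (dg b k) (q b k) t)
      (pure D a D b (- dg a j) (de a j) (- dg b k) (de b k)) else 0"
  have "?X t = ?X t'"
    by (intro sum.cong refl if_cong arg_cong2[of _ _ _ _ fscl] arg_cong[of _ _ "(*) _"] assms(3)) (auto intro: q_in)
  with tens_expand[OF assms(1)] have "t = ?X t'" by (rule trans)
  from this tens_expand[OF assms(2), symmetric] show ?thesis by (rule trans)
qed

text \<open>A candidate for the tensor that \<open>dual_coop\<close> specifies through its pairings;
  the coefficients are those forced by \<open>tens_expand\<close>.\<close>

definition decf :: "nat \<Rightarrow> nat \<Rightarrow> int \<Rightarrow> ('q \<Rightarrow> 'k) \<Rightarrow> (('q \<Rightarrow> 'k, 'q \<Rightarrow> 'k) tkey \<Rightarrow>\<^sub>0 'k)" where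
  "decf a b e g = (\<Sum>j<m a. \<Sum>k<m b. if dg a j + dg b k = - e then
    fscl (ksign (dg a j * dg b k) * g (cmp Q a (dg a j) b (dg b k) 1 (q a j) (q b k)))
      (pure D a D b (- dg a j) (de a j) (- dg b k) (de b k)) else 0)"

lemma decf_in: "decf a b e g \<in> tgr D a D b e"
  unfolding decf_def
  by (intro fs.subspace_sum[OF T.tgr_subspace]) (auto intro!: fs.subspace_scale[OF T.tgr_subspace] fs.subspace_0[OF T.tgr_subspace] T.pure_in de_in)

lemma tpair_decf:
  assumes a: "1 \<le> a" and f: "f \<in> gr D (a + b - 1) e" and x: "x \<in> gr Q a j" and y: "y \<in> gr Q b k" and e: "j + k = - e"
  shows "tpair j x k y (decf a b e f) = f (cmp Q a j b k 1 x y)"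
proof -
  have f': "linmap (scl Q) (*) (gr Q (a + b - 1) (j + k)) UNIV f" using gr_dualD(1)[OF f] e by simp
  note l1 = linmap_comp[OF cmp1_lin_left[OF a] f'] and l2 = linmap_comp[OF cmp1_lin_right[OF a] f']
  have "f (cmp Q a j b k 1 x y) = (\<Sum>j'<m a. if dg a j' = j then de a j' x * f (cmp Q a j b k 1 (q a j') y) else 0)"
    by (rule lin_expand[OF l1[OF y] x])
  also have "\<dots> = (\<Sum>j'<m a. if dg a j' = j then de a j' x * (\<Sum>k'<m b. if dg b k' = k then de b k' y * f (cmp Q a j b k 1 (q a j') (q b k')) else 0) else 0)"
    by (intro sum.cong refl if_cong arg_cong[of _ _ "(*) _"] lin_expand[OF l2 y] q_in) auto
  also have "\<dots> = (\<Sum>j'<m a. \<Sum>k'<m b. if dg a j' = j \<and> dg b k' = k then de a j' x * de b k' y * f (cmp Q a j b k 1 (q a j') (q b k')) else 0)"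
    by (intro sum.cong refl) (auto simp: sum_distrib_left intro!: sum.cong)
  also have "\<dots> = tpair j x k y (decf a b e f)"
    unfolding decf_def tpair_linear
    by (intro sum.cong refl) (use e in \<open>auto simp: tpair_pure de_in ksign_def mult.commute\<close>)
  finally show ?thesis by simp
qed

text \<open>The definite description is legitimate: \<open>decf\<close> has the required pairings,
  and pairings separate tensors by \<open>tens_eqI\<close>. Finiteness of the basis enters through
  the finite sums.\<close>

lemma dec_dual:
  assumes a: "1 \<le> a" and f: "f \<in> gr D (a + b - 1) e"
  shows "dec (dual_coop Q \<epsilon>) a b 1 e f = decf a b e f"
proof -
  have "(THE t. t \<in> tgr D a D b e \<and>
        (\<forall>j k. \<forall>x\<in>gr Q a j. \<forall>y\<in>gr Q b k. j + k = - e \<longrightarrow> tpair j x k y t = f (cmp Q a j b k 1 x y))) = decf a b e f"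
    by (rule the_equality) (use tpair_decf[OF a f] decf_in in \<open>auto intro: tens_eqI\<close>)
  then show ?thesis by (simp add: dual_coop_def dgsmod.defs dgcoop.defs)
qed

lemma precoop_dual: "precoop (dual_coop Q \<epsilon>)"
proof -
  let ?C = "dual_coop Q \<epsilon>"
  interpret C: dsmod ?C
    by (rule dsmod_cong[OF DD.dsmod_axioms]) simp_all
  show ?thesis
  proof unfold_locales
    show "linmap (scl ?C) (*) (gr ?C 1 0) UNIV (counit ?C)" by (rule linmapI) simp_all
    show "counit ?C (dif ?C 1 1 f) = 0" if "f \<in> gr ?C 1 1" for f
    proof -
      have f: "linmap (scl Q) (*) (gr Q 1 (-1)) UNIV f" using that by (simp add: gr_dual)
      show ?thesis using lin_zero[OF f] by (simp add: dif_dual dif_unt)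
    qed
    show "coaug ?C \<in> gr ?C 1 0"
      unfolding dual_coop_simps
      by (rule gr_dualI, rule linmapI) (auto simp: linmapD[OF eps_lin] gr_add gr_scl)
    show "counit ?C (coaug ?C) = 1" by (simp add: unt_in eps_unt)
  next
    fix a b d assume a: "(1::nat) \<le> a"
    show "linmap (scl ?C) fscl (gr ?C (a + b - 1) d) (tgr ?C a ?C b d) (dec ?C a b 1 d)"
    proof (rule linmapI)
      fix f assume f: "f \<in> gr ?C (a + b - 1) d"
      then show "dec ?C a b 1 d f \<in> tgr ?C a ?C b d" using a by (simp add: dec_dual decf_in)
      show "dec ?C a b 1 d (scl ?C c f) = fscl c (dec ?C a b 1 d f)" for c
        using f a C.gr_scl[OF f, of c]
        by (simp add: dec_dual) (auto simp: decf_def fs.scale_sum_right algebra_simps intro!: sum.cong)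
      fix g assume g: "g \<in> gr ?C (a + b - 1) d"
      then show "dec ?C a b 1 d (f + g) = dec ?C a b 1 d f + dec ?C a b 1 d g"
        using f a C.gr_add[OF f g]
        by (simp add: dec_dual) (auto simp: decf_def sum.distrib[symmetric] algebra_simps fs.scale_left_distrib intro!: sum.cong)
    qed
    fix f and \<alpha> \<beta> :: "nat \<Rightarrow> nat"
    assume f: "f \<in> gr ?C (a + b - 1) d" and p: "\<alpha> permutes {1..a}" "\<alpha> 1 = 1" "\<beta> permutes {1..b}"
    let ?p = "perm_cmp a b 1 \<alpha> \<beta>"
    have pp: "?p permutes {1..a + b - 1}" by (rule perm_cmp_permutes[OF order_refl a p(1,3)])
    have f': "f \<in> gr D (a + b - 1) d" using f by simp
    have af: "act D (a + b - 1) d ?p f \<in> gr D (a + b - 1) d" by (rule DD.act_in[OF f' pp])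
    have tin: "tact D a b \<alpha> \<beta> t \<in> tgr D a D b d" if "t \<in> tgr D a D b d" for t
      using that
      by (induction rule: T.tgr_induct)
        (auto simp: DD.tact_pure p intro!: T.pure_in DD.act_in p fs.subspace_scale[OF T.tgr_subspace] fs.subspace_add[OF T.tgr_subspace] fs.subspace_0[OF T.tgr_subspace])
    \<comment> \<open>Under the pairing the action on tensors of functionals becomes the inverse
      action on the arguments.\<close>
    have tp: "tpair j x k y (tact D a b \<alpha> \<beta> t) = tpair j (act Q a j (inv \<alpha>) x) k (act Q b k (inv \<beta>) y) t"
      if x: "x \<in> gr Q a j" "y \<in> gr Q b k" and t: "t \<in> tgr D a D b d" for j k x y t
      using t
    proof (induction rule: T.tgr_induct)
      case (pure i g i' h)
      have "act D a i \<alpha> g x = g (act Q a j (inv \<alpha>) x)" if "i = - j"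
        using x that by (simp add: act_dual)
      moreover have "act D b i' \<beta> h y = h (act Q b k (inv \<beta>) y)" if "i' = - k"
        using x that by (simp add: act_dual)
      ultimately show ?case using pure p by (simp add: DD.tact_pure tpair_pure DD.act_in)
    qed simp_all
    have "act D (a + b - 1) d ?p f (cmp Q a j b k 1 x y) = f (cmp Q a j b k 1 (act Q a j (inv \<alpha>) x) (act Q b k (inv \<beta>) y))"
      if x: "x \<in> gr Q a j" and y: "y \<in> gr Q b k" and e: "j + k = - d" for j k x y
    proof -
      let ?x = "act Q a j (inv \<alpha>) x" and ?y = "act Q b k (inv \<beta>) y"
      have xy: "?x \<in> gr Q a j" "?y \<in> gr Q b k" using x y p by (auto intro!: act_in permutes_inv)
      note z = cmp1_in[OF a xy]
      \<comment> \<open>Equivariance applied to the arguments moved back by the inverse permutations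
        exhibits \<open>?p\<close> in front of the composite, where it cancels the inverse in the
        dual action.\<close>
      have "cmp Q a j b k 1 x y = act Q (a + b - 1) (j + k) ?p (cmp Q a j b k 1 ?x ?y)"
        using cmp1_equi[OF a xy p] act_inv(2)[OF x p(1)] act_inv(2)[OF y p(3)] by simp
      then have "act Q (a + b - 1) (j + k) (inv ?p) (cmp Q a j b k 1 x y) = cmp Q a j b k 1 ?x ?y"
        using act_inv(1)[OF z pp] by simp
      then show ?thesis using cmp1_in[OF a x y] e by (simp add: act_dual)
    qed
    then have "decf a b d (act D (a + b - 1) d ?p f) = tact D a b \<alpha> \<beta> (decf a b d f)"
      by (intro tens_eqI[OF decf_in tin[OF decf_in]])
        (simp add: tp[OF _ _ decf_in] tpair_decf[OF a af] tpair_decf[OF a f'] act_in permutes_inv p)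
    then show "dec ?C a b 1 d (act ?C (a + b - 1) d ?p f) = tact ?C a b \<alpha> \<beta> (dec ?C a b 1 d f)"
      using dec_dual[OF a af] dec_dual[OF a f'] by simp
  qed
qed

end

section \<open>Hadamard products of cooperads\<close>

lemma tensor_had_coop [simp]:
  "tgr (had_coop C D) a (had_coop C' D') b d = tgr (had_smod C D) a (had_smod C' D') b d"
  "pure (had_coop C D) a (had_coop C' D') b = pure (had_smod C D) a (had_smod C' D') b"
  "tact (had_coop C D) a b = tact (had_smod C D) a b"
  unfolding tgr_def pure_def tcls_def tact_def had_coop_simps had_smod_simps by (rule refl)+

definition had_dmul ::
  "('k::field, 'a::ab_group_add) dgcoop \<Rightarrow> ('k, 'b::ab_group_add) dgcoop \<Rightarrow> nat \<Rightarrow> nat \<Rightarrow>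
   ('a, 'a) tkey \<Rightarrow> ('b, 'b) tkey \<Rightarrow> ((('a, 'b) tkey \<Rightarrow>\<^sub>0 'k, ('a, 'b) tkey \<Rightarrow>\<^sub>0 'k) tkey \<Rightarrow>\<^sub>0 'k)" where
  "had_dmul C D a b = (\<lambda>((i', x'), (i'', x'')) ((j', y'), (j'', y'')).
     fscl (ksign (i'' * j'))
                (pure (had_smod C D) a (had_smod C D) b
                  (i' + j') (pure C a D a i' x' j' y') (i'' + j'') (pure C b D b i'' x'' j'' y'')))"

text \<open>The interchange of the two middle factors in the tensor product of \<open>C(a)\<close>,
  \<open>C(b)\<close>, \<open>D(a)\<close> and \<open>D(b)\<close>, with its Koszul sign. The
  decomposition of a Hadamard product is this map applied to the two decompositions.\<close>

definition dmix ::
  "('k::field, 'a::ab_group_add) dgcoop \<Rightarrow> ('k, 'b::ab_group_add) dgcoop \<Rightarrow> nat \<Rightarrow> nat \<Rightarrow>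
   (('a, 'a) tkey \<Rightarrow>\<^sub>0 'k) \<Rightarrow> (('b, 'b) tkey \<Rightarrow>\<^sub>0 'k) \<Rightarrow> ((('a, 'b) tkey \<Rightarrow>\<^sub>0 'k, ('a, 'b) tkey \<Rightarrow>\<^sub>0 'k) tkey \<Rightarrow>\<^sub>0 'k)" where
  "dmix C D a b u w = lext fscl (\<lambda>t. lext fscl (had_dmul C D a b t) w) u"

lemma dmix_linear [simp]:
  "dmix C D a b (u + u') w = dmix C D a b u w + dmix C D a b u' w" "dmix C D a b (fscl c u) w = fscl c (dmix C D a b u w)"
  "dmix C D a b 0 w = 0" "dmix C D a b u (w + w') = dmix C D a b u w + dmix C D a b u w'"
  "dmix C D a b u (fscl c w) = fscl c (dmix C D a b u w)" "dmix C D a b u 0 = 0"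
  by (simp_all add: dmix_def)

lemma had_dec: "dec (had_coop C D) a b k d v = lext fscl (\<lambda>((i, x), (j, y)). dmix C D a b (dec C a b k i x) (dec D a b k j y)) v"
  by (simp add: had_coop_def dgsmod.defs dgcoop.defs had_smod_def dmix_def had_dmul_def split_def)

lemma had_counit: "counit (had_coop C D) = lext (*) (\<lambda>((i, x), (j, y)). if i = 0 \<and> j = 0 then counit C x * counit D y else 0)"
  by (simp add: had_coop_def dgsmod.defs dgcoop.defs had_smod_def)

locale had_precoop = C: precoop C + D: precoop D
  for C :: "('k::field, 'a::ab_group_add) dgcoop" and D :: "('k, 'b::ab_group_add) dgcoop"
begin

abbreviation "H \<equiv> had_smod C D"

sublocale H: dsmod H by (rule dsmod_had) unfold_locales
sublocale CD: tensor C D by unfold_locales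
sublocale HH: tensor H H by unfold_locales

lemma had_counit_pure:
  assumes "x \<in> gr C 1 i" "y \<in> gr D 1 j"
  shows "counit (had_coop C D) (pure C 1 D 1 i x j y) = (if i = 0 \<and> j = 0 then counit C x * counit D y else 0)"
  unfolding had_counit
  by (subst CD.lext_pure[OF vector_space_times], rule bilinI)
    (use assms in \<open>auto intro!: linmapI simp: linmapD[OF C.counit_lin] linmapD[OF D.counit_lin] algebra_simps\<close>)

lemma pure_lin_had:
  "y \<in> gr D n j \<Longrightarrow> linmap (scl C) (scl H) (gr C n i) (gr H n (i + j)) (\<lambda>x. pure C n D n i x j y)"
  "x \<in> gr C n i \<Longrightarrow> linmap (scl D) (scl H) (gr D n j) (gr H n (i + j)) (\<lambda>y. pure C n D n i x j y)"
  using CD.pure_lin_left CD.pure_lin_right by (auto simp: linmap_def intro: CD.pure_in)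

lemma dmix_pure:
  assumes "x' \<in> gr C a i'" "x'' \<in> gr C b i''" "y' \<in> gr D a j'" "y'' \<in> gr D b j''"
  shows "dmix C D a b (pure C a C b i' x' i'' x'') (pure D a D b j' y' j'' y'') =
    fscl (ksign (i'' * j')) (pure H a H b (i' + j') (pure C a D a i' x' j' y') (i'' + j'') (pure C b D b i'' x'' j'' y''))"
proof -
  have p: "pure C n D n i x j y \<in> tgr C n D n (i + j)" if "x \<in> gr C n i" "y \<in> gr D n j" for n i x j y
    using that by (intro CD.pure_in) auto
  have "lext fscl (\<lambda>t. lext fscl (had_dmul C D a b t) (pure D a D b j' y' j'' y'')) (pure C a C b i' x' i'' x'') =
      had_dmul C D a b ((i', x'), (i'', x'')) ((j', y'), (j'', y''))"
  proof (rule lext2_pure[OF _ _ vector_space_fscl assms])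
    fix t' assume "t' \<in> tkeys D a D b (j' + j'')"
    then show "bilin (scl C) (gr C a) (scl C) (gr C b) fscl (i' + i'') (\<lambda>t. had_dmul C D a b t t')"
      by (elim tkeysE) (auto intro!: bilinI linmap_fun_fscl HH.pure_lin_left' HH.pure_lin_right' pure_lin_had p simp: had_dmul_def simp del: had_smod_simps(1))
  next
    fix t assume "t \<in> tkeys C a C b (i' + i'')"
    then show "bilin (scl D) (gr D a) (scl D) (gr D b) fscl (j' + j'') (had_dmul C D a b t)"
      by (elim tkeysE) (auto intro!: bilinI linmap_fun_fscl HH.pure_lin_left' HH.pure_lin_right' pure_lin_had p simp: had_dmul_def simp del: had_smod_simps(1))
  qed unfold_locales
  then show ?thesis by (simp add: dmix_def had_dmul_def)
qed

lemma dmix_in: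
  assumes u: "u \<in> tgr C a C b i" and w: "w \<in> tgr D a D b j"
  shows "dmix C D a b u w \<in> tgr H a H b (i + j)"
  using u
proof (induction rule: C.CC.tgr_induct)
  case (pure i' x' i'' x'')
  note uh = pure
  show ?case using w
  proof (induction rule: D.CC.tgr_induct)
    case (pure j' y' j'' y'')
    have "pure H a H b (i' + j') (pure C a D a i' x' j' y') (i'' + j'') (pure C b D b i'' x'' j'' y'') \<in> tgr H a H b (i + j)"
      using uh pure by (intro HH.pure_in) (auto intro: CD.pure_in)
    then show ?case using uh pure by (simp add: dmix_pure fs.subspace_scale[OF HH.tgr_subspace])
  qed (simp_all add: fs.subspace_scale[OF HH.tgr_subspace] fs.subspace_add[OF HH.tgr_subspace] fs.subspace_0[OF HH.tgr_subspace])
qed (simp_all add: fs.subspace_scale[OF HH.tgr_subspace] fs.subspace_add[OF HH.tgr_subspace] fs.subspace_0[OF HH.tgr_subspace])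

text \<open>The block permutations act in the same way on the factors of \<open>C\<close> and of
  \<open>D\<close>, so rearranging the factors commutes with the action. This is the equivariance of
  the decomposition for Hadamard products.\<close>

lemma dmix_tact:
  assumes u: "u \<in> tgr C a C b i" and w: "w \<in> tgr D a D b j" and p: "\<alpha> permutes {1..a}" "\<beta> permutes {1..b}"
  shows "dmix C D a b (tact C a b \<alpha> \<beta> u) (tact D a b \<alpha> \<beta> w) = tact H a b \<alpha> \<beta> (dmix C D a b u w)"
  using u
proof (induction rule: C.CC.tgr_induct)
  case (pure i' x' i'' x'')
  note uh = pure
  show ?case using w
  proof (induction rule: D.CC.tgr_induct)
    case (pure j' y' j'' y'')
    have "pure C a D a i' x' j' y' \<in> gr H a (i' + j')" "pure C b D b i'' x'' j'' y'' \<in> gr H b (i'' + j'')"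
      using uh pure by (auto intro: CD.pure_in)
    then show ?case using uh pure p
      by (simp only: dmix_pure C.tact_pure D.tact_pure H.tact_pure C.act_in D.act_in tact_linear
        had_act_pure[OF C.smod_axioms D.smod_axioms])
  qed simp_all
qed simp_all

lemma had_dec_pure:
  assumes a: "1 \<le> a" and x: "x \<in> gr C (a + b - 1) i" and y: "y \<in> gr D (a + b - 1) j"
  shows "dec (had_coop C D) a b 1 d (pure C (a + b - 1) D (a + b - 1) i x j y) = dmix C D a b (dec C a b 1 i x) (dec D a b 1 j y)"
  unfolding had_dec
  by (subst CD.lext_pure[OF vector_space_fscl], rule bilinI)
    (auto intro!: linmapI simp: linmapD[OF C.dec_lin[OF a]] linmapD[OF D.dec_lin[OF a]])

lemma precoop_had: "precoop (had_coop C D)"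
proof -
  let ?C = "had_coop C D"
  interpret S: dsmod ?C
    by (rule dsmod_cong[OF H.dsmod_axioms]) simp_all
  have dec_in: "dec ?C a b 1 d v \<in> tgr H a H b d" if a: "1 \<le> a" and v: "v \<in> tgr C (a + b - 1) D (a + b - 1) d" for a b d v
    using v
  proof (induction rule: CD.tgr_induct)
    case (pure i x j y)
    then show ?case
      using dmix_in[OF linmapD(1)[OF C.dec_lin[OF a] pure(1)] linmapD(1)[OF D.dec_lin[OF a] pure(2)]] had_dec_pure[OF a pure(1,2)] by simp
  qed (simp_all add: had_dec fs.subspace_scale[OF HH.tgr_subspace] fs.subspace_add[OF HH.tgr_subspace] fs.subspace_0[OF HH.tgr_subspace])
  show ?thesis
  proof unfold_locales
    show "linmap (scl ?C) (*) (gr ?C 1 0) UNIV (counit ?C)" by (rule linmapI) (simp_all add: had_counit)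
    show "counit ?C (dif ?C 1 1 v) = 0" if "v \<in> gr ?C 1 1" for v
    proof -
      have "v \<in> tgr C 1 D 1 1" using that by simp
      then have "counit ?C (dif H 1 1 v) = 0"
      proof (induction rule: CD.tgr_induct)
        case (pure i x j y)
        then show ?case using linmapD(1)[OF C.dif_lin pure(1)] linmapD(1)[OF D.dif_lin pure(2)] C.counit_dif[of x] D.counit_dif[of y]
          unfolding had_dif_pure[OF C.dsmod_axioms D.dsmod_axioms pure(1,2)]
          by (simp add: had_counit_pure[unfolded had_counit] had_counit) auto
      qed (simp_all add: had_counit lext_zero)
      then show ?thesis by simp
    qed
    show "coaug ?C \<in> gr ?C 1 0" by (simp add: CD.pure_in C.coaug_in D.coaug_in)
    show "counit ?C (coaug ?C) = 1"
      by (simp add: had_counit_pure C.coaug_in D.coaug_in C.counit_coaug D.counit_coaug)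
  next
    fix a b d assume a: "(1::nat) \<le> a"
    show "linmap (scl ?C) fscl (gr ?C (a + b - 1) d) (tgr ?C a ?C b d) (dec ?C a b 1 d)"
      using dec_in[OF a] by (intro linmapI) (simp_all add: had_dec)
    fix v and \<alpha> \<beta> :: "nat \<Rightarrow> nat"
    assume v: "v \<in> gr ?C (a + b - 1) d" and p: "\<alpha> permutes {1..a}" "\<alpha> 1 = 1" "\<beta> permutes {1..b}"
    let ?p = "perm_cmp a b 1 \<alpha> \<beta>"
    have pp: "?p permutes {1..a + b - 1}" by (rule perm_cmp_permutes[OF order_refl a p(1,3)])
    have v': "v \<in> tgr C (a + b - 1) D (a + b - 1) d" using v by simp
    have "dec ?C a b 1 d (act H (a + b - 1) d ?p v) = tact H a b \<alpha> \<beta> (dec ?C a b 1 d v)"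
    proof (rule CD.tgr_ext1[OF v'])
      fix i x j y assume h: "x \<in> gr C (a + b - 1) i" "y \<in> gr D (a + b - 1) j"
      show "dec ?C a b 1 d (act H (a + b - 1) d ?p (pure C (a + b - 1) D (a + b - 1) i x j y)) =
          tact H a b \<alpha> \<beta> (dec ?C a b 1 d (pure C (a + b - 1) D (a + b - 1) i x j y))"
        unfolding had_act_pure[OF C.smod_axioms D.smod_axioms h pp] had_dec_pure[OF a h]
          had_dec_pure[OF a C.act_in[OF h(1) pp] D.act_in[OF h(2) pp]] C.dec_act[OF a h(1) p] D.dec_act[OF a h(2) p]
        by (rule dmix_tact[OF linmapD(1)[OF C.dec_lin[OF a] h(1)] linmapD(1)[OF D.dec_lin[OF a] h(2)] p(1,3)])
    qed (simp_all add: additive_hom_def had_dec)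
    then show "dec ?C a b 1 d (act ?C (a + b - 1) d ?p v) = tact ?C a b \<alpha> \<beta> (dec ?C a b 1 d v)" by simp
  qed
qed

end

section \<open>The cooperads of the statement\<close>

lemma Com_simps [simp]: "scl Com = (*)" "gr Com = (\<lambda>n d. if 1 \<le> n \<and> d = 0 then UNIV else {0})" "dif Com = (\<lambda>n d x. 0)"
  "act Com = (\<lambda>n d \<sigma> x. x)" "unt Com = 1" "cmp Com = (\<lambda>m a n b i x y. x * y)"
  by (simp_all add: Com_def)

lemma End_s_simps [simp]: "scl End_s = (*)" "gr End_s = (\<lambda>n d. if d = 1 - int n then UNIV else {0})" "dif End_s = (\<lambda>n d x. 0)"
  "act End_s = (\<lambda>n d \<sigma> x. of_int (sign \<sigma>) * x)" "unt End_s = 1"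
  "cmp End_s = (\<lambda>m a n b i x y. ksign ((1 - int n) * (int i - 1)) * x * y)"
  by (simp_all add: End_s_def)

interpretation kv: vector_space "(*) :: 'k::field \<Rightarrow> 'k \<Rightarrow> 'k"
  by (rule vector_space_times)

lemma kv_indep: "\<not> module.dependent ((*) :: 'k::field \<Rightarrow> 'k \<Rightarrow> 'k) {1}"
  by (simp add: kv.dependent_single)

lemma kv_span: "module.span ((*) :: 'k::field \<Rightarrow> 'k \<Rightarrow> 'k) {1} = UNIV"
  by (auto simp: kv.span_singleton)

lemma kv_subspace: "module.subspace ((*) :: 'k::field \<Rightarrow> 'k \<Rightarrow> 'k) (if b then UNIV else {0})"
  by (simp add: kv.subspace_def)

text \<open>The basis consists of \<open>1\<close> in degree zero in each positive arity and is
  empty in arity zero, whence the case distinction in the number of basis elements.\<close>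

lemma based_op_Com: "based_op (Com :: ('k::field, 'k) dgop) (\<lambda>n. if 1 \<le> n then 1 else 0) (\<lambda>n i. 1) (\<lambda>n i. 0) std_aug"
proof -
  let ?C = "Com :: ('k, 'k) dgop"
  have g: "gvec ?C" unfolding gvec_def by (simp add: vector_space_times kv_subspace)
  have s: "smod ?C" by (rule smod.intro[OF g], unfold_locales) (auto intro: linmapI)
  have d: "dsmod ?C" by (rule dsmod.intro[OF s], unfold_locales) (auto intro: linmapI)
  have "homogeneous_basis ?C n (if 1 \<le> n then 1 else 0) (\<lambda>i. 1) (\<lambda>i. 0)" for n
    unfolding homogeneous_basis_def Let_def
  proof
    fix d :: int
    let ?I = "{i :: nat. i < (if 1 \<le> n then 1 else 0) \<and> 0 = d}"
    have I: "?I = (if 1 \<le> n \<and> d = 0 then {0} else {})" by auto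
    show "inj_on (\<lambda>i. 1 :: 'k) ?I \<and> \<not> module.dependent (scl ?C) ((\<lambda>i. 1) ` ?I) \<and>
        module.span (scl ?C) ((\<lambda>i. 1) ` ?I) = gr ?C n d"
      unfolding I by (cases "1 \<le> n \<and> d = 0") (auto simp: kv_indep kv_span kv.independent_empty simp del: kv.dependent_single)
  qed
  then have b: "based ?C (\<lambda>n. if 1 \<le> n then 1 else 0) (\<lambda>n i. 1) (\<lambda>n i. 0)"
    by (intro based.intro g) unfold_locales
  show ?thesis
  proof (intro based_op.intro d b, unfold_locales)
    show "linmap (scl ?C) (*) (gr ?C 1 0) UNIV (std_aug 1 0)"
      by (simp add: linmap_def std_aug_def)
    show "linmap (scl ?C) (scl ?C) (gr ?C b j) (gr ?C (a + b - 1) (i + j)) (\<lambda>y. cmp ?C a i b j 1 x y)"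
      if "1 \<le> a" "x \<in> gr ?C a i" for a b i j x
      using that by (cases "i = 0"; cases "1 \<le> b \<and> j = 0") (auto simp: linmap_def distrib_left)
    show "linmap (scl ?C) (scl ?C) (gr ?C a i) (gr ?C (a + b - 1) (i + j)) (\<lambda>x. cmp ?C a i b j 1 x y)"
      if "1 \<le> a" "y \<in> gr ?C b j" for a b i j y
      using that by (cases "i = 0"; cases "1 \<le> b \<and> j = 0") (auto simp: linmap_def distrib_right)
  qed (simp_all add: std_aug_def)
qed

text \<open>Arity zero is included here, with a generator of degree one. At the first slot the
  composition sign is trivial, so equivariance reduces to \<open>sign_perm_cmp_1\<close>.\<close>

lemma based_op_End_s: "based_op (End_s :: ('k::field, 'k) dgop) (\<lambda>n. 1) (\<lambda>n i. 1) (\<lambda>n i. 1 - int n) std_aug"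
proof -
  let ?C = "End_s :: ('k, 'k) dgop"
  have g: "gvec ?C" unfolding gvec_def by (simp add: vector_space_times kv_subspace)
  have sg: "sign (\<sigma> \<circ> \<tau>) = sign \<sigma> * sign \<tau>" if "\<sigma> permutes {1..n}" "\<tau> permutes {1..n}" for \<sigma> \<tau> and n :: nat
    using that by (intro sign_compose) (auto intro: permutes_imp_permutation[OF finite_atLeastAtMost])
  have s: "smod ?C"
  proof (rule smod.intro[OF g], unfold_locales)
    show "act ?C n d id x = x" for n d x by (simp only: End_s_simps sign_id of_int_1 mult_1_left)
    show "act ?C n d \<tau> (act ?C n d \<sigma> x) = act ?C n d (\<sigma> \<circ> \<tau>) x"
      if "\<sigma> permutes {1..n}" "\<tau> permutes {1..n}" for n d x \<sigma> \<tau>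
      unfolding End_s_simps sg[OF that] of_int_mult by (simp only: mult.assoc mult.left_commute)
    show "linmap (scl ?C) (scl ?C) (gr ?C n d) (gr ?C n d) (act ?C n d \<sigma>)" for n :: nat and d \<sigma>
      unfolding End_s_simps
      by (cases "d = 1 - int n") (simp_all add: linmap_def distrib_left mult.left_commute)
  qed
  have d: "dsmod ?C" by (rule dsmod.intro[OF s], unfold_locales) (auto intro: linmapI)
  have "homogeneous_basis ?C n 1 (\<lambda>i. 1) (\<lambda>i. 1 - int n)" for n
    unfolding homogeneous_basis_def Let_def
  proof
    fix d :: int
    let ?I = "{i :: nat. i < 1 \<and> 1 - int n = d}"
    have I: "?I = (if d = 1 - int n then {0} else {})" by auto
    show "inj_on (\<lambda>i. 1 :: 'k) ?I \<and> \<not> module.dependent (scl ?C) ((\<lambda>i. 1) ` ?I) \<and>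
        module.span (scl ?C) ((\<lambda>i. 1) ` ?I) = gr ?C n d"
      unfolding I by (cases "d = 1 - int n") (auto simp: kv_indep kv_span kv.independent_empty simp del: kv.dependent_single)
  qed
  then have b: "based ?C (\<lambda>n. 1) (\<lambda>n i. 1) (\<lambda>n i. 1 - int n)"
    by (intro based.intro g) unfold_locales
  show ?thesis
  proof (intro based_op.intro d b, unfold_locales)
    show "cmp ?C a i b j 1 (act ?C a i \<alpha> x) (act ?C b j \<beta> y) =
      act ?C (a + b - 1) (i + j) (perm_cmp a b 1 \<alpha> \<beta>) (cmp ?C a i b j 1 x y)"
      if "1 \<le> a" "\<alpha> permutes {1..a}" "\<alpha> 1 = 1" "\<beta> permutes {1..b}" for a i b j x y \<alpha> \<beta>
      unfolding End_s_simps sign_perm_cmp_1[OF that] of_int_mult by (simp only: ac_simps)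
    show "linmap (scl ?C) (*) (gr ?C 1 0) UNIV (std_aug 1 0)"
      by (simp add: linmap_def std_aug_def)
    have deg: "i = 1 - int a \<Longrightarrow> j = 1 - int b \<Longrightarrow> i + j = 1 - int (a + b - 1)" if "1 \<le> a" for a b i j
      using that by auto
    show "linmap (scl ?C) (scl ?C) (gr ?C b j) (gr ?C (a + b - 1) (i + j)) (\<lambda>y. cmp ?C a i b j 1 x y)"
      if "1 \<le> a" "x \<in> gr ?C a i" for a b i j x
      using that deg[of a i j b] unfolding End_s_simps
      by (cases "i = 1 - int a"; cases "j = 1 - int b") (simp_all add: linmap_def distrib_left)
    show "linmap (scl ?C) (scl ?C) (gr ?C a i) (gr ?C (a + b - 1) (i + j)) (\<lambda>x. cmp ?C a i b j 1 x y)"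
      if "1 \<le> a" "y \<in> gr ?C b j" for a b i j y
      using that deg[of a i j b] unfolding End_s_simps
      by (cases "i = 1 - int a"; cases "j = 1 - int b") (simp_all add: linmap_def distrib_right)
  qed (simp_all add: std_aug_def)
qed

interpretation Es: based_op "End_s :: ('k::field, 'k) dgop" "\<lambda>n. 1" "\<lambda>n i. 1" "\<lambda>n i. 1 - int n" std_aug
  by (rule based_op_End_s)

lemma precoop_susp: "precoop (susp_coop :: ('k::field, 'k \<Rightarrow> 'k) dgcoop)"
  unfolding susp_coop_def by (rule Es.precoop_dual)

lemma susp_in: "susp_elt n \<in> gr susp_coop n (int n - 1)"
  unfolding susp_coop_def dual_coop_simps
  by (rule gr_dualI) (simp_all add: linmap_def susp_elt_def distrib_left mult.left_commute)

lemma gr_susp: "f \<in> gr susp_coop n d \<Longrightarrow> f = (\<lambda>x. if d = int n - 1 then f 1 * x else 0)"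
proof
  fix x assume "f \<in> gr susp_coop n d"
  then have f: "f \<in> gr (dual_smod End_s) n d" by (simp add: susp_coop_def)
  have l: "linmap (*) (*) (gr End_s n (- d)) UNIV f" using gr_dualD(1)[OF f] by simp
  show "f x = (if d = int n - 1 then f 1 * x else 0)"
  proof (cases "d = int n - 1")
    case True
    then show ?thesis using linmapD(3)[OF l, of 1 x] by simp
  next
    case False
    have "f 0 = 0" using Es.lin_zero[of "(*)" n "- d" UNIV f] l by simp
    moreover have "f x = 0" if "x \<noteq> 0" using gr_dualD(2)[OF f, of x] that False by auto
    ultimately show ?thesis using False by auto
  qed
qed

lemma susp_act: "\<sigma> permutes {1..n} \<Longrightarrow> act susp_coop n (int n - 1) \<sigma> (susp_elt n) = scl susp_coop (of_int (sign \<sigma>)) (susp_elt n)"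
  using sign_inverse[OF permutes_imp_permutation[OF finite_atLeastAtMost, of \<sigma> 1 n]]
  by (simp add: susp_coop_def act_dual susp_elt_def fun_eq_iff mult.left_commute)

lemma susp_dif: "dif susp_coop n (int n - 1) (susp_elt n) = 0"
  by (simp add: susp_coop_def dif_dual susp_elt_def fun_eq_iff)

lemma susp_coaug: "coaug susp_coop = susp_elt 1"
  by (simp add: susp_coop_def susp_elt_def std_aug_def fun_eq_iff)

lemma tensor_susp_coop [simp]:
  "tgr susp_coop a susp_coop b d = tgr (dual_smod End_s) a (dual_smod End_s) b d"
  "pure susp_coop a susp_coop b = pure (dual_smod End_s) a (dual_smod End_s) b"
  unfolding susp_coop_def by simp_all

text \<open>For n = a + b - 1 one has n(n-1)/2 = (a-1)(b-1) + a(a-1)/2 + b(b-1)/2. This identity is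
  the reason for the normalization of S_n^{-1}.\<close>

lemma ksign_triangle:
  assumes "1 \<le> a"
  shows "ksign (int ((a + b - 1) * (a + b - 1 - 1) div 2)) =
    (ksign ((int a - 1) * (int b - 1)) * (ksign (int (a * (a - 1) div 2)) * ksign (int (b * (b - 1) div 2))) :: 'k::field)"
proof -
  \<comment> \<open>The identity of exponents is verified after doubling, where the division
    disappears; natural subtraction at \<open>x = 0\<close> is harmless because the product is
    zero.\<close>
  have t: "2 * int (x * (x - 1) div 2) = int x * (int x - 1)" for x
  proof -
    have "even (x * (x - 1))" by (cases x) auto
    then have "2 * (x * (x - 1) div 2) = x * (x - 1)" by simp
    then have "2 * int (x * (x - 1) div 2) = int (x * (x - 1))" by (metis of_nat_mult of_nat_numeral)
    then show ?thesis by (cases x) (simp_all add: algebra_simps)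
  qed
  have n: "int (a + b - 1) = int a + int b - 1" using assms by simp
  have "2 * int ((a + b - 1) * (a + b - 1 - 1) div 2) =
    2 * ((int a - 1) * (int b - 1) + (int (a * (a - 1) div 2) + int (b * (b - 1) div 2)))"
    unfolding distrib_left t n by (simp add: algebra_simps)
  then have "int ((a + b - 1) * (a + b - 1 - 1) div 2) =
    (int a - 1) * (int b - 1) + (int (a * (a - 1) div 2) + int (b * (b - 1) div 2))"
    by (rule mult_left_cancel[THEN iffD1, rotated]) simp
  then show ?thesis by (simp only: ksign_add)
qed

text \<open>The Koszul sign (-1)^((a-1)(b-1)) of the pairing is exactly absorbed by the
  normalization, by \<open>ksign_triangle\<close>; the decomposition of S_n^{-1} carries no
  sign.\<close>

lemma susp_dec:
  assumes a: "1 \<le> a" and n: "n = a + b - 1"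
  shows "dec susp_coop a b 1 (int n - 1) (susp_elt n :: 'k::field \<Rightarrow> 'k) =
    pure susp_coop a susp_coop b (int a - 1) (susp_elt a) (int b - 1) (susp_elt b)"
proof -
  have n1: "int n = int a + int b - 1" using n a by simp
  let ?c = "\<lambda>x. ksign (int (x * (x - 1) div 2)) :: 'k"
  have de: "Es.de x 0 = (\<lambda>y. y :: 'k)" for x
  proof
    fix y :: 'k
    have "Es.de x 0 (y * 1) = y * Es.de x 0 (1 :: 'k)" by (rule linmapD(3)[OF Es.de_lin[of x 0], simplified]) 
    moreover have "Es.de x 0 (1 :: 'k) = 1" by (simp add: Es.de_q[of 0 0 x, simplified])
    ultimately show "Es.de x 0 y = y" by simp
  qed
  have di: "Es.de x 0 \<in> gr (dual_smod End_s) x (int x - 1)" for x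
    by (rule Es.de_in) simp
  have se: "susp_elt x = scl (dual_smod End_s) (?c x) (Es.de x 0)" for x
    unfolding de by (simp add: susp_elt_def fun_eq_iff)
  have p: "pure (dual_smod End_s) a (dual_smod End_s) b (int a - 1) (susp_elt a) (int b - 1) (susp_elt b)
    = fscl (?c a * ?c b) (pure (dual_smod End_s) a (dual_smod End_s) b (int a - 1) (Es.de a 0) (int b - 1) (Es.de b 0))"
    unfolding se by (simp only: Es.T.pure_scl Es.Dual.gr_scl di fs.scale_scale mult.commute[of "?c b"])
  have "susp_elt n \<in> gr (dual_smod (End_s :: ('k, 'k) dgop)) (a + b - 1) (int n - 1)"
    using susp_in[of n] n by (simp add: susp_coop_def)
  from Es.dec_dual[OF a this] have "dec susp_coop a b 1 (int n - 1) (susp_elt n :: 'k \<Rightarrow> 'k) = Es.decf a b (int n - 1) (susp_elt n)"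
    unfolding susp_coop_def .
  also have "\<dots> = fscl (ksign ((1 - int a) * (1 - int b)) * ?c n)
      (pure (dual_smod End_s) a (dual_smod End_s) b (int a - 1) (Es.de a 0) (int b - 1) (Es.de b 0))"
    unfolding Es.decf_def using n1 by (simp add: susp_elt_def lessThan_Suc One_nat_def)
  also have "ksign ((1 - int a) * (1 - int b)) * ?c n = ?c a * ?c b"
  proof -
    have "(1 - int a) * (1 - int b) = (int a - 1) * (int b - 1)" by (simp add: algebra_simps)
    then show ?thesis unfolding n ksign_triangle[OF a] by (simp add: mult.assoc[symmetric])
  qed
  finally show ?thesis unfolding p[symmetric] by simp
qed

section \<open>The suspended dual cooperad and its desuspended generators\<close>

context based_op
begin

abbreviation "SQ \<equiv> susp_dual Q \<epsilon>"
abbreviation "DQ \<equiv> dual_coop Q \<epsilon>"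

lemma had_precoop_SQ: "had_precoop susp_coop DQ"
  by (intro had_precoop.intro precoop_susp precoop_dual)

sublocale HP: had_precoop susp_coop DQ by (rule had_precoop_SQ)

lemma precoop_SQ: "precoop SQ"
  unfolding susp_dual_def by (rule HP.precoop_had)

sublocale SD: precoop SQ by (rule precoop_SQ)

abbreviation "W \<equiv> cobar SQ"

definition U :: "nat \<Rightarrow> int \<Rightarrow> ('q \<Rightarrow> 'k) \<Rightarrow> ('k, 'q) suspdual" where
  "U n e f = pure susp_coop n DQ n (int n - 1) (susp_elt n) e f"

lemma SQ_simps: "scl SQ = fscl" "gr SQ n d = tgr susp_coop n DQ n d" "act SQ = act HP.H" "dif SQ = dif HP.H"
  by (simp_all add: susp_dual_def)

lemma U_lin: "linmap (scl D) (scl SQ) (gr D n e) (gr SQ n (int n - 1 + e)) (U n e)"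
  unfolding SQ_simps U_def
  using HP.pure_lin_had(2)[OF susp_in[of n], where j = e] by simp

lemma U_in: "f \<in> gr D n e \<Longrightarrow> U n e f \<in> gr SQ n (int n - 1 + e)"
  by (rule linmapD(1)[OF U_lin])

lemma U_act:
  assumes "f \<in> gr D n e" "\<sigma> permutes {1..n}"
  shows "act SQ n d \<sigma> (U n e f) = fscl (of_int (sign \<sigma>)) (U n e (act D n e \<sigma> f))"
proof -
  have f: "f \<in> gr DQ n e" using assms(1) by simp
  have af: "act DQ n e \<sigma> f \<in> gr DQ n e" by (rule HP.D.act_in[OF f assms(2)])
  show ?thesis
    unfolding SQ_simps U_def had_act_pure[OF HP.C.smod_axioms HP.D.smod_axioms susp_in f assms(2)]
      susp_act[OF assms(2)] HP.CD.pure_scl(1)[OF susp_in af] by simp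
qed

lemma U_dif:
  assumes "f \<in> gr D n e"
  shows "dif SQ n d (U n e f) = fscl (ksign (int n - 1)) (U n (e - 1) (dif D n e f))"
proof -
  have f: "f \<in> gr DQ n e" using assms by simp
  have z: "pure susp_coop n DQ n (int n - 1 - 1) 0 e f = 0"
    using HP.C.lin_zero[OF HP.CD.pure_lin_left[OF f]] .
  show ?thesis
    unfolding SQ_simps U_def had_dif_pure[OF HP.C.dsmod_axioms HP.D.dsmod_axioms susp_in f] susp_dif z by simp
qed

lemma U_coaug: "U 1 0 (coaug DQ) = coaug SQ"
  unfolding U_def susp_dual_def had_coop_simps susp_coaug by simp

lemma U_counit: "f \<in> gr D 1 0 \<Longrightarrow> counit SQ (U 1 0 f) = f (unt Q)"
  using HP.had_counit_pure[OF susp_in[of 1], of f 0] by (simp add: U_def susp_dual_def susp_coop_def susp_elt_def)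

text \<open>The element s^{-1} S_n^{-1} f, reduced along the coaugmentation where this is necessary:
  in arity one \<open>f\<close> may lie outside the coideal. In all other arities it coincides with
  \<open>susp_gen\<close>.\<close>

definition \<Gamma> :: "nat \<Rightarrow> int \<Rightarrow> ('q \<Rightarrow> 'k) \<Rightarrow> (('k, 'q) suspdual oterm \<Rightarrow>\<^sub>0 'k)" where
  "\<Gamma> n e f = SD.Gr n (int n - 1 + e) (U n e f)"

lemma \<Gamma>_lin: "linmap (scl D) fscl (gr D n e) (gr W n (int n - 2 + e)) (\<Gamma> n e)"
proof -
  have e: "int n - 1 + e - 1 = int n - 2 + e" by simp
  show ?thesis using linmap_comp[OF U_lin SD.Gr_lin, of n e] unfolding \<Gamma>_def[abs_def] e .
qed

lemma \<Gamma>_in: "f \<in> gr D n e \<Longrightarrow> \<Gamma> n e f \<in> gr W n (int n - 2 + e)"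
  by (rule linmapD(1)[OF \<Gamma>_lin])

lemma \<Gamma>_act:
  assumes "f \<in> gr D n e" "\<sigma> permutes {1..n}"
  shows "act W n (int n - 2 + e) \<sigma> (\<Gamma> n e f) = fscl (of_int (sign \<sigma>)) (\<Gamma> n e (act D n e \<sigma> f))"
proof -
  have e: "int n - 1 + e - 1 = int n - 2 + e" by simp
  have "act W n (int n - 2 + e) \<sigma> (\<Gamma> n e f) = SD.Gr n (int n - 1 + e) (act SQ n (int n - 1 + e) \<sigma> (U n e f))"
    using SD.Gr_act[OF U_in[OF assms(1)] assms(2)] unfolding e \<Gamma>_def .
  also have "\<dots> = fscl (of_int (sign \<sigma>)) (\<Gamma> n e (act D n e \<sigma> f))"
    unfolding U_act[OF assms] \<Gamma>_def
    using linmapD(3)[OF SD.Gr_lin U_in[OF DD.act_in[OF assms]], of "of_int (sign \<sigma>)"] by (simp only: SQ_simps)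
  finally show ?thesis .
qed

text \<open>S_1^{-1} times the coaugmentation is the coaugmentation of the Hadamard product, whose
  reduced part is zero. Hence units contribute nothing to the composites in d_2.\<close>

lemma \<Gamma>_coaug: "\<Gamma> 1 0 (coaug DQ) = 0"
proof -
  have "red_part SQ 1 0 (coaug SQ) = 0"
    by (simp add: red_part_def SD.counit_coaug SQ_simps)
  moreover have "cls SD.E (Gen 1 (-1) 0) = 0" by (rule SD.E.lin_zero[OF SD.gen_lin[unfolded SD.E_simps(1)[symmetric]]])
  ultimately show ?thesis unfolding \<Gamma>_def SD.Gr_def U_coaug by (simp add: U_coaug)
qed

lemma U_in_E: "f \<in> gr D n e \<Longrightarrow> n \<noteq> 1 \<Longrightarrow> U n e f \<in> gr SD.E n (int n - 2 + e)"
  using U_in[of f n e] by (simp add: SD.gr_E algebra_simps)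

lemma susp_gen_cls: "susp_gen Q \<epsilon> n e f = cls SD.E (Gen n (int n - 2 + e) (U n e f))"
  by (simp add: susp_gen_def cobar_gen_def cls_def U_def algebra_simps)

lemma susp_gen_\<Gamma>: "n \<noteq> 1 \<Longrightarrow> susp_gen Q \<epsilon> n e f = \<Gamma> n e f"
  by (simp add: susp_gen_cls \<Gamma>_def SD.Gr_def red_part_def algebra_simps)

text \<open>The exponent \<open>(b - 1) * i\<close> comes from exchanging S_b^{-1} and
  \<open>f\<close> in the Hadamard decomposition; the other factor is the sign of the desuspension,
  S_a^{-1} f having degree \<open>a - 1 + i\<close>.\<close>

lemma Bd_term:
  assumes a: "1 \<le> a" and f: "f \<in> gr D a i" and g: "g \<in> gr D b j"
  shows "SD.Bd a b (dmix susp_coop DQ a b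
      (pure susp_coop a susp_coop b (int a - 1) (susp_elt a) (int b - 1) (susp_elt b)) (pure D a D b i f j g)) =
    fscl (ksign ((int b - 1) * i) * - ksign (int a - 1 + i)) (cmp W a (int a - 2 + i) b (int b - 2 + j) 1 (\<Gamma> a i f) (\<Gamma> b j g))"
proof -
  have f': "f \<in> gr DQ a i" and g': "g \<in> gr DQ b j" using f g by simp_all
  have e: "int a - 1 + i - 1 = int a - 2 + i" "int b - 1 + j - 1 = int b - 2 + j" by auto
  have m: "dmix susp_coop DQ a b
      (pure susp_coop a susp_coop b (int a - 1) (susp_elt a) (int b - 1) (susp_elt b)) (pure D a D b i f j g) =
    fscl (ksign ((int b - 1) * i)) (pure SQ a SQ b (int a - 1 + i) (U a i f) (int b - 1 + j) (U b j g))"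
    using HP.dmix_pure[OF susp_in susp_in f' g'] by (simp add: susp_dual_def U_def)
  show ?thesis
    unfolding m SD.Bd_linear SD.Bd_pure[OF a U_in[OF f] U_in[OF g]] e fs.scale_scale \<Gamma>_def ..
qed

text \<open>The decomposition of \<open>f\<close> is expanded in dual bases, with the values of
  \<open>f\<close> on composites of basis elements as coefficients, and that of S_n^{-1} is a single
  tensor. The sign of the unshuffle comes from the action on S_n^{-1}, while its action on
  \<open>f\<close> is transferred to the composite in \<open>Q\<close>.\<close>

lemma d2_U:
  assumes f: "f \<in> gr D n e"
  shows "SD.d2 n (int n - 2 + e) (U n e f) =
    (\<Sum>a\<in>{1..n + 1}. \<Sum>S\<in>{S. S \<subseteq> {1..n} \<and> card S = n + 1 - a}.
      \<Sum>j<m a. \<Sum>k<m (n + 1 - a). if dg a j + dg (n + 1 - a) k = - e then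
        fscl (of_int (sign (unshuffle n S)) * (ksign (int a + int (n + 1 - a) * dg a j + dg a j * dg (n + 1 - a) k) *
            f (act Q n (- e) (unshuffle n S) (cmp Q a (dg a j) (n + 1 - a) (dg (n + 1 - a) k) 1 (q a j) (q (n + 1 - a) k)))))
          (act W n (int n - 3 + e) (unshuffle n S) (cmp W a (int a - 2 - dg a j) (n + 1 - a) (int (n + 1 - a) - 2 - dg (n + 1 - a) k) 1
            (\<Gamma> a (- dg a j) (de a j)) (\<Gamma> (n + 1 - a) (- dg (n + 1 - a) k) (de (n + 1 - a) k)))) else 0)"
  unfolding SD.d2_def
proof (intro sum.cong[OF refl])
  fix a S assume a': "a \<in> {1..n + 1}" and S: "S \<in> {S. S \<subseteq> {1..n} \<and> card S = n + 1 - a}"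
  let ?b = "n + 1 - a" and ?s = "unshuffle n S"
  define b where "b = ?b"
  have a: "1 \<le> a" and n: "n = a + b - 1" using a' by (auto simp: b_def)
  have s: "?s permutes {1..n}" by (rule unshuffle_permutes) (use S in simp)
  note iss = permutes_inv[OF s]
  let ?g = "act D n e (inv ?s) f"
  have g: "?g \<in> gr D n e" by (rule DD.act_in[OF f iss])
  have sg: "sign (inv ?s) = sign ?s" by (rule sign_inverse[OF permutes_imp_permutation[OF finite_atLeastAtMost s]])
  have e1: "int n - 2 + e + 1 = int n - 1 + e" "int n - 2 + e - 1 = int n - 3 + e" by auto
  let ?ps = "pure susp_coop a susp_coop b (int a - 1) (susp_elt a) (int b - 1) (susp_elt b)"
  have "dec SQ a b 1 (int n - 1 + e) (act SQ n (int n - 1 + e) (inv ?s) (U n e f)) =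
      fscl (of_int (sign ?s)) (dec SQ a b 1 (int n - 1 + e) (U n e ?g))"
    unfolding U_act[OF f iss] sg using linmapD(3)[OF SD.dec_lin[OF a], of "U n e ?g" b "int n - 1 + e" "of_int (sign ?s)"] U_in[OF g] n
    by (simp add: SQ_simps)
  also have "dec SQ a b 1 (int n - 1 + e) (U n e ?g) = dmix susp_coop DQ a b ?ps (decf a b e ?g)"
  proof -
    have "susp_elt n \<in> gr susp_coop (a + b - 1) (int n - 1)" using susp_in n by simp
    moreover have "?g \<in> gr DQ (a + b - 1) e" using g n by simp
    ultimately have "dec SQ a b 1 (int n - 1 + e) (pure susp_coop (a + b - 1) DQ (a + b - 1) (int n - 1) (susp_elt n) e ?g) =
      dmix susp_coop DQ a b (dec susp_coop a b 1 (int n - 1) (susp_elt n)) (dec DQ a b 1 e ?g)"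
      unfolding susp_dual_def by (rule HP.had_dec_pure[OF a])
    moreover have "dec DQ a b 1 e ?g = decf a b e ?g" by (rule dec_dual[OF a]) (use g n in simp)
    ultimately show ?thesis unfolding U_def susp_dec[OF a n, symmetric] n[symmetric] by simp
  qed
  finally have D: "dec SQ a b 1 (int n - 1 + e) (act SQ n (int n - 1 + e) (inv ?s) (U n e f)) =
      fscl (of_int (sign ?s)) (dmix susp_coop DQ a b ?ps (decf a b e ?g))" .
  let ?c = "\<lambda>j k. ksign (dg a j * dg b k) * ?g (cmp Q a (dg a j) b (dg b k) 1 (q a j) (q b k))"
  let ?Y = "\<lambda>j k. cmp W a (int a - 2 - dg a j) b (int b - 2 - dg b k) 1 (\<Gamma> a (- dg a j) (de a j)) (\<Gamma> b (- dg b k) (de b k))"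
  have dsum: "dmix susp_coop DQ a b u (sum h A) = (\<Sum>x\<in>A. dmix susp_coop DQ a b u (h x))" for u h and A :: "nat set"
    by (induction A rule: infinite_finite_induct) simp_all
  have reorder: "x * G * y = K * G'" if "G = G'" "x * y = K" for G G' x y K :: 'k
    unfolding that(2)[symmetric] that(1) by (simp only: ac_simps)
  have "SD.Bd a b (dmix susp_coop DQ a b ?ps (decf a b e ?g)) =
    (\<Sum>j<m a. \<Sum>k<m b. SD.Bd a b (dmix susp_coop DQ a b ?ps (if dg a j + dg b k = - e then
      fscl (?c j k) (pure D a D b (- dg a j) (de a j) (- dg b k) (de b k)) else 0)))"
    unfolding decf_def dsum SD.Bd_linear ..
  also have "\<dots> = (\<Sum>j<m a. \<Sum>k<m b. if dg a j + dg b k = - e then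
      fscl (?c j k * (ksign ((int b - 1) * - dg a j) * - ksign (int a - 1 - dg a j))) (?Y j k) else 0)"
  proof (intro sum.cong refl)
    fix j k assume "j \<in> {..<m a}" "k \<in> {..<m b}"
    have di: "de a j \<in> gr D a (- dg a j)" "de b k \<in> gr D b (- dg b k)" by (simp_all add: de_in)
    show "SD.Bd a b (dmix susp_coop DQ a b ?ps (if dg a j + dg b k = - e then
      fscl (?c j k) (pure D a D b (- dg a j) (de a j) (- dg b k) (de b k)) else 0)) =
      (if dg a j + dg b k = - e then
      fscl (?c j k * (ksign ((int b - 1) * - dg a j) * - ksign (int a - 1 - dg a j))) (?Y j k) else 0)"
      using Bd_term[OF a di] by (simp only: dmix_linear SD.Bd_linear fs.scale_scale if_distrib[of "dmix _ _ _ _ _"] if_distrib[of "SD.Bd a b"] add_uminus_conv_diff cong: if_cong)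
  qed
  also have "\<dots> = (\<Sum>j<m a. \<Sum>k<m b. if dg a j + dg b k = - e then
      fscl (ksign (int a + int b * dg a j + dg a j * dg b k) * f (act Q n (- e) ?s (cmp Q a (dg a j) b (dg b k) 1 (q a j) (q b k)))) (?Y j k) else 0)"
  proof (intro sum.cong refl if_cong arg_cong2[of _ _ _ _ fscl])
    fix j k assume jk: "j \<in> {..<m a}" "k \<in> {..<m b}" and e: "dg a j + dg b k = - e"
    have "cmp Q a (dg a j) b (dg b k) 1 (q a j) (q b k) \<in> gr Q n (- e)"
      using cmp1_in[OF a q_in q_in, of j "dg a j" k b "dg b k"] jk e n by simp
    then have "?g (cmp Q a (dg a j) b (dg b k) 1 (q a j) (q b k)) = f (act Q n (- e) ?s (cmp Q a (dg a j) b (dg b k) 1 (q a j) (q b k)))"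
      by (simp only: act_dual if_True permutes_inv_inv[OF s])
    \<comment> \<open>The sign of the pairing, the interchange sign and the desuspension sign are
      combined. The leading minus turns \<open>a - 1\<close> into \<open>a\<close>, and two
      contributions \<open>dg a j\<close> cancel modulo 2.\<close>
    moreover have "ksign (dg a j * dg b k) * (ksign ((int b - 1) * - dg a j) * - ksign (int a - 1 - dg a j)) =
      (ksign (int a + int b * dg a j + dg a j * dg b k) :: 'k)"
      by (auto simp: ksign_def)
    ultimately show "?c j k * (ksign ((int b - 1) * - dg a j) * - ksign (int a - 1 - dg a j)) =
      ksign (int a + int b * dg a j + dg a j * dg b k) * f (act Q n (- e) ?s (cmp Q a (dg a j) b (dg b k) 1 (q a j) (q b k)))"
      by (rule reorder)
  qed
  finally have B: "SD.Bd a b (dmix susp_coop DQ a b ?ps (decf a b e ?g)) = \<dots>" .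
  have "SD.Tm n (int n - 2 + e) a ?s (U n e f) = act W n (int n - 3 + e) ?s (SD.Bd a b (fscl (of_int (sign ?s)) (dmix susp_coop DQ a b ?ps (decf a b e ?g))))"
    unfolding SD.Tm_def e1 b_def[symmetric] D ..
  also have "\<dots> = (\<Sum>j<m a. \<Sum>k<m b. if dg a j + dg b k = - e then
        fscl (of_int (sign ?s) * (ksign (int a + int b * dg a j + dg a j * dg b k) *
            f (act Q n (- e) ?s (cmp Q a (dg a j) b (dg b k) 1 (q a j) (q b k)))))
          (act W n (int n - 3 + e) ?s (?Y j k)) else 0)"
    unfolding SD.Bd_linear B SD.F_linear SD.act_F_sum fs.scale_sum_right
    by (intro sum.cong refl, simp only: SD.F_linear fs.scale_scale fs.scale_zero_right
      if_distrib[of "act W n (int n - 3 + e) ?s"] if_distrib[of "fscl _"] cong: if_cong)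
  finally show "SD.Tm n (int n - 2 + e) a ?s (U n e f) = (\<Sum>j<m a. \<Sum>k<m ?b. if dg a j + dg ?b k = - e then
        fscl (of_int (sign ?s) * (ksign (int a + int ?b * dg a j + dg a j * dg ?b k) *
            f (act Q n (- e) ?s (cmp Q a (dg a j) ?b (dg ?b k) 1 (q a j) (q ?b k)))))
          (act W n (int n - 3 + e) ?s (cmp W a (int a - 2 - dg a j) ?b (int ?b - 2 - dg ?b k) 1
            (\<Gamma> a (- dg a j) (de a j)) (\<Gamma> ?b (- dg ?b k) (de ?b k)))) else 0)"
    unfolding b_def .
qed

text \<open>In the linear part, the minus of the desuspension and the sign (-1)^(n-1) for passing
  S_n^{-1} combine to (-1)^n. From arity two on there is no reduction, so the formula for generators
  applies directly.\<close>

lemma dif_\<Gamma>: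
  assumes f: "f \<in> gr D n e" and n: "2 \<le> n"
  shows "dif W n (int n - 2 + e) (\<Gamma> n e f) = fscl (ksign (int n)) (\<Gamma> n (e - 1) (dif D n e f)) + SD.d2 n (int n - 2 + e) (U n e f)"
proof -
  have n1: "n \<noteq> 1" using n by simp
  have e: "int n - 2 + e + 1 = int n - 1 + e" "int n - 2 + e - 1 = int n - 2 + (e - 1)" by auto
  note df = linmapD(1)[OF DD.dif_lin f]
  have k: "- ksign (int n - 1) = (ksign (int n) :: 'k)" by (auto simp: ksign_def)
  have "- dif SQ n (int n - 1 + e) (U n e f) = fscl (ksign (int n)) (U n (e - 1) (dif D n e f))"
    unfolding U_dif[OF f] k[symmetric] by simp
  then show ?thesis
    unfolding susp_gen_\<Gamma>[OF n1, symmetric] susp_gen_cls SD.dif_gen[OF U_in_E[OF f n1]] e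
    using linmapD(3)[OF SD.gen_lin U_in_E[OF df n1]] by (simp add: SQ_simps e)
qed

end

section \<open>The canonical element\<close>

text \<open>With the canonical elements of \<open>Q\<close> and \<open>R\<close>, applying the
  transpose of \<open>A\<close> to the second factor of the first equals applying \<open>A\<close>
  to the first factor of the second: both sides are the double sum over the matrix entries of
  \<open>A\<close>. The map has degree \<open>s\<close>, and \<beta> may depend on the degree, which
  allows for Koszul signs. Its instances are a permutation, the projection \<open>rd\<close>, the
  differential and \<Theta>.\<close>

lemma (in based) canonical_swap:
  fixes s :: int and A :: "int \<Rightarrow> 'r::ab_group_add \<Rightarrow> 'q" and \<beta> :: "int \<Rightarrow> 'q \<Rightarrow> ('r \<Rightarrow> 'k) \<Rightarrow> ('x \<Rightarrow>\<^sub>0 'k)"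
    and R :: "('k, 'r, 'y) dgsmod_scheme"
  assumes R: "based R m' r dg'"
    and A: "\<And>d. linmap (scl R) (scl Q) (gr R n' d) (gr Q n (d + s)) (A d)"
    and \<beta>1: "\<And>d x. x \<in> gr Q n d \<Longrightarrow> linmap (scl (dual_smod R)) fscl (gr (dual_smod R) n' (s - d)) UNIV (\<beta> d x)"
    and \<beta>2: "\<And>d g. g \<in> gr (dual_smod R) n' (s - d) \<Longrightarrow> linmap (scl Q) fscl (gr Q n d) UNIV (\<lambda>x. \<beta> d x g)"
  shows "(\<Sum>i<m n. \<beta> (dg n i) (q n i) (\<lambda>x. if x \<in> gr R n' (dg n i - s) then de n i (A (dg n i - s) x) else 0)) =
    (\<Sum>k<m' n'. \<beta> (dg' n' k + s) (A (dg' n' k) (r n' k)) (dual_elt R n' (m' n') (r n') (dg' n') k))"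
proof -
  interpret R: based R m' r dg' by fact
  let ?g = "\<lambda>i x. if x \<in> gr R n' (dg n i - s) then de n i (A (dg n i - s) x) else 0"
  let ?T = "\<lambda>i k. if dg n i = dg' n' k + s then fscl (de n i (A (dg' n' k) (r n' k))) (\<beta> (dg n i) (q n i) (R.de n' k)) else 0"
  have g: "?g i \<in> gr (dual_smod R) n' (s - dg n i)" for i
    using dual_pullback[OF A[of "dg n i - s"] de_in, of i 1] R.gvec_axioms by (simp cong: if_cong)
  have 1: "\<beta> (dg n i) (q n i) (?g i) = (\<Sum>k<m' n'. ?T i k)" if i: "i < m n" for i
  proof -
    have "\<beta> (dg n i) (q n i) (?g i) = (\<Sum>k<m' n'. if dg' n' k = - (s - dg n i) then fscl (?g i (r n' k)) (\<beta> (dg n i) (q n i) (R.de n' k)) else 0)"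
      by (rule R.dual_lin_expand[OF \<beta>1[OF q_in[OF i refl]] g])
    also have "\<dots> = (\<Sum>k<m' n'. ?T i k)"
    proof (rule sum.cong[OF refl])
      fix k assume "k \<in> {..<m' n'}"
      then have "r n' k \<in> gr R n' (dg' n' k)" by (intro R.q_in) simp_all
      then show "(if dg' n' k = - (s - dg n i) then fscl (?g i (r n' k)) (\<beta> (dg n i) (q n i) (R.de n' k)) else 0) = ?T i k"
        by auto
    qed
    finally show ?thesis .
  qed
  have 2: "\<beta> (dg' n' k + s) (A (dg' n' k) (r n' k)) (R.de n' k) = (\<Sum>i<m n. ?T i k)" if k: "k < m' n'" for k
  proof -
    have "R.de n' k \<in> gr (dual_smod R) n' (s - (dg' n' k + s))" by (rule R.de_in) simp
    from lin_expand[OF \<beta>2[OF this] linmapD(1)[OF A R.q_in[OF k refl]]]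
    show ?thesis by (simp cong: if_cong)
  qed
  have "(\<Sum>i<m n. \<beta> (dg n i) (q n i) (?g i)) = (\<Sum>i<m n. \<Sum>k<m' n'. ?T i k)"
    by (intro sum.cong refl 1) simp
  also have "\<dots> = (\<Sum>k<m' n'. \<Sum>i<m n. ?T i k)" by (rule sum.swap)
  also have "\<dots> = (\<Sum>k<m' n'. \<beta> (dg' n' k + s) (A (dg' n' k) (r n' k)) (R.de n' k))"
    by (intro sum.cong refl 2[symmetric]) simp
  finally show ?thesis .
qed

section \<open>The images of the generators and their differential\<close>

locale twist = based_op Q m q dg \<epsilon> + P: predg P + QQ: predg Q
  for P :: "('k::field, 'p::ab_group_add) dgop" and Q :: "('k, 'q::ab_group_add) dgop"
    and m q dg and \<epsilon> :: "('q, 'k) fam" +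
  fixes \<Psi> :: "('q, 'p) fam"
  assumes Psi: "dg_operad_hom Q P \<Psi>"
begin

lemma Psi_g: "graded_operad_hom Q P \<Psi>"
  using Psi by (simp add: dg_operad_hom_def)

lemmas psi = ghomD[OF Psi_g]

lemma psi_in: "x \<in> gr Q n d \<Longrightarrow> \<Psi> n d x \<in> gr P n d"
  by (rule linmapD(1)[OF psi(1)])

lemma psi_dif: "x \<in> gr Q n d \<Longrightarrow> \<Psi> n (d - 1) (dif Q n d x) = dif P n d (\<Psi> n d x)"
  using Psi by (simp add: dg_operad_hom_def)

sublocale PW: tensor P W by unfold_locales

abbreviation "H \<equiv> had_op P W"

sublocale H: predg H by (intro predg_had P.predg_axioms SD.predg_cobar)

lemma W_scl: "scl W = fscl"
  by (rule SD.F_simps(1))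

lemma \<Gamma>_lin': "linmap (scl D) (scl W) (gr D n (- d)) (gr W n (int n - 2 - d)) (\<Gamma> n (- d))"
  using \<Gamma>_lin[of n "- d"] by (simp add: W_scl)

lemma \<Gamma>_in': "f \<in> gr D n (- d) \<Longrightarrow> \<Gamma> n (- d) f \<in> gr W n (int n - 2 - d)"
  by (rule linmapD(1)[OF \<Gamma>_lin'])

abbreviation G :: "nat \<Rightarrow> nat \<Rightarrow> (('k, 'q) suspdual oterm \<Rightarrow>\<^sub>0 'k)" where
  "G n i \<equiv> \<Gamma> n (- dg n i) (de n i)"

abbreviation p :: "nat \<Rightarrow> nat \<Rightarrow> 'p" where
  "p n i \<equiv> \<Psi> n (dg n i) (q n i)"

lemma G_in: "G n i \<in> gr W n (int n - 2 - dg n i)"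
  by (intro \<Gamma>_in' de_in) simp

lemma p_in: "i < m n \<Longrightarrow> p n i \<in> gr P n (dg n i)"
  by (intro psi_in q_in) simp_all

text \<open>Defined in every arity by means of the reduced generators: from arity two on it is the
  prescribed image of \<open>ell n\<close>, but the expansion of its differential also involves
  arities zero and one.\<close>

definition X :: "nat \<Rightarrow> (('p, ('k, 'q) suspdual oterm \<Rightarrow>\<^sub>0 'k) tkey \<Rightarrow>\<^sub>0 'k)" where
  "X n = (\<Sum>i<m n. fscl (ksign (int n * dg n i)) (pure P n W n (dg n i) (p n i) (int n - 2 - dg n i) (G n i)))"

lemma X_in: "X n \<in> gr H n (int n - 2)"
proof -
  have "fscl (ksign (int n * dg n i)) (pure P n W n (dg n i) (p n i) (int n - 2 - dg n i) (G n i)) \<in> gr H n (int n - 2)"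
    if "i < m n" for i
  proof -
    have "pure P n W n (dg n i) (p n i) (int n - 2 - dg n i) (G n i) \<in> gr H n (int n - 2)"
      unfolding had_op_simps by (rule PW.pure_in[OF p_in[OF that] G_in]) simp
    then show ?thesis using H.gr_scl[of _ n "int n - 2" "ksign (int n * dg n i)"] by simp
  qed
  then show ?thesis unfolding X_def by (intro H.gr_sum) simp
qed

lemma swap_bilin:
  assumes B: "\<And>d. linmap (scl Q) (scl P) (gr Q n d) (gr P n' (d - c)) (B d)"
  shows "x \<in> gr Q n d \<Longrightarrow> linmap (scl D) fscl (gr D n' (- e)) UNIV
      (\<lambda>g. fscl k (pure P n' W n' (d - c) (B d x) (int n' - 2 - e) (\<Gamma> n' (- e) g)))"
    "g \<in> gr D n' (- e) \<Longrightarrow> linmap (scl Q) fscl (gr Q n d) UNIV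
      (\<lambda>x. fscl k (pure P n' W n' (d - c) (B d x) (int n' - 2 - e) (\<Gamma> n' (- e) g)))"
  by (intro linmap_fun_fscl PW.pure_lin_right'[OF \<Gamma>_lin'] PW.pure_lin_left'[OF B] linmapD(1)[OF B] \<Gamma>_in'; assumption)+

text \<open>The canonical element is invariant, since \<sigma> on \<open>Q\<close> cancels its dual
  action on the functionals. What remains is the sign by which S_n^{-1} transforms, as for
  \<open>ell n\<close>.\<close>

lemma X_act:
  assumes s: "\<sigma> permutes {1..n}"
  shows "act H n d \<sigma> (X n) = fscl (of_int (sign \<sigma>)) (X n)"
proof -
  \<comment> \<open>The action on the first factor is made part of \<beta>; the dual action on the
    second is the transpose of \<open>inv \<sigma>\<close>, which the exchange moves to the first
    factor.\<close>
  let ?\<beta> = "\<lambda>d x g. fscl (ksign (int n * d)) (pure P n W n (d - 0) (\<Psi> n d (act Q n d \<sigma> x)) (int n - 2 - d) (\<Gamma> n (- d) g))"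
  have B: "linmap (scl Q) (scl P) (gr Q n d) (gr P n (d - 0)) (\<lambda>x. \<Psi> n d (act Q n d \<sigma> x))" for d
    using linmap_comp[OF act_lin[OF s] psi(1)] by simp
  have b1: "linmap (scl D) fscl (gr D n (0 - d)) UNIV (?\<beta> d x)" if "x \<in> gr Q n d" for d x
    using swap_bilin(1)[OF B, of x d d] that by simp
  have b2: "linmap (scl Q) fscl (gr Q n d) UNIV (\<lambda>x. ?\<beta> d x g)" if "g \<in> gr D n (0 - d)" for d g
    using swap_bilin(2)[OF B, of g d d] that by simp
  have A: "linmap (scl Q) (scl Q) (gr Q n d) (gr Q n (d + 0)) (act Q n d (inv \<sigma>))" for d
    using act_lin[OF permutes_inv[OF s]] by simp
  have "act H n d \<sigma> (X n) = (\<Sum>i<m n. fscl (of_int (sign \<sigma>)) (?\<beta> (dg n i) (q n i) (act D n (- dg n i) \<sigma> (de n i))))"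
    unfolding X_def had_op_simps had_act_linear
  proof (rule sum.cong[OF refl])
    fix i assume "i \<in> {..<m n}"
    then have i: "i < m n" by simp
    have d: "de n i \<in> gr D n (- dg n i)" by (rule de_in) simp
    have "act W n (int n - 2 - dg n i) \<sigma> (G n i) = fscl (of_int (sign \<sigma>)) (\<Gamma> n (- dg n i) (act D n (- dg n i) \<sigma> (de n i)))"
      using \<Gamma>_act[OF d s] by simp
    then show "fscl (ksign (int n * dg n i)) (act (had_smod P W) n d \<sigma> (pure P n W n (dg n i) (p n i) (int n - 2 - dg n i) (G n i))) =
      fscl (of_int (sign \<sigma>)) (?\<beta> (dg n i) (q n i) (act D n (- dg n i) \<sigma> (de n i)))"
      unfolding had_act_pure[OF P.smod_axioms SD.F.smod_axioms p_in[OF i] G_in s] psi(2)[OF q_in[OF i refl] s]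
      using PW.pure_scl(2)[OF P.act_in[OF p_in[OF i] s] \<Gamma>_in'[OF DD.act_in[OF d s]]]
      by (simp add: W_scl fs.scale_left_commute)
  qed
  also have "\<dots> = fscl (of_int (sign \<sigma>)) (\<Sum>i<m n. ?\<beta> (dg n i) (q n i) (\<lambda>x. if x \<in> gr Q n (dg n i - 0) then de n i (act Q n (dg n i - 0) (inv \<sigma>) x) else 0))"
    unfolding fs.scale_sum_right act_dual by (simp only: minus_minus diff_0_right)
  also have "\<dots> = fscl (of_int (sign \<sigma>)) (\<Sum>k<m n. ?\<beta> (dg n k + 0) (act Q n (dg n k) (inv \<sigma>) (q n k)) (de n k))"
    by (rule arg_cong[of _ _ "fscl _"]) (rule canonical_swap[OF based_axioms A b1 b2])
  also have "\<dots> = fscl (of_int (sign \<sigma>)) (X n)"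
    unfolding X_def by (rule arg_cong[of _ _ "fscl _"]) (intro sum.cong refl, simp add: act_inv q_in s)
  finally show ?thesis .
qed

text \<open>The projection onto the augmentation ideal along the unit. Its transpose subtracts from
  a functional its value at the unit times the coaugmentation, and so corresponds to
  \<open>red_part\<close>.\<close>

definition rd :: "nat \<Rightarrow> int \<Rightarrow> 'q \<Rightarrow> 'q" where
  "rd a d x = (if a = 1 \<and> d = 0 then x - scl Q (\<epsilon> 1 0 x) (unt Q) else x)"

lemma rd_lin: "linmap (scl Q) (scl Q) (gr Q a d) (gr Q a d) (rd a d)"
  by (rule linmapI)
    (auto simp: rd_def linmapD[OF eps_lin] gr_diff gr_scl unt_in vec.scale_left_distrib vec.scale_right_diff_distrib)

text \<open>\<open>\<Gamma>\<close> does not change when a functional is composed with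
  \<open>rd\<close>, because the coaugmentation is killed. Exchanging transposes moves
  \<open>rd\<close> to the first tensor factor.\<close>

lemma X_rd: "X a = (\<Sum>j<m a. fscl (ksign (int a * dg a j)) (pure P a W a (dg a j) (\<Psi> a (dg a j) (rd a (dg a j) (q a j))) (int a - 2 - dg a j) (G a j)))"
proof -
  let ?\<beta> = "\<lambda>d x g. fscl (ksign (int a * d)) (pure P a W a (d - 0) (\<Psi> a d x) (int a - 2 - d) (\<Gamma> a (- d) g))"
  have B: "linmap (scl Q) (scl P) (gr Q a d) (gr P a (d - 0)) (\<lambda>x. \<Psi> a d x)" for d
    using psi(1) by simp
  have b1: "linmap (scl D) fscl (gr D a (0 - d)) UNIV (?\<beta> d x)" if "x \<in> gr Q a d" for d x
    using swap_bilin(1)[OF B, of x d d] that by simp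
  have b2: "linmap (scl Q) fscl (gr Q a d) UNIV (\<lambda>x. ?\<beta> d x g)" if "g \<in> gr D a (0 - d)" for d g
    using swap_bilin(2)[OF B, of g d d] that by simp
  have A: "linmap (scl Q) (scl Q) (gr Q a d) (gr Q a (d + 0)) (rd a d)" for d
    using rd_lin by simp
  have red: "\<Gamma> a (- dg a i) (\<lambda>x. if x \<in> gr Q a (dg a i - 0) then de a i (rd a (dg a i - 0) x) else 0) = G a i" for i
  proof (cases "a = 1 \<and> dg a i = 0")
    case False
    then have "(\<lambda>x. if x \<in> gr Q a (dg a i - 0) then de a i (rd a (dg a i - 0) x) else 0) = de a i"
      by (auto simp: rd_def dual_elt_def)
    then show ?thesis by simp
  next
    case True
    have d: "de 1 i \<in> gr D 1 0" using True by (intro de_in) auto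
    have c: "coaug DQ \<in> gr D 1 0" using HP.D.coaug_in by simp
    have l: "linmap (scl Q) (*) (gr Q 1 0) UNIV (de 1 i)" using gr_dualD(1)[OF d] by simp
    \<comment> \<open>Composition with \<open>rd\<close> changes a functional by a multiple of the
      coaugmentation, the multiple being its value at the unit.\<close>
    have "(\<lambda>x. if x \<in> gr Q 1 0 then de 1 i (rd 1 0 x) else 0) = de 1 i - scl D (de 1 i (unt Q)) (coaug DQ)"
      using lin_diff[OF l _ gr_scl[OF unt_in]] linmapD(3)[OF l unt_in] gr_dualD(2)[OF d] by (auto simp: rd_def fun_eq_iff mult.commute)
    moreover have "\<Gamma> 1 0 (de 1 i - scl D (de 1 i (unt Q)) (coaug DQ)) = \<Gamma> 1 0 (de 1 i)"
      unfolding Dual.lin_diff[OF \<Gamma>_lin d Dual.gr_scl[OF c]] linmapD(3)[OF \<Gamma>_lin c] \<Gamma>_coaug by simp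
    moreover have "a = 1" "dg 1 i = 0" using True by auto
    ultimately show ?thesis by (simp only: diff_0_right minus_zero)
  qed
  have "X a = (\<Sum>i<m a. ?\<beta> (dg a i) (q a i) (\<lambda>x. if x \<in> gr Q a (dg a i - 0) then de a i (rd a (dg a i - 0) x) else 0))"
    unfolding red X_def by simp
  also have "\<dots> = (\<Sum>k<m a. ?\<beta> (dg a k + 0) (rd a (dg a k) (q a k)) (de a k))"
    by (rule canonical_swap[OF based_axioms A b1 b2])
  finally show ?thesis by simp
qed

text \<open>By the previous lemma only the components in the augmentation ideal of the first tensor factors
  contribute to the composite.\<close>

lemma X_low:
  assumes low: "low_arity_vanishing Q \<epsilon> \<Psi>" and aug: "augmentation Q \<epsilon>"
    and a: "1 \<le> a" "a \<le> 1 \<or> b \<le> 1" "2 \<le> a + b - 1"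
  shows "cmp H a i b k 1 (X a) (X b) = 0"
proof -
  have rd_aug: "rd c d x \<in> aug_ideal Q \<epsilon> c d" if x: "x \<in> gr Q c d" for c d x
  proof -
    have r: "rd c d x \<in> gr Q c d" by (rule linmapD(1)[OF rd_lin x])
    have "\<epsilon> c d (rd c d x) = 0"
    proof (cases "c = 1 \<and> d = 0")
      case True
      then have "\<epsilon> 1 0 (x - scl Q (\<epsilon> 1 0 x) (unt Q)) = 0"
        using x lin_diff[OF eps_lin _ gr_scl[OF unt_in], of x] linmapD(3)[OF eps_lin unt_in] eps_unt by simp
      then show ?thesis using True by (simp add: rd_def)
    next
      case False
      \<comment> \<open>Outside arity one and degree zero the unit operad is zero, so the
        augmentation vanishes there.\<close>
      have "graded_operad_hom Q unit_operad \<epsilon>" using aug by (simp add: augmentation_def dg_operad_hom_def)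
      from linmapD(1)[OF ghomD(1)[OF this] r] False show ?thesis by (auto simp: unit_operad_def split: if_splits)
    qed
    then show ?thesis using r by (simp add: aug_ideal_def)
  qed
  have z: "cmp H a i b k 1 (pure P a W a (dg a j) (\<Psi> a (dg a j) (rd a (dg a j) (q a j))) (int a - 2 - dg a j) (G a j))
      (pure P b W b (dg b l) (\<Psi> b (dg b l) (rd b (dg b l) (q b l))) (int b - 2 - dg b l) (G b l)) = 0"
    if "j < m a" "l < m b" for j l
  proof -
    have x: "rd a (dg a j) (q a j) \<in> gr Q a (dg a j)" "rd b (dg b l) (q b l) \<in> gr Q b (dg b l)"
      using that by (auto intro!: linmapD(1)[OF rd_lin] q_in)
    have "\<Psi> (a + b - 1) (dg a j + dg b l) (cmp Q a (dg a j) b (dg b l) 1 (rd a (dg a j) (q a j)) (rd b (dg b l) (q b l))) = 0"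
      using low a that rd_aug[OF q_in] unfolding low_arity_vanishing_def by simp
    then have c0: "cmp P a (dg a j) b (dg b l) 1 (\<Psi> a (dg a j) (rd a (dg a j) (q a j))) (\<Psi> b (dg b l) (rd b (dg b l) (q b l))) = 0"
      using psi(4)[OF x, of 1] a by simp
    have "cmp W a (int a - 2 - dg a j) b (int b - 2 - dg b l) 1 (G a j) (G b l) \<in> gr W (a + b - 1) (int a - 2 - dg a j + (int b - 2 - dg b l))"
      by (rule SD.F.cmp_in[OF order_refl a(1) G_in G_in])
    from P.lin_zero[OF PW.pure_lin_left[OF this]]
    show ?thesis
      unfolding had_cmp_pure[OF P.gop_axioms SD.F.gop_axioms order_refl a(1) psi_in[OF x(1)] G_in psi_in[OF x(2)] G_in] c0 by simp
  qed
  show ?thesis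
    unfolding X_rd[of a] X_rd[of b] had_cmp_linear had_cmp_sum_right
    by (intro sum.neutral ballI) (simp add: z)
qed

text \<open>The first two signs are the coefficients in \<open>X a\<close> and \<open>X b\<close>;
  the third arises from exchanging \<open>G a j\<close>, of degree \<open>a - 2 - dg a j\<close>,
  with \<open>p b k\<close>. \<Psi> is collected in front since it preserves composition and
  action.\<close>

lemma cmp_X:
  assumes n: "2 \<le> n" and a: "a \<in> {1..n + 1}" and s: "\<sigma> permutes {1..n}" and b: "b = n + 1 - a"
  shows "act H n (int n - 3) \<sigma> (cmp H a (int a - 2) b (int b - 2) 1 (X a) (X b)) =
    (\<Sum>j<m a. \<Sum>k<m b. fscl (ksign (int a * dg a j) * ksign (int b * dg b k) * ksign ((int a - 2 - dg a j) * dg b k))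
      (pure P n W n (dg a j + dg b k) (\<Psi> n (dg a j + dg b k) (act Q n (dg a j + dg b k) \<sigma> (cmp Q a (dg a j) b (dg b k) 1 (q a j) (q b k))))
        (int n - 3 - (dg a j + dg b k)) (act W n (int n - 3 - (dg a j + dg b k)) \<sigma>
           (cmp W a (int a - 2 - dg a j) b (int b - 2 - dg b k) 1 (G a j) (G b k)))))"
proof -
  have a1: "1 \<le> a" and ab: "a + b - 1 = n" and iab: "int a + int b = int n + 1" using a b by auto
  have e: "int a - 2 - dg a j + (int b - 2 - dg b k) = int n - 3 - (dg a j + dg b k)" for j k
    using iab by simp
  have t: "act H n (int n - 3) \<sigma> (cmp H a (int a - 2) b (int b - 2) 1
      (pure P a W a (dg a j) (p a j) (int a - 2 - dg a j) (G a j)) (pure P b W b (dg b k) (p b k) (int b - 2 - dg b k) (G b k))) =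
    fscl (ksign ((int a - 2 - dg a j) * dg b k)) (pure P n W n (dg a j + dg b k) (\<Psi> n (dg a j + dg b k) (act Q n (dg a j + dg b k) \<sigma> (cmp Q a (dg a j) b (dg b k) 1 (q a j) (q b k))))
        (int n - 3 - (dg a j + dg b k)) (act W n (int n - 3 - (dg a j + dg b k)) \<sigma>
           (cmp W a (int a - 2 - dg a j) b (int b - 2 - dg b k) 1 (G a j) (G b k))))"
    if jk: "j < m a" "k < m b" for j k
  proof -
    note qi = q_in[OF jk(1) refl] q_in[OF jk(2) refl]
    have c: "cmp Q a (dg a j) b (dg b k) 1 (q a j) (q b k) \<in> gr Q n (dg a j + dg b k)"
      using cmp1_in[OF a1 qi] ab by simp
    have cp: "cmp P a (dg a j) b (dg b k) 1 (p a j) (p b k) = \<Psi> n (dg a j + dg b k) (cmp Q a (dg a j) b (dg b k) 1 (q a j) (q b k))"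
      using psi(4)[OF qi order_refl a1] ab by simp
    have cw: "cmp W a (int a - 2 - dg a j) b (int b - 2 - dg b k) 1 (G a j) (G b k) \<in> gr W n (int n - 3 - (dg a j + dg b k))"
      using SD.F.cmp_in[OF order_refl a1 G_in G_in, of j b k] unfolding ab e .
    show ?thesis
      unfolding had_cmp_pure[OF P.gop_axioms SD.F.gop_axioms order_refl a1 p_in[OF jk(1)] G_in p_in[OF jk(2)] G_in] cp ab e
        had_op_simps had_act_linear had_act_pure[OF P.smod_axioms SD.F.smod_axioms psi_in[OF c] cw s] psi(2)[OF c s] ..
  qed
  have al: "act H n d \<sigma> (sum f A) = (\<Sum>x\<in>A. act H n d \<sigma> (f x))" "act H n d \<sigma> (fscl c v) = fscl c (act H n d \<sigma> v)" for d f c v and A :: "nat set"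
    by simp_all
  show ?thesis
    unfolding X_def[of a] X_def[of b] had_cmp_linear had_cmp_sum_right al fs.scale_sum_right
    by (subst sum.swap, intro sum.cong refl) (simp only: lessThan_iff t fs.scale_scale ac_simps)
qed

lemma dif_\<Gamma>':
  assumes "f \<in> gr D n (- d)" "2 \<le> n"
  shows "dif W n (int n - 2 - d) (\<Gamma> n (- d) f) = fscl (ksign (int n)) (\<Gamma> n (- (d + 1)) (dif D n (- d) f)) + SD.d2 n (int n - 2 - d) (U n (- d) f)"
proof -
  have e: "int n - 2 + - d = int n - 2 - d" "- d - 1 = - (d + 1)" by simp_all
  show ?thesis using dif_\<Gamma>[OF assms] unfolding e .
qed

text \<open>The internal differential of \<open>P\<close> cancels against the part \<open>d\<^sub>1\<close> of the cobar differential.\<close>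

lemma d1_cancel:
  "(\<Sum>i<m n. fscl (ksign (int n * dg n i)) (pure P n W n (dg n i - 1) (dif P n (dg n i) (p n i)) (int n - 2 - dg n i) (G n i))) +
   (\<Sum>i<m n. fscl (ksign (int n * dg n i + dg n i + int n)) (pure P n W n (dg n i) (p n i) (int n - 3 - dg n i)
      (\<Gamma> n (- (dg n i + 1)) (dif D n (- dg n i) (de n i))))) = 0"
proof -
  \<comment> \<open>The functional has degree \<open>- (d + 1)\<close> because the dual differential
    has already been applied to it. The sign is that of the second sum after the factor from
    \<open>dif_dual\<close> has been split off.\<close>
  let ?\<beta> = "\<lambda>d x g. fscl (- ksign (int n * d + int n)) (pure P n W n (d - 0) (\<Psi> n d x) (int n - 2 - (d + 1)) (\<Gamma> n (- (d + 1)) g))"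
  have B: "linmap (scl Q) (scl P) (gr Q n d) (gr P n (d - 0)) (\<lambda>x. \<Psi> n d x)" for d
    using psi(1) by simp
  have e1: "- 1 - d = - (d + 1)" for d :: int by simp
  have b1: "linmap (scl D) fscl (gr D n (- 1 - d)) UNIV (?\<beta> d x)" if "x \<in> gr Q n d" for d x
    using swap_bilin(1)[OF B that, of "d + 1"] unfolding e1 .
  have b2: "linmap (scl Q) fscl (gr Q n d) UNIV (\<lambda>x. ?\<beta> d x g)" if "g \<in> gr D n (- 1 - d)" for d g
    using swap_bilin(2)[OF B, of g "d + 1"] that unfolding e1 by blast
  have A: "linmap (scl Q) (scl Q) (gr Q n d) (gr Q n (d + - 1)) (dif Q n d)" for d
    using dif_lin[of n d] by simp
  let ?A = "\<lambda>i x. if x \<in> gr Q n (dg n i - - 1) then de n i (dif Q n (dg n i - - 1) x) else 0"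
  have Ain: "?A i \<in> gr D n (- (dg n i + 1))" for i
    using dual_pullback[OF A[of "dg n i + 1"], of "de n i" 1] de_in[of n i] gvec_axioms by (simp cong: if_cong)
  have dA: "dif D n (- dg n i) (de n i) = scl D (- ksign (dg n i)) (?A i)" for i
  proof -
    have e: "1 - - dg n i = dg n i - - 1" by simp
    show ?thesis unfolding dif_dual e dual_smod_simps by (intro ext) (simp only: ksign_simps split: if_split; simp)
  qed
  have "(\<Sum>i<m n. fscl (ksign (int n * dg n i + dg n i + int n)) (pure P n W n (dg n i) (p n i) (int n - 3 - dg n i)
      (\<Gamma> n (- (dg n i + 1)) (dif D n (- dg n i) (de n i))))) = (\<Sum>i<m n. ?\<beta> (dg n i) (q n i) (?A i))"
  proof (rule sum.cong[OF refl])
    fix i assume "i \<in> {..<m n}"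
    then have i: "i < m n" by simp
    have k: "ksign (int n * dg n i + dg n i + int n) * - ksign (dg n i) = (- ksign (int n * dg n i + int n) :: 'k)"
      by (auto simp: ksign_def)
    have e: "int n - 2 - (dg n i + 1) = int n - 3 - dg n i" by simp
    show "fscl (ksign (int n * dg n i + dg n i + int n)) (pure P n W n (dg n i) (p n i) (int n - 3 - dg n i)
      (\<Gamma> n (- (dg n i + 1)) (dif D n (- dg n i) (de n i)))) = ?\<beta> (dg n i) (q n i) (?A i)"
      unfolding dA linmapD(3)[OF \<Gamma>_lin' Ain] diff_0_right
      using PW.pure_scl(2)[OF p_in[OF i] \<Gamma>_in'[OF Ain[of i]]] unfolding e by (simp only: fs.scale_scale k)
  qed
  also have "\<dots> = (\<Sum>k<m n. ?\<beta> (dg n k + - 1) (dif Q n (dg n k) (q n k)) (de n k))"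
    by (rule canonical_swap[OF based_axioms A b1 b2])
  also have "\<dots> = (\<Sum>i<m n. - fscl (ksign (int n * dg n i)) (pure P n W n (dg n i - 1) (dif P n (dg n i) (p n i)) (int n - 2 - dg n i) (G n i)))"
  proof (rule sum.cong[OF refl])
    fix i assume "i \<in> {..<m n}"
    then have i: "i < m n" by simp
    \<comment> \<open>After the exchange the first factor has degree \<open>dg n i - 1\<close>, and
      the sign turns into that of the first sum; the minus in \<beta> produces the
      cancellation.\<close>
    have k: "int n * (dg n i - 1) + int n = int n * dg n i" by (simp add: algebra_simps)
    show "?\<beta> (dg n i + - 1) (dif Q n (dg n i) (q n i)) (de n i) =
      - fscl (ksign (int n * dg n i)) (pure P n W n (dg n i - 1) (dif P n (dg n i) (p n i)) (int n - 2 - dg n i) (G n i))"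
      using psi_dif[OF q_in[OF i refl]] by (simp add: k)
  qed
  finally show ?thesis by (simp add: sum_negf)
qed

text \<open>After the cancellation of d_1 the dual basis elements occur through their values on
  composites of basis elements. Summed over the basis of \<open>Q(n)\<close> against \<Psi>, these
  values reassemble \<Psi> of the composite, and \<open>cmp_X\<close> recognizes the result.\<close>

lemma dif_X:
  assumes n: "2 \<le> n"
  shows "dif H n (int n - 2) (X n) = (\<Sum>a\<in>{1..n + 1}. \<Sum>S\<in>{S. S \<subseteq> {1..n} \<and> card S = n + 1 - a}.
    fscl (of_int (sign (unshuffle n S)) * ksign (int a))
      (act H n (int n - 3) (unshuffle n S) (cmp H a (int a - 2) (n + 1 - a) (int (n + 1 - a) - 2) 1 (X a) (X (n + 1 - a)))))"
proof -
  let ?D2 = "\<lambda>i. SD.d2 n (int n - 2 - dg n i) (U n (- dg n i) (de n i))"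
  have di: "de n i \<in> gr D n (- dg n i)" for i by (rule de_in) simp
  have U2: "U n (- dg n i) (de n i) \<in> gr SQ n (int n - 2 - dg n i + 1)" for i
    using U_in[OF di[of i]] by (simp add: algebra_simps)
  have D2: "?D2 i \<in> gr W n (int n - 3 - dg n i)" for i
  proof -
    have e: "int n - 2 - dg n i - 1 = int n - 3 - dg n i" by simp
    show ?thesis using linmapD(1)[OF SD.d2_linmap U2[of i]] unfolding e .
  qed
  have dG: "\<Gamma> n (- (dg n i + 1)) (dif D n (- dg n i) (de n i)) \<in> gr W n (int n - 3 - dg n i)" for i
  proof -
    have e: "int n - 2 - (dg n i + 1) = int n - 3 - dg n i" "- dg n i - 1 = - (dg n i + 1)" by simp_all
    show ?thesis using \<Gamma>_in'[of "dif D n (- dg n i) (de n i)" n "dg n i + 1"] linmapD(1)[OF DD.dif_lin di[of i]] unfolding e by blast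
  qed
  have "dif H n (int n - 2) (X n) = (\<Sum>i<m n.
      fscl (ksign (int n * dg n i)) (pure P n W n (dg n i - 1) (dif P n (dg n i) (p n i)) (int n - 2 - dg n i) (G n i)) +
      (fscl (ksign (int n * dg n i + dg n i + int n)) (pure P n W n (dg n i) (p n i) (int n - 3 - dg n i) (\<Gamma> n (- (dg n i + 1)) (dif D n (- dg n i) (de n i)))) +
       fscl (ksign (int n * dg n i + dg n i)) (pure P n W n (dg n i) (p n i) (int n - 3 - dg n i) (?D2 i))))"
    unfolding X_def had_op_simps had_dif_linear
  proof (rule sum.cong[OF refl])
    fix i assume "i \<in> {..<m n}"
    then have i: "i < m n" by simp
    have e: "int n - 2 - dg n i - 1 = int n - 3 - dg n i" by simp
    have sc: "fscl (ksign (int n)) (\<Gamma> n (- (dg n i + 1)) (dif D n (- dg n i) (de n i))) \<in> gr W n (int n - 3 - dg n i)"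
      using SD.F.gr_scl[OF dG[of i], of "ksign (int n)"] by (simp add: W_scl)
    show "fscl (ksign (int n * dg n i)) (dif (had_smod P W) n (int n - 2) (pure P n W n (dg n i) (p n i) (int n - 2 - dg n i) (G n i))) =
      fscl (ksign (int n * dg n i)) (pure P n W n (dg n i - 1) (dif P n (dg n i) (p n i)) (int n - 2 - dg n i) (G n i)) +
      (fscl (ksign (int n * dg n i + dg n i + int n)) (pure P n W n (dg n i) (p n i) (int n - 3 - dg n i) (\<Gamma> n (- (dg n i + 1)) (dif D n (- dg n i) (de n i)))) +
       fscl (ksign (int n * dg n i + dg n i)) (pure P n W n (dg n i) (p n i) (int n - 3 - dg n i) (?D2 i)))"
      unfolding had_dif_pure[OF P.dsmod_axioms predg.axioms(2)[OF SD.predg_cobar] p_in[OF i] G_in] dif_\<Gamma>'[OF di n] e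
        PW.pure_add(2)[OF p_in[OF i] sc D2] PW.pure_scl(2)[OF p_in[OF i] dG, unfolded W_scl]
      by (simp only: fs.scale_right_distrib fs.scale_scale ksign_add mult.assoc)
  qed
  also have "\<dots> = (\<Sum>i<m n. fscl (ksign (int n * dg n i + dg n i)) (pure P n W n (dg n i) (p n i) (int n - 3 - dg n i) (?D2 i)))"
    unfolding sum.distrib using d1_cancel[of n] by (simp add: add.assoc[symmetric])
  also have "\<dots> = (\<Sum>a\<in>{1..n + 1}. \<Sum>S\<in>{S. S \<subseteq> {1..n} \<and> card S = n + 1 - a}.
    fscl (of_int (sign (unshuffle n S)) * ksign (int a))
      (act H n (int n - 3) (unshuffle n S) (cmp H a (int a - 2) (n + 1 - a) (int (n + 1 - a) - 2) 1 (X a) (X (n + 1 - a)))))"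
  proof -
    let ?I = "\<lambda>a. {S. S \<subseteq> {1..n} \<and> card S = n + 1 - a}"
    let ?z = "\<lambda>a S j k. act Q n (dg a j + dg (n + 1 - a) k) (unshuffle n S) (cmp Q a (dg a j) (n + 1 - a) (dg (n + 1 - a) k) 1 (q a j) (q (n + 1 - a) k))"
    let ?Y = "\<lambda>a S j k. act W n (int n - 3 - (dg a j + dg (n + 1 - a) k)) (unshuffle n S) (cmp W a (int a - 2 - dg a j) (n + 1 - a) (int (n + 1 - a) - 2 - dg (n + 1 - a) k) 1 (G a j) (G (n + 1 - a) k))"
    let ?s = "\<lambda>a S j k. of_int (sign (unshuffle n S)) * ksign (int a + int (n + 1 - a) * dg a j + dg a j * dg (n + 1 - a) k) :: 'k"
    have up: "unshuffle n S permutes {1..n}" if "S \<in> ?I a" for a S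
      using that by (intro unshuffle_permutes) simp
    have zin: "?z a S j k \<in> gr Q n (dg a j + dg (n + 1 - a) k)" and Yin: "?Y a S j k \<in> gr W n (int n - 3 - (dg a j + dg (n + 1 - a) k))"
      if h: "a \<in> {1..n + 1}" "S \<in> ?I a" "j < m a" "k < m (n + 1 - a)" for a S j k
    proof -
      have a1: "1 \<le> a" and ab: "a + (n + 1 - a) - 1 = n" and iab: "int a + int (n + 1 - a) = int n + 1" using h(1) by auto
      have e: "int a - 2 - dg a j + (int (n + 1 - a) - 2 - dg (n + 1 - a) k) = int n - 3 - (dg a j + dg (n + 1 - a) k)"
        using iab by linarith
      show "?z a S j k \<in> gr Q n (dg a j + dg (n + 1 - a) k)"
        using cmp1_in[OF a1 q_in[OF h(3) refl] q_in[OF h(4) refl]] up[OF h(2)] unfolding ab by (rule act_in)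
      show "?Y a S j k \<in> gr W n (int n - 3 - (dg a j + dg (n + 1 - a) k))"
        using SD.F.cmp_in[OF order_refl a1 G_in G_in, of j "n + 1 - a" k] up[OF h(2)] unfolding ab e by (rule SD.F.act_in)
    qed
    have D2e: "?D2 i = (\<Sum>a\<in>{1..n + 1}. \<Sum>S\<in>?I a. \<Sum>j<m a. \<Sum>k<m (n + 1 - a).
        if dg n i = dg a j + dg (n + 1 - a) k then fscl (?s a S j k * de n i (?z a S j k)) (?Y a S j k) else 0)" for i
    proof -
      have e: "int n - 2 + - dg n i = int n - 2 - dg n i" "int n - 3 + - dg n i = int n - 3 - dg n i" "- (- dg n i) = dg n i" by simp_all
      have "?D2 i = (\<Sum>a\<in>{1..n + 1}. \<Sum>S\<in>?I a. \<Sum>j<m a. \<Sum>k<m (n + 1 - a). if dg a j + dg (n + 1 - a) k = dg n i then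
        fscl (of_int (sign (unshuffle n S)) * (ksign (int a + int (n + 1 - a) * dg a j + dg a j * dg (n + 1 - a) k) *
            de n i (act Q n (dg n i) (unshuffle n S) (cmp Q a (dg a j) (n + 1 - a) (dg (n + 1 - a) k) 1 (q a j) (q (n + 1 - a) k)))))
          (act W n (int n - 3 - dg n i) (unshuffle n S) (cmp W a (int a - 2 - dg a j) (n + 1 - a) (int (n + 1 - a) - 2 - dg (n + 1 - a) k) 1
            (G a j) (G (n + 1 - a) k))) else 0)"
        using d2_U[OF di[of i]] unfolding e .
      also have "\<dots> = (\<Sum>a\<in>{1..n + 1}. \<Sum>S\<in>?I a. \<Sum>j<m a. \<Sum>k<m (n + 1 - a).
        if dg n i = dg a j + dg (n + 1 - a) k then fscl (?s a S j k * de n i (?z a S j k)) (?Y a S j k) else 0)"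
      proof (intro sum.cong refl)
        fix a S j k
        let ?d = "dg a j + dg (n + 1 - a) k"
        show "(if ?d = dg n i then
        fscl (of_int (sign (unshuffle n S)) * (ksign (int a + int (n + 1 - a) * dg a j + dg a j * dg (n + 1 - a) k) *
            de n i (act Q n (dg n i) (unshuffle n S) (cmp Q a (dg a j) (n + 1 - a) (dg (n + 1 - a) k) 1 (q a j) (q (n + 1 - a) k)))))
          (act W n (int n - 3 - dg n i) (unshuffle n S) (cmp W a (int a - 2 - dg a j) (n + 1 - a) (int (n + 1 - a) - 2 - dg (n + 1 - a) k) 1
            (G a j) (G (n + 1 - a) k))) else 0) =
          (if dg n i = ?d then fscl (?s a S j k * de n i (?z a S j k)) (?Y a S j k) else 0)"
        proof (cases "dg n i = ?d")
          case True
          show ?thesis unfolding True by (simp only: if_True mult.assoc)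
        next
          case False
          show ?thesis using False False[symmetric] by (simp only: if_False)
        qed
      qed
      finally show ?thesis .
    qed
    let ?V = "\<lambda>i a S j k. if dg n i = dg a j + dg (n + 1 - a) k then fscl (?s a S j k * de n i (?z a S j k)) (?Y a S j k) else 0"
    let ?Z = "\<lambda>i a S j k. fscl (ksign (int n * dg n i + dg n i)) (pure P n W n (dg n i) (p n i) (int n - 3 - dg n i) (?V i a S j k))"
    have Vin: "?V i a S j k \<in> gr W n (int n - 3 - dg n i)"
      if h: "a \<in> {1..n + 1}" "S \<in> ?I a" "j < m a" "k < m (n + 1 - a)" for i a S j k
    proof (cases "dg n i = dg a j + dg (n + 1 - a) k")
      case True
      then show ?thesis using SD.F.gr_scl[OF Yin[OF h], unfolded W_scl] by (simp only: if_True HOL.simp_thms)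
    next
      case False
      then show ?thesis using SD.F.gr_zero by (simp only: if_False HOL.simp_thms)
    qed
    have "(\<Sum>i<m n. fscl (ksign (int n * dg n i + dg n i)) (pure P n W n (dg n i) (p n i) (int n - 3 - dg n i) (?D2 i))) =
      (\<Sum>i<m n. \<Sum>a\<in>{1..n + 1}. \<Sum>S\<in>?I a. \<Sum>j<m a. \<Sum>k<m (n + 1 - a). ?Z i a S j k)"
    proof (rule sum.cong[OF refl])
      fix i assume "i \<in> {..<m n}"
      then have i: "i < m n" by simp
      note ls = SD.F.lin_sum[OF PW.pure_lin_right[OF p_in[OF i]]]
      have 1: "pure P n W n (dg n i) (p n i) (int n - 3 - dg n i) (\<Sum>k<m (n + 1 - a). ?V i a S j k) =
        (\<Sum>k<m (n + 1 - a). pure P n W n (dg n i) (p n i) (int n - 3 - dg n i) (?V i a S j k))"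
        if "a \<in> {1..n + 1}" "S \<in> ?I a" "j < m a" for a S j
        by (rule ls, rule Vin) (use that in auto)
      have 2: "pure P n W n (dg n i) (p n i) (int n - 3 - dg n i) (\<Sum>j<m a. \<Sum>k<m (n + 1 - a). ?V i a S j k) =
        (\<Sum>j<m a. \<Sum>k<m (n + 1 - a). pure P n W n (dg n i) (p n i) (int n - 3 - dg n i) (?V i a S j k))"
        if "a \<in> {1..n + 1}" "S \<in> ?I a" for a S
        by (subst ls) (use that 1 in \<open>auto intro!: SD.F.gr_sum Vin sum.cong\<close>)
      have 3: "pure P n W n (dg n i) (p n i) (int n - 3 - dg n i) (\<Sum>S\<in>?I a. \<Sum>j<m a. \<Sum>k<m (n + 1 - a). ?V i a S j k) =
        (\<Sum>S\<in>?I a. \<Sum>j<m a. \<Sum>k<m (n + 1 - a). pure P n W n (dg n i) (p n i) (int n - 3 - dg n i) (?V i a S j k))"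
        if "a \<in> {1..n + 1}" for a
        by (subst ls) (use that 2 in \<open>auto intro!: SD.F.gr_sum Vin sum.cong\<close>)
      have 4: "pure P n W n (dg n i) (p n i) (int n - 3 - dg n i) (?D2 i) =
        (\<Sum>a\<in>{1..n + 1}. \<Sum>S\<in>?I a. \<Sum>j<m a. \<Sum>k<m (n + 1 - a). pure P n W n (dg n i) (p n i) (int n - 3 - dg n i) (?V i a S j k))"
        unfolding D2e by (subst ls) (use 3 in \<open>auto intro!: SD.F.gr_sum Vin sum.cong\<close>)
      show "fscl (ksign (int n * dg n i + dg n i)) (pure P n W n (dg n i) (p n i) (int n - 3 - dg n i) (?D2 i)) =
        (\<Sum>a\<in>{1..n + 1}. \<Sum>S\<in>?I a. \<Sum>j<m a. \<Sum>k<m (n + 1 - a). ?Z i a S j k)"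
        unfolding 4 fs.scale_sum_right ..
    qed
    \<comment> \<open>The sum over the basis of \<open>Q(n)\<close> is moved to the innermost
      position, where it can be contracted for each fixed composite.\<close>
    also have "\<dots> = (\<Sum>a\<in>{1..n + 1}. \<Sum>i<m n. \<Sum>S\<in>?I a. \<Sum>j<m a. \<Sum>k<m (n + 1 - a). ?Z i a S j k)"
      by (rule sum.swap)
    also have "\<dots> = (\<Sum>a\<in>{1..n + 1}. \<Sum>S\<in>?I a. \<Sum>i<m n. \<Sum>j<m a. \<Sum>k<m (n + 1 - a). ?Z i a S j k)"
      by (intro sum.cong refl sum.swap)
    also have "\<dots> = (\<Sum>a\<in>{1..n + 1}. \<Sum>S\<in>?I a. \<Sum>j<m a. \<Sum>i<m n. \<Sum>k<m (n + 1 - a). ?Z i a S j k)"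
      by (intro sum.cong refl sum.swap)
    also have "\<dots> = (\<Sum>a\<in>{1..n + 1}. \<Sum>S\<in>?I a. \<Sum>j<m a. \<Sum>k<m (n + 1 - a). \<Sum>i<m n. ?Z i a S j k)"
      by (intro sum.cong refl sum.swap)
    also have "\<dots> = (\<Sum>a\<in>{1..n + 1}. \<Sum>S\<in>?I a. \<Sum>j<m a. \<Sum>k<m (n + 1 - a).
      fscl (ksign (int n * (dg a j + dg (n + 1 - a) k) + (dg a j + dg (n + 1 - a) k)) * ?s a S j k)
        (pure P n W n (dg a j + dg (n + 1 - a) k) (\<Psi> n (dg a j + dg (n + 1 - a) k) (?z a S j k)) (int n - 3 - (dg a j + dg (n + 1 - a) k)) (?Y a S j k)))"
    proof (intro sum.cong refl)
      fix a S j k assume "a \<in> {1..n + 1}" "S \<in> ?I a" "j \<in> {..<m a}" "k \<in> {..<m (n + 1 - a)}"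
      then have h: "a \<in> {1..n + 1}" "S \<in> ?I a" "j < m a" "k < m (n + 1 - a)" by simp_all
      let ?d = "dg a j + dg (n + 1 - a) k"
      have "(\<Sum>i<m n. ?Z i a S j k) = (\<Sum>i<m n. if dg n i = ?d then fscl (de n i (?z a S j k))
          (fscl (ksign (int n * ?d + ?d) * ?s a S j k) (pure P n W n ?d (\<Psi> n ?d (q n i)) (int n - 3 - ?d) (?Y a S j k))) else 0)"
      proof (rule sum.cong[OF refl])
        fix i assume "i \<in> {..<m n}"
        then have i: "i < m n" by simp
        show "?Z i a S j k = (if dg n i = ?d then fscl (de n i (?z a S j k))
          (fscl (ksign (int n * ?d + ?d) * ?s a S j k) (pure P n W n ?d (\<Psi> n ?d (q n i)) (int n - 3 - ?d) (?Y a S j k))) else 0)"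
        proof (cases "dg n i = ?d")
          case True
          have pi: "\<Psi> n ?d (q n i) \<in> gr P n ?d" using p_in[OF i] True by simp
          show ?thesis using PW.pure_scl(2)[OF pi Yin[OF h], unfolded W_scl] unfolding True
            by (simp only: if_True fs.scale_scale ac_simps HOL.simp_thms)
        next
          case False
          then show ?thesis using SD.F.lin_zero[OF PW.pure_lin_right[OF p_in[OF i]]] by simp
        qed
      qed
      \<comment> \<open>The sum over \<open>i\<close> is the basis expansion of the composite
        \<open>?z a S j k\<close>, seen through a linear map that involves \<Psi>.\<close>
      also have "\<dots> = fscl (ksign (int n * ?d + ?d) * ?s a S j k) (pure P n W n ?d (\<Psi> n ?d (?z a S j k)) (int n - 3 - ?d) (?Y a S j k))"
        by (rule lin_expand[symmetric, OF linmap_fun_fscl[OF PW.pure_lin_left'[OF psi(1) Yin[OF h]]] zin[OF h]])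
      finally show "(\<Sum>i<m n. ?Z i a S j k) = \<dots>" .
    qed
    also have "\<dots> = (\<Sum>a\<in>{1..n + 1}. \<Sum>S\<in>?I a. fscl (of_int (sign (unshuffle n S)) * ksign (int a))
      (act H n (int n - 3) (unshuffle n S) (cmp H a (int a - 2) (n + 1 - a) (int (n + 1 - a) - 2) 1 (X a) (X (n + 1 - a)))))"
    proof (intro sum.cong refl)
      fix a S assume a: "a \<in> {1..n + 1}" and S: "S \<in> ?I a"
      define b where "b = n + 1 - a"
      have nab: "int n = int a + int b - 1" using a by (auto simp: b_def)
      \<comment> \<open>The choice of sign in \<open>X\<close> is decisive here: with n = a + b - 1
        the exponent (n+1)(x+y) has the parity of (a+b)(x+y). Its terms \<open>b * x\<close> cancel
        against d_2, and those left are the exponents of \<open>cmp_X\<close> together with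
        \<open>a\<close>.\<close>
      have k: "ksign (int n * (x + y) + (x + y)) * (of_int (sign (unshuffle n S)) * ksign (int a + int b * x + x * y)) =
        (of_int (sign (unshuffle n S)) * ksign (int a) * (ksign (int a * x) * ksign (int b * y) * ksign ((int a - 2 - x) * y)) :: 'k)" for x y
        unfolding nab by (auto simp: ksign_def)
      show "(\<Sum>j<m a. \<Sum>k<m (n + 1 - a).
      fscl (ksign (int n * (dg a j + dg (n + 1 - a) k) + (dg a j + dg (n + 1 - a) k)) * ?s a S j k)
        (pure P n W n (dg a j + dg (n + 1 - a) k) (\<Psi> n (dg a j + dg (n + 1 - a) k) (?z a S j k)) (int n - 3 - (dg a j + dg (n + 1 - a) k)) (?Y a S j k))) =
        fscl (of_int (sign (unshuffle n S)) * ksign (int a))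
      (act H n (int n - 3) (unshuffle n S) (cmp H a (int a - 2) (n + 1 - a) (int (n + 1 - a) - 2) 1 (X a) (X (n + 1 - a))))"
        unfolding b_def[symmetric] cmp_X[OF n a up[OF S] b_def] fs.scale_sum_right fs.scale_scale k ..
    qed
    finally show ?thesis .
  qed
  finally show ?thesis .
qed

end

section \<open>The operad of homotopy Lie algebras\<close>

interpretation Cm: based_op "Com :: ('k::field, 'k) dgop" "\<lambda>n. if 1 \<le> n then 1 else 0" "\<lambda>n i. 1" "\<lambda>n i. 0" std_aug
  by (rule based_op_Com)

lemma L_infinity_eq: "L_infinity = Cm.W"
  by (simp add: L_infinity_def)

lemma id_dual_Com: "1 \<le> n \<Longrightarrow> (\<lambda>x. x) \<in> gr (dual_smod Com) n 0"
  by (rule gr_dualI) (simp_all add: linmap_def)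

lemma gr_dual_Com: "f \<in> gr (dual_smod Com) n d \<Longrightarrow> f = (\<lambda>x. if 1 \<le> n \<and> d = 0 then f 1 * x else 0)"
proof
  fix x assume f: "f \<in> gr (dual_smod Com) n d"
  have l: "linmap (*) (*) (gr Com n (- d)) UNIV f" using gr_dualD(1)[OF f] by simp
  show "f x = (if 1 \<le> n \<and> d = 0 then f 1 * x else 0)"
  proof (cases "1 \<le> n \<and> d = 0")
    case True
    then show ?thesis using linmapD(3)[OF l, of 1 x] by simp
  next
    case False
    have "f 0 = 0" using Cm.lin_zero[of "(*)" n "- d" UNIV f] l by simp
    moreover have "f x = 0" if "x \<noteq> 0" using gr_dualD(2)[OF f, of x] that False by auto
    ultimately show ?thesis using False by auto
  qed
qed

lemma Cm_de: "1 \<le> n \<Longrightarrow> Cm.de n 0 = (\<lambda>x. x :: 'k::field)"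
proof
  fix y :: 'k assume n: "1 \<le> n"
  have d: "Cm.de n 0 \<in> gr (dual_smod (Com :: ('k, 'k) dgop)) n 0" by (rule Cm.de_in) simp
  have "Cm.de n 0 (1 :: 'k) = 1" using n by (subst Cm.de_q) simp_all
  then show "Cm.de n 0 y = y" using fun_cong[OF gr_dual_Com[OF d], of y] n by simp
qed

definition gen_L :: "nat \<Rightarrow> ('k::field, 'k) suspdual" where
  "gen_L n = Cm.U n 0 (\<lambda>x. x)"

text \<open>The coordinate on the line spanned by \<open>gen_L n\<close>; the sign undoes the
  normalization of S_n^{-1}, so that \<open>gen_L n\<close> has coordinate one.\<close>

definition coord_L :: "nat \<Rightarrow> ('k::field, 'k) suspdual \<Rightarrow> 'k" where
  "coord_L n = lext (*) (\<lambda>((i, u), (j, w)).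
     if i = int n - 1 \<and> j = 0 then ksign (int (n * (n - 1) div 2)) * u 1 * w 1 else 0)"

lemma coord_L_linear [simp]: "coord_L n (x + y) = coord_L n x + coord_L n y" "coord_L n (fscl c x) = c * coord_L n x"
  "coord_L n 0 = 0"
  by (simp_all add: coord_L_def lext_zero)

lemma coord_L_pure:
  assumes "u \<in> gr susp_coop n i" "w \<in> gr (dual_coop Com std_aug) n j"
  shows "coord_L n (pure susp_coop n (dual_coop Com std_aug) n i u j w) =
    (if i = int n - 1 \<and> j = 0 then ksign (int (n * (n - 1) div 2)) * u 1 * w 1 else 0)"
  unfolding coord_L_def
proof (subst Cm.HP.CD.lext_pure[OF vector_space_times])
  show "bilin (scl susp_coop) (gr susp_coop n) (scl (dual_coop Com std_aug)) (gr (dual_coop Com std_aug) n) (*) (i + j)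
    (\<lambda>((i, u), (j, w)). if i = int n - 1 \<and> j = 0 then ksign (int (n * (n - 1) div 2)) * u 1 * w 1 else 0)"
  proof (rule bilinI, goal_cases)
    case (1 ia ja x)
    show ?case
      by (cases "ia = int n - 1 \<and> ja = 0", simp_all only: prod.case if_True if_False)
        (simp_all add: linmap_def susp_coop_def distrib_left distrib_right mult.left_commute)
  next
    case (2 ia ja x)
    show ?case
      by (cases "ia = int n - 1 \<and> ja = 0", simp_all only: prod.case if_True if_False)
        (simp_all add: linmap_def susp_coop_def distrib_left distrib_right mult.left_commute)
  qed
qed simp

lemma coord_gen_L: "1 \<le> n \<Longrightarrow> coord_L n (gen_L n) = 1"
  unfolding gen_L_def Cm.U_def
  by (subst coord_L_pure[OF susp_in]) (simp_all add: id_dual_Com susp_elt_def)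

text \<open>Both tensor factors are at most one-dimensional in each arity, concentrated in degrees n
  - 1 and 0; a pure tensor of other degrees is zero.\<close>

lemma SQ_Com_coord:
  fixes x :: "('k::field, 'k) suspdual"
  assumes "x \<in> gr Cm.SQ n d"
  shows "x = (if 1 \<le> n \<and> d = int n - 1 then fscl (coord_L n x) (gen_L n) else 0)"
proof (rule Cm.HP.CD.tgr_ext1[where f = "\<lambda>x. x" and g = "\<lambda>x. if 1 \<le> n \<and> d = int n - 1 then fscl (coord_L n x) (gen_L n) else 0"])
  show "x \<in> tgr susp_coop n (dual_coop Com std_aug) n d" using assms by (simp only: Cm.SQ_simps)
  show "additive_hom (\<lambda>x. x :: ('k, 'k) suspdual)"
    "additive_hom (\<lambda>x. if 1 \<le> n \<and> d = int n - 1 then fscl (coord_L n x) (gen_L n) else 0)"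
    by (simp add: additive_hom_def, cases "1 \<le> n \<and> d = int n - 1", simp_all only: if_True if_False)
      (simp_all add: additive_hom_def fs.scale_left_distrib)
  fix i j and u w :: "'k \<Rightarrow> 'k" assume u: "u \<in> gr susp_coop n i" and w: "w \<in> gr (dual_coop Com std_aug) n j" and d: "i + j = d"
  let ?P = "pure susp_coop n (dual_coop (Com :: ('k, 'k) dgop) std_aug) n"
  let ?c = "ksign (int (n * (n - 1) div 2)) :: 'k"
  have w': "w \<in> gr (dual_smod Com) n j" using w by simp
  note eu = gr_susp[OF u] and ew = gr_dual_Com[OF w']
  show "?P i u j w = (if 1 \<le> n \<and> d = int n - 1 then fscl (coord_L n (?P i u j w)) (gen_L n) else 0)"
  proof (cases "1 \<le> n \<and> i = int n - 1 \<and> j = 0")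
    case True
    then have n: "1 \<le> n" and i: "i = int n - 1" and j: "j = 0" by auto
    have idg: "(\<lambda>x. x) \<in> gr (dual_coop Com std_aug) n 0" using id_dual_Com[OF n] by simp
    \<comment> \<open>\<open>susp_elt n\<close> is \<open>?c\<close> times the identity and
      \<open>?c\<close> is its own inverse, whence the factor \<open>?c\<close> in the
      scalar.\<close>
    have u2: "u = scl susp_coop (?c * u 1) (susp_elt n)"
    proof
      fix x
      have "u x = u 1 * x" using fun_cong[OF eu, of x] i by simp
      moreover have "?c * u 1 * (?c * x) = (?c * ?c) * (u 1 * x)" by (simp only: ac_simps)
      moreover have "scl susp_coop (?c * u 1) (susp_elt n) x = ?c * u 1 * (?c * x)"
        by (simp add: susp_coop_def susp_elt_def)
      ultimately show "u x = scl susp_coop (?c * u 1) (susp_elt n) x" by simp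
    qed
    have w2: "w = scl (dual_coop Com std_aug) (w 1) (\<lambda>x. x)"
    proof
      fix x show "w x = scl (dual_coop Com std_aug) (w 1) (\<lambda>x. x) x" using fun_cong[OF ew, of x] n j by simp
    qed
    have "?P i u j w = ?P (int n - 1) (scl susp_coop (?c * u 1) (susp_elt n)) 0 (scl (dual_coop Com std_aug) (w 1) (\<lambda>x. x))"
      unfolding i j by (rule arg_cong2[OF u2 w2])
    also have "\<dots> = fscl (?c * u 1) (fscl (w 1) (gen_L n))"
      unfolding gen_L_def Cm.U_def Cm.HP.CD.pure_scl(1)[OF susp_in Cm.HP.D.gr_scl[OF idg]] Cm.HP.CD.pure_scl(2)[OF susp_in idg] ..
    also have "\<dots> = (if 1 \<le> n \<and> d = int n - 1 then fscl (coord_L n (?P i u j w)) (gen_L n) else 0)"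
      unfolding coord_L_pure[OF u w] using n i j d by simp
    finally show ?thesis .
  next
    case False
    have "?P i u j w = 0"
    proof (cases "i = int n - 1")
      case True
      then have "w = 0" using ew False by auto
      then show ?thesis using Cm.HP.D.lin_zero[OF Cm.HP.CD.pure_lin_right[OF u]] by simp
    next
      case False
      then have u0: "u = (\<lambda>x. 0)" using eu by auto
      have "scl susp_coop 0 u = u" unfolding u0 by (simp add: susp_coop_def)
      then show ?thesis using linmapD(3)[OF Cm.HP.CD.pure_lin_left[OF w] u, of 0] by simp
    qed
    moreover have "1 \<le> n \<and> d = int n - 1 \<Longrightarrow> coord_L n (?P i u j w) = 0"
      using calculation by simp
    ultimately show ?thesis by simp
  qed
qed

text \<open>In arity one the counit takes the value one on \<open>gen_L 1\<close>, so the coideal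
  vanishes there and generators exist only from arity two on.\<close>

lemma E_Com_coord:
  fixes x :: "('k::field, 'k) suspdual"
  assumes x: "x \<in> gr Cm.SD.E n d"
  shows "x = (if 2 \<le> n \<and> d = int n - 2 then fscl (coord_L n x) (gen_L n) else 0)"
proof -
  have e: "x = (if 1 \<le> n \<and> d + 1 = int n - 1 then fscl (coord_L n x) (gen_L n) else 0)"
    by (rule SQ_Com_coord[OF Cm.SD.gr_ED[OF x]])
  show ?thesis
  proof (cases "n = 1 \<and> d = - 1")
    case True
    then have n: "n = 1" and d: "d = - 1" by auto
    have g: "gen_L 1 \<in> gr Cm.SQ 1 0" using Cm.U_in[OF id_dual_Com[of 1]] by (simp add: gen_L_def)
    have "x = fscl (coord_L 1 x) (gen_L 1)" using e n d by simp
    moreover have "counit Cm.SQ x = 0" using x n d by (simp add: Cm.SD.gr_E)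
    ultimately have "counit Cm.SQ (scl Cm.SQ (coord_L 1 x) (gen_L 1)) = 0" by (simp only: Cm.SQ_simps)
    then have "coord_L 1 x * counit Cm.SQ (gen_L 1) = 0"
      unfolding linmapD(3)[OF Cm.SD.counit_lin g] .
    moreover have "counit Cm.SQ (gen_L 1 :: ('k, 'k) suspdual) = 1"
      unfolding gen_L_def by (subst Cm.U_counit[OF id_dual_Com]) simp_all
    ultimately have "coord_L 1 x = 0" by simp
    then show ?thesis using e n d by simp
  next
    case False
    have "2 \<le> n \<and> d = int n - 2 \<longleftrightarrow> 1 \<le> n \<and> d + 1 = int n - 1" using False by auto
    then show ?thesis using e by simp
  qed
qed

lemma ell_cls: "ell n = cls Cm.SD.E (Gen n (int n - 2) (gen_L n))"
  by (simp add: ell_def Cm.susp_gen_cls gen_L_def)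

lemma gen_L_in: "2 \<le> n \<Longrightarrow> gen_L n \<in> gr Cm.SD.E n (int n - 2)"
  using Cm.U_in_E[OF id_dual_Com, of n] by (simp add: gen_L_def)

lemma ell_in: "2 \<le> n \<Longrightarrow> ell n \<in> gr L_infinity n (int n - 2)"
  unfolding ell_cls L_infinity_eq by (rule linmapD(1)[OF Cm.SD.gen_lin gen_L_in])

lemma gen_cls_coord:
  fixes x :: "('k::field, 'k) suspdual"
  assumes x: "x \<in> gr Cm.SD.E n d"
  shows "cls Cm.SD.E (Gen n d x) = (if 2 \<le> n \<and> d = int n - 2 then fscl (coord_L n x) (ell n) else 0)"
proof (cases "2 \<le> n \<and> d = int n - 2")
  case True
  then have "x = fscl (coord_L n x) (gen_L n)" using E_Com_coord[OF x] by simp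
  then have "cls Cm.SD.E (Gen n d x) = cls Cm.SD.E (Gen n d (scl Cm.SQ (coord_L n x) (gen_L n)))" by (simp add: Cm.SQ_simps)
  also have "\<dots> = fscl (coord_L n x) (ell n)"
    unfolding ell_cls using linmapD(3)[OF Cm.SD.gen_lin gen_L_in, of n] True by simp
  finally show ?thesis using True by simp
next
  case False
  then have x0: "x = 0" using E_Com_coord[OF x] by (simp only: if_False)
  have "cls Cm.SD.E (Gen n d x) = 0"
    unfolding x0 by (rule Cm.SD.E.lin_zero[OF Cm.SD.gen_lin[unfolded Cm.SD.E_simps(1)[symmetric]]])
  then show ?thesis unfolding if_not_P[OF False] .
qed

text \<open>The class of any generator is a multiple of some \<open>ell n\<close> with n at least 2,
  or zero; morphisms out of the free operad are determined by these classes.\<close>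

lemma L_hom_unique:
  fixes H :: "('k::field, 'h::ab_group_add) dgop"
  assumes "gop H" "graded_operad_hom L_infinity H f" "graded_operad_hom L_infinity H g"
    and ell: "\<And>n. 2 \<le> n \<Longrightarrow> f n (int n - 2) (ell n) = g n (int n - 2) (ell n)"
  shows "fam_eq_on L_infinity f g"
  unfolding L_infinity_eq Cm.SD.F_eq
proof (rule Cm.SD.FE.free_hom_unique[OF assms(1)])
  note f = assms(2)[unfolded L_infinity_eq Cm.SD.F_eq] and g = assms(3)[unfolded L_infinity_eq Cm.SD.F_eq]
  show "graded_operad_hom (quasi_free Cm.SD.E (\<lambda>n d c. cobar_d1 Cm.SQ n d c + cobar_d2 Cm.SQ n d c)) H f" by (rule f)
  show "graded_operad_hom (quasi_free Cm.SD.E (\<lambda>n d c. cobar_d1 Cm.SQ n d c + cobar_d2 Cm.SQ n d c)) H g" by (rule g)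
  note fl = ghomD(1)[OF assms(2)] and gl = ghomD(1)[OF assms(3)]
  have s: "scl L_infinity = (fscl :: 'k \<Rightarrow> _)" unfolding L_infinity_eq by (rule Cm.SD.F_simps(1))
  fix n d and x :: "('k, 'k) suspdual" assume "x \<in> gr Cm.SD.E n d"
  note c = gen_cls_coord[OF this]
  show "f n d (cls Cm.SD.E (Gen n d x)) = g n d (cls Cm.SD.E (Gen n d x))"
  proof (cases "2 \<le> n \<and> d = int n - 2")
    case True
    then have n: "2 \<le> n" and d: "d = int n - 2" by auto
    show ?thesis unfolding c using linmapD(3)[OF fl ell_in[OF n]] linmapD(3)[OF gl ell_in[OF n]] ell[OF n] n d by (simp add: s)
  next
    case False
    have "f n d 0 = 0" "g n d 0 = 0"
      using Cm.SD.F.lin_zero fl[unfolded L_infinity_eq] gl[unfolded L_infinity_eq] by blast+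
    then show ?thesis unfolding c if_not_P[OF False] by simp
  qed
qed

definition \<Gamma>_L :: "nat \<Rightarrow> (('k::field, 'k) suspdual oterm \<Rightarrow>\<^sub>0 'k)" where
  "\<Gamma>_L a = Cm.\<Gamma> a 0 (\<lambda>x. x)"

lemma \<Gamma>_L_ell: "a \<noteq> 1 \<Longrightarrow> \<Gamma>_L a = ell a"
  unfolding \<Gamma>_L_def ell_def by (rule Cm.susp_gen_\<Gamma>[symmetric])

text \<open>For \<open>Com\<close> the identity functional in arity one is the coaugmentation
  itself.\<close>

lemma \<Gamma>_L_1: "\<Gamma>_L 1 = (0 :: ('k::field, 'k) suspdual oterm \<Rightarrow>\<^sub>0 'k)"
proof -
  have c: "(\<lambda>x. x :: 'k) = coaug Cm.DQ" by (simp add: std_aug_def fun_eq_iff)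
  show ?thesis unfolding \<Gamma>_L_def c by (rule Cm.\<Gamma>_coaug)
qed

text \<open>The instance of \<open>d2_U\<close> for \<open>Com\<close>: all basis elements have
  degree zero, so the Koszul signs disappear and sgn (-1)^a is left. The condition on
  \<open>n + 1 - a\<close> reflects that \<open>Com\<close> is zero in arity zero.\<close>

lemma dif_ell:
  assumes n: "2 \<le> n"
  shows "dif L_infinity n (int n - 2) (ell n :: _ \<Rightarrow>\<^sub>0 'k::field) =
    (\<Sum>a\<in>{1..n + 1}. \<Sum>S\<in>{S. S \<subseteq> {1..n} \<and> card S = n + 1 - a}. if 1 \<le> n + 1 - a then
      fscl (of_int (sign (unshuffle n S)) * ksign (int a)) (act L_infinity n (int n - 3) (unshuffle n S)
        (cmp L_infinity a (int a - 2) (n + 1 - a) (int (n + 1 - a) - 2) 1 (\<Gamma>_L a) (\<Gamma>_L (n + 1 - a)))) else 0)"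
proof -
  have i: "(\<lambda>x. x :: 'k) \<in> gr (dual_smod Com) n 0" by (rule id_dual_Com) (use n in simp)
  have n1: "n \<noteq> 1" using n by simp
  have df: "dif (dual_smod Com) n 0 (\<lambda>x. x :: 'k) = 0" by (simp add: dif_dual fun_eq_iff)
  have g0: "Cm.\<Gamma> n (0 - 1) 0 = 0" by (rule Cm.Dual.lin_zero[OF Cm.\<Gamma>_lin])
  have "dif L_infinity n (int n - 2) (ell n :: _ \<Rightarrow>\<^sub>0 'k) = Cm.SD.d2 n (int n - 2) (Cm.U n 0 (\<lambda>x. x))"
    using Cm.dif_\<Gamma>[OF i n] unfolding df g0 \<Gamma>_L_def[symmetric] \<Gamma>_L_ell[OF n1] L_infinity_eq by simp
  also have "\<dots> = (\<Sum>a\<in>{1..n + 1}. \<Sum>S\<in>{S. S \<subseteq> {1..n} \<and> card S = n + 1 - a}. if 1 \<le> n + 1 - a then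
      fscl (of_int (sign (unshuffle n S)) * ksign (int a)) (act L_infinity n (int n - 3) (unshuffle n S)
        (cmp L_infinity a (int a - 2) (n + 1 - a) (int (n + 1 - a) - 2) 1 (\<Gamma>_L a) (\<Gamma>_L (n + 1 - a)))) else 0)"
  proof -
    have one: "(\<Sum>j<(if 1 \<le> a then 1 else 0). F j) = (if 1 \<le> a then F 0 else 0)" for a :: nat and F :: "nat \<Rightarrow> ('k, 'k) suspdual oterm \<Rightarrow>\<^sub>0 'k"
      by (simp add: lessThan_Suc One_nat_def)
    have e: "int n - 2 + 0 = int n - 2" "int n - 3 + 0 = int n - 3" by simp_all
    show ?thesis
      using Cm.d2_U[OF i] unfolding one e
    proof (rule trans, intro sum.cong refl)
      fix a S assume a: "a \<in> {1..n + 1}"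
      then have a1: "1 \<le> a" by simp
      show "(if 1 \<le> a then if 1 \<le> n + 1 - a then if (0::int) + 0 = - 0 then
         fscl (of_int (sign (unshuffle n S)) * (ksign (int a + int (n + 1 - a) * 0 + 0 * 0) *
            act Com n (- 0) (unshuffle n S) (cmp Com a 0 (n + 1 - a) 0 1 1 1)))
          (act Cm.W n (int n - 3) (unshuffle n S) (cmp Cm.W a (int a - 2 - 0) (n + 1 - a) (int (n + 1 - a) - 2 - 0) 1
            (Cm.\<Gamma> a (- 0) (Cm.de a 0)) (Cm.\<Gamma> (n + 1 - a) (- 0) (Cm.de (n + 1 - a) 0)))) else 0 else 0 else 0) =
        (if 1 \<le> n + 1 - a then
      fscl (of_int (sign (unshuffle n S)) * ksign (int a)) (act L_infinity n (int n - 3) (unshuffle n S)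
        (cmp L_infinity a (int a - 2) (n + 1 - a) (int (n + 1 - a) - 2) 1 (\<Gamma>_L a) (\<Gamma>_L (n + 1 - a)))) else 0)"
      proof (cases "1 \<le> n + 1 - a")
        case True
        show ?thesis unfolding Cm_de[OF a1] Cm_de[OF True] \<Gamma>_L_def L_infinity_eq using a1 True by simp
      qed simp
    qed
  qed
  finally show ?thesis .
qed

section \<open>Existence, uniqueness and the differential of M\<close>

context twist
begin

lemma is_M_iff: "is_M P Q \<epsilon> m q dg \<Psi> M \<longleftrightarrow>
  graded_operad_hom L_infinity H M \<and> (\<forall>n\<ge>2. M n (int n - 2) (ell n) = X n)"
proof -
  have "(\<Sum>i<m n. fscl (ksign (int n * dg n i)) (pure P n W n (dg n i) (p n i) (int n - 2 - dg n i) (susp_gen Q \<epsilon> n (- dg n i) (de n i)))) = X n"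
    if "2 \<le> n" for n
    unfolding X_def using susp_gen_\<Gamma>[of n] that by (intro sum.cong) auto
  then show ?thesis unfolding is_M_def by auto
qed

definition gen_M :: "nat \<Rightarrow> int \<Rightarrow> ('k, 'k) suspdual \<Rightarrow> (('p, ('k, 'q) suspdual oterm \<Rightarrow>\<^sub>0 'k) tkey \<Rightarrow>\<^sub>0 'k)" where
  "gen_M n d x = (if 2 \<le> n \<and> d = int n - 2 then fscl (coord_L n x) (X n) else 0)"

text \<open>By the universal property the values on generators only have to be linear and
  equivariant. Equivariance holds because \<open>gen_L n\<close> and \<open>X n\<close> both
  transform by the sign of the permutation.\<close>

lemma ex_M: "\<exists>M. is_M P Q \<epsilon> m q dg \<Psi> M"
proof -
  have XI: "X n \<in> tgr P n W n (int n - 2)" for n using X_in by simp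
  have sX: "fscl c (X n) \<in> tgr P n W n (int n - 2)" for c n
    using fs.subspace_scale[OF PW.tgr_subspace XI] .
  interpret L: free_ext Cm.SD.E H gen_M
  proof unfold_locales
    show "linmap (scl Cm.SD.E) (scl H) (gr Cm.SD.E n d) (gr H n d) (gen_M n d)" for n d
    proof (cases "2 \<le> n \<and> d = int n - 2")
      case True
      then show ?thesis by (intro linmapI) (simp_all add: gen_M_def Cm.SQ_simps fs.scale_left_distrib sX)
    next
      case False
      have "(0 :: _ \<Rightarrow>\<^sub>0 'k) \<in> gr H n d" by (rule H.gr_zero)
      then show ?thesis unfolding gen_M_def if_not_P[OF False] by (intro linmapI) simp_all
    qed
    show "gen_M n d (act Cm.SD.E n d \<sigma> x) = act H n d \<sigma> (gen_M n d x)"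
      if x: "x \<in> gr Cm.SD.E n d" and s: "\<sigma> permutes {1..n}" for x n d \<sigma>
    proof (cases "2 \<le> n \<and> d = int n - 2")
      case True
      then have n: "2 \<le> n" "1 \<le> n" and d: "d = int n - 2" by auto
      have "x = fscl (coord_L n x) (gen_L n)" using E_Com_coord[OF x] n d by simp
      then have "act Cm.SQ n (d + 1) \<sigma> x = act Cm.SQ n (d + 1) \<sigma> (fscl (coord_L n x) (gen_L n))" by simp
      also have "\<dots> = fscl (coord_L n x) (act Cm.SQ n (d + 1) \<sigma> (gen_L n))"
        by (simp add: Cm.SQ_simps)
      also have "act Cm.SQ n (d + 1) \<sigma> (gen_L n) = fscl (of_int (sign \<sigma>)) (gen_L n :: ('k, 'k) suspdual)"
      proof -
        have a: "act (dual_smod Com) n 0 \<sigma> (\<lambda>x. x :: 'k) = (\<lambda>x. x)" using n by (simp add: act_dual)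
        show ?thesis unfolding gen_L_def Cm.U_act[OF id_dual_Com[OF n(2)] s] by (simp add: a)
      qed
      finally have "coord_L n (act Cm.SQ n (d + 1) \<sigma> x) = coord_L n x * of_int (sign \<sigma>)"
        by (simp add: coord_gen_L[OF n(2)])
      then show ?thesis using n d X_act[OF s, of "int n - 2"] by (simp add: gen_M_def Cm.SD.E_simps)
    next
      case False then show ?thesis unfolding gen_M_def if_not_P[OF False] by simp
    qed
  qed
  have "graded_operad_hom L_infinity H (\<lambda>n d. L.lev)"
    unfolding L_infinity_eq Cm.SD.F_eq by (rule L.lev_hom)
  moreover have "L.lev (ell n) = X n" if "2 \<le> n" for n
    unfolding ell_cls L.lev_cls using that by (simp add: gen_M_def coord_gen_L)
  ultimately show ?thesis using is_M_iff by blast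
qed

lemma unique_M: "is_M P Q \<epsilon> m q dg \<Psi> M \<Longrightarrow> is_M P Q \<epsilon> m q dg \<Psi> M' \<Longrightarrow> fam_eq_on L_infinity M M'"
  unfolding is_M_iff by (intro L_hom_unique[OF H.gop_axioms]) auto

text \<open>\<open>dif_ell\<close> and \<open>dif_X\<close> are compared summand by summand. If both
  arities are at least two, multiplicativity of \<open>M\<close> suffices. Otherwise the source
  summand vanishes, since \<open>\<Gamma>_L 1\<close> is zero and arity zero does not occur, and the
  target summand vanishes by \<open>X_low\<close>.\<close>

lemma M_dg_hom:
  assumes M: "is_M P Q \<epsilon> m q dg \<Psi> M" and low: "low_arity_vanishing Q \<epsilon> \<Psi>" and aug: "augmentation Q \<epsilon>"
  shows "dg_operad_hom L_infinity H M"
proof -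
  have hom: "graded_operad_hom L_infinity H M" and val: "\<And>n. 2 \<le> n \<Longrightarrow> M n (int n - 2) (ell n) = X n"
    using M is_M_iff by auto
  interpret L: predg "L_infinity :: ('k, ('k, 'k) suspdual oterm \<Rightarrow>\<^sub>0 'k) dgop" unfolding L_infinity_eq by (rule Cm.SD.predg_cobar)
  let ?L = "L_infinity :: ('k, ('k, 'k) suspdual oterm \<Rightarrow>\<^sub>0 'k) dgop"
  note h = ghomD[OF hom]
  have s: "scl ?L = fscl" unfolding L_infinity_eq by (rule Cm.SD.F_simps(1))
  have z: "M n d 0 = 0" for n d by (rule L.lin_zero[OF h(1)])
  have main: "M n (int n - 2 - 1) (dif ?L n (int n - 2) (ell n)) = dif H n (int n - 2) (X n)" if n: "2 \<le> n" for n
  proof -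
    let ?I = "\<lambda>a. {S. S \<subseteq> {1..n} \<and> card S = n + 1 - a}"
    have e: "int n - 2 - 1 = int n - 3" by simp
    let ?t = "\<lambda>a S. if 1 \<le> n + 1 - a then
      fscl (of_int (sign (unshuffle n S)) * ksign (int a)) (act ?L n (int n - 3) (unshuffle n S)
        (cmp ?L a (int a - 2) (n + 1 - a) (int (n + 1 - a) - 2) 1 (\<Gamma>_L a) (\<Gamma>_L (n + 1 - a)))) else (0 :: _ \<Rightarrow>\<^sub>0 'k)"
    \<comment> \<open>Membership in the graded piece is proved along with the value, since
      \<open>M\<close> is known to be additive only there.\<close>
    have t: "?t a S \<in> gr ?L n (int n - 3) \<and> M n (int n - 3) (?t a S) = fscl (of_int (sign (unshuffle n S)) * ksign (int a))
      (act H n (int n - 3) (unshuffle n S) (cmp H a (int a - 2) (n + 1 - a) (int (n + 1 - a) - 2) 1 (X a) (X (n + 1 - a))))"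
      if a: "a \<in> {1..n + 1}" and S: "S \<in> ?I a" for a S
    proof -
      define b where "b = n + 1 - a"
      have a1: "1 \<le> a" and ab: "a + b - 1 = n" using a by (auto simp: b_def)
      have u: "unshuffle n S permutes {1..n}" by (rule unshuffle_permutes) (use S in simp)
      let ?c = "of_int (sign (unshuffle n S)) * ksign (int a) :: 'k"
      show ?thesis
        unfolding b_def[symmetric]
      proof (cases "2 \<le> a \<and> 2 \<le> b")
        case True
        then have a2: "2 \<le> a" and b2: "2 \<le> b" and b1: "1 \<le> b" and na: "a \<noteq> 1" and nb: "b \<noteq> 1" by auto
        have ei: "int a - 2 + (int b - 2) = int n - 3" using ab a1 by linarith
        have c: "cmp ?L a (int a - 2) b (int b - 2) 1 (ell a) (ell b) \<in> gr ?L n (int n - 3)"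
          using L.cmp_in[OF order_refl a1 ell_in[OF a2] ell_in[OF b2]] unfolding ab ei .
        have ac: "act ?L n (int n - 3) (unshuffle n S) (cmp ?L a (int a - 2) b (int b - 2) 1 (ell a) (ell b)) \<in> gr ?L n (int n - 3)"
          by (rule L.act_in[OF c u])
        have mc: "M n (int n - 3) (cmp ?L a (int a - 2) b (int b - 2) 1 (ell a) (ell b)) = cmp H a (int a - 2) b (int b - 2) 1 (X a) (X b)"
          using h(4)[OF ell_in[OF a2] ell_in[OF b2] order_refl a1] unfolding ab ei val[OF a2] val[OF b2] .
        have "M n (int n - 3) (fscl ?c (act ?L n (int n - 3) (unshuffle n S) (cmp ?L a (int a - 2) b (int b - 2) 1 (ell a) (ell b)))) =
          fscl ?c (act H n (int n - 3) (unshuffle n S) (cmp H a (int a - 2) b (int b - 2) 1 (X a) (X b)))"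
          using linmapD(3)[OF h(1) ac, of ?c] unfolding h(2)[OF c u] mc s by simp
        then show "(if 1 \<le> b then fscl ?c (act ?L n (int n - 3) (unshuffle n S)
            (cmp ?L a (int a - 2) b (int b - 2) 1 (\<Gamma>_L a) (\<Gamma>_L b))) else (0 :: _ \<Rightarrow>\<^sub>0 'k)) \<in> gr ?L n (int n - 3) \<and>
          M n (int n - 3) (if 1 \<le> b then fscl ?c (act ?L n (int n - 3) (unshuffle n S)
            (cmp ?L a (int a - 2) b (int b - 2) 1 (\<Gamma>_L a) (\<Gamma>_L b))) else 0) =
          fscl ?c (act H n (int n - 3) (unshuffle n S) (cmp H a (int a - 2) b (int b - 2) 1 (X a) (X b)))"
          using L.gr_scl[OF ac, of ?c] unfolding \<Gamma>_L_ell[OF na] \<Gamma>_L_ell[OF nb] if_P[OF b1] s by blast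
      next
        case False
        then have "a \<le> 1 \<or> b \<le> 1" by auto
        then have X0: "cmp H a (int a - 2) b (int b - 2) 1 (X a) (X b) = 0"
          by (intro X_low[OF low aug a1]) (use n ab in auto)
        have R: "fscl ?c (act H n (int n - 3) (unshuffle n S) (cmp H a (int a - 2) b (int b - 2) 1 (X a) (X b))) = 0"
          unfolding X0 by simp
        have L0: "cmp ?L a (int a - 2) b (int b - 2) 1 (\<Gamma>_L a) (\<Gamma>_L b) = (0 :: _ \<Rightarrow>\<^sub>0 'k)" if b: "1 \<le> b"
        proof -
          have "a = 1 \<or> b = 1" using False a1 b by auto
          then show ?thesis unfolding L_infinity_eq by (elim disjE) (simp_all add: \<Gamma>_L_1)
        qed
        have T0: "(if 1 \<le> b then fscl ?c (act ?L n (int n - 3) (unshuffle n S)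
            (cmp ?L a (int a - 2) b (int b - 2) 1 (\<Gamma>_L a) (\<Gamma>_L b))) else (0 :: _ \<Rightarrow>\<^sub>0 'k)) = 0"
          using L0 by (simp add: L_infinity_eq)
        show "(if 1 \<le> b then fscl ?c (act ?L n (int n - 3) (unshuffle n S)
            (cmp ?L a (int a - 2) b (int b - 2) 1 (\<Gamma>_L a) (\<Gamma>_L b))) else (0 :: _ \<Rightarrow>\<^sub>0 'k)) \<in> gr ?L n (int n - 3) \<and>
          M n (int n - 3) (if 1 \<le> b then fscl ?c (act ?L n (int n - 3) (unshuffle n S)
            (cmp ?L a (int a - 2) b (int b - 2) 1 (\<Gamma>_L a) (\<Gamma>_L b))) else 0) =
          fscl ?c (act H n (int n - 3) (unshuffle n S) (cmp H a (int a - 2) b (int b - 2) 1 (X a) (X b)))"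
          unfolding T0 R z using L.gr_zero by blast
      qed
    qed
    have "M n (int n - 3) (\<Sum>a\<in>{1..n + 1}. \<Sum>S\<in>?I a. ?t a S) = (\<Sum>a\<in>{1..n + 1}. M n (int n - 3) (\<Sum>S\<in>?I a. ?t a S))"
      by (rule L.lin_sum[OF h(1)], rule L.gr_sum) (use t in blast)
    also have "\<dots> = (\<Sum>a\<in>{1..n + 1}. \<Sum>S\<in>?I a. M n (int n - 3) (?t a S))"
      by (intro sum.cong refl L.lin_sum[OF h(1)]) (use t in blast)
    also have "\<dots> = dif H n (int n - 2) (X n)"
      unfolding dif_X[OF n] using t by (intro sum.cong refl) blast
    finally show ?thesis unfolding dif_ell[OF n] e .
  qed
  show ?thesis
    unfolding L_infinity_eq Cm.SD.F_eq
  proof (rule Cm.SD.FD.free_dg_hom[OF H.predg_axioms])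
    show "graded_operad_hom (quasi_free Cm.SD.E (\<lambda>n d c. cobar_d1 Cm.SQ n d c + cobar_d2 Cm.SQ n d c)) H M"
      using hom unfolding L_infinity_eq Cm.SD.F_eq .
    fix n d and x :: "('k, 'k) suspdual" assume "x \<in> gr Cm.SD.E n d"
    note c = gen_cls_coord[OF this]
    show "M n (d - 1) (dif (quasi_free Cm.SD.E (\<lambda>n d c. cobar_d1 Cm.SQ n d c + cobar_d2 Cm.SQ n d c)) n d (cls Cm.SD.E (Gen n d x))) =
      dif H n d (M n d (cls Cm.SD.E (Gen n d x)))"
      unfolding Cm.SD.F_eq[symmetric] L_infinity_eq[symmetric] c
    proof (cases "2 \<le> n \<and> d = int n - 2")
      case True
      then have n: "2 \<le> n" and d: "d = int n - 2" by auto
      note l = ell_in[OF n]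
      have "M n (d - 1) (dif ?L n d (fscl (coord_L n x) (ell n))) = fscl (coord_L n x) (M n (d - 1) (dif ?L n d (ell n)))"
        using linmapD(3)[OF L.dif_lin l] linmapD(3)[OF h(1) linmapD(1)[OF L.dif_lin l]] unfolding d by (simp add: s)
      also have "\<dots> = fscl (coord_L n x) (dif H n d (M n d (ell n)))" unfolding d main[OF n] val[OF n] ..
      also have "\<dots> = dif H n d (M n d (fscl (coord_L n x) (ell n)))"
        using linmapD(3)[OF h(1) l] unfolding d by (simp add: s)
      finally show "M n (d - 1) (dif ?L n d (if 2 \<le> n \<and> d = int n - 2 then fscl (coord_L n x) (ell n) else 0)) =
        dif H n d (M n d (if 2 \<le> n \<and> d = int n - 2 then fscl (coord_L n x) (ell n) else 0))" unfolding if_P[OF True] .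
    next
      case False
      show "M n (d - 1) (dif ?L n d (if 2 \<le> n \<and> d = int n - 2 then fscl (coord_L n x) (ell n) else 0)) =
        dif H n d (M n d (if 2 \<le> n \<and> d = int n - 2 then fscl (coord_L n x) (ell n) else 0))"
        unfolding if_not_P[OF False] z L.lin_zero[OF L.dif_lin] by simp
    qed
  qed
qed

end

section \<open>Naturality\<close>

lemma ghom_comp:
  assumes "graded_operad_hom A B f" "graded_operad_hom B C g"
  shows "graded_operad_hom A C (fam_comp g f)"
proof -
  note f = ghomD[OF assms(1)] and g = ghomD[OF assms(2)]
  show ?thesis unfolding graded_operad_hom_def fam_comp_def
    using linmap_comp[OF f(1) g(1)] linmapD(1)[OF f(1)] by (auto simp: f(2-4) g(2-4))
qed

lemma ghom_id: "graded_operad_hom A A id_fam"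
  by (simp add: graded_operad_hom_def id_fam_def linmap_id)

text \<open>Families are meaningful only on graded pieces; \<open>cobar_map\<close> is identified
  with a morphism only on these.\<close>

lemma ghom_cong:
  assumes "graded_operad_hom A B f" "gop A" "\<And>n d x. x \<in> gr A n d \<Longrightarrow> f n d x = g n d x"
  shows "graded_operad_hom A B g"
proof -
  interpret A: gop A by fact
  note f = ghomD[OF assms(1)]
  show ?thesis unfolding graded_operad_hom_def
  proof (intro conjI allI ballI impI)
    show "linmap (scl A) (scl B) (gr A n d) (gr B n d) (g n d)" for n d
      by (rule linmapI) (simp_all add: assms(3)[symmetric] linmapD[OF f(1)] A.gr_add A.gr_scl)
    show "g n d (act A n d \<sigma> x) = act B n d \<sigma> (g n d x)" if "x \<in> gr A n d" "\<sigma> permutes {1..n}" for n d \<sigma> x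
      using that by (simp add: assms(3)[symmetric] A.act_in f(2))
    show "g 1 0 (unt A) = unt B" using A.unt_in f(3) assms(3) by simp
    show "g (m + n - 1) (a + b) (cmp A m a n b i x y) = cmp B m a n b i (g m a x) (g n b y)"
      if "x \<in> gr A m a" "y \<in> gr A n b" "1 \<le> i \<and> i \<le> m" for m a n b i x y
      using that by (simp add: assms(3)[symmetric] A.cmp_in f(4))
  qed
qed

locale twist_map = Q: based_op Q m q dg \<epsilon> + R: based_op R m' r dg' \<epsilon>'
  for Q :: "('k::field, 'q::ab_group_add) dgop" and m q dg \<epsilon> and R :: "('k, 'r::ab_group_add) dgop" and m' r dg' \<epsilon>' +
  fixes \<Theta> :: "('r, 'q) fam"
  assumes Th: "graded_operad_hom R Q \<Theta>"
begin

lemmas th = ghomD[OF Th]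

abbreviation "g \<equiv> had_map susp_coop R.DQ id_fam (dual_map R \<Theta>)"

lemma dual_map_lin: "linmap (scl Q.DQ) (scl R.DQ) (gr Q.DQ n d) (gr R.DQ n d) (dual_map R \<Theta> n d)"
proof (rule linmapI)
  fix f assume "f \<in> gr Q.DQ n d"
  then show "dual_map R \<Theta> n d f \<in> gr R.DQ n d"
    using dual_pullback[OF th(1)[of n "- d"], of f 1] R.gvec_axioms by (simp add: dual_map_def cong: if_cong)
qed (auto simp: dual_map_def fun_eq_iff)

lemma id_susp_lin: "linmap (scl susp_coop) (scl susp_coop) (gr susp_coop n d) (gr susp_coop n d) (id_fam n d)"
  by (simp add: id_fam_def linmap_id)

lemmas g_gv = Q.HP.C.gvec_axioms Q.HP.D.gvec_axioms Q.HP.C.gvec_axioms R.HP.D.gvec_axioms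

lemmas g_pure = had_map_pure[OF g_gv id_susp_lin dual_map_lin]
lemmas g_lin0 = had_map_linmap[OF g_gv id_susp_lin dual_map_lin]

lemma g_act:
  assumes x: "x \<in> gr Q.SQ n d" and s: "\<sigma> permutes {1..n}"
  shows "g n d (act Q.SQ n d' \<sigma> x) = act R.SQ n d' \<sigma> (g n d x)"
proof -
  have dm: "dual_map R \<Theta> n j (act Q.DQ n j \<sigma> f) = act R.DQ n j \<sigma> (dual_map R \<Theta> n j f)" for j f
    using R.act_in[OF _ permutes_inv[OF s]] linmapD(1)[OF th(1)] th(2)[OF _ permutes_inv[OF s]]
    by (auto simp: dual_map_def act_dual fun_eq_iff)
  have "x \<in> tgr susp_coop n Q.DQ n d" using x by (simp only: Q.SQ_simps)
  then have "g n d (act Q.HP.H n d' \<sigma> x) = act R.HP.H n d' \<sigma> (g n d x)"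
  proof (rule Q.HP.CD.tgr_ext1)
    fix i and u :: "'k \<Rightarrow> 'k" and j f assume h: "u \<in> gr susp_coop n i" "f \<in> gr Q.DQ n j"
    show "g n d (act Q.HP.H n d' \<sigma> (pure susp_coop n Q.DQ n i u j f)) = act R.HP.H n d' \<sigma> (g n d (pure susp_coop n Q.DQ n i u j f))"
      unfolding had_act_pure[OF Q.HP.C.smod_axioms Q.HP.D.smod_axioms h s] g_pure[OF h] g_pure[OF Q.HP.C.act_in[OF h(1) s] Q.HP.D.act_in[OF h(2) s]]
        had_act_pure[OF Q.HP.C.smod_axioms R.HP.D.smod_axioms linmapD(1)[OF id_susp_lin h(1)] linmapD(1)[OF dual_map_lin h(2)] s] dm
      by (simp add: id_fam_def)
  qed (simp_all add: additive_hom_def)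
  then show ?thesis by (simp only: Q.SQ_simps R.SQ_simps)
qed

text \<open>\<Theta> preserves the unit, so its transpose preserves the counit; consequently
  \<open>g\<close> maps one coideal into the other.\<close>

lemma g_counit:
  assumes x: "x \<in> gr Q.SQ 1 0"
  shows "counit R.SQ (g 1 0 x) = counit Q.SQ x"
proof -
  have "x \<in> tgr susp_coop 1 Q.DQ 1 0" using x by (simp only: Q.SQ_simps)
  then have "counit R.SQ (g 1 0 x) = counit Q.SQ x"
  proof (induction rule: Q.HP.CD.tgr_induct)
    case zero
    then show ?case by (simp add: susp_dual_def had_counit lext_zero)
  next
    case (pure i u j f)
    show ?case
      unfolding g_pure[OF pure(1,2)] susp_dual_def Q.HP.had_counit_pure[OF pure(1,2)]
        R.HP.had_counit_pure[OF linmapD(1)[OF id_susp_lin pure(1)] linmapD(1)[OF dual_map_lin pure(2)]]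
      using R.unt_in th(3) by (auto simp: id_fam_def dual_map_def)
  qed (simp_all add: susp_dual_def had_counit)
  then show ?thesis .
qed

lemma g_E: "linmap (scl Q.SD.E) (scl R.SD.E) (gr Q.SD.E n d) (gr R.SD.E n d) (g n (d + 1))"
proof (rule linmapI)
  fix x assume x: "x \<in> gr Q.SD.E n d"
  then have x': "x \<in> gr Q.SQ n (d + 1)" by (rule Q.SD.gr_ED)
  then have "x \<in> tgr susp_coop n Q.DQ n (d + 1)" by (simp only: Q.SQ_simps)
  then have gx: "g n (d + 1) x \<in> gr R.SQ n (d + 1)" using linmapD(1)[OF g_lin0] by (simp only: R.SQ_simps)
  show "g n (d + 1) x \<in> gr R.SD.E n d"
  proof (cases "n = 1 \<and> d + 1 = 0")
    case True
    have "counit R.SQ (g 1 0 x) = 0" using g_counit[of x] x x' True by (auto simp: Q.SD.gr_E)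
    then show ?thesis using gx True by (auto simp: R.SD.gr_E)
  next
    case False then show ?thesis using gx by (auto simp: R.SD.gr_E)
  qed
qed (simp_all add: Q.SQ_simps R.SQ_simps)

sublocale ext: free_ext Q.SD.E R.W "\<lambda>n d x. cls R.SD.E (Gen n d (g n (d + 1) x))"
proof unfold_locales
  show "linmap (scl Q.SD.E) (scl R.W) (gr Q.SD.E n d) (gr R.W n d) (\<lambda>x. cls R.SD.E (Gen n d (g n (d + 1) x)))" for n d
    using linmap_comp[OF g_E R.SD.gen_lin[unfolded R.SD.E_simps(1)[symmetric] R.SD.F_simps(1)[symmetric]]] .
  show "cls R.SD.E (Gen n d (g n (d + 1) (act Q.SD.E n d \<sigma> x))) = act R.W n d \<sigma> (cls R.SD.E (Gen n d (g n (d + 1) x)))"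
    if "x \<in> gr Q.SD.E n d" "\<sigma> permutes {1..n}" for x n d \<sigma>
    unfolding R.SD.gen_act[OF linmapD(1)[OF g_E that(1)] that(2)] Q.SD.E_simps g_act[OF Q.SD.gr_ED[OF that(1)] that(2)] ..
qed

lemma map_term_wf: "wf_term Q.SD.E t \<Longrightarrow> wf_term R.SD.E (map_term g t) \<and> ar (map_term g t) = ar t \<and> deg (map_term g t) = deg t"
  by (induction t) (use linmapD(1)[OF g_E] in auto)

lemma ev_map_term: "wf_term Q.SD.E t \<Longrightarrow> ev R.W (\<lambda>n d x. cls R.SD.E (Gen n d (g n (d + 1) x))) t = cls R.SD.E (map_term g t)"
proof (induction t)
  case Unt
  show ?case by (simp add: R.SD.F_eq cls_def)
next
  case (Cmp t i u)
  then show ?case unfolding R.SD.F_eq using R.SD.FE.cmp_cls[of "map_term g t" "map_term g u" i] map_term_wf[of t] map_term_wf[of u]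
    by (simp del: quasi_free_simps)
next
  case (Prm \<sigma> t)
  then show ?case unfolding R.SD.F_eq using R.SD.FE.act_cls[of "map_term g t" \<sigma>] map_term_wf[of t]
    by (simp del: quasi_free_simps)
qed simp

text \<open>\<open>cobar_map\<close> renames the generators in a representative. On each term this
  is the evaluation map given by the universal property, which makes \<open>cobar_map\<close> a
  morphism of graded operads.\<close>

lemma cobar_map_eq:
  assumes "v \<in> gr Q.W n d"
  shows "cobar_map R.SQ g n d v = ext.lev v"
proof -
  have k: "Poly_Mapping.keys v \<subseteq> terms Q.SD.E n d"
    using assms unfolding Q.SD.F_eq by (simp add: Q.SD.FE.gr_free_eq)
  have "cobar_map R.SQ g n d v = lext fscl (\<lambda>t. fcls R.SD.E n d (bas (map_term g t))) v"
    unfolding cobar_map_def by (rule R.SD.FE.fcls_lext)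
  also have "\<dots> = lext fscl (ev R.W (\<lambda>n d x. cls R.SD.E (Gen n d (g n (d + 1) x)))) v"
  proof (rule lext_cong)
    fix t assume "t \<in> Poly_Mapping.keys v"
    then have t: "wf_term Q.SD.E t" "ar t = n" "deg t = d" using k by (auto simp: terms_iff)
    then show "fcls R.SD.E n d (bas (map_term g t)) = ev R.W (\<lambda>n d x. cls R.SD.E (Gen n d (g n (d + 1) x))) t"
      unfolding ev_map_term[OF t(1)] unfolding cls_def using map_term_wf[OF t(1)] by simp
  qed
  finally show ?thesis by (simp only: R.SD.F_simps)
qed

lemma cobar_map_hom: "graded_operad_hom Q.W R.W (cobar_map R.SQ g)"
proof (rule ghom_cong)
  show "graded_operad_hom Q.W R.W (\<lambda>n d. ext.lev)" unfolding Q.SD.F_eq by (rule ext.lev_hom)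
  show "gop Q.W" by (rule Q.SD.F.gop_axioms)
qed (simp add: cobar_map_eq)

text \<open>Away from arity one no reduction intervenes, and \<open>\<Gamma>\<close> is the class of
  a single generator, on which renaming amounts to transposing \<open>f\<close> along
  \<Theta>.\<close>

lemma cobar_map_\<Gamma>:
  assumes f: "f \<in> gr Q.D n e" and n: "n \<noteq> 1"
  shows "cobar_map R.SQ g n (int n - 2 + e) (Q.\<Gamma> n e f) = R.\<Gamma> n e (dual_map R \<Theta> n e f)"
proof -
  have f': "f \<in> gr Q.DQ n e" using f by simp
  have e: "int n - 2 + e + 1 = int n - 1 + e" by simp
  have "g n (int n - 1 + e) (Q.U n e f) = R.U n e (dual_map R \<Theta> n e f)"
    unfolding Q.U_def R.U_def g_pure[OF susp_in f'] by (simp add: id_fam_def)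
  then show ?thesis
    unfolding cobar_map_eq[OF Q.\<Gamma>_in[OF f]]
    unfolding Q.susp_gen_\<Gamma>[OF n, symmetric] R.susp_gen_\<Gamma>[OF n, symmetric]
    unfolding Q.susp_gen_cls R.susp_gen_cls ext.lev_cls by (simp add: e)
qed

end

section \<open>Naturality of M and the final statement\<close>

lemma twistI:
  assumes "dg_operad P" "dg_operad Q" "augmentation Q \<epsilon>" "dg_operad_hom Q P \<Psi>" "\<forall>n. homogeneous_basis Q n (m n) (q n) (dg n)"
  shows "twist P Q m q dg \<epsilon> \<Psi>"
proof -
  interpret P: predg P by (rule dg_operad_predg[OF assms(1)])
  interpret Q: predg Q by (rule dg_operad_predg[OF assms(2)])
  have "graded_operad_hom Q unit_operad \<epsilon>" using assms(3) by (simp add: augmentation_def dg_operad_hom_def)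
  note e = ghomD[OF this]
  interpret based Q m q dg by unfold_locales (use assms(5) in blast)
  have "based_op Q m q dg \<epsilon>"
  proof unfold_locales
    show "linmap (scl Q) (*) (gr Q 1 0) UNIV (\<epsilon> 1 0)" using e(1)[of 1 0] by (simp add: unit_operad_def)
    show "\<epsilon> 1 0 (unt Q) = 1" using e(3) by (simp add: unit_operad_def)
    show "cmp Q a i b j 1 (act Q a i \<alpha> x) (act Q b j \<beta> y) = act Q (a + b - 1) (i + j) (perm_cmp a b 1 \<alpha> \<beta>) (cmp Q a i b j 1 x y)"
      if "1 \<le> a" "x \<in> gr Q a i" "y \<in> gr Q b j" "\<alpha> permutes {1..a}" "\<alpha> 1 = 1" "\<beta> permutes {1..b}" for a b i j x y \<alpha> \<beta>
      using Q.equi[OF that(2,3) order_refl that(1,4,6)] that(5) by simp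
  qed (use Q.unt_in Q.dif_unt Q.cmp_lin_left[OF order_refl] Q.cmp_lin_right[OF order_refl] in auto)
  then show ?thesis
    by (intro twist.intro P.predg_axioms Q.predg_axioms twist_axioms.intro assms(4))
qed

lemma dg_hom_comp:
  assumes "dg_operad_hom A B f" "dg_operad_hom B C g"
  shows "dg_operad_hom A C (fam_comp g f)"
proof -
  have f: "graded_operad_hom A B f" and g: "graded_operad_hom B C g" using assms by (auto simp: dg_operad_hom_def)
  show ?thesis
    unfolding dg_operad_hom_def using ghom_comp[OF f g] assms linmapD(1)[OF ghomD(1)[OF f]]
    by (simp add: dg_operad_hom_def fam_comp_def)
qed

text \<open>Only the first tensor factors change, so the images of \<open>ell n\<close> agree
  summand by summand in the same basis of \<open>R(n)\<close>.\<close>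

lemma M_natural_left:
  assumes "twist P Q m q dg \<epsilon> \<Psi>" "twist Q R m' r dg' \<epsilon>' \<Theta>" "twist P R m' r dg' \<epsilon>' (fam_comp \<Psi> \<Theta>)"
    and M: "is_M Q R \<epsilon>' m' r dg' \<Theta> M"
  shows "is_M P R \<epsilon>' m' r dg' (fam_comp \<Psi> \<Theta>) (fam_comp (had_map P (cobar (susp_dual R \<epsilon>')) \<Psi> id_fam) M)"
proof -
  interpret A: twist P Q m q dg \<epsilon> \<Psi> by fact
  interpret B: twist Q R m' r dg' \<epsilon>' \<Theta> by fact
  interpret C: twist P R m' r dg' \<epsilon>' "fam_comp \<Psi> \<Theta>" by fact
  let ?h = "had_map P B.W \<Psi> id_fam"
  have hom: "graded_operad_hom B.H C.H ?h"
    by (rule had_map_hom[OF A.QQ.gop_axioms B.SD.F.gop_axioms A.P.gop_axioms B.SD.F.gop_axioms A.Psi_g ghom_id])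
  have "?h n d (B.X n) = C.X n" for n d
  proof -
    have idl: "linmap (scl B.W) (scl B.W) (gr B.W n d) (gr B.W n d) (id_fam n d)" for n d by (simp add: id_fam_def linmap_id)
    show ?thesis
      unfolding B.X_def C.X_def had_map_linear
      by (intro sum.cong refl arg_cong[of _ _ "fscl _"])
        (subst had_map_pure[OF A.gvec_axioms B.SD.F.gvec_axioms A.P.gvec_axioms B.SD.F.gvec_axioms A.psi(1) idl B.p_in B.G_in],
          simp_all add: fam_comp_def id_fam_def)
  qed
  then show ?thesis
    using M ghom_comp[OF _ hom, of L_infinity M] unfolding B.is_M_iff C.is_M_iff by (simp add: fam_comp_def)
qed

text \<open>Here the two sides use different bases: the transpose of \<Theta> acts on the dual basis
  of \<open>Q(n)\<close>, and \<open>canonical_swap\<close> with \<open>A\<close> equal to \<Theta>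
  rewrites the sum in the basis of \<open>R(n)\<close>.\<close>

lemma M_natural_right:
  assumes "twist P Q m q dg \<epsilon> \<Psi>" "twist Q R m' r dg' \<epsilon>' \<Theta>" "twist P R m' r dg' \<epsilon>' (fam_comp \<Psi> \<Theta>)"
    and M: "is_M P Q \<epsilon> m q dg \<Psi> M"
  shows "is_M P R \<epsilon>' m' r dg' (fam_comp \<Psi> \<Theta>)
    (fam_comp (had_map P (cobar (susp_dual R \<epsilon>')) id_fam
      (cobar_map (susp_dual R \<epsilon>') (had_map susp_coop (dual_coop R \<epsilon>') id_fam (dual_map R \<Theta>)))) M)"
proof -
  interpret A: twist P Q m q dg \<epsilon> \<Psi> by fact
  interpret B: twist Q R m' r dg' \<epsilon>' \<Theta> by fact
  interpret C: twist P R m' r dg' \<epsilon>' "fam_comp \<Psi> \<Theta>" by fact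
  interpret T: twist_map Q m q dg \<epsilon> R m' r dg' \<epsilon>' \<Theta> by unfold_locales (rule B.Psi_g)
  let ?c = "cobar_map B.SQ T.g"
  let ?h = "had_map P B.W id_fam ?c"
  have hom: "graded_operad_hom A.H C.H ?h"
    by (rule had_map_hom[OF A.P.gop_axioms A.SD.F.gop_axioms A.P.gop_axioms B.SD.F.gop_axioms ghom_id T.cobar_map_hom])
  have "?h n d (A.X n) = C.X n" if n: "2 \<le> n" for n d
  proof -
    let ?\<beta> = "\<lambda>d x f. fscl (ksign (int n * d)) (pure P n B.W n (d - 0) (\<Psi> n d x) (int n - 2 - d) (B.\<Gamma> n (- d) f))"
    have Bl: "linmap (scl Q) (scl P) (gr Q n d) (gr P n (d - 0)) (\<lambda>x. \<Psi> n d x)" for d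
      using A.psi(1) by simp
    have b1: "linmap (scl B.D) fscl (gr B.D n (0 - d)) UNIV (?\<beta> d x)" if "x \<in> gr Q n d" for d x
      unfolding diff_0 by (intro linmap_fun_fscl C.PW.pure_lin_right'[OF B.\<Gamma>_lin']) (use A.psi_in that in simp)
    have b2: "linmap (scl Q) fscl (gr Q n d) UNIV (\<lambda>x. ?\<beta> d x f)" if "f \<in> gr B.D n (0 - d)" for d f
      by (intro linmap_fun_fscl C.PW.pure_lin_left'[OF Bl] B.\<Gamma>_in') (use that in simp)
    have Al: "linmap (scl R) (scl Q) (gr R n d) (gr Q n (d + 0)) (\<Theta> n d)" for d
      using B.psi(1) by simp
    have idl: "linmap (scl P) (scl P) (gr P n d) (gr P n d) (id_fam n d)" for n d by (simp add: id_fam_def linmap_id)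
    have "?h n d (A.X n) = (\<Sum>i<m n. ?\<beta> (dg n i) (q n i) (dual_map R \<Theta> n (- dg n i) (A.de n i)))"
      unfolding A.X_def had_map_linear
    proof (rule sum.cong[OF refl])
      fix i assume "i \<in> {..<m n}"
      then have i: "i < m n" by simp
      have di: "A.de n i \<in> gr A.D n (- dg n i)" by (rule A.de_in) simp
      have n1: "n \<noteq> 1" using n by simp
      have e: "int n - 2 + - dg n i = int n - 2 - dg n i" by simp
      have c: "?c n (int n - 2 - dg n i) (A.G n i) = B.\<Gamma> n (- dg n i) (dual_map R \<Theta> n (- dg n i) (A.de n i))"
        using T.cobar_map_\<Gamma>[OF di n1] unfolding e .
      show "fscl (ksign (int n * dg n i)) (?h n d (pure P n A.W n (dg n i) (A.p n i) (int n - 2 - dg n i) (A.G n i))) =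
        ?\<beta> (dg n i) (q n i) (dual_map R \<Theta> n (- dg n i) (A.de n i))"
        unfolding had_map_pure[OF A.P.gvec_axioms A.SD.F.gvec_axioms A.P.gvec_axioms B.SD.F.gvec_axioms idl ghomD(1)[OF T.cobar_map_hom] A.p_in[OF i] A.G_in] c
        by (simp add: id_fam_def)
    qed
    also have "\<dots> = (\<Sum>i<m n. ?\<beta> (dg n i) (q n i) (\<lambda>x. if x \<in> gr R n (dg n i - 0) then A.de n i (\<Theta> n (dg n i - 0) x) else 0))"
      unfolding dual_map_def minus_minus diff_0_right ..
    also have "\<dots> = (\<Sum>k<m' n. ?\<beta> (dg' n k + 0) (\<Theta> n (dg' n k) (r n k)) (B.de n k))"
      by (rule A.canonical_swap[OF B.based_axioms Al b1 b2])
    also have "\<dots> = C.X n" unfolding C.X_def by (simp add: fam_comp_def)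
    finally show ?thesis .
  qed
  then show ?thesis
    using M ghom_comp[OF _ hom, of L_infinity M] unfolding A.is_M_iff C.is_M_iff by (simp add: fam_comp_def)
qed

theorem theorem3p6:
  fixes P :: "('k::field_char_0, 'p::ab_group_add) dgop"
    and Q :: "('k, 'q::ab_group_add) dgop"
    and \<epsilon> :: "('q, 'k) fam" and \<Psi> :: "('q, 'p) fam"
    and m :: "nat \<Rightarrow> nat" and q :: "nat \<Rightarrow> nat \<Rightarrow> 'q" and dg :: "nat \<Rightarrow> nat \<Rightarrow> int"
  assumes "dg_operad P" and "dg_operad Q" and "augmentation Q \<epsilon>"
    and "dg_operad_hom Q P \<Psi>"
    and "\<forall>n. finite_dim_arity Q n"
    and "\<forall>n. homogeneous_basis Q n (m n) (q n) (dg n)"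
  shows
    "(\<exists>M. is_M P Q \<epsilon> m q dg \<Psi> M) \<and>
     (\<forall>M M'. is_M P Q \<epsilon> m q dg \<Psi> M \<and> is_M P Q \<epsilon> m q dg \<Psi> M' \<longrightarrow> fam_eq_on L_infinity M M') \<and>
     (low_arity_vanishing Q \<epsilon> \<Psi> \<longrightarrow>
       (\<forall>M. is_M P Q \<epsilon> m q dg \<Psi> M \<longrightarrow>
         dg_operad_hom L_infinity (had_op P (cobar (susp_dual Q \<epsilon>))) M)) \<and>
     (\<forall>(R :: ('k, 'r::ab_group_add) dgop) \<epsilon>' \<Theta> m' r dg'.
       dg_operad R \<and> augmentation R \<epsilon>' \<and> dg_operad_hom R Q \<Theta> \<and>
       fam_eq_on R (fam_comp \<epsilon> \<Theta>) \<epsilon>' \<and>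
       (\<forall>n. finite_dim_arity R n) \<and> (\<forall>n. homogeneous_basis R n (m' n) (r n) (dg' n)) \<longrightarrow>
       (\<forall>M\<^sub>\<Psi> M\<^sub>\<Theta> M\<^sub>\<Psi>\<^sub>\<Theta>.
         is_M P Q \<epsilon> m q dg \<Psi> M\<^sub>\<Psi> \<and> is_M Q R \<epsilon>' m' r dg' \<Theta> M\<^sub>\<Theta> \<and>
         is_M P R \<epsilon>' m' r dg' (fam_comp \<Psi> \<Theta>) M\<^sub>\<Psi>\<^sub>\<Theta> \<longrightarrow>
         fam_eq_on L_infinity M\<^sub>\<Psi>\<^sub>\<Theta>
           (fam_comp (had_map P (cobar (susp_dual R \<epsilon>')) \<Psi> id_fam) M\<^sub>\<Theta>) \<and>
         fam_eq_on L_infinity M\<^sub>\<Psi>\<^sub>\<Theta>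
           (fam_comp (had_map P (cobar (susp_dual R \<epsilon>')) id_fam
              (cobar_map (susp_dual R \<epsilon>') (had_map susp_coop (dual_coop R \<epsilon>') id_fam (dual_map R \<Theta>))))
             M\<^sub>\<Psi>)))"
proof -
  have A: "twist P Q m q dg \<epsilon> \<Psi>" by (rule twistI[OF assms(1-4,6)])
  note nat = M_natural_left[OF A] M_natural_right[OF A]
  show ?thesis
  proof (intro conjI allI impI; (elim conjE)?)
    show "\<exists>M. is_M P Q \<epsilon> m q dg \<Psi> M" by (rule twist.ex_M[OF A])
    show "fam_eq_on L_infinity M M'" if "is_M P Q \<epsilon> m q dg \<Psi> M" "is_M P Q \<epsilon> m q dg \<Psi> M'" for M M'
      using that by (rule twist.unique_M[OF A])
    show "dg_operad_hom L_infinity (had_op P (cobar (susp_dual Q \<epsilon>))) M"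
      if "low_arity_vanishing Q \<epsilon> \<Psi>" "is_M P Q \<epsilon> m q dg \<Psi> M" for M
      by (rule twist.M_dg_hom[OF A that(2,1) assms(3)])
    fix R :: "('k, 'r) dgop" and \<epsilon>' \<Theta> m' r dg' M\<^sub>\<Psi> M\<^sub>\<Theta> M\<^sub>\<Psi>\<^sub>\<Theta>
    assume R: "dg_operad R" "augmentation R \<epsilon>'" "dg_operad_hom R Q \<Theta>" "\<forall>n. homogeneous_basis R n (m' n) (r n) (dg' n)"
      and M: "is_M P Q \<epsilon> m q dg \<Psi> M\<^sub>\<Psi>" "is_M Q R \<epsilon>' m' r dg' \<Theta> M\<^sub>\<Theta>" "is_M P R \<epsilon>' m' r dg' (fam_comp \<Psi> \<Theta>) M\<^sub>\<Psi>\<^sub>\<Theta>"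
    have B: "twist Q R m' r dg' \<epsilon>' \<Theta>" by (rule twistI[OF assms(2) R])
    have C: "twist P R m' r dg' \<epsilon>' (fam_comp \<Psi> \<Theta>)"
      by (rule twistI[OF assms(1) R(1,2) dg_hom_comp[OF R(3) assms(4)] R(4)])
    \<comment> \<open>Both composites satisfy the property that characterizes M for
      \<open>fam_comp \<Psi> \<Theta>\<close>, so uniqueness yields the two equalities.\<close>
    note u = twist.unique_M[OF C M(3)]
    show "fam_eq_on L_infinity M\<^sub>\<Psi>\<^sub>\<Theta> (fam_comp (had_map P (cobar (susp_dual R \<epsilon>')) \<Psi> id_fam) M\<^sub>\<Theta>)"
      by (rule u[OF nat(1)[OF B C M(2)]])
    show "fam_eq_on L_infinity M\<^sub>\<Psi>\<^sub>\<Theta>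
           (fam_comp (had_map P (cobar (susp_dual R \<epsilon>')) id_fam
              (cobar_map (susp_dual R \<epsilon>') (had_map susp_coop (dual_coop R \<epsilon>') id_fam (dual_map R \<Theta>))))
             M\<^sub>\<Psi>)"
      by (rule u[OF nat(2)[OF B C M(1)]])
  qed
qed

end
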